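(* Let $k$ be an infinite field, $S=k[x_1,\ldots,x_{d+1}]$, $f\in S$ a homogeneous polynomial of degree $m\ge 1$, and $R=S/(f)$; let $\overline{\,\cdot\,}$ denote images modulo $(f)$. Let $I$ be a perfect Gorenstein $R$-ideal of grade $3$ with alternating presentation matrix $\varphi$ consisting of linear entries in $R$, and assume that $I$ satisfies $G_d$, $\mu(I)=d+1$, and $I_1(\varphi)=\overline{(x_1,\ldots,x_{d+1})}$. Let $\psi$ be a $(d+1)\times(d+1)$ alternating matrix of linear forms in $S$ with $I_1(\psi)=(x_1,\ldots,x_{d+1})$ and $\overline{\psi}=\varphi$, write $[\ell_1\cdots\ell_{d+1}]=[T_1\cdots T_{d+1}]\cdot\psi$, and set $\mathscr{L}=(\ell_1,\ldots,\ell_{d+1},f)$ and $\mathcal{A}=\mathscr{L}:(x_1,\ldots,x_{d+1})^m$ in $S[T_1,\ldots,T_{d+1}]$. Let $(\mathcal{B}_m,\mathcal{L}_m)$ be the $m$-th gcd-iteration of $(B,\mathscr{L})$, where $B$ is a modified Jacobian dual of $\psi$. Then $$\mathcal{A}=\mathcal{L}_m+\big(\gcd I_{d+1}(\mathcal{B}_m)\big).$$ Moreover, the defining ideal $\mathcal{J}\subset R[T_1,\ldots,T_{d+1}]$ of $\mathcal{R}(I)$ satisfies $$\mathcal{J}=\overline{\mathcal{L}_m+\big(\gcd I_{d+1}(\mathcal{B}_m)\big)}.$$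
   Context: **Ideals.** An ideal $I$ of grade $g$ in $R$ is perfect if $\operatorname{pd}_R(R/I)=g$; a perfect ideal is Gorenstein if $\operatorname{Ext}^g_R(R/I,R)\cong R/I$. $\mu$ denotes minimal number of generators, $I_j(M)$ the ideal generated by the $j\times j$ minors of a matrix $M$. $I$ satisfies $G_s$ if $\mu(I_{\mathfrak p})\le\dim R_{\mathfrak p}$ for all primes $\mathfrak p\supseteq I$ with $\dim R_{\mathfrak p}\le s-1$. Alternating means skew-symmetric with zero diagonal; $\varphi$ is $(d+1)\times(d+1)$ with $R^{d+1}\xrightarrow{\varphi}R^{d+1}\to I\to 0$ exact. **Rees algebra.** For $I=(f_1,\ldots,f_{d+1})$ (generators corresponding to the presentation $\varphi$), $\mathcal{R}(I)=R[f_1t,\ldots,f_{d+1}t]\subset R[t]$ and $\mathcal{J}=\ker\big(R[T_1,\ldots,T_{d+1}]\to\mathcal{R}(I),\ T_i\mapsto f_it\big)$. **Modified Jacobian dual.** $B(\psi)$ is the unique $(d+1)\times(d+1)$ matrix of linear forms in $k[T_1,\ldots,T_{d+1}]$ with $[T_1\cdots T_{d+1}]\cdot\psi=[x_1\cdots x_{d+1}]\cdot B(\psi)$. Bigrade $S[T_1,\ldots,T_{d+1}]$ by $\deg x_i=(1,0)$, $\deg T_i=(0,1)$. For a nonzero bihomogeneous $F\in(x_1,\ldots,x_{d+1})S[T_1,\ldots,T_{d+1}]$, $\partial F$ denotes a (chosen, not unique) column with bihomogeneous entries of bidegree $\deg F-(1,0)$ such that $[x_1\cdots x_{d+1}]\cdot\partial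 F=F$; if $F=0$ then $\partial F$ is the zero column. A modified Jacobian dual of $\psi$ is a matrix $B=[B(\psi)\,|\,\partial f]$. **gcd-iterations.** $\gcd I_{d+1}(M)$ denotes the greatest common divisor of the $(d+1)\times(d+1)$ minors of $M$ (up to a unit; $0$ if all minors are $0$). Set $\mathcal{B}_1=B$, $\mathcal{L}_1=\mathscr{L}$. For $2\le i\le m$, let $g_{i-1}=\gcd I_{d+1}(\mathcal{B}_{i-1})$ and set $\mathcal{L}_i=\mathcal{L}_{i-1}+(g_{i-1})$, $\mathcal{B}_i=[B(\psi)\,|\,\partial g_{i-1}]$. The pair $(\mathcal{B}_i,\mathcal{L}_i)$ is the $i$-th gcd-iteration of $(B,\mathscr{L})$. *)

theory Defs
  imports
    "HOL-Library.Poly_Mapping"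
    "HOL-Library.Extended_Nat"
    "HOL-Computational_Algebra.Polynomial"
    "HOL-Combinatorics.Permutations"
    "HOL-Analysis.Finite_Cartesian_Product"
    "HOL-Algebra.QuotRing"
    "HOL-Algebra.Ideal_Product"
    "HOL-Algebra.Module"
    "HOL-Algebra.Algebraic_Closure_Type"
begin

no_notation fps_nth (infixl \<open>$\<close> 75)

section \<open>Ideals and modules over a commutative ring\<close>

subsection \<open>Ideals\<close>

definition ideal_pow :: "'a ring \<Rightarrow> 'a set \<Rightarrow> nat \<Rightarrow> 'a set" where
  "ideal_pow R I n = ((\<lambda>J. I \<cdot>\<^bsub>R\<^esub> J) ^^ n) (carrier R)"

definition colon :: "'a ring \<Rightarrow> 'a set \<Rightarrow> 'a set \<Rightarrow> 'a set" where
  "colon R I J = {a \<in> carrier R. \<forall>b\<in>J. a \<otimes>\<^bsub>R\<^esub> b \<in> I}"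

definition mu :: "'a ring \<Rightarrow> 'a set \<Rightarrow> enat" where
  "mu R I = Inf {enat (card U) | U. finite U \<and> U \<subseteq> carrier R \<and> Idl\<^bsub>R\<^esub> U = I}"

definition krull_dim :: "'a ring \<Rightarrow> enat" where
  "krull_dim R = Sup {enat n | n. \<exists>P :: nat \<Rightarrow> 'a set.
     (\<forall>i\<le>n. primeideal (P i) R) \<and> (\<forall>i<n. P i \<subset> P (Suc i))}"

definition regular_sequence :: "'a ring \<Rightarrow> 'a list \<Rightarrow> bool" where
  "regular_sequence R xs \<longleftrightarrow>
     set xs \<subseteq> carrier R \<and> Idl\<^bsub>R\<^esub> (set xs) \<noteq> carrier R \<and>
     (\<forall>i<length xs. \<forall>r\<in>carrier R.
        xs ! i \<otimes>\<^bsub>R\<^esub> r \<in> Idl\<^bsub>R\<^esub> (set (take i xs)) \<longrightarrow> r \<in> Idl\<^bsub>R\<^esub> (set (take i xs)))"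

definition grade :: "'a ring \<Rightarrow> 'a set \<Rightarrow> enat" where
  "grade R I = Sup {enat (length xs) | xs. regular_sequence R xs \<and> set xs \<subseteq> I}"

subsection \<open>Localization at a prime ideal\<close>

definition frac_rel :: "'a ring \<Rightarrow> 'a set \<Rightarrow> (('a \<times> 'a) \<times> ('a \<times> 'a)) set" where
  "frac_rel R P = {((a, s), (b, t)) | a s b t.
     a \<in> carrier R \<and> b \<in> carrier R \<and> s \<in> carrier R - P \<and> t \<in> carrier R - P \<and>
     (\<exists>u \<in> carrier R - P. u \<otimes>\<^bsub>R\<^esub> (a \<otimes>\<^bsub>R\<^esub> t) = u \<otimes>\<^bsub>R\<^esub> (b \<otimes>\<^bsub>R\<^esub> s))}"

definition loc_frac :: "'a ring \<Rightarrow> 'a set \<Rightarrow> 'a \<Rightarrow> 'a \<Rightarrow> ('a \<times> 'a) set" where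
  "loc_frac R P a s = frac_rel R P `` {(a, s)}"

text \<open>Each union below is over representatives of the two classes, and all of its members
  coincide, as in \<^const>\<open>rcoset_mult\<close>.\<close>

definition localization :: "'a ring \<Rightarrow> 'a set \<Rightarrow> ('a \<times> 'a) set ring" where
  "localization R P =
     \<lparr>carrier = (carrier R \<times> (carrier R - P)) // frac_rel R P,
      monoid.mult = (\<lambda>U V. \<Union>(a, s)\<in>U. \<Union>(b, t)\<in>V. loc_frac R P (a \<otimes>\<^bsub>R\<^esub> b) (s \<otimes>\<^bsub>R\<^esub> t)),
      one = loc_frac R P \<one>\<^bsub>R\<^esub> \<one>\<^bsub>R\<^esub>,
      zero = loc_frac R P \<zero>\<^bsub>R\<^esub> \<one>\<^bsub>R\<^esub>,
      add = (\<lambda>U V. \<Union>(a, s)\<in>U. \<Union>(b, t)\<in>V.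
               loc_frac R P (a \<otimes>\<^bsub>R\<^esub> t \<oplus>\<^bsub>R\<^esub> b \<otimes>\<^bsub>R\<^esub> s) (s \<otimes>\<^bsub>R\<^esub> t))\<rparr>"

definition ideal_localization :: "'a ring \<Rightarrow> 'a set \<Rightarrow> 'a set \<Rightarrow> ('a \<times> 'a) set set" where
  "ideal_localization R P I = {loc_frac R P a s | a s. a \<in> I \<and> s \<in> carrier R - P}"

definition satisfies_G :: "'a ring \<Rightarrow> 'a set \<Rightarrow> nat \<Rightarrow> bool" where
  "satisfies_G R I s \<longleftrightarrow>
     (\<forall>P. primeideal P R \<and> I \<subseteq> P \<and> krull_dim (localization R P) + 1 \<le> enat s \<longrightarrow>
        mu (localization R P) (ideal_localization R P I) \<le> krull_dim (localization R P))"

subsection \<open>Modules\<close>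

text \<open>The fields \<^const>\<open>monoid.mult\<close> and \<^const>\<open>one\<close> of a module record carry no information.\<close>

definition module_hom :: "'a ring \<Rightarrow> ('a, 'b) module \<Rightarrow> ('a, 'c) module \<Rightarrow> ('b \<Rightarrow> 'c) set" where
  "module_hom R M N = {h \<in> carrier M \<rightarrow>\<^sub>E carrier N.
     (\<forall>x\<in>carrier M. \<forall>y\<in>carrier M. h (x \<oplus>\<^bsub>M\<^esub> y) = h x \<oplus>\<^bsub>N\<^esub> h y) \<and>
     (\<forall>r\<in>carrier R. \<forall>x\<in>carrier M. h (r \<odot>\<^bsub>M\<^esub> x) = r \<odot>\<^bsub>N\<^esub> h x)}"

definition module_iso :: "'a ring \<Rightarrow> ('a, 'b) module \<Rightarrow> ('a, 'c) module \<Rightarrow> bool" where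
  "module_iso R M N \<longleftrightarrow> (\<exists>h\<in>module_hom R M N. bij_betw h (carrier M) (carrier N))"

definition module_ker :: "('a, 'b) module \<Rightarrow> ('a, 'c) module \<Rightarrow> ('b \<Rightarrow> 'c) \<Rightarrow> 'b set" where
  "module_ker M N h = {x \<in> carrier M. h x = \<zero>\<^bsub>N\<^esub>}"

definition self_module :: "'a ring \<Rightarrow> ('a, 'a) module" where
  "self_module R =
     \<lparr>carrier = carrier R, monoid.mult = monoid.mult R, one = monoid.one R, zero = ring.zero R, add = ring.add R,
      module.smult = monoid.mult R\<rparr>"

definition quot_module :: "('a, 'b) module \<Rightarrow> 'b set \<Rightarrow> ('a, 'b set) module" where
  "quot_module M K =
     \<lparr>carrier = a_rcosets\<^bsub>M\<^esub> K, monoid.mult = undefined, one = undefined, zero = K, add = set_add M,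
      module.smult = (\<lambda>r U. \<Union>x\<in>U. K +>\<^bsub>M\<^esub> (r \<odot>\<^bsub>M\<^esub> x))\<rparr>"

definition hom_module ::
    "'a ring \<Rightarrow> ('a, 'b) module \<Rightarrow> ('a, 'c) module \<Rightarrow> ('a, 'b \<Rightarrow> 'c) module" where
  "hom_module R M N =
     \<lparr>carrier = module_hom R M N, monoid.mult = undefined, one = undefined,
      zero = (\<lambda>x\<in>carrier M. \<zero>\<^bsub>N\<^esub>),
      add = (\<lambda>g h. \<lambda>x\<in>carrier M. g x \<oplus>\<^bsub>N\<^esub> h x),
      module.smult = (\<lambda>r h. \<lambda>x\<in>carrier M. r \<odot>\<^bsub>N\<^esub> h x)\<rparr>"

definition free_module :: "'a ring \<Rightarrow> 'i set \<Rightarrow> ('a, 'i \<Rightarrow> 'a) module" where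
  "free_module R B =
     \<lparr>carrier = {v. (\<forall>b. v b \<in> carrier R) \<and> (\<forall>b. b \<notin> B \<longrightarrow> v b = \<zero>\<^bsub>R\<^esub>) \<and>
                    finite {b. v b \<noteq> \<zero>\<^bsub>R\<^esub>}},
      monoid.mult = undefined, one = undefined,
      zero = (\<lambda>b. \<zero>\<^bsub>R\<^esub>),
      add = (\<lambda>v w b. v b \<oplus>\<^bsub>R\<^esub> w b),
      module.smult = (\<lambda>r v b. r \<otimes>\<^bsub>R\<^esub> v b)\<rparr>"

text \<open>A module is projective if it is a direct summand of a free module.  Bases contained in the
  carrier type of the module suffice: a projective module is a summand of the free module on its
  own underlying set.\<close>

definition projective :: "'a ring \<Rightarrow> ('a, 'b) module \<Rightarrow> bool" where
  "projective R M \<longleftrightarrow> module R M \<and>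
     (\<exists>(B :: 'b set) i p. i \<in> module_hom R M (free_module R B) \<and>
        p \<in> module_hom R (free_module R B) M \<and> (\<forall>x\<in>carrier M. p (i x) = x))"

subsection \<open>Projective resolutions, projective dimension, Ext\<close>

text \<open>The resolving modules are carried by sets of sequences in \<open>R\<close>.  Up to isomorphism this admits
  all countably generated projective modules, hence resolutions of every finitely generated module
  over a Noetherian ring, and does not affect the projective dimension of such a module.\<close>

definition projective_resolution ::
    "'a ring \<Rightarrow> ('a, 'b) module \<Rightarrow> (nat \<Rightarrow> ('a, nat \<Rightarrow> 'a) module) \<Rightarrow>
     (nat \<Rightarrow> (nat \<Rightarrow> 'a) \<Rightarrow> (nat \<Rightarrow> 'a)) \<Rightarrow> ((nat \<Rightarrow> 'a) \<Rightarrow> 'b) \<Rightarrow> bool" where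
  "projective_resolution R M P D \<epsilon> \<longleftrightarrow>
     (\<forall>i. projective R (P i)) \<and>
     (\<forall>i. D i \<in> module_hom R (P (Suc i)) (P i)) \<and>
     \<epsilon> \<in> module_hom R (P 0) M \<and>
     \<epsilon> ` carrier (P 0) = carrier M \<and>
     D 0 ` carrier (P 1) = module_ker (P 0) M \<epsilon> \<and>
     (\<forall>i. D (Suc i) ` carrier (P (Suc (Suc i))) = module_ker (P (Suc i)) (P i) (D i))"

definition pd :: "'a ring \<Rightarrow> ('a, 'b) module \<Rightarrow> enat" where
  "pd R M = Inf {enat n | n. \<exists>P D \<epsilon>. projective_resolution R M P D \<epsilon> \<and>
                               (\<forall>i>n. carrier (P i) = {\<zero>\<^bsub>P i\<^esub>})}"

definition hom_cocycles ::
    "'a ring \<Rightarrow> (nat \<Rightarrow> ('a, 'b) module) \<Rightarrow> (nat \<Rightarrow> 'b \<Rightarrow> 'b) \<Rightarrow> nat \<Rightarrow> ('a, 'c) module \<Rightarrow>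
     ('b \<Rightarrow> 'c) set" where
  "hom_cocycles R P D n N =
     {h \<in> module_hom R (P n) N. \<forall>x\<in>carrier (P (Suc n)). h (D n x) = \<zero>\<^bsub>N\<^esub>}"

definition hom_coboundaries ::
    "'a ring \<Rightarrow> (nat \<Rightarrow> ('a, 'b) module) \<Rightarrow> (nat \<Rightarrow> 'b \<Rightarrow> 'b) \<Rightarrow> nat \<Rightarrow> ('a, 'c) module \<Rightarrow>
     ('b \<Rightarrow> 'c) set" where
  "hom_coboundaries R P D n N =
     (case n of
        0 \<Rightarrow> {\<lambda>x\<in>carrier (P 0). \<zero>\<^bsub>N\<^esub>}
      | Suc j \<Rightarrow> (\<lambda>h. compose (carrier (P (Suc j))) h (D j)) ` module_hom R (P j) N)"

text \<open>Ext is computed from a chosen projective resolution; up to isomorphism it does not depend on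
  the choice.\<close>

definition Ext ::
    "'a ring \<Rightarrow> nat \<Rightarrow> ('a, 'b) module \<Rightarrow> ('a, 'c) module \<Rightarrow> ('a, ((nat \<Rightarrow> 'a) \<Rightarrow> 'c) set) module"
  where
  "Ext R n M N =
     (let (P, D, \<epsilon>) = (SOME (P, D, \<epsilon>). projective_resolution R M P D \<epsilon>)
      in quot_module ((hom_module R (P n) N)\<lparr>carrier := hom_cocycles R P D n N\<rparr>)
                     (hom_coboundaries R P D n N))"

definition perfect_ideal :: "'a ring \<Rightarrow> 'a set \<Rightarrow> bool" where
  "perfect_ideal R I \<longleftrightarrow> ideal I R \<and> pd R (quot_module (self_module R) I) = grade R I"

definition perfect_gorenstein_ideal :: "'a ring \<Rightarrow> 'a set \<Rightarrow> nat \<Rightarrow> bool" where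
  "perfect_gorenstein_ideal R I g \<longleftrightarrow> perfect_ideal R I \<and> grade R I = enat g \<and>
     module_iso R (Ext R g (quot_module (self_module R) I) (self_module R))
                  (quot_module (self_module R) I)"

section \<open>Polynomials in the variables \<open>x\<^sub>i\<close> and \<open>T\<^sub>i\<close>\<close>

text \<open>\<open>('n, 'a) mpoly\<close> is the polynomial ring over \<open>'a\<close> in variables indexed by \<open>'n\<close>.  The ring
  \<open>S\<close> is \<open>('n, 'k) mpoly\<close>, and \<open>S[T]\<close> is the iterated polynomial ring \<open>('n, ('n, 'k) mpoly) mpoly\<close>.\<close>

type_synonym ('n, 'a) mpoly = "('n \<Rightarrow>\<^sub>0 nat) \<Rightarrow>\<^sub>0 'a"

definition const :: "'a::zero \<Rightarrow> ('n, 'a) mpoly" where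
  "const c = Poly_Mapping.single 0 c"

definition var :: "'n \<Rightarrow> ('n, 'a::zero_neq_one) mpoly" where
  "var i = Poly_Mapping.single (Poly_Mapping.single i 1) 1"

definition total_degree :: "('n::finite \<Rightarrow>\<^sub>0 nat) \<Rightarrow> nat" where
  "total_degree t = (\<Sum>i\<in>UNIV. Poly_Mapping.lookup t i)"

definition homogeneous :: "nat \<Rightarrow> ('n::finite, 'a::zero) mpoly \<Rightarrow> bool" where
  "homogeneous m p \<longleftrightarrow> (\<forall>t\<in>Poly_Mapping.keys p. total_degree t = m)"

text \<open>As usual, the zero polynomial is homogeneous of every degree and bihomogeneous of every
  bidegree.\<close>

definition bihomogeneous ::
    "nat \<Rightarrow> nat \<Rightarrow> ('n::finite, ('n, 'k::zero) mpoly) mpoly \<Rightarrow> bool" where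
  "bihomogeneous a b F \<longleftrightarrow>
     homogeneous b F \<and> (\<forall>t\<in>Poly_Mapping.keys F. homogeneous a (Poly_Mapping.lookup F t))"

definition xvec :: "('n, ('n, 'k::comm_ring_1) mpoly) mpoly ^ 'n::finite" where
  "xvec = (\<chi> i. const (var i))"

definition Tvec :: "('n, ('n, 'k::comm_ring_1) mpoly) mpoly ^ 'n::finite" where
  "Tvec = (\<chi> i. var i)"

section \<open>Matrices\<close>

definition alternating :: "'a::ring_1 ^ 'n ^ 'n \<Rightarrow> bool" where
  "alternating M \<longleftrightarrow> (\<forall>i j. M $ i $ j = - (M $ j $ i)) \<and> (\<forall>i. M $ i $ i = 0)"

text \<open>The rows and columns of a minor are picked in an arbitrary order, so that each minor occurs
  together with its negative.\<close>

definition minors :: "nat \<Rightarrow> 'a::comm_ring_1 ^ 'c ^ 'r \<Rightarrow> 'a set" where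
  "minors j M = {\<Sum>p | p permutes {..<j}. of_int (sign p) * (\<Prod>i<j. M $ \<rho> i $ \<gamma> (p i))
                 | \<rho> \<gamma>. inj_on \<rho> {..<j} \<and> inj_on \<gamma> {..<j}}"

definition minor_ideal :: "nat \<Rightarrow> 'a::comm_ring_1 ^ 'c ^ 'r \<Rightarrow> 'a set" where
  "minor_ideal j M = Idl\<^bsub>ring_of_type_algebra\<^esub> (minors j M)"

definition is_gcd :: "'a::comm_monoid_mult set \<Rightarrow> 'a \<Rightarrow> bool" where
  "is_gcd U g \<longleftrightarrow> (\<forall>p\<in>U. g dvd p) \<and> (\<forall>h. (\<forall>p\<in>U. h dvd p) \<longrightarrow> h dvd g)"

text \<open>The matrix \<open>[M | c]\<close>, whose additional column has index \<open>None\<close>.\<close>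

definition append_column :: "'a ^ 'n ^ 'm \<Rightarrow> 'a ^ 'm \<Rightarrow> 'a ^ ('n::finite option) ^ 'm" where
  "append_column M c = (\<chi> i j. case j of None \<Rightarrow> c $ i | Some j' \<Rightarrow> M $ i $ j')"

section \<open>Rees algebras and modified Jacobian duals\<close>

text \<open>\<open>R\<^sup>n \<rightarrow> R\<^sup>n \<rightarrow> I \<rightarrow> 0\<close> is exact, the first map being \<open>\<phi>\<close> and the second being given by the row
  \<open>a\<close> of generators of \<open>I\<close>.\<close>

definition presents ::
    "'r::comm_ring_1 ^ 'n ^ 'n \<Rightarrow> 'r ^ 'n \<Rightarrow> 'r set \<Rightarrow> bool" where
  "presents \<phi> a I \<longleftrightarrow>
     range (\<lambda>v. \<Sum>i\<in>UNIV. a $ i * v $ i) = I \<and>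
     {v. (\<Sum>i\<in>UNIV. a $ i * v $ i) = 0} = range (\<lambda>w. \<phi> *v w)"

text \<open>The homomorphism \<open>R[T] \<rightarrow> R[t]\<close> with \<open>T\<^sub>i \<mapsto> a\<^sub>i t\<close>; its image is the Rees algebra of the ideal
  generated by the entries of \<open>a\<close>.\<close>

definition rees_map :: "'r::comm_ring_1 ^ 'n \<Rightarrow> ('n::finite, 'r) mpoly \<Rightarrow> 'r poly" where
  "rees_map a F = (\<Sum>t\<in>Poly_Mapping.keys F.
     [:Poly_Mapping.lookup F t:] * (\<Prod>i\<in>UNIV. [:0, a $ i:] ^ Poly_Mapping.lookup t i))"

definition rees_ideal :: "'r::comm_ring_1 ^ 'n \<Rightarrow> ('n::finite, 'r) mpoly set" where
  "rees_ideal a = {F. rees_map a F = 0}"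

text \<open>A matrix of linear forms in \<open>k[T]\<close> is a matrix with entries of bidegree \<open>(0, 1)\<close>.\<close>

definition is_jacobian_dual ::
    "('n::finite, 'k::comm_ring_1) mpoly ^ 'n ^ 'n \<Rightarrow> ('n, ('n, 'k) mpoly) mpoly ^ 'n ^ 'n \<Rightarrow> bool"
  where
  "is_jacobian_dual \<psi> B \<longleftrightarrow>
     (\<forall>i j. bihomogeneous 0 1 (B $ i $ j)) \<and> Tvec v* map_matrix const \<psi> = xvec v* B"

definition jacobian_dual ::
    "('n::finite, 'k::comm_ring_1) mpoly ^ 'n ^ 'n \<Rightarrow> ('n, ('n, 'k) mpoly) mpoly ^ 'n ^ 'n" where
  "jacobian_dual \<psi> = (THE B. is_jacobian_dual \<psi> B)"

text \<open>\<open>c\<close> is a possible choice of the column \<open>\<partial>F\<close>.\<close>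

definition is_partial ::
    "('n::finite, ('n, 'k::comm_ring_1) mpoly) mpoly \<Rightarrow> ('n, ('n, 'k) mpoly) mpoly ^ 'n \<Rightarrow> bool"
  where
  "is_partial F c \<longleftrightarrow>
     (if F = 0 then c = 0
      else (\<exists>a b. bihomogeneous (Suc a) b F \<and> (\<forall>i. bihomogeneous a b (c $ i))) \<and>
           (\<Sum>i\<in>UNIV. xvec $ i * c $ i) = F)"

definition is_modified_jacobian_dual ::
    "('n::finite, 'k::comm_ring_1) mpoly ^ 'n ^ 'n \<Rightarrow> ('n, 'k) mpoly \<Rightarrow>
     ('n, ('n, 'k) mpoly) mpoly ^ ('n option) ^ 'n \<Rightarrow> bool" where
  "is_modified_jacobian_dual \<psi> f B \<longleftrightarrow>
     (\<exists>c. is_partial (const f) c \<and> B = append_column (jacobian_dual \<psi>) c)"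

text \<open>\<open>gcd_iteration \<psi> B\<^sub>1 L\<^sub>1 i B L\<close> says that \<open>(B, L)\<close> is an \<open>i\<close>-th gcd-iteration of
  \<open>(B\<^sub>1, L\<^sub>1)\<close>, for some choice of the gcds (unique up to units) and of the columns \<open>\<partial>g\<close>.\<close>

inductive gcd_iteration ::
    "('n::finite, 'k::comm_ring_1) mpoly ^ 'n ^ 'n \<Rightarrow>
     ('n, ('n, 'k) mpoly) mpoly ^ ('n option) ^ 'n \<Rightarrow> ('n, ('n, 'k) mpoly) mpoly set \<Rightarrow> nat \<Rightarrow>
     ('n, ('n, 'k) mpoly) mpoly ^ ('n option) ^ 'n \<Rightarrow> ('n, ('n, 'k) mpoly) mpoly set \<Rightarrow> bool"
  for \<psi> :: "('n::finite, 'k::comm_ring_1) mpoly ^ 'n ^ 'n" and B\<^sub>1 L\<^sub>1 where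
  first: "gcd_iteration \<psi> B\<^sub>1 L\<^sub>1 1 B\<^sub>1 L\<^sub>1"
| step: "gcd_iteration \<psi> B\<^sub>1 L\<^sub>1 i B L \<Longrightarrow> is_gcd (minors CARD('n) B) g \<Longrightarrow> is_partial g c \<Longrightarrow>
    gcd_iteration \<psi> B\<^sub>1 L\<^sub>1 (Suc i) (append_column (jacobian_dual \<psi>) c)
      (L <+>\<^bsub>ring_of_type_algebra\<^esub> PIdl\<^bsub>ring_of_type_algebra\<^esub> g)"

section \<open>Existence and uniqueness of \<open>B(\<psi>)\<close>\<close>

lemma lookup_const_times: "Poly_Mapping.lookup (const c * F) t = c * Poly_Mapping.lookup F t"
  for c :: "'a::comm_ring_1"
  unfolding const_def mult_map_scale_conv_mult[symmetric]
  by (auto simp: Poly_Mapping.map.rep_eq when_def)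

lemma homogeneous_0: "homogeneous 0 p \<Longrightarrow> p = const (Poly_Mapping.lookup p 0)"
  for p :: "('n::finite, 'a::comm_ring_1) mpoly"
proof (rule poly_mapping_eqI)
  fix t assume h: "homogeneous 0 p"
  have "t = 0" if "t \<in> Poly_Mapping.keys p"
  proof -
    have "total_degree t = 0" using h that by (auto simp: homogeneous_def)
    then show "t = 0" by (auto simp: total_degree_def intro: poly_mapping_eqI)
  qed
  then show "Poly_Mapping.lookup p t = Poly_Mapping.lookup (const (Poly_Mapping.lookup p 0)) t"
    by (auto simp: const_def lookup_single when_def in_keys_iff)
qed

lemma total_degree_1:
  assumes "total_degree t = 1"
  obtains i where "t = Poly_Mapping.single i 1"
proof -
  have s: "(\<Sum>i\<in>UNIV. Poly_Mapping.lookup t i) = 1" using assms by (simp add: total_degree_def)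
  then obtain i where i: "Poly_Mapping.lookup t i = 1"
    "\<And>j. j \<noteq> i \<Longrightarrow> Poly_Mapping.lookup t j = 0"
    by (metis (no_types, lifting) finite_class.finite_UNIV sum_eq_1_iff UNIV_I)
  have "t = Poly_Mapping.single i 1"
    by (rule poly_mapping_eqI) (auto simp: lookup_single when_def i)
  then show ?thesis using that by blast
qed

lemma single_1_eq_iff: "Poly_Mapping.single i (1::nat) = Poly_Mapping.single j 1 \<longleftrightarrow> i = j"
  by (metis lookup_single_eq lookup_single_not_eq one_neq_zero)

lemma lookup_var_times_const:
  "Poly_Mapping.lookup (var i * const c) (Poly_Mapping.single j 1) = (c when i = j)"
  for c :: "'a::comm_ring_1"
  by (simp add: var_def const_def mult_single lookup_single single_1_eq_iff del: One_nat_def)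

lemma linear_form_eq_sum:
  fixes p :: "('n::finite, 'a::comm_ring_1) mpoly"
  assumes "homogeneous 1 p"
  shows "p = (\<Sum>i\<in>UNIV. var i * const (Poly_Mapping.lookup p (Poly_Mapping.single i 1)))"
proof (rule poly_mapping_eqI)
  fix t
  show "Poly_Mapping.lookup p t = Poly_Mapping.lookup
    (\<Sum>i\<in>UNIV. var i * const (Poly_Mapping.lookup p (Poly_Mapping.single i 1))) t"
  proof (cases "\<exists>i. t = Poly_Mapping.single i 1")
    case True
    then obtain i where t: "t = Poly_Mapping.single i 1" by blast
    show ?thesis unfolding t lookup_sum lookup_var_times_const by (simp add: when_def)
  next
    case False
    then have "Poly_Mapping.lookup p t = 0"
      using assms total_degree_1 by (metis homogeneous_def in_keys_iff)
    moreover have "Poly_Mapping.lookup (var i * const c) t = 0" for i and c :: 'a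
      using False by (auto simp: var_def const_def mult_single lookup_single when_def)
    ultimately show ?thesis by (simp add: lookup_sum)
  qed
qed

lemma const_simps:
  "const (a + b) = const a + const (b :: 'a::comm_ring_1)"
  "const (a * b) = const a * const b"
  "const 0 = (0 :: ('n, 'a) mpoly)"
  by (simp_all add: const_def single_add mult_single)

lemma const_sum: "const (sum h A) = (\<Sum>i\<in>A. const (h i :: 'a::comm_ring_1))"
  by (induction A rule: infinite_finite_induct) (simp_all add: const_simps)

lemma jacobian_dual_unique:
  fixes B B' :: "('n::finite, ('n, 'k::comm_ring_1) mpoly) mpoly ^ 'n ^ 'n"
  assumes "\<forall>i j. bihomogeneous 0 1 (B $ i $ j)" "\<forall>i j. bihomogeneous 0 1 (B' $ i $ j)"
    and eq: "xvec v* B = xvec v* B'"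
  shows "B = B'"
proof -
  have key: "Poly_Mapping.lookup (Poly_Mapping.lookup ((xvec v* M) $ j) t) (Poly_Mapping.single a 1)
      = Poly_Mapping.lookup (Poly_Mapping.lookup (M $ a $ j) t) 0"
    if M: "\<forall>i j. bihomogeneous 0 1 (M $ i $ j)"
    for M :: "('n, ('n, 'k) mpoly) mpoly ^ 'n ^ 'n" and j t a
  proof -
    have "homogeneous 0 (Poly_Mapping.lookup (M $ i $ j) t)" for i
      using M by (cases "t \<in> Poly_Mapping.keys (M $ i $ j)")
        (auto simp: bihomogeneous_def in_keys_iff homogeneous_def)
    then have c: "Poly_Mapping.lookup (M $ i $ j) t
        = const (Poly_Mapping.lookup (Poly_Mapping.lookup (M $ i $ j) t) 0)" for i
      using homogeneous_0 by blast
    have "Poly_Mapping.lookup ((xvec v* M) $ j) t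
        = (\<Sum>i\<in>UNIV. var i * Poly_Mapping.lookup (M $ i $ j) t)"
      by (simp add: vector_matrix_mult_def xvec_def lookup_sum lookup_const_times mult.commute[of _ "const _"])
    also have "\<dots> = (\<Sum>i\<in>UNIV. var i *
        const (Poly_Mapping.lookup (Poly_Mapping.lookup (M $ i $ j) t) 0))"
      using c by simp
    finally show ?thesis by (simp only: lookup_sum lookup_var_times_const) (simp add: when_def)
  qed
  have c: "Poly_Mapping.lookup (M $ i $ j) t
        = const (Poly_Mapping.lookup (Poly_Mapping.lookup (M $ i $ j) t) 0)"
    if M: "\<forall>i j. bihomogeneous 0 1 (M $ i $ j)"
    for M :: "('n, ('n, 'k) mpoly) mpoly ^ 'n ^ 'n" and i j t
    using M by (intro homogeneous_0, cases "t \<in> Poly_Mapping.keys (M $ i $ j)")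
        (auto simp: bihomogeneous_def in_keys_iff homogeneous_def)
  have "B $ a $ j = B' $ a $ j" for a j
    by (rule poly_mapping_eqI) (metis assms c key)
  then show ?thesis by (simp add: vec_eq_iff)
qed

lemma jacobian_dual_exists:
  fixes \<psi> :: "('n::finite, 'k::comm_ring_1) mpoly ^ 'n ^ 'n"
  assumes lin: "\<forall>i j. homogeneous 1 (\<psi> $ i $ j)"
  shows "\<exists>B. is_jacobian_dual \<psi> B"
proof -
  define c where "c i j a = Poly_Mapping.lookup (\<psi> $ i $ j) (Poly_Mapping.single a 1)" for i j a
  define B :: "('n, ('n, 'k) mpoly) mpoly ^ 'n ^ 'n"
    where "B = (\<chi> a j. \<Sum>i\<in>UNIV. var i * const (const (c i j a)))"
  have lk: "Poly_Mapping.lookup (B $ a $ j) t = (\<Sum>i\<in>UNIV. const (c i j a) when t = Poly_Mapping.single i 1)" for a j t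
    by (auto simp: B_def lookup_sum var_def const_def mult_single lookup_single when_def intro!: sum.cong)
  have "bihomogeneous 0 1 (B $ a $ j)" for a j
  proof -
    have "homogeneous 0 (Poly_Mapping.lookup (B $ a $ j) t)" for t
    proof -
      have "Poly_Mapping.lookup (B $ a $ j) t = const (\<Sum>i\<in>UNIV. c i j a when t = Poly_Mapping.single i 1)"
        unfolding lk const_sum by (intro sum.cong) (auto simp: when_def const_simps)
      then show ?thesis by (simp add: homogeneous_def const_def total_degree_def)
    qed
    moreover have "total_degree t = 1" if "t \<in> Poly_Mapping.keys (B $ a $ j)" for t
    proof -
      have "(\<Sum>i\<in>UNIV. (const (c i j a) :: ('n, 'k) mpoly) when t = Poly_Mapping.single i 1) \<noteq> 0"
        using that unfolding in_keys_iff lk by blast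
      then obtain i where "((const (c i j a) :: ('n, 'k) mpoly) when t = Poly_Mapping.single i 1) \<noteq> 0"
        by (rule sum.not_neutral_contains_not_neutral)
      then have "t = Poly_Mapping.single i 1" by (auto simp: when_def split: if_splits)
      then show ?thesis by (simp add: total_degree_def lookup_single when_def)
    qed
    ultimately show ?thesis by (auto simp: bihomogeneous_def homogeneous_def)
  qed
  moreover have "(Tvec v* map_matrix const \<psi>) $ j = (xvec v* B) $ j" for j
  proof -
    have psi: "\<psi> $ i $ j = (\<Sum>a\<in>UNIV. var a * const (c i j a))" for i
      unfolding c_def by (rule linear_form_eq_sum) (use lin in auto)
    have "(Tvec v* map_matrix const \<psi>) $ j = (\<Sum>i\<in>UNIV. \<Sum>a\<in>UNIV. const (var a) * const (const (c i j a)) * var i)"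
      by (simp add: vector_matrix_mult_def Tvec_def psi const_sum const_simps sum_distrib_left sum_distrib_right mult.commute)
    also have "\<dots> = (\<Sum>a\<in>UNIV. \<Sum>i\<in>UNIV. const (var a) * const (const (c i j a)) * var i)"
      by (rule sum.swap)
    also have "\<dots> = (xvec v* B) $ j"
      by (simp add: vector_matrix_mult_def xvec_def B_def sum_distrib_left sum_distrib_right ac_simps)
    finally show ?thesis .
  qed
  ultimately show ?thesis unfolding is_jacobian_dual_def vec_eq_iff by blast
qed

lemma is_jacobian_dual_jacobian_dual:
  fixes \<psi> :: "('n::finite, 'k::comm_ring_1) mpoly ^ 'n ^ 'n"
  assumes "\<forall>i j. homogeneous 1 (\<psi> $ i $ j)"
  shows "is_jacobian_dual \<psi> (jacobian_dual \<psi>)"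
  unfolding jacobian_dual_def
  by (rule theI') (metis assms jacobian_dual_exists jacobian_dual_unique is_jacobian_dual_def)

end

(* Proof idea.  Write n = d + 1 and L' for the ideal of the forms l_j.  The module Hom(I, R) is R since
I has grade at least two, so lowest components of lifts of the generators of I are homogeneous
generators p_j of I up to a nonzerodivisor.  The Jacobian dual satisfies B T = 0, hence its cofactors
are T_j u_k, and every maximal minor of [B | c] is 0 or, up to sign, T_j (sum_k u_k c_k).  So each gcd
is, up to a unit, obtained from its predecessor sum_k x_k c_k by replacing one x by u, and modulo L
it may be multiplied back by x.  Conversely an element F of the Rees ideal is killed by a power of
the p_j modulo L; evaluating F at x = u and dividing by f(u) produces the multiple of an iterated
gcd which cancels F up to elements killed by powers of the p_j and of the T_j u_k.

Everything thus rests on L being unmixed.  The l_j with one of them left out, together with f, form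
a complete intersection after a general linear change of T; a Tate complex (a divided power variable
kills the relation sum T_j l_j = 0) carries the torsion statement over to L.  Koszul complexes of
homogeneous elements with the origin as only zero are exact by a comparison with the Cech complex of
Laurent polynomials, and dimensions are transcendence degrees of residue rings of homogeneous
primes; G_d bounds them off the origin. *)
theory Submission
  imports Defs "HOL-Library.Function_Algebras" "HOL-Analysis.Determinants"
begin

text \<open>Dimension theory enters through two facts. A homogeneous ideal such that no homogeneous
  prime over it carries s independent classes contains a nontrivial polynomial in any s given
  elements; and a ring integral over r elements carries no r + 1 independent classes. Primes that
  arise on the way are replaced by their homogeneous cores.

  The obstacle to unmixedness is the relation between the l_j: L has the dimension n of a complete
  intersection without being one. Leaving out one l_j adds components where T_j = 0. Over a minimal
  prime of f that contains p_j such a component could be too large. There are finitely many minimal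
  primes and k is infinite, so a change of basis moves every p_j off all of them.

  Unmixedness is used as a criterion for single elements: h lies in L if powers of the elements of a
  set E carry h into L and every homogeneous prime over L and E has transcendence degree below n.
  For x_i u_k - x_k u_i the set E consists of the T_j; for the final cancellation it consists of the
  p_a and the T_a u_k.\<close>

no_notation suminf (binder \<open>\<Sum>\<close> 10)

no_syntax "_Sum_any" :: "pttrn => 'a => 'a" (\<open>(\<open>indent=2 notation=\<open>binder \<Sum>\<close>\<close>\<Sum>_. _)\<close> [0, 10] 10)

notation (input) iff (infixr "<->" 25)

text \<open>A sum without index set runs over the whole (finite) index type.\<close>

abbreviation (input) usum :: "('i => 'a) => 'a::comm_monoid_add" (binder \<open>\<Sum>\<close> 10)
 where "usum g == sum g UNIV"

section \<open>Evaluation of polynomials\<close>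

abbreviation lk :: "('a \<Rightarrow>\<^sub>0 'b::zero) => 'a => 'b" where "lk \<equiv> Poly_Mapping.lookup"
abbreviation sng :: "'a => 'b => ('a \<Rightarrow>\<^sub>0 'b::zero)" where "sng \<equiv> Poly_Mapping.single"
abbreviation keys :: "('a \<Rightarrow>\<^sub>0 'b::zero) => 'a set" where "keys \<equiv> Poly_Mapping.keys"

definition ring_map :: "('a::comm_ring_1 => 'b::comm_ring_1) => bool" where
 "ring_map h <-> h 1 = 1 & (ALL x y. h (x + y) = h x + h y) & (ALL x y. h (x * y) = h x * h y)"

lemma ring_map_simps:
 assumes "ring_map h"
 shows "h 1 = 1" "h (x + y) = h x + h y" "h (x * y) = h x * h y" "h 0 = 0" "h (- x) = - h x"
  "h (x - y) = h x - h y" "h (x ^ n) = h x ^ n" "h (sum f A) = (\<Sum>a\<in>A. h (f a))"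
  "h (prod f A) = (\<Prod>a\<in>A. h (f a))" "h (of_int z) = of_int z"
proof -
 show 1: "h 1 = 1" and add: "h (x + y) = h x + h y" and mult: "h (x * y) = h x * h y" for x y
  using assms by (auto simp: ring_map_def)
 show 0: "h 0 = 0" using add[of 0 0] by simp
 show m: "h (- x) = - h x" for x using add[of x "- x"] 0 by (simp add: eq_neg_iff_add_eq_0 add.commute)
 show "h (x - y) = h x - h y" using add[of x "- y"] m[of y] by simp
 show "h (x ^ n) = h x ^ n" by (induction n) (auto simp: 1 mult)
 show "h (sum f A) = (\<Sum>a\<in>A. h (f a))"
  by (induction A rule: infinite_finite_induct) (auto simp: 0 add)
 show "h (prod f A) = (\<Prod>a\<in>A. h (f a))"
  by (induction A rule: infinite_finite_induct) (auto simp: 1 mult)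
 have n: "h (of_nat k) = of_nat k" for k by (induction k) (auto simp: 0 1 add)
 show "h (of_int z) = of_int z" by (cases z rule: int_diff_cases) (use n add m in \<open>metis diff_conv_add_uminus of_int_diff of_int_of_nat_eq\<close>)
qed

lemma ring_mapI:
 "h 1 = 1 ==> (!!x y. h (x + y) = h x + h y) ==> (!!x y. h (x * y) = h x * h y) ==> ring_map h"
 by (simp add: ring_map_def)

lemma ring_map_comp: "ring_map g ==> ring_map h ==> ring_map (%x. g (h x))"
 by (simp add: ring_map_def)

lemma ring_map_const: "ring_map (const :: 'a::comm_ring_1 => ('v, 'a) mpoly)"
 by (rule ring_mapI) (simp_all add: const_simps, simp add: const_def)

lemma ring_map_C: "ring_map (%c::'a::comm_ring_1. [:c:])"
 by (rule ring_mapI) auto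

lemma ring_map_id: "ring_map (%x. x)" by (simp add: ring_map_def)

definition ev_monom :: "('v => 'b::comm_ring_1) => ('v \<Rightarrow>\<^sub>0 nat) => 'b" where
 "ev_monom h t = (\<Prod>v\<in>keys t. h v ^ lk t v)"

definition ev :: "('a::comm_ring_1 => 'b::comm_ring_1) => ('v => 'b) => ('v, 'a) mpoly => 'b" where
 "ev g h F = (\<Sum>t\<in>keys F. g (lk F t) * ev_monom h t)"

lemma ev_monom_superset:
 "finite A ==> keys t \<subseteq> A ==> ev_monom h t = (\<Prod>v\<in>A. h v ^ lk t v)"
 unfolding ev_monom_def by (rule prod.mono_neutral_left) (auto simp: in_keys_iff)

lemma ev_monom_simps [simp]:
 "ev_monom h 0 = 1" "ev_monom h (s + t) = ev_monom h s * ev_monom h t"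
 "ev_monom h (sng v k) = h v ^ k"
proof -
 show "ev_monom h 0 = 1" by (simp add: ev_monom_def)
 have "keys (s + t) \<subseteq> keys s Un keys t" by (rule Poly_Mapping.keys_add)
 thus "ev_monom h (s + t) = ev_monom h s * ev_monom h t"
  by (simp add: ev_monom_superset[of "keys s Un keys t"] lookup_add power_add prod.distrib)
 show "ev_monom h (sng v k) = h v ^ k" by (cases "k = 0") (auto simp: ev_monom_def)
qed

lemma ev_superset:
 "ring_map g ==> finite A ==> keys F \<subseteq> A ==> ev g h F = (\<Sum>t\<in>A. g (lk F t) * ev_monom h t)"
 unfolding ev_def by (rule sum.mono_neutral_left) (auto simp: in_keys_iff ring_map_simps)

lemma ev_add: "ring_map g ==> ev g h (F + G) = ev g h F + ev g h G"
 using Poly_Mapping.keys_add[of F G]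
 by (simp add: ev_superset[of g "keys F Un keys G"] lookup_add ring_map_simps algebra_simps sum.distrib)

lemma ev_single: "ring_map g ==> ev g h (sng t c) = g c * ev_monom h t"
 by (cases "c = 0") (auto simp: ev_def ring_map_simps)

lemma poly_mapping_sum_single: "F = (\<Sum>t\<in>keys F. sng t (lk F t))"
 by (rule poly_mapping_eqI) (simp add: lookup_sum lookup_single when_def sum.delta' in_keys_iff)

lemma poly_mapping_add_induct [case_names single add]:
 assumes "!!t c. P (sng t c)" "!!F G. P F ==> P G ==> P (F + G)"
 shows "P (F :: 'a \<Rightarrow>\<^sub>0 'b::comm_monoid_add)"
proof -
 have "P 0" using assms(1)[of undefined 0] by simp
 hence "P (\<Sum>t\<in>A. sng t (lk F t))" for A
  by (induction A rule: infinite_finite_induct) (auto intro: assms)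
 thus ?thesis by (subst poly_mapping_sum_single)
qed

lemma ev_mult:
 assumes "ring_map g" shows "ev g h (F * G) = ev g h F * ev g h G"
proof (induction F rule: poly_mapping_add_induct)
 case (single s a)
 show ?case
  by (induction G rule: poly_mapping_add_induct)
   (simp_all add: ev_single[OF assms] mult_single ring_map_simps[OF assms] ev_add[OF assms] algebra_simps)
next
 case (add F F')
 thus ?case by (simp add: ev_add[OF assms] distrib_right)
qed

lemma ev_const: "ring_map g ==> ev g h (const c) = g c"
 by (simp add: const_def ev_single)

lemma ev_var: "ring_map g ==> ev g h (var v) = h v"
 by (simp add: var_def ev_single ring_map_simps)

lemma ring_map_ev: "ring_map g ==> ring_map (ev g h)"
 by (rule ring_mapI) (simp_all add: ev_add ev_mult, metis const_def ev_const ring_map_simps(1) single_one)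

lemmas ev_simps = ring_map_simps[OF ring_map_ev] ev_const ev_var

lemma single_eq_const_prod: "sng t c = const c * ev_monom var t"
proof -
 have "sng t 1 = (ev_monom var t :: ('a, 'b::comm_ring_1) mpoly)"
 proof (induction t rule: poly_mapping_add_induct)
  case (single v k)
  have "var v ^ k = (sng (sng v k) 1 :: ('a, 'b) mpoly)"
   by (induction k) (simp_all add: var_def mult_single single_add[symmetric])
  thus ?case by simp
 next
  case (add s t)
  thus ?case by (metis ev_monom_simps(2) mult.left_neutral mult_single)
 qed
 thus ?thesis by (metis add_0 const_def mult.right_neutral mult_single)
qed

lemma mpoly_induct [case_names const var add mult]:
 assumes "!!c. P (const c)" "!!v. P (var v)" "!!F G. P F ==> P G ==> P (F + G)"
  "!!F G. P F ==> P G ==> P (F * G)"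
 shows "P (F :: ('v, 'a::comm_ring_1) mpoly)"
proof (induction F rule: poly_mapping_add_induct)
 case (single t c)
 have 1: "P 1" using assms(1)[of 1] by (simp add: const_def)
 have pw: "P (var v ^ k)" for v k by (induction k) (auto intro: assms 1)
 have "P (\<Prod>v\<in>A. var v ^ lk t v)" for A
  by (induction A rule: infinite_finite_induct) (auto intro: assms 1 pw)
 thus ?case unfolding single_eq_const_prod ev_monom_def by (intro assms)
qed (rule assms)

text \<open>Uniqueness in the universal property. Most identities between substitutions, component
  maps and embeddings below are reduced by it to constants and variables.\<close>

lemma ring_map_eqI:
 assumes "ring_map g" "ring_map h" "!!c. g (const c) = h (const c)" "!!v. g (var v) = h (var v)"
 shows "g F = h (F :: ('v, 'a::comm_ring_1) mpoly)"
 by (induction F rule: mpoly_induct) (auto simp: assms ring_map_simps)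

lemma ev_comp:
 assumes "ring_map f" "ring_map g" "ring_map g'" "!!c. g' c = f (g c)"
 shows "f (ev g h F) = ev g' (%v. f (h v)) F"
 by (rule ring_map_eqI[OF ring_map_comp[OF assms(1) ring_map_ev[OF assms(2)]] ring_map_ev[OF assms(3)]])
  (simp_all add: assms(4) ev_const[OF assms(2)] ev_const[OF assms(3)] ev_var[OF assms(2)] ev_var[OF assms(3)])

abbreviation sub :: "('v => ('w, 'a) mpoly) => ('v, 'a::comm_ring_1) mpoly => ('w, 'a) mpoly" where
 "sub \<equiv> ev const"

lemmas ring_map_sub = ring_map_ev[OF ring_map_const]
lemmas sub_simps = ev_simps[OF ring_map_const]

lemma sub_sub: "sub h (sub g F) = sub (%v. sub h (g v)) F"
 by (rule ev_comp) (auto simp: ring_map_const ring_map_sub sub_simps)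

lemma sub_var: "sub var F = F"
 by (rule ring_map_eqI) (auto simp: ring_map_sub sub_simps ring_map_id)

section \<open>Ideals and primes\<close>

text \<open>Ideals are plain sets over a whole type, so that images and preimages under ring
  homomorphisms need no carriers. \<open>ideal_RT\<close>, \<open>genideal_RT\<close> and
  \<open>primeideal_RT\<close> connect them with the notions of the theorem.\<close>

definition idl :: "'a::comm_ring_1 set => bool" where
 "idl Q <-> 0 \<in> Q & (ALL x:Q. ALL y:Q. x + y \<in> Q) & (ALL r. ALL x:Q. r * x \<in> Q)"

lemma idlI: "0 \<in> Q ==> (!!x y. x \<in> Q ==> y \<in> Q ==> x + y \<in> Q) ==> (!!r x. x \<in> Q ==> r * x \<in> Q) ==> idl Q"
 by (auto simp: idl_def)

lemma idl_D:
 assumes "idl Q"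
 shows idl_0: "0 \<in> Q" and idl_add: "x \<in> Q ==> y \<in> Q ==> x + y \<in> Q"
  and idl_mult: "x \<in> Q ==> r * x \<in> Q" and idl_multr: "x \<in> Q ==> x * r \<in> Q"
  and idl_minus: "x \<in> Q ==> - x \<in> Q" and idl_diff: "x \<in> Q ==> y \<in> Q ==> x - y \<in> Q"
  and idl_sum: "(!!a. a \<in> A ==> f a \<in> Q) ==> sum f A \<in> Q"
proof -
 show *: "0 \<in> Q" "x \<in> Q ==> y \<in> Q ==> x + y \<in> Q" "x \<in> Q ==> r * x \<in> Q" for x y r
  using assms by (auto simp: idl_def)
 show "x \<in> Q ==> x * r \<in> Q" using *(3)[of x r] by (simp add: mult.commute)
 show m: "x \<in> Q ==> - x \<in> Q" for x using *(3)[of x "-1"] by simp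
 show "x \<in> Q ==> y \<in> Q ==> x - y \<in> Q" using *(2)[of x "- y"] m[of y] by simp
 show "(!!a. a \<in> A ==> f a \<in> Q) ==> sum f A \<in> Q"
  by (induction A rule: infinite_finite_induct) (auto intro: *)
qed

definition gen :: "'a::comm_ring_1 set => 'a set" where
 "gen U = \<Inter>{Q. idl Q & U \<subseteq> Q}"

lemma idl_gen: "idl (gen U)" by (auto simp: gen_def intro!: idlI dest: idl_D)
lemma gen_incl: "U \<subseteq> gen U" by (auto simp: gen_def)
lemma gen_least: "idl Q ==> U \<subseteq> Q ==> gen U \<subseteq> Q" by (auto simp: gen_def)
lemma gen_mono: "U \<subseteq> V ==> gen U \<subseteq> gen V" by (auto simp: gen_def)
lemma gen_subI: "U \<subseteq> gen V ==> gen U \<subseteq> gen V" by (intro gen_least idl_gen)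
lemma genI: "x \<in> U ==> x \<in> gen U" using gen_incl by auto
lemma gen_idl: "idl Q ==> gen Q = Q" using gen_least[of Q Q] gen_incl[of Q] by auto

lemma gen_Un_image:
 assumes "idl Q" "finite I"
 shows "gen (Q Un y ` I) = {q + (\<Sum>i\<in>I. r i * y i) | q r. q \<in> Q}" (is "_ = ?R")
proof
 have "idl ?R"
 proof (rule idlI)
  show "0 \<in> ?R" using idl_0[OF assms(1)] by (auto intro!: exI[of _ 0] exI[of _ "%_. 0"])
  fix a b assume "a \<in> ?R" "b \<in> ?R"
  then obtain q r q' r' where "q \<in> Q" "q' \<in> Q" "a = q + (\<Sum>i\<in>I. r i * y i)" "b = q' + (\<Sum>i\<in>I. r' i * y i)"
   by auto
  thus "a + b \<in> ?R" by (auto intro!: exI[of _ "q + q'"] exI[of _ "%i. r i + r' i"]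
     simp: idl_add[OF assms(1)] distrib_right sum.distrib)
 next
  fix c a assume "a \<in> ?R"
  then obtain q r where "q \<in> Q" "a = q + (\<Sum>i\<in>I. r i * y i)" by auto
  thus "c * a \<in> ?R" by (auto intro!: exI[of _ "c * q"] exI[of _ "%i. c * r i"]
     simp: idl_mult[OF assms(1)] distrib_left sum_distrib_left mult.assoc)
 qed
 moreover have "Q \<subseteq> ?R" by (auto intro!: exI[of _ "%_. 0"])
 moreover have "y i \<in> ?R" if "i \<in> I" for i
  using that assms idl_0[OF assms(1)]
  by (auto intro!: exI[of _ 0] exI[of _ "%j. if j = i then 1 else 0"] simp: if_distrib[of "%x. x * _"] cong: if_cong)
 ultimately show "gen (Q Un y ` I) \<subseteq> ?R" by (intro gen_least) auto
 show "?R \<subseteq> gen (Q Un y ` I)"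
  using idl_gen[of "Q Un y ` I"] by (auto intro!: idl_add idl_sum idl_mult intro: genI)
qed

lemma gen_image:
 assumes "finite I" shows "gen (y ` I) = {(\<Sum>i\<in>I. r i * y i) | r. True}"
proof -
 have z: "idl {0}" by (auto intro: idlI)
 have "gen ({0} Un y ` I) = gen (y ` I)"
  using idl_0[OF idl_gen] by (intro equalityI gen_subI) (auto intro: genI)
 thus ?thesis using gen_Un_image[OF z assms, of y] by auto
qed

definition pr :: "'a::comm_ring_1 set => bool" where
 "pr Q <-> idl Q & 1 ~: Q & (ALL a b. a * b \<in> Q --> a \<in> Q \<or> b \<in> Q)"

lemma pr_D:
 assumes "pr Q"
 shows pr_idl: "idl Q" and pr_1: "1 ~: Q" and pr_mult: "a * b \<in> Q ==> a \<in> Q \<or> b \<in> Q"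
  and pr_power: "a ^ n \<in> Q ==> a \<in> Q"
proof -
 show "idl Q" "1 ~: Q" and m: "a * b \<in> Q ==> a \<in> Q \<or> b \<in> Q" for a b using assms by (auto simp: pr_def)
 thus "a ^ n \<in> Q ==> a \<in> Q" by (induction n) auto
qed

lemma idl_vimage: "ring_map h ==> idl Q ==> idl (h -` Q)"
 by (intro idlI) (auto simp: ring_map_simps idl_D)

lemma pr_vimage: "ring_map h ==> pr Q ==> pr (h -` Q)"
 using idl_vimage[of h Q] by (auto simp: pr_def ring_map_simps)

definition poly_ext :: "'a::comm_ring_1 set => 'a poly set" where
 "poly_ext Q = {p. ALL i. coeff p i \<in> Q}"

lemma idl_poly_ext: assumes "idl Q" shows "idl (poly_ext Q)"
 by (rule idlI) (auto simp: poly_ext_def coeff_mult idl_D[OF assms] intro!: idl_sum[OF assms])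

text \<open>The argument of Gauss: for the first coefficients of p and q outside Q, all other
  summands of the corresponding coefficient of the product lie in Q. Pulled back along
  \<open>homog_map\<close> and \<open>split_var\<close> it yields new primes.\<close>

lemma pr_poly_ext:
 fixes Q :: "'a::comm_ring_1 set"
 assumes "pr Q" shows "pr (poly_ext Q)"
 unfolding pr_def
proof (intro conjI allI impI)
 have I: "idl Q" using pr_idl[OF assms] .
 show "idl (poly_ext Q)" by (rule idl_poly_ext[OF I])
 show "1 ~: poly_ext Q" using pr_1[OF assms] by (auto simp: poly_ext_def dest!: spec[of _ 0])
 fix p q :: "'a poly" assume pq: "p * q \<in> poly_ext Q"
 show "p \<in> poly_ext Q \<or> q \<in> poly_ext Q"
 proof (rule ccontr)
  assume "\<not> ?thesis"
  hence ex: "EX i. coeff p i ~: Q" "EX i. coeff q i ~: Q" by (auto simp: poly_ext_def)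
  define i j where "i = (LEAST i. coeff p i ~: Q)" and "j = (LEAST j. coeff q j ~: Q)"
  have ij: "coeff p i ~: Q" "coeff q j ~: Q" using LeastI_ex[OF ex(1)] LeastI_ex[OF ex(2)] by (auto simp: i_def j_def)
  have lt: "a < i ==> coeff p a \<in> Q" "a < j ==> coeff q a \<in> Q" for a
   using not_less_Least by (auto simp: i_def j_def)
  have "coeff (p * q) (i + j) = (\<Sum>a\<le>i + j. coeff p a * coeff q (i + j - a))" by (rule coeff_mult)
  also have "\<dots> = coeff p i * coeff q j + (\<Sum>a\<in>{..i + j} - {i}. coeff p a * coeff q (i + j - a))"
   by (subst sum.remove[of _ i]) auto
  finally have e: "coeff p i * coeff q j = coeff (p * q) (i + j) - (\<Sum>a\<in>{..i + j} - {i}. coeff p a * coeff q (i + j - a))"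
   by simp
  have "coeff p a * coeff q (i + j - a) \<in> Q" if "a \<in> {..i + j} - {i}" for a
  proof (cases "a < i")
   case True thus ?thesis using lt(1) idl_multr[OF I] by blast
  next
   case False
   hence "i + j - a < j" using that by auto
   thus ?thesis using lt(2) idl_mult[OF I] by blast
  qed
  hence "coeff p i * coeff q j \<in> Q" unfolding e
   using pq by (intro idl_diff[OF I] idl_sum[OF I]) (auto simp: poly_ext_def)
  thus False using ij pr_mult[OF assms] by blast
 qed
qed

text \<open>The tool for exchanging variables modulo an ideal. Combined with
  \<open>ev_homog_scale\<close> it replaces x by u and T by p at the cost of a power of a scalar
  factor.\<close>

lemma ring_map_cong_idl:
 assumes "ring_map g" "ring_map h" "idl Q" "!!c. g (const c) - h (const c) \<in> Q" "!!v. g (var v) - h (var v) \<in> Q"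
 shows "g F - h (F :: ('v, 'a::comm_ring_1) mpoly) \<in> Q"
proof (induction F rule: mpoly_induct)
 case (add F G)
 have "g (F + G) - h (F + G) = (g F - h F) + (g G - h G)" by (simp add: ring_map_simps assms)
 thus ?case using add idl_add[OF assms(3)] by auto
next
 case (mult F G)
 have "g (F * G) - h (F * G) = g F * (g G - h G) + (g F - h F) * h G"
  by (simp add: ring_map_simps assms algebra_simps)
 thus ?case using mult by (auto simp: idl_D[OF assms(3)])
qed (use assms in auto)

section \<open>Homogeneous components\<close>

text \<open>\<open>homog_map w\<close> substitutes \<open>X\<^sub>v t\<^bsup>w v\<^esup>\<close> for \<open>X\<^sub>v\<close>, so that the coefficient of \<open>t\<^sup>d\<close> is the
  component of weighted degree \<open>d\<close>.\<close>

definition homog_map :: "('v => nat) => ('v, 'a::comm_ring_1) mpoly => ('v, 'a) mpoly poly" where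
 "homog_map w = ev (%c. [:const c:]) (%v. monom (var v) (w v))"

definition hcomp :: "('v => nat) => nat => ('v, 'a::comm_ring_1) mpoly => ('v, 'a) mpoly" where
 "hcomp w d F = coeff (homog_map w F) d"

text \<open>Stated as an equation for \<open>homog_map\<close>, so that products and substitutions
  of homogeneous elements become computations with monomials; \<open>homog_iff\<close> recovers the
  description by exponents.\<close>

definition homog :: "('v => nat) => nat => ('v, 'a::comm_ring_1) mpoly => bool" where
 "homog w d F <-> homog_map w F = monom F d"

abbreviation (input) w1 :: "'v => nat" where "w1 \<equiv> (%_. Suc 0)"

lemma ring_map_constC: "ring_map (%c::'a::comm_ring_1. [:const c:: ('v, 'a) mpoly:])"
 by (rule ring_map_comp[OF ring_map_C ring_map_const])

lemma ring_map_homog_map: "ring_map (homog_map w)"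
 unfolding homog_map_def by (rule ring_map_ev[OF ring_map_constC])

lemmas homog_map_simps = ring_map_simps[OF ring_map_homog_map]

lemma homog_map_const: "homog_map w (const c) = monom (const c) 0"
 by (simp add: homog_map_def ev_simps ring_map_constC monom_0)
lemma homog_map_var: "homog_map w (var v) = monom (var v) (w v)"
 by (simp add: homog_map_def ev_simps ring_map_constC)

lemma homog_const: "homog w 0 (const c)" by (simp add: homog_def homog_map_const)
lemma homog_var: "homog w (w v) (var v)" by (simp add: homog_def homog_map_var)
lemma homog_0: "homog w d 0" by (simp add: homog_def homog_map_simps)
lemma homog_1: "homog w 0 1" by (simp add: homog_def homog_map_simps monom_0)
lemma homog_add: "homog w d F ==> homog w d G ==> homog w d (F + G)"
 by (simp add: homog_def homog_map_simps add_monom)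
lemma homog_diff: "homog w d F ==> homog w d G ==> homog w d (F - G)"
 by (simp add: homog_def homog_map_simps diff_monom)
lemma homog_minus: "homog w d F ==> homog w d (- F)"
 by (simp add: homog_def homog_map_simps minus_monom)
lemma homog_mult: "homog w d F ==> homog w e G ==> homog w (d + e) (F * G)"
 by (simp add: homog_def homog_map_simps mult_monom)
lemma homog_sum: "(!!a. a \<in> A ==> homog w d (F a)) ==> homog w d (sum F A)"
 by (induction A rule: infinite_finite_induct) (auto simp: homog_0 homog_add)
lemma homog_power: "homog w d F ==> homog w (k * d) (F ^ k)"
 by (induction k) (auto simp: homog_1 homog_mult)

lemma homog_prod: "(!!a. a \<in> A ==> homog w (d a) (F a)) ==> homog w (sum d A) (prod F A)"
 by (induction A rule: infinite_finite_induct) (auto simp: homog_1 homog_mult)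

lemma hcomp_homog: "homog w d F ==> hcomp w e F = (if e = d then F else 0)"
 by (auto simp: hcomp_def homog_def)

lemma hcomp_add: "hcomp w d (F + G) = hcomp w d F + hcomp w d G"
 by (simp add: hcomp_def homog_map_simps)
lemma hcomp_minus: "hcomp w d (- F) = - hcomp w d F"
 by (simp add: hcomp_def homog_map_simps)
lemma hcomp_diff: "hcomp w d (F - G) = hcomp w d F - hcomp w d G"
 by (simp add: hcomp_def homog_map_simps)
lemma hcomp_0: "hcomp w d 0 = 0" by (simp add: hcomp_def homog_map_simps)
lemma hcomp_sum: "hcomp w d (sum F A) = (\<Sum>a\<in>A. hcomp w d (F a))"
 by (induction A rule: infinite_finite_induct) (auto simp: hcomp_0 hcomp_add)
lemma hcomp_mult_homog:
 "homog w e F ==> hcomp w d (F * G) = (if e \<le> d then F * hcomp w (d - e) G else 0)"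
 by (simp add: hcomp_def homog_def homog_map_simps coeff_monom_mult)
lemma hcomp_mult_homog2:
 "homog w e F ==> hcomp w d (G * F) = (if e \<le> d then hcomp w (d - e) G * F else 0)"
 by (simp add: hcomp_mult_homog mult.commute)

lemma homog_map_single: "homog_map w (sng t c) = monom (sng t c) (\<Sum>v\<in>keys t. w v * lk t v)"
 unfolding single_eq_const_prod ev_monom_def homog_map_simps homog_map_const homog_map_var
proof -
 have "(\<Prod>a\<in>A. monom (var a) (w a) ^ lk t a) = (monom (\<Prod>v\<in>A. var v ^ lk t v) (\<Sum>v\<in>A. w v * lk t v) :: ('a, 'b) mpoly poly)" for A
  by (induction A rule: infinite_finite_induct) (auto simp: monom_power mult_monom mult.commute monom_0)
 thus "monom (const c) 0 * (\<Prod>a\<in>keys t. monom (var a) (w a) ^ lk t a) =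
  (monom (const c * (\<Prod>v\<in>keys t. var v ^ lk t v)) (\<Sum>v\<in>keys t. w v * lk t v) :: ('a, 'b) mpoly poly)"
  by (simp add: mult_monom)
qed

lemma lookup_hcomp: "lk (hcomp w d F) t = (if (\<Sum>v\<in>keys t. w v * lk t v) = d then lk F t else 0)"
proof (induction F rule: poly_mapping_add_induct)
 case (single s c)
 thus ?case by (auto simp: hcomp_def homog_map_single lookup_single when_def)
qed (simp add: hcomp_add lookup_add)

lemma homog_iff: "homog w d F <-> (ALL t:keys F. (\<Sum>v\<in>keys t. w v * lk t v) = d)"
proof
 assume h: "homog w d F"
 show "ALL t:keys F. (\<Sum>v\<in>keys t. w v * lk t v) = d"
 proof
  fix t assume "t \<in> keys F"
  thus "(\<Sum>v\<in>keys t. w v * lk t v) = d"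
   using lookup_hcomp[of w d F t] hcomp_homog[OF h, of d] by (auto simp: in_keys_iff split: if_splits)
 qed
next
 assume *: "ALL t:keys F. (\<Sum>v\<in>keys t. w v * lk t v) = d"
 have "homog w d (sng t (lk F t))" if "t \<in> keys F" for t
  using * that by (simp add: homog_def homog_map_single)
 thus "homog w d F" by (subst poly_mapping_sum_single) (rule homog_sum)
qed

lemma homog_hcomp: "homog w d (hcomp w d F)"
 by (auto simp: homog_iff in_keys_iff lookup_hcomp split: if_splits)

lemma sum_hcomp: "F = (\<Sum>d\<le>degree (homog_map w F). hcomp w d F)"
proof -
 have "poly (homog_map w F) 1 = F"
 proof -
  have "ring_map (%p::('a, 'b) mpoly poly. poly p 1)" by (simp add: ring_map_def)
  from ring_map_comp[OF this ring_map_homog_map] show ?thesis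
   by (rule ring_map_eqI[OF _ ring_map_id]) (simp_all add: homog_map_const homog_map_var poly_monom)
 qed
 thus ?thesis by (simp add: poly_altdef hcomp_def)
qed

lemma hcomp_hcomp: "hcomp w d (hcomp w e F) = (if d = e then hcomp w d F else 0)"
 by (simp add: hcomp_homog[OF homog_hcomp])

definition hideal :: "('v => nat) => ('v, 'a::comm_ring_1) mpoly set => bool" where
 "hideal w Q <-> idl Q & (ALL F:Q. ALL d. hcomp w d F \<in> Q)"

text \<open>The elements all of whose components lie in \<open>gen U\<close> form the preimage of an
  extended ideal under \<open>homog_map\<close>. This is an ideal, and it contains U.\<close>

lemma hideal_gen:
 assumes "!!F. F \<in> U ==> EX d. homog w d F" shows "hideal w (gen U)"
 unfolding hideal_def
proof (intro conjI idl_gen ballI allI)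
 fix F d assume "F \<in> gen U"
 have "gen U \<subseteq> homog_map w -` poly_ext (gen U)"
 proof (rule gen_least)
  show "idl (homog_map w -` poly_ext (gen U))"
   by (intro idl_vimage ring_map_homog_map idl_poly_ext idl_gen)
  show "U \<subseteq> homog_map w -` poly_ext (gen U)"
  proof
   fix F assume F: "F \<in> U"
   then obtain d where "homog w d F" using assms by blast
   thus "F \<in> homog_map w -` poly_ext (gen U)"
    using genI[OF F] idl_0[OF idl_gen] by (auto simp: homog_def poly_ext_def)
  qed
 qed
 thus "hcomp w d F \<in> gen U" using \<open>F \<in> gen U\<close> by (auto simp: poly_ext_def hcomp_def)
qed

lemma hideal_hcompI:
 assumes "hideal w Q" "!!d. hcomp w d F \<in> Q" shows "F \<in> Q"
 using sum_hcomp[of F w] idl_sum[of Q "{..degree (homog_map w F)}" "%d. hcomp w d F"] assms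
 by (auto simp: hideal_def)

text \<open>The homogeneous core of an ideal Q, its largest w-homogeneous subideal. In this form, as
  the preimage of an extension, it is visibly prime if Q is.\<close>

definition core :: "('v => nat) => ('v, 'a::comm_ring_1) mpoly set => ('v, 'a) mpoly set" where
 "core w Q = homog_map w -` poly_ext Q"

lemma mem_core: "F \<in> core w Q <-> (ALL d. hcomp w d F \<in> Q)"
 by (auto simp: core_def poly_ext_def hcomp_def)

lemma pr_core: "pr Q ==> pr (core w Q)"
 unfolding core_def by (intro pr_vimage ring_map_homog_map pr_poly_ext)

lemma core_subset: "idl Q ==> core w Q \<subseteq> Q"
proof
 fix F assume "idl Q" "F \<in> core w Q"
 thus "F \<in> Q" using sum_hcomp[of F w] idl_sum[of Q "{..degree (homog_map w F)}" "%d. hcomp w d F"]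
  by (auto simp: mem_core)
qed

lemma homog_mem_core: "homog w d F ==> idl Q ==> F \<in> Q ==> F \<in> core w Q"
 by (auto simp: mem_core hcomp_homog idl_0)

lemma hideal_core: "idl Q ==> hideal w (core w Q)"
 unfolding hideal_def
 by (simp add: mem_core hcomp_hcomp idl_0) (simp add: core_def idl_vimage ring_map_homog_map idl_poly_ext)

lemma hideal_subset_core: "hideal w b ==> b \<subseteq> Q ==> b \<subseteq> core w Q"
 unfolding hideal_def by (meson mem_core subsetD subsetI)

section \<open>Algebraic independence modulo a prime\<close>

definition vars_in :: "'v set => ('v, 'a::comm_ring_1) mpoly => bool" where
 "vars_in A F <-> (ALL t:keys F. keys t \<subseteq> A)"

lemma vars_in_induct [consumes 1, case_names const var add mult]:
 assumes "vars_in A F" "!!c. P (const c)" "!!v. v \<in> A ==> P (var v)"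
  "!!F G. P F ==> P G ==> P (F + G)" "!!F G. P F ==> P G ==> P (F * G)"
 shows "P (F :: ('v, 'a::comm_ring_1) mpoly)"
proof -
 have 1: "P 1" using assms(2)[of 1] by (simp add: const_def)
 have 0: "P 0" using assms(2)[of 0] by (simp add: const_def)
 have pw: "P (var v ^ k)" if "v \<in> A" for v k using that by (induction k) (auto intro: assms 1)
 have "P (\<Prod>v\<in>B. var v ^ lk t v)" if "B \<subseteq> A" for B t
  using that by (induction B rule: infinite_finite_induct) (auto intro: assms 1 pw)
 hence s: "P (sng t c)" if "keys t \<subseteq> A" for t c
  using that unfolding single_eq_const_prod ev_monom_def by (intro assms) auto
 have "P (\<Sum>t\<in>B. sng t (lk F t))" if "B \<subseteq> keys F" for B
  using that
 proof (induction B rule: infinite_finite_induct)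
  case (insert t B)
  hence "keys t \<subseteq> A" using assms(1) by (auto simp: vars_in_def)
  thus ?case using insert by (simp add: assms(4) s)
 qed (simp_all add: 0)
 from this[of "keys F"] show ?thesis by (subst poly_mapping_sum_single) simp
qed

lemma vars_in_add: "vars_in A F ==> vars_in A G ==> vars_in A (F + G)"
 using Poly_Mapping.keys_add[of F G] by (auto simp: vars_in_def)
lemma vars_in_mult: "vars_in A F ==> vars_in A G ==> vars_in A (F * G)"
 unfolding vars_in_def
proof
 fix t assume a: "ALL t:keys F. keys t \<subseteq> A" "ALL t:keys G. keys t \<subseteq> A" "t \<in> keys (F * G)"
 then obtain r s where "t = r + s" "r \<in> keys F" "s \<in> keys G" using keys_mult[of F G] by blast
 thus "keys t \<subseteq> A" using a(1,2) Poly_Mapping.keys_add[of r s] by blast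
qed
lemma vars_in_const: "vars_in A (const c)" by (auto simp: vars_in_def const_def)
lemma vars_in_0: "vars_in A 0" and vars_in_1: "vars_in A 1" by (auto simp: vars_in_def)
lemma vars_in_var: "v \<in> A ==> vars_in A (var v)" by (auto simp: vars_in_def var_def)
lemma vars_in_sum: "(!!i. i \<in> I ==> vars_in A (f i)) ==> vars_in A (sum f I)"
 by (induction I rule: infinite_finite_induct) (auto simp: vars_in_0 vars_in_add)
lemma vars_in_uminus: "vars_in A F ==> vars_in A (- F)" by (simp add: vars_in_def)
lemma vars_in_diff: "vars_in A F ==> vars_in A G ==> vars_in A (F - G)"
 using vars_in_add[of A F "- G"] vars_in_uminus[of A G] by simp
lemma vars_in_mono: "vars_in A F ==> A \<subseteq> B ==> vars_in B F" by (auto simp: vars_in_def)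
lemma vars_in_UNIV: "vars_in UNIV F" by (auto simp: vars_in_def)
lemmas vars_in_intros = vars_in_add vars_in_mult vars_in_const vars_in_0 vars_in_1 vars_in_var vars_in_sum
 vars_in_uminus vars_in_diff

lemma vars_in_empty: assumes "vars_in {} F" obtains c where "F = const c"
proof -
 have "EX c. F = const c"
  using assms by (induction F rule: vars_in_induct) (auto simp: const_simps[symmetric])
 thus ?thesis using that by blast
qed

lemma ev_cong:
 assumes "ring_map g" "vars_in A F" "!!v. v \<in> A ==> h v = h' v" shows "ev g h F = ev g h' F"
 using assms(2) by (induction F rule: vars_in_induct) (auto simp: ev_simps[OF assms(1)] assms(3))

lemma vars_in_sub:
 assumes "vars_in A F" "!!v. v \<in> A ==> vars_in B (h v)" shows "vars_in B (sub h F)"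
 using assms(1) by (induction F rule: vars_in_induct) (auto simp: sub_simps vars_in_intros assms(2))

text \<open>F as a polynomial in the variable v. The coefficients stay in the same ring and merely
  avoid v, so that variables can be eliminated one after the other without changing the
  type.\<close>

definition split_var :: "'v => ('v, 'a::comm_ring_1) mpoly => ('v, 'a) mpoly poly" where
 "split_var v = ev (%c. [:const c:]) (%u. if u = v then [:0, 1:] else [:var u:])"

lemma ring_map_split_var: "ring_map (split_var v)"
 unfolding split_var_def by (rule ring_map_ev[OF ring_map_constC])

lemma split_var_const: "split_var v (const c) = [:const c:]"
 and split_var_var: "split_var v (var u) = (if u = v then [:0, 1:] else [:var u:])"
 unfolding split_var_def by (simp_all add: ev_simps[OF ring_map_constC])

lemmas split_var_simps = ring_map_simps[OF ring_map_split_var] split_var_const split_var_var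

lemma ring_map_poly: "ring_map (%p::'a::comm_ring_1 poly. poly p c)" by (simp add: ring_map_def)

lemma poly_split_var: "poly (split_var v F) (var v) = F"
 by (rule ring_map_eqI[OF ring_map_comp[OF ring_map_poly ring_map_split_var] ring_map_id])
  (auto simp: split_var_simps)

lemma split_var_eq_0: "split_var v F = 0 ==> F = 0"
 using poly_split_var[of v F] by simp

lemma vars_in_split_var:
 assumes "vars_in A F" shows "vars_in (A - {v}) (coeff (split_var v F) i)"
proof -
 have "ALL i. vars_in (A - {v}) (coeff (split_var v F) i)"
  using assms
 proof (induction F rule: vars_in_induct)
  case (mult F G)
  thus ?case by (auto simp: split_var_simps coeff_mult intro!: vars_in_sum vars_in_mult)
 qed (auto simp: split_var_simps vars_in_add coeff_pCons vars_in_intros split: nat.split)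
 thus ?thesis by blast
qed

lemma split_var_notin: assumes "vars_in A F" "v ~: A" shows "split_var v F = [:F:]"
 using assms(1) by (induction F rule: vars_in_induct) (use assms(2) in \<open>auto simp: split_var_simps\<close>)

lemma ring_map_map_poly: assumes "ring_map h" shows "ring_map (map_poly h)"
proof (rule ring_mapI)
 have c: "coeff (map_poly h p) i = h (coeff p i)" for p i
  by (simp add: coeff_map_poly ring_map_simps[OF assms])
 show "map_poly h 1 = 1" by (rule poly_eqI) (simp add: c coeff_1 ring_map_simps[OF assms])
 show "map_poly h (p + q) = map_poly h p + map_poly h q" for p q
  by (rule poly_eqI) (simp add: c ring_map_simps[OF assms])
 show "map_poly h (p * q) = map_poly h p * map_poly h q" for p q
  by (rule poly_eqI) (simp add: c coeff_mult ring_map_simps[OF assms])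
qed

lemma sub_upd: "sub (w(v := c)) F = poly (map_poly (sub w) (split_var v F)) c"
proof -
 have m: "ring_map (%F. poly (map_poly (sub w) (split_var v F)) c)"
  by (rule ring_map_comp[OF ring_map_poly ring_map_comp[OF ring_map_map_poly[OF ring_map_sub] ring_map_split_var]])
 show ?thesis
  by (rule ring_map_eqI[OF ring_map_sub m])
   (auto simp: split_var_simps sub_simps map_poly_pCons)
qed

text \<open>Relations are polynomials in countably many new variables, so s is not bounded a priori.
  For prime Q, \<open>ind Q s\<close> says that the fraction field of the residue ring has
  transcendence degree at least s.\<close>

definition alg_indep :: "('v, 'k::field) mpoly set => (nat => ('v, 'k) mpoly) => nat => bool" where
 "alg_indep Q w s <-> (ALL G. vars_in {..<s} G --> sub w G \<in> Q --> G = 0)"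

definition ind :: "('v, 'k::field) mpoly set => nat => bool" where
 "ind Q s <-> (EX w. alg_indep Q w s)"

lemma ind_mono: "ind Q s ==> Q' \<subseteq> Q ==> s' \<le> s ==> ind Q' s'"
 unfolding ind_def alg_indep_def
 by (meson lessThan_subset_iff subsetD vars_in_mono)

lemma const_in_prime: assumes "pr Q" "const (c :: 'k::field) \<in> Q" shows "c = 0"
proof (rule ccontr)
 assume "c ~= 0"
 hence "const (inverse c) * const c = (1 :: ('a, 'k) mpoly)"
  by (simp add: const_simps[symmetric]) (simp add: const_def)
 thus False using assms idl_mult[OF pr_idl[OF assms(1)] assms(2), of "const (inverse c)"] pr_1[OF assms(1)] by simp
qed

lemma ind_0: "pr Q ==> ind Q 0"
 unfolding ind_def alg_indep_def
proof (intro exI allI impI)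
 fix G assume "pr Q" "vars_in {..<0::nat} G" "sub (%_. 0) G \<in> Q"
 hence "vars_in {} G" by (simp add: lessThan_0)
 then obtain c where "G = const c" by (rule vars_in_empty)
 with \<open>pr Q\<close> \<open>sub _ G \<in> Q\<close> show "G = 0" by (auto simp: sub_simps const_simps dest: const_in_prime)
qed

text \<open>Adjoin c to a family that is independent modulo Q'. In a relation modulo Q the part free
  of c lies in Q' and hence vanishes; then c can be cancelled modulo Q. This makes \<open>td\<close>
  strictly decreasing.\<close>

lemma ind_Suc:
 assumes Q: "pr Q" and Q': "idl Q'" "Q \<subseteq> Q'" and c: "c \<in> Q'" "c ~: Q" and s: "ind Q' s"
 shows "ind Q (Suc s)"
proof -
 obtain w where w: "alg_indep Q' w s" using s by (auto simp: ind_def)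
 have *: "g = 0" if "ALL i. vars_in {..<s} (coeff g i)" "poly (map_poly (sub w) g) c \<in> Q" for g
  using that
 proof (induction g)
  case (pCons a g)
  have e: "poly (map_poly (sub w) (pCons a g)) c = sub w a + c * poly (map_poly (sub w) g) c"
   by (simp add: map_poly_pCons sub_simps)
  have "sub w a = poly (map_poly (sub w) (pCons a g)) c - c * poly (map_poly (sub w) g) c" using e by simp
  hence "sub w a \<in> Q'" using pCons.prems(2) Q' c by (auto intro!: idl_diff idl_multr)
  hence a: "a = 0" using w pCons.prems(1)[rule_format, of 0] by (auto simp: alg_indep_def)
  hence "c * poly (map_poly (sub w) g) c \<in> Q" using e pCons.prems(2) by (simp add: sub_simps)
  hence "poly (map_poly (sub w) g) c \<in> Q" using pr_mult[OF Q] c by blast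
  moreover have "ALL i. vars_in {..<s} (coeff g i)"
   using pCons.prems(1) by (metis coeff_pCons_Suc)
  ultimately show ?case using a pCons.IH by simp
 qed simp
 have "alg_indep Q (w(s := c)) (Suc s)"
  unfolding alg_indep_def
 proof (intro allI impI)
  fix G assume G: "vars_in {..<Suc s} G" "sub (w(s := c)) G \<in> Q"
  have "{..<Suc s} - {s} = {..<s}" by auto
  hence "vars_in {..<s} (coeff (split_var s G) i)" for i using vars_in_split_var[OF G(1), of s i] by simp
  hence "split_var s G = 0" using * G(2) by (simp add: sub_upd)
  thus "G = 0" by (rule split_var_eq_0)
 qed
 thus ?thesis by (auto simp: ind_def)
qed

section \<open>Counting\<close>

text \<open>Fraction-free elimination: the rows are multiplied by the pivot, and primality of Q
  keeps the pivot from annihilating the solution of the smaller system.\<close>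

lemma linear_system_mod_prime:
 assumes "pr (Q :: 'a::comm_ring_1 set)" "finite E" "finite U" "card E < card U"
 shows "EX v. (EX u:U. v u ~: Q) & (ALL e:E. (\<Sum>u\<in>U. c e u * v u) \<in> Q)"
 using assms(2-)
proof (induction E arbitrary: U c rule: finite_induct)
 case empty
 then obtain u where "u \<in> U" by fastforce
 thus ?case using pr_1[OF assms(1)] by (intro exI[of _ "%_. 1"]) auto
next
 case (insert e E)
 note I = pr_idl[OF assms(1)]
 show ?case
 proof (cases "ALL u:U. c e u \<in> Q")
  case True
  have "card E < card U" using insert by simp
  from insert.IH[OF insert.prems(1) this, of c] obtain v where "EX u:U. v u ~: Q" "ALL e:E. (\<Sum>u\<in>U. c e u * v u) \<in> Q" by auto
  thus ?thesis using True by (intro exI[of _ v]) (auto intro!: idl_sum[OF I] idl_multr[OF I])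
 next
  case False
  then obtain p where p: "p \<in> U" "c e p ~: Q" by blast
  define c' where "c' a u = c e p * c a u - c a p * c e u" for a u
  have "card E < card (U - {p})" using insert p by simp
  from insert.IH[OF _ this, of c'] insert obtain v where
   v: "EX u:U - {p}. v u ~: Q" "ALL a:E. (\<Sum>u\<in>U - {p}. c' a u * v u) \<in> Q" by auto
  define v' where "v' u = (if u = p then - (\<Sum>u\<in>U - {p}. c e u * v u) else c e p * v u)" for u
  have s: "(\<Sum>u\<in>U. c a u * v' u) = (\<Sum>u\<in>U - {p}. c' a u * v u)" for a
  proof -
   have "(\<Sum>u\<in>U. c a u * v' u) = c a p * v' p + (\<Sum>u\<in>U - {p}. c a u * (c e p * v u))"
    using p insert.prems by (simp add: sum.remove[of U p] v'_def)
   also have "\<dots> = (\<Sum>u\<in>U - {p}. c' a u * v u)"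
    by (simp add: v'_def c'_def sum_distrib_left sum_negf[symmetric] sum.distrib[symmetric] algebra_simps)
   finally show ?thesis .
  qed
  have "(\<Sum>u\<in>U - {p}. c' e u * v u) = 0" by (simp add: c'_def mult.commute)
  hence "ALL a:insert e E. (\<Sum>u\<in>U. c a u * v' u) \<in> Q" using v(2) s idl_0[OF I] by auto
  moreover from v(1) p have "EX u:U. v' u ~: Q"
   using pr_mult[OF assms(1)] by (auto simp: v'_def)
  ultimately show ?thesis by blast
 qed
qed

lemma pr_zero_idom: "pr {0 :: 'a::idom}"
 by (auto simp: pr_def intro: idlI)

definition box :: "'i set => nat => ('i \<Rightarrow>\<^sub>0 nat) set" where
 "box A D = {t. keys t \<subseteq> A & (ALL i:A. lk t i < D)}"

lemma card_box: assumes "finite A" shows "finite (box A D) & card (box A D) = D ^ card A"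
proof -
 have "bij_betw (%t. \<lambda>i\<in>A. lk t i) (box A D) (PiE A (%_. {..<D}))"
  unfolding bij_betw_def
 proof
  show "inj_on (%t. \<lambda>i\<in>A. lk t i) (box A D)"
  proof (rule inj_onI, rule poly_mapping_eqI)
   fix s t i assume st: "s \<in> box A D" "t \<in> box A D" "(\<lambda>i\<in>A. lk s i) = (\<lambda>i\<in>A. lk t i)"
   show "lk s i = lk t i"
   proof (cases "i \<in> A")
    case True thus ?thesis using fun_cong[OF st(3), of i] by simp
   next
    case False hence "i ~: keys s" "i ~: keys t" using st(1,2) by (auto simp: box_def)
    thus ?thesis by (simp add: in_keys_iff)
   qed
  qed
  show "(%t. \<lambda>i\<in>A. lk t i) ` box A D = (PiE A (%_. {..<D}))"
  proof
   show "(PiE A (%_. {..<D})) \<subseteq> (%t. \<lambda>i\<in>A. lk t i) ` box A D"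
   proof
    fix f assume f: "f \<in> PiE A (%_. {..<D})"
    define t where "t = (\<Sum>i\<in>A. sng i (f i))"
    have l: "lk t i = (if i \<in> A then f i else 0)" for i
     using assms by (simp add: t_def lookup_sum lookup_single when_def)
    have "t \<in> box A D" using f by (auto simp: box_def l in_keys_iff split: if_splits)
    moreover have "f = (\<lambda>i\<in>A. lk t i)" using f by (auto simp: l fun_eq_iff restrict_def PiE_def extensional_def)
    ultimately show "f \<in> (%t. \<lambda>i\<in>A. lk t i) ` box A D" by blast
   qed
  qed (auto simp: box_def)
 qed
 moreover have "finite (PiE A (%_. {..<D}))" using assms by (intro finite_PiE) auto
 ultimately have "finite (box A D)" "card (box A D) = card (PiE A (%_. {..<D}))"
  by (metis bij_betw_finite, metis bij_betw_same_card)
 thus ?thesis by (simp add: card_PiE[OF assms])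
qed

text \<open>Modulo Q, F is a combination of the monomials in B over polynomials in the y whose
  degree in each variable is at most E. Bounding every exponent separately lets
  \<open>card_box\<close> count the coefficients.\<close>

definition in_span :: "('v, 'k::field) mpoly set => (nat => ('v, 'k) mpoly) => nat set => ('v \<Rightarrow>\<^sub>0 nat) set =>
  nat => ('v, 'k) mpoly => bool" where
 "in_span Q y I B E F <-> (EX g. (ALL b:B. keys (g b) \<subseteq> box I (Suc E)) &
   F - (\<Sum>b\<in>B. sub y (g b) * ev_monom var b) \<in> Q)"

lemma in_span_0: "idl Q ==> in_span Q y I B E 0"
 unfolding in_span_def by (rule exI[of _ "%_. 0"]) (simp add: sub_simps idl_0)

lemma in_span_add:
 assumes "idl Q" "in_span Q y I B E F" "in_span Q y I B E G" shows "in_span Q y I B E (F + G)"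
proof -
 obtain g h where g: "ALL b:B. keys (g b) \<subseteq> box I (Suc E)" "F - (\<Sum>b\<in>B. sub y (g b) * ev_monom var b) \<in> Q"
  and h: "ALL b:B. keys (h b) \<subseteq> box I (Suc E)" "G - (\<Sum>b\<in>B. sub y (h b) * ev_monom var b) \<in> Q"
  using assms(2,3) by (auto simp: in_span_def)
 have "keys (g b + h b) \<subseteq> box I (Suc E)" if "b \<in> B" for b
  using that g(1) h(1) Poly_Mapping.keys_add[of "g b" "h b"] by blast
 moreover have "F + G - (\<Sum>b\<in>B. sub y (g b + h b) * ev_monom var b) \<in> Q"
  using idl_add[OF assms(1) g(2) h(2)] by (simp add: sub_simps distrib_right sum.distrib algebra_simps)
 ultimately show ?thesis unfolding in_span_def by (intro exI[of _ "%b. g b + h b"]) blast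
qed

lemma in_span_sum: "idl Q ==> (!!a. a \<in> A ==> in_span Q y I B E (F a)) ==> in_span Q y I B E (sum F A)"
 by (induction A rule: infinite_finite_induct) (auto simp: in_span_0 in_span_add)

lemma in_span_mem: "idl Q ==> F \<in> Q ==> in_span Q y I B E F"
 unfolding in_span_def by (rule exI[of _ "%_. 0"]) (simp add: sub_simps)

lemma in_span_mono: "in_span Q y I B E F ==> E \<le> E' ==> in_span Q y I B E' F"
proof -
 assume "in_span Q y I B E F" "E \<le> E'"
 moreover hence "box I (Suc E) \<subseteq> box I (Suc E')" by (fastforce simp: box_def)
 ultimately show ?thesis unfolding in_span_def by (meson subset_trans)
qed

lemma in_span_mult:
 assumes "idl Q" "in_span Q y I B E F" "i \<in> I" shows "in_span Q y I B (Suc E) (F * y i)"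
proof -
 obtain g where g: "ALL b:B. keys (g b) \<subseteq> box I (Suc E)" "F - (\<Sum>b\<in>B. sub y (g b) * ev_monom var b) \<in> Q"
  using assms(2) by (auto simp: in_span_def)
 have "keys (g b * var i) \<subseteq> box I (Suc (Suc E))" if b: "b \<in> B" for b
 proof
  fix t assume "t \<in> keys (g b * var i)"
  then obtain s where s: "s \<in> keys (g b)" "t = s + sng i 1"
   using keys_mult[of "g b" "var i"] by (auto simp: var_def split: if_splits)
  hence "s \<in> box I (Suc E)" using g(1) b by blast
  thus "t \<in> box I (Suc (Suc E))"
   using assms(3) Poly_Mapping.keys_add[of s "sng i 1"] s(2)
   by (auto simp: box_def lookup_add lookup_single when_def le_SucI split: if_splits)
 qed
 moreover have "F * y i - (\<Sum>b\<in>B. sub y (g b * var i) * ev_monom var b) \<in> Q"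
  using idl_multr[OF assms(1) g(2), of "y i"] by (simp add: sub_simps algebra_simps sum_distrib_left)
 ultimately show ?thesis unfolding in_span_def by (intro exI[of _ "%b. g b * var i"]) auto
qed

text \<open>A monomial outside the box is divisible by some \<open>var v ^ M\<close>, which lies in
  the ideal of Q and the y. In the component of degree d the cofactor of each y i has smaller
  degree, because y i has positive degree, so induction on d applies.\<close>

lemma homog_in_span:
 fixes Q :: "('v::finite, 'k::field) mpoly set"
 assumes Q: "hideal w1 Q" and y: "!!i. i \<in> I ==> homog w1 (dg i) (y i) & dg i \<ge> 1" and "finite I"
  and M: "!!v. var v ^ M \<in> gen (Q Un y ` I)"
 shows "homog w1 d F ==> in_span Q y I (box UNIV M) d F"
proof (induction d arbitrary: F rule: less_induct)
 case (less d)
 have iQ: "idl Q" using Q by (simp add: hideal_def)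
 have fin: "finite (box UNIV M :: ('v \<Rightarrow>\<^sub>0 nat) set)" using card_box[of "UNIV :: 'v set" M] by simp
 have "in_span Q y I (box UNIV M) d (sng t (lk F t))" if "t \<in> keys F" for t
 proof (cases "t \<in> box UNIV M")
  case True
  define g where "g b = (if b = t then const (lk F t) else 0 :: (nat, 'k) mpoly)" for b
  have "0 \<in> box I (Suc d)" by (auto simp: box_def)
  hence "ALL b:box UNIV M. keys (g b) \<subseteq> box I (Suc d)" by (auto simp: g_def const_def)
  moreover have "(\<Sum>b\<in>box UNIV M. sub y (g b) * ev_monom var b) = (\<Sum>b\<in>{t}. sub y (g b) * ev_monom var b)"
   using True fin by (intro sum.mono_neutral_right) (auto simp: g_def sub_simps)
  hence "sng t (lk F t) - (\<Sum>b\<in>box UNIV M. sub y (g b) * ev_monom var b) \<in> Q"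
   by (simp add: g_def sub_simps single_eq_const_prod idl_0[OF iQ])
  ultimately show ?thesis unfolding in_span_def by blast
 next
  case False
  then obtain v where v: "M \<le> lk t v" by (auto simp: box_def not_less)
  define t' where "t' = t - sng v M"
  have t: "t = sng v M + t'"
   by (rule poly_mapping_eqI) (use v in \<open>auto simp: t'_def lookup_add lookup_minus lookup_single when_def\<close>)
  have "sng t (lk F t) = var v ^ M * sng t' (lk F t)"
   by (simp add: t single_eq_const_prod algebra_simps)
  hence "sng t (lk F t) \<in> gen (Q Un y ` I)" using M[of v] idl_gen idl_multr by metis
  then obtain q r where q: "q \<in> Q" and e: "sng t (lk F t) = q + (\<Sum>i\<in>I. r i * y i)"
   unfolding gen_Un_image[OF iQ \<open>finite I\<close>] by auto
  have "homog w1 d (sng t (lk F t))" using less.prems that by (auto simp: homog_iff)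
  hence "sng t (lk F t) = hcomp w1 d (sng t (lk F t))" by (simp add: hcomp_homog)
  also have "\<dots> = hcomp w1 d q + (\<Sum>i\<in>I. if dg i \<le> d then hcomp w1 (d - dg i) (r i) * y i else 0)"
   unfolding e hcomp_add hcomp_sum
   by (auto intro!: sum.cong simp: hcomp_mult_homog2[OF conjunct1[OF y]])
  finally have e': "sng t (lk F t) = \<dots>" .
  have "in_span Q y I (box UNIV M) d (hcomp w1 (d - dg i) (r i) * y i)" if "i \<in> I" "dg i \<le> d" for i
  proof -
   have "d - dg i < d" using y[OF that(1)] that(2) by linarith
   from in_span_mult[OF iQ less.IH[OF this homog_hcomp] that(1), of "r i"] show ?thesis
    by (rule in_span_mono) (use \<open>d - dg i < d\<close> in simp)
  qed
  moreover have "in_span Q y I (box UNIV M) d (hcomp w1 d q)"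
   using Q q iQ by (auto simp: hideal_def intro: in_span_mem)
  ultimately show ?thesis by (subst e') (auto intro!: in_span_add[OF iQ] in_span_sum[OF iQ] in_span_0[OF iQ])
 qed
 thus ?case by (subst poly_mapping_sum_single[of F]) (rule in_span_sum[OF iQ])
qed

lemma degree_homog_map_ev_monom:
 assumes "t \<in> box {..<s} D" "!!i. i < s ==> degree (homog_map w1 (w i)) \<le> \<delta>"
 shows "degree (homog_map w1 (ev_monom w t)) \<le> s * (D * \<delta>)"
proof -
 have "ev_monom w t = (\<Prod>i<s. w i ^ lk t i)" using assms(1) by (intro ev_monom_superset) (auto simp: box_def)
 hence "homog_map w1 (ev_monom w t) = (\<Prod>i<s. homog_map w1 (w i) ^ lk t i)"
  by (simp add: homog_map_simps)
 also have "degree \<dots> \<le> sum (degree \<circ> (%i. homog_map w1 (w i) ^ lk t i)) {..<s}" by (rule degree_prod_sum_le) simp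
 also have "\<dots> \<le> (\<Sum>i<s. D * \<delta>)"
 proof (rule sum_mono)
  fix i assume i: "i \<in> {..<s}"
  have "degree (homog_map w1 (w i) ^ lk t i) \<le> degree (homog_map w1 (w i)) * lk t i" by (rule degree_power_le)
  also have "\<dots> \<le> \<delta> * D" using assms i by (intro mult_mono) (auto simp: box_def less_imp_le)
  finally show "(degree \<circ> (%i. homog_map w1 (w i) ^ lk t i)) i \<le> D * \<delta>" by (simp add: mult.commute)
 qed
 finally show ?thesis by simp
qed

text \<open>If the quotient by \<open>Q\<close> is integral over \<open>r\<close> elements, its Hilbert function grows too slowly
  for \<open>r + 1\<close> algebraically independent elements.\<close>

lemma not_ind_integral:
 fixes Q :: "('v::finite, 'k::field) mpoly set" and y :: "nat => ('v, 'k) mpoly"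
 assumes Q: "hideal w1 Q" and y: "!!i. i \<in> I ==> homog w1 (dg i) (y i) & dg i \<ge> 1" and fI: "finite I"
  and M: "!!v. var v ^ M \<in> gen (Q Un y ` I)"
 shows "\<not> ind Q (Suc (card I))"
proof
 let ?r = "card I" let ?s = "Suc ?r" let ?B = "box UNIV M :: ('v \<Rightarrow>\<^sub>0 nat) set"
 assume "ind Q ?s"
 then obtain w where w: "alg_indep Q w ?s" by (auto simp: ind_def)
 have iQ: "idl Q" using Q by (simp add: hideal_def)
 define \<delta> where "\<delta> = Max ((%i. degree (homog_map w1 (w i))) ` {..<?s})"
 have \<delta>: "degree (homog_map w1 (w i)) \<le> \<delta>" if "i < ?s" for i
  unfolding \<delta>_def using that by (intro Max_ge) auto
 \<comment> \<open>D exceeds card B times (s \<delta> + 1)^r, where s = r + 1. Hence the D^s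
   monomials in the w with exponents below D outnumber the card B times (E + 1)^r coefficients that
   describe them in the span.\<close>
 define D where "D = card ?B * (?s * \<delta> + 1) ^ ?r + 1"
 define E where "E = ?s * (D * \<delta>)"
 have fB: "finite ?B" using card_box[of "UNIV :: 'v set" M] by simp
 have fE: "finite (?B \<times> box I (Suc E))" using fB card_box[OF fI] by simp
 have fU: "finite (box {..<?s} D)" "card (box {..<?s} D) = D ^ ?s" using card_box[of "{..<?s}" D] by auto
 have "card (?B \<times> box I (Suc E)) = card ?B * Suc E ^ ?r" using card_box[OF fI, of "Suc E"] by (simp add: card_cartesian_product)
 also have "\<dots> \<le> card ?B * ((?s * \<delta> + 1) * D) ^ ?r"
 proof -
  have "Suc E \<le> (?s * \<delta> + 1) * D" by (simp add: E_def D_def algebra_simps)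
  thus ?thesis by (intro mult_left_mono power_mono) auto
 qed
 also have "\<dots> = (D - 1) * D ^ ?r" by (simp add: D_def power_mult_distrib del: power_Suc mult_Suc mult_Suc_right add_Suc)
 also have "\<dots> < D ^ ?s" by (simp add: D_def)
 finally have card: "card (?B \<times> box I (Suc E)) < card (box {..<?s} D)" using fU by simp
 have "in_span Q y I ?B E (ev_monom w t)" if t: "t \<in> box {..<?s} D" for t
 proof -
  have "degree (homog_map w1 (ev_monom w t)) \<le> E"
   unfolding E_def by (rule degree_homog_map_ev_monom[OF t \<delta>])
  hence "in_span Q y I ?B E (hcomp w1 d (ev_monom w t))" if "d \<le> degree (homog_map w1 (ev_monom w t))" for d
   using that by (intro in_span_mono[OF homog_in_span[OF Q y fI M homog_hcomp]]) auto
  hence "in_span Q y I ?B E (\<Sum>d\<le>degree (homog_map w1 (ev_monom w t)). hcomp w1 d (ev_monom w t))"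
   by (intro in_span_sum[OF iQ]) simp
  thus ?thesis using sum_hcomp[of "ev_monom w t" w1] by simp
 qed
 hence "ALL t:box {..<?s} D. EX g. (ALL b:?B. keys (g b) \<subseteq> box I (Suc E)) &
   ev_monom w t - (\<Sum>b\<in>?B. sub y (g b) * ev_monom var b) \<in> Q"
  unfolding in_span_def by simp
 from bchoice[OF this] obtain g where "ALL t:box {..<?s} D. (ALL b:?B. keys (g t b) \<subseteq> box I (Suc E)) &
   ev_monom w t - (\<Sum>b\<in>?B. sub y (g t b) * ev_monom var b) \<in> Q" by blast
 hence g: "(ALL b:?B. keys (g t b) \<subseteq> box I (Suc E)) &
   ev_monom w t - (\<Sum>b\<in>?B. sub y (g t b) * ev_monom var b) \<in> Q" if "t \<in> box {..<?s} D" for t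
  using that by simp
 obtain c where c0: "EX t:box {..<?s} D. c t ~: {0::'k}"
  and c: "\<forall>(b, \<tau>)\<in>?B \<times> box I (Suc E). (\<Sum>t\<in>box {..<?s} D. lk (g t b) \<tau> * c t) \<in> {0}"
  using linear_system_mod_prime[OF pr_zero_idom fE fU(1) card, of "%(b, \<tau>) t. lk (g t b) \<tau>"] by (auto simp: case_prod_unfold)
 \<comment> \<open>The dependence of the coefficient vectors, read as a polynomial: a relation
   between the w modulo Q supported in the box of side D.\<close>
 define G where "G = (\<Sum>t\<in>box {..<?s} D. sng t (c t))"
 have lG: "lk G t = (if t \<in> box {..<?s} D then c t else 0)" for t
  using fU by (simp add: G_def lookup_sum lookup_single when_def)
 have "G ~= 0"
 proof
  assume "G = 0"
  hence "lk G t = 0" for t by simp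
  thus False using c0 lG by (metis insertI1)
 qed
 have "t \<in> box {..<?s} D" if "t \<in> keys G" for t using that lG[of t] unfolding in_keys_iff by metis
 hence vG: "vars_in {..<?s} G" unfolding vars_in_def box_def by blast
 have z: "(\<Sum>t\<in>box {..<?s} D. const (c t) * g t b) = 0" if b: "b \<in> ?B" for b
 proof (rule poly_mapping_eqI)
  fix \<tau>
  have "(\<Sum>t\<in>box {..<?s} D. lk (g t b) \<tau> * c t) = 0"
  proof (cases "\<tau> \<in> box I (Suc E)")
   case True thus ?thesis using c b by auto
  next
   case False
   thus ?thesis using g b by (intro sum.neutral) (auto simp: in_keys_iff subset_iff)
  qed
  thus "lk (\<Sum>t\<in>box {..<?s} D. const (c t) * g t b) \<tau> = lk 0 \<tau>"
   by (simp add: lookup_sum lookup_const_times mult.commute)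
 qed
 have "sub w G = (\<Sum>t\<in>box {..<?s} D. const (c t) * ev_monom w t)"
  by (simp add: G_def ev_simps[OF ring_map_const] ev_single[OF ring_map_const])
 also have "\<dots> = (\<Sum>t\<in>box {..<?s} D. const (c t) * (ev_monom w t - (\<Sum>b\<in>?B. sub y (g t b) * ev_monom var b)))
   + (\<Sum>t\<in>box {..<?s} D. \<Sum>b\<in>?B. sub y (const (c t) * g t b) * ev_monom var b)"
  by (simp add: algebra_simps sum_subtractf sum.distrib sum_distrib_left sub_simps)
 also have "(\<Sum>t\<in>box {..<?s} D. \<Sum>b\<in>?B. sub y (const (c t) * g t b) * ev_monom var b) =
   (\<Sum>b\<in>?B. sub y (\<Sum>t\<in>box {..<?s} D. const (c t) * g t b) * ev_monom var b)"
  by (subst sum.swap) (simp add: sub_simps sum_distrib_right)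
 also have "\<dots> = 0" using z by (auto simp: sub_simps intro!: sum.neutral)
 finally have "sub w G \<in> Q" using g by (auto intro!: idl_sum[OF iQ] idl_mult[OF iQ])
 thus False using w vG \<open>G ~= 0\<close> by (auto simp: alg_indep_def)
qed

lemma idl_zero: "idl {0}" by (auto intro: idlI)

lemma ind_le_card:
 assumes "ind (Q :: ('v::finite, 'k::field) mpoly set) s" "idl Q" shows "s \<le> CARD('v)"
proof (rule ccontr)
 assume "\<not> ?thesis"
 hence i: "ind {0 :: ('v, 'k) mpoly} (Suc CARD('v))" using assms by (intro ind_mono[OF assms(1)]) (auto intro: idl_0)
 obtain e :: "nat => 'v" where e: "bij_betw e {0..<CARD('v)} UNIV"
  using ex_bij_betw_nat_finite[of "UNIV :: 'v set"] by auto
 have h: "hideal w1 {0 :: ('v, 'k) mpoly}" by (simp add: hideal_def idl_zero hcomp_0)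
 have "var v ^ 1 \<in> gen ({0} Un (%i. var (e i)) ` {0..<CARD('v)})" for v :: 'v
 proof -
  have "v \<in> e ` {0..<CARD('v)}" using e by (auto simp: bij_betw_def)
  thus ?thesis by (auto intro!: genI)
 qed
 from not_ind_integral[OF h _ _ this, of "%_. 1"] i show False by (simp add: homog_var[of w1, simplified])
qed

section \<open>Transcendence degree\<close>

text \<open>The transcendence degree of the residue ring. For prime Q the set is nonempty by
  \<open>ind_0\<close> and bounded by \<open>ind_le_card\<close>, so \<open>Max\<close> is
  meaningful.\<close>

definition td :: "('v::finite, 'k::field) mpoly set => nat" where
 "td Q = Max {s. ind Q s}"

lemma td:
 fixes Q :: "('v::finite, 'k::field) mpoly set"
 assumes "pr Q" shows td_ind: "ind Q (td Q)" and le_td: "ind Q s ==> s \<le> td Q" and td_le: "td Q \<le> CARD('v)"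
proof -
 have f: "finite {s. ind Q s}" using ind_le_card[of Q] pr_idl[OF assms]
  by (intro finite_subset[of "{s. ind Q s}" "{..CARD('v)}"]) blast+
 have ne: "{s. ind Q s} ~= {}" using ind_0[OF assms] by auto
 show *: "ind Q (td Q)" using Max_in[OF f ne] by (simp add: td_def)
 show "ind Q s ==> s \<le> td Q" using Max_ge[OF f] by (simp add: td_def)
 show "td Q \<le> CARD('v)" using ind_le_card[OF * pr_idl[OF assms]] .
qed

lemma td_strict: "pr Q ==> pr Q' ==> Q \<subset> Q' ==> td Q' < td Q"
proof -
 assume Q: "pr Q" "pr Q'" "Q \<subset> Q'"
 then obtain c where "c \<in> Q'" "c ~: Q" by blast
 with ind_Suc[OF Q(1) pr_idl[OF Q(2)] _ this td_ind[OF Q(2)]] Q have "ind Q (Suc (td Q'))" by auto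
 thus ?thesis using le_td[OF Q(1)] by fastforce
qed

lemma td_mono: "pr Q ==> pr Q' ==> Q \<subseteq> Q' ==> td Q' \<le> td Q"
 using td_strict[of Q Q'] by (cases "Q = Q'") (auto simp: psubset_eq less_imp_le)

text \<open>The extension to the full ring of the contraction of Q to the polynomials without
  v.\<close>

definition rem :: "'v => ('v, 'a::comm_ring_1) mpoly set => ('v, 'a) mpoly set" where
 "rem v Q = split_var v -` poly_ext Q"

lemma mem_rem: "F \<in> rem v Q <-> (ALL i. coeff (split_var v F) i \<in> Q)"
 by (simp add: rem_def poly_ext_def)

lemma pr_rem: "pr Q ==> pr (rem v Q)"
 unfolding rem_def by (intro pr_vimage ring_map_split_var pr_poly_ext)

lemma rem_subset: assumes "idl Q" shows "rem v Q \<subseteq> Q"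
proof
 fix F assume "F \<in> rem v Q"
 hence "poly (split_var v F) (var v) \<in> Q"
  unfolding poly_altdef by (intro idl_sum[OF assms] idl_multr[OF assms]) (simp add: mem_rem)
 thus "F \<in> Q" by (simp add: poly_split_var)
qed

lemma mem_rem_notin: "idl Q ==> F \<in> Q ==> vars_in A F ==> v ~: A ==> F \<in> rem v Q"
 by (auto simp: mem_rem split_var_notin coeff_pCons idl_0 split: nat.split)

primrec rem_list :: "'v list => ('v, 'a::comm_ring_1) mpoly set => ('v, 'a) mpoly set" where
 "rem_list [] Q = Q"
| "rem_list (v # vs) Q = rem_list vs (rem v Q)"

text \<open>The variables whose removal changes nothing; they form a transcendence basis.\<close>

primrec free_vars :: "'v list => ('v, 'a::comm_ring_1) mpoly set => 'v set" where
 "free_vars [] Q = {}"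
| "free_vars (v # vs) Q = (if rem v Q = Q then {v} else {}) Un free_vars vs (rem v Q)"

lemma pr_rem_list: "pr Q ==> pr (rem_list vs Q)"
 by (induction vs arbitrary: Q) (auto simp: pr_rem)

lemma free_vars_subset: "free_vars vs Q \<subseteq> set vs"
 by (induction vs arbitrary: Q) auto

lemma rem_list_coeff:
 assumes "F \<in> rem_list vs Q" "F ~= 0" "vars_in A F"
 shows "EX G:Q. G ~= 0 & vars_in (A - set vs) G"
 using assms(1)
proof (induction vs arbitrary: Q)
 case Nil thus ?case using assms by auto
next
 case (Cons v vs)
 then obtain G where G: "G \<in> rem v Q" "G ~= 0" "vars_in (A - set vs) G" by auto
 then obtain i where "coeff (split_var v G) i ~= 0" using split_var_eq_0 by (metis coeff_0 poly_eqI)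
 thus ?case using G vars_in_split_var[OF G(3), of v i]
  by (auto simp: mem_rem set_diff_eq conj_commute intro!: bexI[of _ "coeff (split_var v G) i"] elim: vars_in_mono)
qed

lemma rem_list_all:
 assumes "pr (Q :: ('v, 'k::field) mpoly set)" "set vs = UNIV" shows "rem_list vs Q = {0}"
proof -
 have "F = 0" if "F \<in> rem_list vs Q" for F
 proof (rule ccontr)
  assume "F ~= 0"
  from rem_list_coeff[OF that this vars_in_UNIV] assms obtain G where "G \<in> Q" "G ~= 0" "vars_in {} G" by auto
  from this(3) obtain c where "G = const c" by (rule vars_in_empty)
  thus False using const_in_prime[OF assms(1), of c] \<open>G \<in> Q\<close> \<open>G ~= 0\<close> by (auto simp: const_simps)
 qed
 thus ?thesis using idl_0[OF pr_idl[OF pr_rem_list[OF assms(1)]]] by blast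
qed

text \<open>A relation among the free variables survives every removal, at worst after passing to a
  coefficient. When all variables are removed only 0 is left, by \<open>rem_list_all\<close>, so
  there is no such relation.\<close>

lemma free_vars_indep:
 assumes "pr Q" "distinct vs" "G \<in> Q" "G ~= 0" "vars_in (free_vars vs Q) G"
 shows "EX G':rem_list vs Q. G' ~= 0"
 using assms
proof (induction vs arbitrary: Q G)
 case (Cons v vs)
 show ?case
 proof (cases "rem v Q = Q")
  case True
  hence "G \<in> rem v Q" using Cons.prems by simp
  obtain i where i: "coeff (split_var v G) i ~= 0" using split_var_eq_0 Cons.prems(4) by (metis coeff_0 poly_eqI)
  have "vars_in (free_vars (v # vs) Q - {v}) (coeff (split_var v G) i)"
   by (rule vars_in_split_var) fact
  hence "vars_in (free_vars vs (rem v Q)) (coeff (split_var v G) i)" by (rule vars_in_mono) auto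
  moreover have "coeff (split_var v G) i \<in> rem v Q" using \<open>G \<in> rem v Q\<close>[unfolded mem_rem] True by simp
  ultimately show ?thesis using Cons.IH[OF pr_rem[OF Cons.prems(1)] _ _ i] Cons.prems by auto
 next
  case False
  hence "vars_in (free_vars vs (rem v Q)) G" using Cons.prems by simp
  moreover hence "G \<in> rem v Q"
   using Cons.prems free_vars_subset[of vs "rem v Q"] by (intro mem_rem_notin[OF pr_idl]) auto
  ultimately show ?thesis using Cons.IH[OF pr_rem[OF Cons.prems(1)]] Cons.prems by auto
 qed
qed auto

text \<open>Each removal that changes Q raises \<open>td\<close> by at least one. When all variables
  are removed, \<open>td\<close> is at most their number, so at least \<open>td Q\<close> removals
  change nothing.\<close>

lemma td_rem_list:
 "pr (Q :: ('v::finite, 'k::field) mpoly set) ==> distinct vs ==>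
  td Q + length vs \<le> td (rem_list vs Q) + card (free_vars vs Q)"
proof (induction vs arbitrary: Q)
 case (Cons v vs)
 have IH: "td (rem v Q) + length vs \<le> td (rem_list vs (rem v Q)) + card (free_vars vs (rem v Q))"
  using Cons.IH[OF pr_rem[OF Cons.prems(1)]] Cons.prems by simp
 have v: "v ~: free_vars vs (rem v Q)" using free_vars_subset[of vs "rem v Q"] Cons.prems by auto
 have f: "finite (free_vars vs (rem v Q))" by simp
 show ?case
 proof (cases "rem v Q = Q")
  case True
  thus ?thesis using IH v f by simp
 next
  case False
  hence "td Q < td (rem v Q)"
   using rem_subset[OF pr_idl[OF Cons.prems(1)]] by (intro td_strict pr_rem Cons.prems) blast
  thus ?thesis using IH False by simp
 qed
qed simp

lemma td_le_free_vars:
 assumes "pr (Q :: ('v::finite, 'k::field) mpoly set)" "distinct vs" "set vs = UNIV"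
 shows "td Q \<le> card (free_vars vs Q)"
proof -
 have "length vs = CARD('v)" using distinct_card[OF assms(2)] assms(3) by simp
 thus ?thesis
  using td_rem_list[OF assms(1,2)] td_le[OF pr_rem_list[OF assms(1)], of vs] by linarith
qed

lemma free_vars_zero:
 assumes "pr (Q :: ('v, 'k::field) mpoly set)" "distinct vs" "set vs = UNIV" "G \<in> Q" "vars_in (free_vars vs Q) G"
 shows "G = 0"
 using free_vars_indep[OF assms(1,2,4) _ assms(5)] rem_list_all[OF assms(1,3)] by blast

text \<open>Used in the contrapositive to show that v is not free: it suffices to find an element of
  Q that avoids the variables removed earlier and has a coefficient with respect to v outside
  Q.\<close>

lemma free_vars_cert:
 assumes "pr Q" "distinct (as @ v # bs)" "v \<in> free_vars (as @ v # bs) Q" "g \<in> Q" "vars_in (- set as) g"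
 shows "coeff (split_var v g) i \<in> Q"
 using assms
proof (induction as arbitrary: Q)
 case Nil
 hence "v ~: free_vars bs (rem v Q)" using free_vars_subset[of bs "rem v Q"] by auto
 hence "g \<in> rem v Q" using Nil by (auto split: if_splits)
 thus ?case by (simp add: mem_rem)
next
 case (Cons a as)
 have "g \<in> rem a Q" using Cons.prems by (intro mem_rem_notin[OF pr_idl, where A = "- set (a # as)"]) auto
 moreover have "vars_in (- set as) g" using Cons.prems(5) by (rule vars_in_mono) auto
 moreover have "v \<in> free_vars (as @ v # bs) (rem a Q)" using Cons.prems by (auto split: if_splits)
 ultimately have "coeff (split_var v g) i \<in> rem a Q"
  using Cons.IH[OF pr_rem[OF Cons.prems(1)]] Cons.prems by simp
 thus ?case using rem_subset[OF pr_idl[OF Cons.prems(1)]] by blast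
qed

lemma ind_vars:
 fixes Q :: "('v, 'k::field) mpoly set"
 assumes "finite W" "!!G. vars_in W G ==> G \<in> Q ==> G = 0" shows "ind Q (card W)"
proof -
 obtain e where e: "bij_betw e {0..<card W} W" using ex_bij_betw_nat_finite[OF assms(1)] by auto
 have "alg_indep Q (%i. var (e i)) (card W)"
  unfolding alg_indep_def
 proof (intro allI impI)
  fix G assume G: "vars_in {..<card W} G" "sub (%i. var (e i)) G \<in> Q"
  have "vars_in W (sub (%i. var (e i)) G)"
   by (rule vars_in_sub[OF G(1)]) (use e in \<open>auto simp: bij_betw_def atLeast0LessThan intro!: vars_in_var\<close>)
  hence 0: "sub (%i. var (e i)) G = 0" using assms(2) G(2) by blast
  have "G = sub var G" by (simp add: sub_var)
  also have "\<dots> = sub (%i. var (inv_into {0..<card W} e (e i))) G"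
   by (rule ev_cong[OF ring_map_const G(1)]) (use e in \<open>auto simp: bij_betw_def\<close>)
  also have "\<dots> = sub (%v. var (inv_into {0..<card W} e v)) (sub (%i. var (e i)) G)"
   by (simp add: sub_sub sub_simps)
  finally show "G = 0" by (simp add: 0 sub_simps)
 qed
 thus ?thesis by (auto simp: ind_def)
qed

section \<open>A bound for the transcendence degree of a fibre\<close>

abbreviation sx :: "('n, 'k::comm_ring_1) mpoly => ('n + 'm, 'k) mpoly" where
 "sx \<equiv> sub (%i. var (Inl i))"
abbreviation sT :: "('m, 'k::comm_ring_1) mpoly => ('n + 'm, 'k) mpoly" where
 "sT \<equiv> sub (%i. var (Inr i))"

text \<open>The elements \<open>\<eta> k\<close> are adjoined as new variables; removing the variables in the order
  \<open>T, U, x\<close> leaves at most those \<open>U\<^sub>k\<close> with \<open>k \<in> K\<close> and an independent set of \<open>x\<^sub>i\<close>.\<close>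

lemma td_le_fibre:
 fixes Q :: "('n::finite + 'n, 'k::field) mpoly set"
 assumes Q: "pr Q" and s: "sx s ~: Q"
  and rel: "!!j. sx s * var (Inr j) - (\<Sum>k\<in>K. sx (\<beta> k j) * \<eta> k) \<in> Q"
 shows "td Q \<le> td (sx -` Q) + card (K :: 'n set)"
proof -
 \<comment> \<open>\<open>Inl\<close> carries the old variables x and T; \<open>Inr k\<close> is the
   new variable U_k, sent to \<eta> k if k is in K and to 0 otherwise.\<close>
 let ?h = "case_sum var (%k. if k \<in> K then \<eta> k else 0) :: ('n + 'n) + 'n => ('n + 'n, 'k) mpoly"
 define Q' where "Q' = sub ?h -` Q"
 have Q': "pr Q'" unfolding Q'_def by (intro pr_vimage ring_map_sub Q)
 have emb: "sub ?h (sx F) = F" for F by (simp add: sub_sub sub_simps sub_var)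
 have "ind Q' (td Q)"
 proof -
  obtain w where w: "alg_indep Q w (td Q)" using td_ind[OF Q] by (auto simp: ind_def)
  have "sub ?h (sub (%i. sx (w i)) G) = sub w G" for G by (subst sub_sub) (simp only: emb)
  hence "alg_indep Q' (%i. sx (w i)) (td Q)" using w by (simp add: alg_indep_def Q'_def)
  thus ?thesis by (auto simp: ind_def)
 qed
 hence 1: "td Q \<le> td Q'" by (rule le_td[OF Q'])
 obtain ns :: "'n list" where ns: "set ns = UNIV" "distinct ns" using finite_distinct_list[of "UNIV :: 'n set"] by auto
 define Ts :: "(('n + 'n) + 'n) list" where "Ts = map (%j. Inl (Inr j)) ns"
 define Us :: "(('n + 'n) + 'n) list" where "Us = map Inr ns"
 define Xs :: "(('n + 'n) + 'n) list" where "Xs = map (%j. Inl (Inl j)) ns"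
 \<comment> \<open>T comes before U and x: when T_j is removed, the relation between s T_j and the U
   is still available, and it exhibits s as a coefficient of T_j.\<close>
 define vs where "vs = Ts @ Us @ Xs"
 have dvs: "distinct vs" using ns by (auto simp: vs_def Ts_def Us_def Xs_def distinct_map inj_on_def)
 have "v \<in> set vs" for v
 proof (cases v)
  case (Inl a)
  thus ?thesis using ns by (cases a) (auto simp: vs_def Ts_def Us_def Xs_def)
 next
  case (Inr b) thus ?thesis using ns by (auto simp: vs_def Ts_def Us_def Xs_def)
 qed
 hence svs: "set vs = UNIV" by blast
 let ?W = "free_vars vs Q'"
 define WX where "WX = {i. Inl (Inl i) \<in> ?W}"
 have T: "Inl (Inr j) ~: ?W" for j
 proof
  assume jW: "Inl (Inr j) \<in> ?W"
  obtain as bs where sp: "ns = as @ j # bs" using ns by (metis UNIV_I in_set_conv_decomp)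
  hence vsp: "vs = map (%j. Inl (Inr j)) as @ Inl (Inr j) # (map (%j. Inl (Inr j)) bs @ Us @ Xs)"
   by (simp add: vs_def Ts_def)
  define g where "g = sx (sx s) * var (Inl (Inr j)) - (\<Sum>k\<in>K. sx (sx (\<beta> k j)) * (var (Inr k) :: (('n + 'n) + 'n, 'k) mpoly))"
  have nx: "vars_in (range (%i. Inl (Inl i))) (sx (sx F :: ('n + 'n, 'k) mpoly) :: (('n + 'n) + 'n, 'k) mpoly)" for F
   unfolding sub_sub by (rule vars_in_sub[OF vars_in_UNIV]) (simp add: sub_simps vars_in_intros)
  have "g \<in> Q'" using rel[of j] by (simp add: Q'_def g_def sub_simps emb cong: sum.cong)
  moreover have "vars_in (- set (map (%j. Inl (Inr j)) as)) g"
   unfolding g_def using sp ns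
   by (intro vars_in_diff vars_in_mult vars_in_sum vars_in_mono[OF nx] vars_in_var) auto
  ultimately have "coeff (split_var (Inl (Inr j)) g) 1 \<in> Q'"
   using free_vars_cert[of Q' "map (%j. Inl (Inr j)) as" "Inl (Inr j)"] Q' dvs jW unfolding vsp by blast
  moreover have "coeff (split_var (Inl (Inr j)) g) 1 = sx (sx s)"
  proof -
   have "split_var (Inl (Inr j)) (sx (sx F :: ('n + 'n, 'k) mpoly)) = [:sx (sx F) :: (('n + 'n) + 'n, 'k) mpoly:]" for F
    by (rule split_var_notin[OF nx]) auto
   hence "split_var (Inl (Inr j)) g = [:0, sx (sx s):] - [:\<Sum>k\<in>K. sx (sx (\<beta> k j)) * var (Inr k):]"
    unfolding g_def split_var_simps ring_map_simps(8)[OF ring_map_C] by (simp add: split_var_var mult.commute)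
   thus ?thesis by simp
  qed
  ultimately show False using s by (simp add: Q'_def emb)
 qed
 have U: "k \<in> K" if kW: "Inr k \<in> ?W" for k
 proof (rule ccontr)
  assume k: "k ~: K"
  obtain as bs where sp: "ns = as @ k # bs" using ns by (metis UNIV_I in_set_conv_decomp)
  hence vsp: "vs = (Ts @ map Inr as) @ Inr k # (map Inr bs @ Xs)" by (simp add: vs_def Us_def)
  have "var (Inr k) \<in> Q'" using k by (simp add: Q'_def sub_simps idl_0[OF pr_idl[OF Q]])
  moreover have "vars_in (- set (Ts @ map Inr as)) (var (Inr k) :: (('n + 'n) + 'n, 'k) mpoly)"
   using sp ns by (intro vars_in_var) (auto simp: Ts_def)
  ultimately have "coeff (split_var (Inr k) (var (Inr k))) 1 \<in> Q'"
   using free_vars_cert[of Q' "Ts @ map Inr as" "Inr k"] Q' dvs kW unfolding vsp by blast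
  thus False using pr_1[OF Q'] by (simp add: split_var_simps)
 qed
 have "ind (sx -` Q) (card WX)"
 proof (rule ind_vars)
  fix G assume G: "vars_in WX G" "G \<in> sx -` Q"
  have "vars_in ?W (sx (sx G :: ('n + 'n, 'k) mpoly) :: (('n + 'n) + 'n, 'k) mpoly)"
   unfolding sub_sub by (rule vars_in_sub[OF G(1)]) (auto simp: sub_simps WX_def vars_in_var)
  moreover have "sx (sx G) \<in> Q'" using G(2) by (simp add: Q'_def emb)
  ultimately have "(sx (sx G :: ('n + 'n, 'k) mpoly) :: (('n + 'n) + 'n, 'k) mpoly) = 0"
   using free_vars_zero[OF Q' dvs svs] by blast
  hence "sub ?h (sx (sx G)) = 0" by (simp add: sub_simps)
  hence z: "sx G = (0 :: ('n + 'n, 'k) mpoly)" by (simp only: emb)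
  have "G = sub (case_sum var var) (sx G :: ('n + 'n, 'k) mpoly)" by (simp add: sub_sub sub_simps sub_var)
  thus "G = 0" by (simp add: z sub_simps)
 qed simp
 hence 2: "card WX \<le> td (sx -` Q)" by (rule le_td[OF pr_vimage[OF ring_map_sub Q]])
 have "?W \<subseteq> Inr ` K Un (%i. Inl (Inl i)) ` WX"
 proof
  fix v assume v: "v \<in> ?W"
  show "v \<in> Inr ` K Un (%i. Inl (Inl i)) ` WX"
  proof (cases v)
   case (Inl a) thus ?thesis using v T by (cases a) (auto simp: WX_def)
  next
   case (Inr b) thus ?thesis using v U by auto
  qed
 qed
 hence "card ?W \<le> card (Inr ` K Un (%i. Inl (Inl i)) ` WX :: (('n + 'n) + 'n) set)" by (rule card_mono[rotated]) simp
 also have "\<dots> \<le> card K + card WX" by (rule order.trans[OF card_Un_le]) (intro add_mono card_image_le; simp)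
 finally show ?thesis using 1 2 td_le_free_vars[OF Q' dvs svs] by linarith
qed

section \<open>Homogeneous primes and Noether normalization\<close>

lemma prime_avoiding:
 assumes b: "idl b" and M: "1 \<in> M" "!!x y. x \<in> M ==> y \<in> M ==> x * y \<in> M" "b \<inter> M = {}"
 shows "EX Q. pr Q & b \<subseteq> Q & Q \<inter> M = {}"
proof -
 let ?A = "{Q. idl Q & b \<subseteq> Q & Q \<inter> M = {}}"
 have "EX Q:?A. ALL Y:?A. Q \<subseteq> Y --> Y = Q"
 proof (rule subset_Zorn_nonempty)
  show "?A ~= {}" using b M by blast
  fix \<C> assume \<C>: "\<C> ~= {}" "subset.chain ?A \<C>"

  hence ch: "!!Y. Y \<in> \<C> ==> idl Y & b \<subseteq> Y & Y \<inter> M = {}" "!!Z Y. Z \<in> \<C> ==> Y \<in> \<C> ==> Z \<subseteq> Y \<or> Y \<subseteq> Z"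
   using \<C>(2) unfolding subset_chain_def by blast+
  have "idl (\<Union>\<C>)"
  proof (rule idlI)
   show "0 \<in> \<Union>\<C>" using \<C>(1) ch(1) idl_0 by blast
   fix x y assume "x \<in> \<Union>\<C>" "y \<in> \<Union>\<C>"
   then obtain X' Y where "X' \<in> \<C>" "Y \<in> \<C>" "x \<in> X'" "y \<in> Y" by blast
   then obtain Z where "Z \<in> \<C>" "x \<in> Z" "y \<in> Z" using ch(2) by blast
   thus "x + y \<in> \<Union>\<C>" using ch(1)[of Z] idl_add[of Z x y] by blast
  next
   fix a x assume "x \<in> \<Union>\<C>"
   then obtain Y where "Y \<in> \<C>" "x \<in> Y" by blast
   thus "a * x \<in> \<Union>\<C>" using ch(1)[of Y] idl_mult[of Y x a] by blast
  qed
  thus "\<Union>\<C> \<in> ?A" using \<C>(1) ch(1) by blast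
 qed
 then obtain Q where Q': "Q \<in> ?A" and m: "ALL Y:?A. Q \<subseteq> Y --> Y = Q" by (elim bexE)
 hence Q: "idl Q" "b \<subseteq> Q" "Q \<inter> M = {}" by simp_all
 have max: "Y = Q" if "idl Y" "b \<subseteq> Y" "Y \<inter> M = {}" "Q \<subseteq> Y" for Y
  using m that by simp
 have ext: "EX q:Q. EX r. q + r * a \<in> M" if "a ~: Q" for a
 proof -
  have e: "gen (Q Un (%_. a) ` {()}) = {q + (\<Sum>i\<in>{()}. r i * a) | q r. q \<in> Q}" by (rule gen_Un_image[OF Q(1)]) simp
  have "a \<in> gen (Q Un (%_. a) ` {()})" by (rule genI) simp
  hence "gen (Q Un (%_. a) ` {()}) ~= Q" using that by blast
  hence "gen (Q Un (%_. a) ` {()}) \<inter> M ~= {}"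
   using max[OF idl_gen] gen_incl[of "Q Un (%_. a) ` {()}"] Q(2) by blast
  thus ?thesis unfolding e by auto
 qed
 have "pr Q"
  unfolding pr_def
 proof (intro conjI allI impI)
  fix a c assume ac: "a * c \<in> Q"
  show "a \<in> Q \<or> c \<in> Q"
  proof (rule ccontr)
   assume "\<not> ?thesis"
   then obtain q r q' r' where q: "q \<in> Q" "q' \<in> Q" and m: "q + r * a \<in> M" "q' + r' * c \<in> M" using ext by metis
   have "(q + r * a) * (q' + r' * c) = q * (q' + r' * c) + r * a * q' + r * r' * (a * c)" by (simp add: algebra_simps)
   also have "\<dots> \<in> Q"
    using idl_multr[OF Q(1) q(1)] idl_mult[OF Q(1) q(2)] idl_mult[OF Q(1) ac] by (intro idl_add[OF Q(1)])
   finally show False using M(2)[OF m] Q(3) by blast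
  qed
 qed (use Q M in blast)+
 thus ?thesis using Q by blast
qed

text \<open>If there is no relation, the values at y of the nonzero G form a multiplicative set that
  misses b. The core of a prime avoiding this set is homogeneous, contains b and keeps y
  independent.\<close>

lemma relation_or_prime:
 fixes b :: "('v, 'k::field) mpoly set"
 assumes b: "hideal w b" and no: "!!Q. pr Q ==> hideal w Q ==> b \<subseteq> Q ==> \<not> ind Q r"
 shows "EX G. G ~= 0 & vars_in {..<r} G & sub y G \<in> b"
proof (rule ccontr)
 assume *: "\<not> ?thesis"
 define M where "M = {sub y G | G. G ~= 0 & vars_in {..<r} G}"
 have "1 \<in> M" by (auto simp: M_def vars_in_1 sub_simps intro!: exI[of _ 1])
 moreover have "x * z \<in> M" if "x \<in> M" "z \<in> M" for x z
  using that by (auto simp: M_def sub_simps vars_in_mult) (metis no_zero_divisors sub_simps(3) vars_in_mult)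
 moreover have "b \<inter> M = {}" using * by (auto simp: M_def)
 ultimately obtain Q where Q: "pr Q" "b \<subseteq> Q" "Q \<inter> M = {}" using prime_avoiding[of b M] b by (auto simp: hideal_def)
 have "alg_indep (core w Q) y r"
  using Q(3) core_subset[OF pr_idl[OF Q(1)], of w] by (auto simp: alg_indep_def M_def)
 thus False using no[of "core w Q"] pr_core[OF Q(1)] hideal_core[OF pr_idl[OF Q(1)]] hideal_subset_core[OF b Q(2)]
  by (auto simp: ind_def)
qed

lemma ev_upd:
 assumes "ring_map g" shows "ev g (w(v := c)) F = poly (map_poly (ev g w) (split_var v F)) c"
proof -
 have m: "ring_map (%F. poly (map_poly (ev g w) (split_var v F)) c)"
  by (rule ring_map_comp[OF ring_map_poly ring_map_comp[OF ring_map_map_poly[OF ring_map_ev[OF assms]] ring_map_split_var]])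
 show ?thesis
  by (rule ring_map_eqI[OF ring_map_ev[OF assms] m])
   (auto simp: split_var_simps ev_simps[OF assms] map_poly_pCons)
qed

lemma exists_nonzero_value:
 fixes G :: "(nat, 'k::field) mpoly"
 assumes "infinite (UNIV :: 'k set)"
 shows "G ~= 0 ==> vars_in {..<r} G ==> EX c. ev (%x. x) c G ~= 0"
proof (induction r arbitrary: G)
 case 0
 hence "vars_in {} G" by (simp add: lessThan_0)
 then obtain a where "G = const a" by (rule vars_in_empty)
 thus ?case using 0 by (auto simp: ev_const[OF ring_map_id] const_simps)
next
 case (Suc r)
 obtain i where i: "coeff (split_var r G) i ~= 0" using split_var_eq_0 Suc.prems(1) by (metis coeff_0 poly_eqI)
 have "vars_in {..<r} (coeff (split_var r G) i)"
  by (rule vars_in_mono[OF vars_in_split_var[OF Suc.prems(2)]]) auto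
 then obtain c where c: "ev (%x. x) c (coeff (split_var r G) i) ~= 0" using Suc.IH i by blast
 define q where "q = map_poly (ev (%x. x) c) (split_var r G)"
 have "coeff q i ~= 0" using c by (simp add: q_def coeff_map_poly ev_simps[OF ring_map_id])
 hence "q ~= 0" by auto
 hence "finite {x. poly q x = 0}" by (rule poly_roots_finite)
 then obtain a where "poly q a ~= 0" using assms by (metis (mono_tags, lifting) UNIV_I ex_new_if_finite mem_Collect_eq)
 thus ?case using ev_upd[OF ring_map_id, of c r a G] unfolding q_def by metis
qed

lemma ev_homog_map:
 assumes "ring_map g"
 shows "ev g (%v. h v * z ^ w v) F = poly (map_poly (ev g h) (homog_map w F)) z"
proof -
 have m: "ring_map (%F. poly (map_poly (ev g h) (homog_map w F)) z)"
  by (rule ring_map_comp[OF ring_map_poly ring_map_comp[OF ring_map_map_poly[OF ring_map_ev[OF assms]] ring_map_homog_map]])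
 show ?thesis
  by (rule ring_map_eqI[OF ring_map_ev[OF assms] m])
   (auto simp: homog_map_const homog_map_var ev_simps[OF assms] map_poly_monom poly_monom)
qed

lemma ev_homog_scale:
 assumes "ring_map g" "homog w d F" shows "ev g (%v. h v * z ^ w v) F = ev g h F * z ^ d"
 using assms(2) by (simp add: ev_homog_map[OF assms(1)] homog_def map_poly_monom poly_monom ev_simps[OF assms(1)])

lemma homog_map_sub:
 assumes "!!v. homog w' (w v) (h v)"
 shows "homog_map w' (sub h F) = map_poly (sub h) (homog_map w F)"
 by (rule ring_map_eqI[OF ring_map_comp[OF ring_map_homog_map ring_map_sub]
    ring_map_comp[OF ring_map_map_poly[OF ring_map_sub] ring_map_homog_map]])
  (use assms in \<open>auto simp: homog_map_const homog_map_var sub_simps map_poly_monom homog_def\<close>)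

lemma hcomp_sub: "(!!v. homog w' (w v) (h v)) ==> hcomp w' d (sub h F) = sub h (hcomp w d F)"
 by (simp add: hcomp_def homog_map_sub[of w' w h] coeff_map_poly sub_simps)

lemma homog_sub: "(!!v. homog w' (w v) (h v)) ==> homog w d F ==> homog w' d (sub h F)"
 by (simp add: homog_def homog_map_sub[of w' w] map_poly_monom sub_simps)

lemma vars_in_hcomp: "vars_in A F ==> vars_in A (hcomp w d F)"
 by (auto simp: vars_in_def in_keys_iff lookup_hcomp split: if_splits)

lemma power_cong_idl:
 assumes "idl J" "x - a \<in> J" shows "x ^ k - a ^ k \<in> J"
proof (induction k)
 case (Suc k)
 have "x ^ Suc k - a ^ Suc k = x * (x ^ k - a ^ k) + (x - a) * a ^ k" by (simp add: algebra_simps)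
 thus ?case using Suc assms by (simp add: idl_D)
qed (simp add: idl_0[OF assms(1)])

definition rad_all :: "('v, 'k::field) mpoly set => bool" where
 "rad_all J <-> (ALL v. EX M. var v ^ M \<in> J)"

lemma rad_all_uniform:
 fixes J :: "('v::finite, 'k::field) mpoly set"
 assumes "rad_all J" "idl J" shows "EX M. ALL v. var v ^ M \<in> J"
proof -
 obtain M where M: "!!v. var v ^ M v \<in> J" using assms(1) unfolding rad_all_def by metis
 have "var v ^ (\<Sum>v. M v) \<in> J" for v
 proof -
  have "M v \<le> (\<Sum>v. M v)" by (rule member_le_sum) auto
  then obtain k where "(\<Sum>v. M v) = M v + k" using le_Suc_ex by blast
  thus ?thesis using M[of v] assms(2) by (simp add: power_add idl_multr)
 qed
 thus ?thesis by blast
qed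

text \<open>Choose a point c with G(c) and c 0 nonzero, and put z = y 0 / c 0. The new forms are
  chosen such that y is congruent to c z modulo them. Then G(y) becomes G(c) z^\<delta>, so z is
  nilpotent modulo the new ideal and can be left out.\<close>

lemma noether_step:
 fixes b :: "('v, 'k::field) mpoly set"
 assumes inf: "infinite (UNIV :: 'k set)" and b: "idl b" and y: "!!i. homog w1 1 (y i)"
  and G: "G ~= 0" "vars_in {..<Suc r} G" "homog w1 \<delta> G" "sub y G \<in> b"
  and rad: "rad_all (gen (b Un y ` {..<Suc r}))"
 shows "EX y'. (ALL i. homog w1 1 (y' i)) & rad_all (gen (b Un y' ` {..<r}))"
proof -
 have "lk (var 0 :: (nat, 'k) mpoly) (sng 0 1) = 1" by (simp add: var_def)
 hence "(var 0 :: (nat, 'k) mpoly) ~= 0" by (metis lookup_zero one_neq_zero)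
 \<comment> \<open>The factor \<open>var 0\<close> forces c 0 to be nonzero.\<close>
 hence "G * var 0 ~= 0" using G(1) by simp
 moreover have "vars_in {..<Suc r} (G * var 0)" by (intro vars_in_mult G vars_in_var) simp
 ultimately obtain c where "ev (%x. x) c (G * var 0) ~= 0" using exists_nonzero_value[OF inf] by blast
 hence c: "ev (%x. x) c G ~= 0" "c 0 ~= 0" by (auto simp: ev_simps[OF ring_map_id])
 define z where "z = const (1 / c 0) * y 0"
 have yz: "y 0 = const (c 0) * z" using c(2) by (simp add: z_def mult.assoc[symmetric] const_simps[symmetric]) (simp add: const_def)
 have hz: "homog w1 1 z" using homog_mult[OF homog_const y[of 0]] by (simp add: z_def)
 define y' where "y' i = y (Suc i) - const (c (Suc i)) * z" for i
 let ?J = "gen (b Un y' ` {..<r})"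
 have J: "idl ?J" by (rule idl_gen)
 have hy': "homog w1 1 (y' i)" for i
  unfolding y'_def using homog_mult[OF homog_const hz, of "c (Suc i)"] by (intro homog_diff y) simp
 \<comment> \<open>\<open>yy\<close> agrees with y on the variables of G; the remaining entries are
   set so that the congruence to c z holds for every variable.\<close>
 define yy where "yy i = (if i < Suc r then y i else const (c i) * z)" for i
 have "sub yy G - sub (%i. const (c i) * z) G \<in> ?J"
 proof (rule ring_map_cong_idl[OF ring_map_sub ring_map_sub J])
  fix i show "sub yy (var i) - sub (%i. const (c i) * z) (var i) \<in> ?J"
  proof (cases i)
   case 0 thus ?thesis using yz idl_0[OF J] by (simp add: sub_simps yy_def)
  next
   case (Suc j)
   show ?thesis
   proof (cases "j < r")
    case True
    hence "y' j \<in> ?J" by (intro genI) auto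
    thus ?thesis using True Suc by (simp add: sub_simps yy_def y'_def)
   next
    case False thus ?thesis using Suc idl_0[OF J] by (simp add: sub_simps yy_def)
   qed
  qed
 qed (simp add: sub_simps idl_0[OF J])
 moreover have "sub yy G = sub y G" by (rule ev_cong[OF ring_map_const G(2)]) (simp add: yy_def)
 moreover have "sub y G \<in> ?J" using G(4) by (intro genI) simp
 ultimately have "sub y G - (sub yy G - sub (%i. const (c i) * z) G) \<in> ?J" using idl_diff[OF J] by blast
 hence "sub (%i. const (c i) * z) G \<in> ?J" using \<open>sub yy G = sub y G\<close> by simp
 moreover have "sub (%i. const (c i) * z) G = const (ev (%x. x) c G) * z ^ \<delta>"
 proof -
  have "const (ev (%x. x) c G) = (sub (%i. const (c i)) G :: ('v, 'k) mpoly)"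
   by (rule ev_comp[OF ring_map_const ring_map_id ring_map_const]) simp
  thus ?thesis using ev_homog_scale[OF ring_map_const G(3), of "%i. const (c i)" z] by simp
 qed
 ultimately have "const (1 / ev (%x. x) c G) * (const (ev (%x. x) c G) * z ^ \<delta>) \<in> ?J" by (metis J idl_mult)
 moreover have "const (1 / ev (%x. x) c G) * const (ev (%x. x) c G) = (1 :: ('v, 'k) mpoly)"
  using c(1) by (simp add: const_simps[symmetric]) (simp add: const_def)
 ultimately have zJ: "z ^ \<delta> \<in> ?J" by (simp add: mult.assoc[symmetric])
 have sub: "gen (b Un y ` {..<Suc r}) \<subseteq> gen (?J Un (%_. z) ` {()})"
 proof (rule gen_subI)
  let ?K = "gen (?J Un (%_. z) ` {()})"
  have K: "idl ?K" by (rule idl_gen)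
  have z: "z \<in> ?K" by (rule genI) simp
  have "y i \<in> ?K" if "i < Suc r" for i
  proof (cases i)
   case 0 thus ?thesis using yz z idl_mult[OF K] by simp
  next
   case (Suc j)
   hence "y' j \<in> ?J" using that by (intro genI) auto
   hence "y' j + const (c i) * z \<in> ?K" using z by (intro idl_add[OF K] idl_mult[OF K]) (auto intro: genI)
   thus ?thesis using Suc by (simp add: y'_def)
  qed
  moreover have "b \<subseteq> ?K" using gen_incl[of "b Un y' ` {..<r}"] gen_incl[of "?J Un (%_. z) ` {()}"] by blast
  ultimately show "b Un y ` {..<Suc r} \<subseteq> ?K" by auto
 qed
 have "EX M. var v ^ M \<in> ?J" for v
 proof -
  obtain M where "var v ^ M \<in> gen (b Un y ` {..<Suc r})" using rad by (auto simp: rad_all_def)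
  hence "var v ^ M \<in> gen (?J Un (%_. z) ` {()})" using sub by blast
  then obtain q a where q: "q \<in> ?J" and e: "var v ^ M = q + a * z"
   unfolding gen_Un_image[OF J finite.insertI[OF finite.emptyI]] by auto
  have "(var v ^ M) ^ \<delta> - (a * z) ^ \<delta> \<in> ?J" by (rule power_cong_idl[OF J]) (simp add: e q)
  moreover have "(a * z) ^ \<delta> \<in> ?J" using zJ by (simp add: power_mult_distrib idl_mult[OF J])
  ultimately have "var v ^ (M * \<delta>) \<in> ?J" using idl_add[OF J] by (fastforce simp: power_mult)
  thus ?thesis by blast
 qed
 thus ?thesis using hy' unfolding rad_all_def by blast
qed

lemma homog_relation:
 assumes b: "hideal w1 b" and y: "!!i. homog w1 1 (y i)" and G: "G ~= 0" "vars_in {..<r} G" "sub y G \<in> b"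
 shows "EX G \<delta>. G ~= 0 & vars_in {..<r} G & homog w1 \<delta> G & sub y G \<in> b"
proof -
 have "EX d. hcomp w1 d G ~= 0" using sum_hcomp[of G w1] G(1) by (metis sum.neutral)
 then obtain d where "hcomp w1 d G ~= 0" by blast
 moreover have "hcomp w1 d (sub y G) \<in> b" using b G(3) by (auto simp: hideal_def)
 hence "sub y (hcomp w1 d G) \<in> b" using hcomp_sub[of w1 w1 y d G] y by simp
 ultimately show ?thesis using G(2) homog_hcomp vars_in_hcomp by blast
qed

text \<open>Start with all variables, which trivially work, and apply \<open>noether_step\<close> as
  long as more than r forms are left. The dimension hypothesis supplies the relation each
  time.\<close>

lemma noether_normalization:
 fixes b :: "('v::finite, 'k::field) mpoly set"
 assumes inf: "infinite (UNIV :: 'k set)" and b: "hideal w1 b"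
  and no: "!!Q. pr Q ==> hideal w1 Q ==> b \<subseteq> Q ==> \<not> ind Q (Suc r)"
 shows "EX y. (ALL i. homog w1 1 (y i)) & rad_all (gen (b Un y ` {..<r}))"
proof -
 let ?P = "%s. EX y. (ALL i. homog w1 1 (y i)) & rad_all (gen (b Un y ` {..<s}))"
 obtain e :: "nat => 'v" where e: "bij_betw e {0..<CARD('v)} UNIV"
  using ex_bij_betw_nat_finite[of "UNIV :: 'v set"] by auto
 have "?P (max CARD('v) r)"
 proof (intro exI conjI allI)
  show "homog w1 1 (var (e i) :: ('v, 'k) mpoly)" for i using homog_var[of w1 "e i"] by simp
  have "var v ^ 1 \<in> gen (b Un (%i. var (e i)) ` {..<max CARD('v) r})" for v
  proof -
   have "v \<in> e ` {0..<CARD('v)}" using e by (auto simp: bij_betw_def)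
   thus ?thesis by (auto intro!: genI)
  qed
  thus "rad_all (gen (b Un (%i. var (e i)) ` {..<max CARD('v) r}))" unfolding rad_all_def by blast
 qed
 moreover have "?P s" if "?P (Suc s)" "r \<le> s" for s
 proof -
  from that(1) obtain y where y: "ALL i. homog w1 1 (y i)" "rad_all (gen (b Un y ` {..<Suc s}))" by blast
  have "\<not> ind Q (Suc s)" if "pr Q" "hideal w1 Q" "b \<subseteq> Q" for Q
   using no[OF that] \<open>r \<le> s\<close> ind_mono by blast
  then obtain G where "G ~= 0" "vars_in {..<Suc s} G" "sub y G \<in> b" using relation_or_prime[OF b] by blast
  then obtain G \<delta> where "G ~= 0" "vars_in {..<Suc s} G" "homog w1 \<delta> G" "sub y G \<in> b"
   using homog_relation[OF b y(1)[rule_format], of G "Suc s"] by meson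
  thus ?thesis using noether_step[OF inf _ y(1)[rule_format] _ _ _ _ y(2), of G \<delta>] b unfolding hideal_def by meson
 qed
 ultimately show ?thesis using inc_induct[of r "max CARD('v) r" ?P] by simp
qed

section \<open>The principal ideal theorem for homogeneous primes\<close>

lemma one_notin_add_homog:
 assumes "pr p" "hideal w1 p" "homog w1 m f" "m \<ge> 1" shows "1 ~: gen (p Un {f})"
proof
 assume "1 \<in> gen (p Un {f})"
 hence "1 \<in> gen (p Un (%_. f) ` {()})" by simp
 then obtain q a where q: "q \<in> p" and e: "1 = q + a * f"
  unfolding gen_Un_image[OF pr_idl[OF assms(1)] finite.insertI[OF finite.emptyI]] by auto
 have "1 = hcomp w1 0 (q + a * f)" by (metis e hcomp_homog homog_1)
 also have "\<dots> = hcomp w1 0 q" using assms(4) by (simp add: hcomp_add hcomp_mult_homog2[OF assms(3)])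
 finally show False using assms(1,2) q pr_1 by (metis hideal_def)
qed

text \<open>If every homogeneous prime over p and f had \<open>td\<close> at most td p - 2,
  normalization would need only td p - 2 linear forms. Together with f, the residue ring of p would
  be integral over td p - 1 elements.\<close>

lemma prime_over_hypersurface:
 fixes p :: "('v::finite, 'k::field) mpoly set"
 assumes inf: "infinite (UNIV :: 'k set)" and p: "pr p" "hideal w1 p" and f: "homog w1 m f" "m \<ge> 1"
 shows "EX Q. pr Q & hideal w1 Q & p \<subseteq> Q & f \<in> Q & td p \<le> Suc (td Q)"
proof (rule ccontr)
 assume *: "\<not> ?thesis"
 let ?b = "gen (p Un {f})"
 have hb: "hideal w1 ?b"
 proof -
  have "p Un {f} \<subseteq> homog_map w1 -` poly_ext ?b"
  proof
   fix F assume F: "F \<in> p Un {f}"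
   hence "hcomp w1 d F \<in> p Un {f} \<or> hcomp w1 d F = 0" for d
    using p(2) f(1) by (auto simp: hideal_def hcomp_homog)
   hence "hcomp w1 d F \<in> ?b" for d
    using idl_0[OF idl_gen] genI by metis
   thus "F \<in> homog_map w1 -` poly_ext ?b" by (simp add: poly_ext_def hcomp_def)
  qed
  hence "?b \<subseteq> homog_map w1 -` poly_ext ?b"
   by (intro gen_least idl_vimage ring_map_homog_map idl_poly_ext idl_gen)
  thus ?thesis by (auto simp: hideal_def idl_gen poly_ext_def hcomp_def)
 qed
 have no: "\<not> ind Q (td p - 1)" if Q: "pr Q" "hideal w1 Q" "?b \<subseteq> Q" for Q
 proof
  assume "ind Q (td p - 1)"
  hence "td p - 1 \<le> td Q" by (rule le_td[OF Q(1)])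
  moreover have "p \<subseteq> Q" "f \<in> Q" using Q(3) gen_incl[of "p Un {f}"] by auto
  ultimately show False using * Q by (metis One_nat_def Suc_le_eq Suc_le_mono Suc_pred' le_SucI not_less_eq_eq zero_le le_diff_conv add.commute plus_1_eq_Suc)
 qed
 show False
 proof (cases "td p \<le> 1")
  \<comment> \<open>Here td p - 1 is 0, so the relation is a nonzero constant in the ideal of p and
    f. This is excluded because f has positive degree.\<close>
  case True
  then obtain G where G: "G ~= 0" "vars_in {..<td p - 1} G" "sub (%_. 0) G \<in> ?b"
   using relation_or_prime[OF hb no] by blast
  hence "vars_in {} G" using True by (simp add: lessThan_0)
  then obtain c where c: "G = const c" by (rule vars_in_empty)
  hence "const (1 / c) * const c \<in> ?b" using G(3) by (simp add: sub_simps idl_mult[OF idl_gen])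
  moreover have "const (1 / c) * const c = (1 :: ('v, 'k) mpoly)"
   using G(1) c by (cases "c = 0") (simp_all add: const_simps[symmetric], simp_all add: const_def)
  ultimately show False using one_notin_add_homog[OF p f] by simp
 next
  case False
  define r where "r = td p - 2"
  have r: "td p = Suc (Suc r)" using False by (simp add: r_def)
  have "EX y. (ALL i. homog w1 1 (y i)) & rad_all (gen (?b Un y ` {..<r}))"
   by (rule noether_normalization[OF inf hb]) (use no r in simp)
  then obtain y where y: "ALL i. homog w1 1 (y i)" "rad_all (gen (?b Un y ` {..<r}))" by blast
  define z where "z i = (if i = 0 then f else y (i - 1))" for i
  have "gen (?b Un y ` {..<r}) \<subseteq> gen (p Un z ` {..<Suc r})"
  proof (rule gen_subI)
   have "f \<in> z ` {..<Suc r}" by (auto simp: z_def intro!: image_eqI[of _ _ 0])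
   hence "?b \<subseteq> gen (p Un z ` {..<Suc r})" by (intro gen_mono) auto
   moreover have "y i \<in> z ` {..<Suc r}" if "i < r" for i using that by (auto simp: z_def intro!: image_eqI[of _ _ "Suc i"])
   hence "y ` {..<r} \<subseteq> gen (p Un z ` {..<Suc r})" by (auto intro: genI)
   ultimately show "?b Un y ` {..<r} \<subseteq> gen (p Un z ` {..<Suc r})" by simp
  qed
  hence "rad_all (gen (p Un z ` {..<Suc r}))" using y(2) unfolding rad_all_def by blast
  then obtain M where M: "!!v. var v ^ M \<in> gen (p Un z ` {..<Suc r})" using rad_all_uniform idl_gen by blast
  have "\<not> ind p (Suc (card {..<Suc r}))"
  proof (rule not_ind_integral[OF p(2) _ _ M])
   show "homog w1 (if i = 0 then m else 1) (z i) & (if i = 0 then m else 1) \<ge> 1" for i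
    using f y(1) by (simp add: z_def)
  qed simp
  thus False using td_ind[OF p(1)] r by simp
 qed
qed

section \<open>Exterior algebra on index sets\<close>

text \<open>Functions of index sets are coordinates with respect to the basis e_J of an exterior
  algebra. \<open>sg i J\<close> is the sign of moving e_i past the smaller elements of J,
  \<open>iota i\<close> is contraction by e_i, and \<open>eps i\<close> is multiplication by
  e_i.\<close>

definition sg :: "nat => nat set => 'm::ab_group_add => 'm" where
 "sg i J x = (if even (card {j\<in>J. j < i}) then x else - x)"

definition iota :: "nat => (nat set => 'm::ab_group_add) => nat set => 'm" where
 "iota i z J = (if i \<in> J then 0 else sg i J (z (insert i J)))"

definition eps :: "nat => (nat set => 'm::ab_group_add) => nat set => 'm" where
 "eps i z J = (if i \<in> J then sg i (J - {i}) (z (J - {i})) else 0)"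

lemma sg_insert: "j ~: J ==> sg i (insert j J) x = (if j < i then - sg i J x else sg i J x)"
proof -
 assume j: "j ~: J"
 have "{l \<in> insert j J. l < i} = (if j < i then insert j {l\<in>J. l < i} else {l\<in>J. l < i})" by auto
 moreover have "finite {l\<in>J. l < i}" by simp
 ultimately show ?thesis using j by (auto simp: sg_def)
qed

lemma sg_simps [simp]: "sg i J (0 :: 'm::ab_group_add) = 0" "sg i J (- x) = - sg i J x" "sg i J (sg i J x) = x"
 "sg i J (x + y) = sg i J x + sg i J (y :: 'm::ab_group_add)"
 by (auto simp: sg_def)

lemma sg_comm: "sg i K (sg j L x) = sg j L (sg i K x)" by (auto simp: sg_def)

lemma iota_iota: "iota i (iota j z) J = - iota j (iota i z) J"
proof (cases "i = j \<or> i \<in> J \<or> j \<in> J")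
 case False
 thus ?thesis by (cases "i < j") (auto simp: iota_def sg_insert insert_commute[of i j] sg_comm[of i J j])
qed (auto simp: iota_def)

lemma iota_same: "iota i (iota i z) J = 0" by (simp add: iota_def)
lemma eps_same: "eps i (eps i z) J = 0" by (simp add: eps_def)

lemma eps_eps: "eps i (eps j z) J = - eps j (eps i z) J"
proof (cases "i ~= j & i \<in> J & j \<in> J")
 case True
 define K where "K = J - {i} - {j}"
 have J: "J - {i} = insert j K" "J - {j} = insert i K" "J - {i} - {j} = K" "J - {j} - {i} = K"
  using True by (auto simp: K_def)
 have K: "i ~: K" "j ~: K" by (auto simp: K_def)
 have *: "J - {i} - {j} = K" "J - {j} - {i} = K" "insert j K - {j} = K" "insert i K - {i} = K" using J K by auto
 show ?thesis using True by (cases "i < j") (auto simp: eps_def J(1,2) sg_insert K * sg_comm[of i K j])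
qed (auto simp: eps_def)

text \<open>The Clifford relation between multiplication and contraction; the homotopies of the
  Koszul, Cech and Tate complexes all rest on it.\<close>

lemma eps_iota: "eps i (iota j z) J + iota j (eps i z) J = (if i = j then z J else 0)"
proof (cases "i = j")
 case True
 show ?thesis
 proof (cases "i \<in> J")
  case True
  thus ?thesis using \<open>i = j\<close> by (simp add: eps_def iota_def insert_absorb)
 next
  case False
  thus ?thesis using \<open>i = j\<close> by (simp add: eps_def iota_def)
 qed
next
 case False

 show ?thesis
 proof (cases "i \<in> J & j ~: J")
  case True
  define K where "K = J - {i}"
  have J: "J = insert i K" and K: "i ~: K" "j ~: K" and d: "insert j (insert i K) - {i} = insert j K" "insert i K - {i} = K"
   using True False by (auto simp: K_def)
  have 1: "eps i (iota j z) J = sg i K (sg j K (z (insert j K)))"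
   unfolding J by (simp add: eps_def iota_def d K)
  have 2: "iota j (eps i z) J = sg j (insert i K) (sg i (insert j K) (z (insert j K)))"
   unfolding J using False K by (simp add: eps_def iota_def d)
  show ?thesis using False by (cases "i < j") (simp_all add: 1 2 sg_insert K sg_comm[of i K j])
 next
  case c: False
  thus ?thesis using False by (auto simp: eps_def iota_def)
 qed
qed

text \<open>The diagonal is a separate hypothesis, so that characteristic two is covered.\<close>

lemma antisym_sum:
 assumes "finite A" "!!i j. f i j = - f j i" "!!i. f i i = 0"
 shows "(\<Sum>i\<in>A. \<Sum>j\<in>A. f i j) = (0 :: 'm::ab_group_add)"
 using assms(1)
proof (induction A rule: finite_induct)
 case (insert a A)
 have "(\<Sum>i\<in>A. f i a) = - (\<Sum>j\<in>A. f a j)" by (subst assms(2)) (simp add: sum_negf)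
 thus ?case using insert assms(3) by (simp add: sum.distrib)
qed simp

lemma sum_fun_apply: "sum f A x = (\<Sum>a\<in>A. f a x)"
 by (induction A rule: infinite_finite_induct) (auto simp: zero_fun_def plus_fun_def)

lemma iota_add: "iota i (%J. z J + y J) J = iota i z J + iota i y J" by (simp add: iota_def)
lemma iota_mult: "iota i (%J. (c :: 'a::comm_ring_1) * z J) J = c * iota i z J" by (simp add: iota_def sg_def)
lemma iota_zero: "iota i (%J. 0) J = 0" by (simp add: iota_def)
lemma iota_sum: "iota i (%J. \<Sum>a\<in>A. z a J) J = (\<Sum>a\<in>A. iota i (z a) J)"
 by (induction A rule: infinite_finite_induct) (auto simp: iota_add iota_zero)
lemma eps_add: "eps i (%J. z J + y J) J = eps i z J + eps i y J" by (simp add: eps_def)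
lemma eps_mult: "eps i (%J. (c :: 'a::comm_ring_1) * z J) J = c * eps i z J" by (simp add: eps_def sg_def)
lemma eps_zero: "eps i (%J. 0) J = 0" by (simp add: eps_def)
lemma eps_sum: "eps i (%J. \<Sum>a\<in>A. z a J) J = (\<Sum>a\<in>A. eps i (z a) J)"
 by (induction A rule: infinite_finite_induct) (auto simp: eps_add eps_zero)

text \<open>\<open>kd\<close> is the Koszul differential of the sequence a; \<open>wd\<close> below
  is multiplication by the element \<Sum> T_i e_i.\<close>

definition kd :: "nat set => (nat => 'a::comm_ring_1) => (nat set => 'a) => nat set => 'a" where
 "kd A a z J = (\<Sum>i\<in>A. a i * iota i z J)"

definition wd :: "nat set => (nat => 'a::comm_ring_1) => (nat set => 'a) => nat set => 'a" where
 "wd A T z J = (\<Sum>i\<in>A. T i * eps i z J)"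

lemma kd_fun: "kd A a z = (%J. \<Sum>i\<in>A. a i * iota i z J)" by (simp add: fun_eq_iff kd_def)
lemma wd_fun: "wd A T z = (%J. \<Sum>i\<in>A. T i * eps i z J)" by (simp add: fun_eq_iff wd_def)

lemma kd_add: "kd A a (%J. z J + y J) J = kd A a z J + kd A a y J"
 by (simp add: kd_def iota_add distrib_left sum.distrib)
lemma kd_mult: "kd A a (%J. c * z J) J = c * kd A a z J"
 by (simp add: kd_def iota_mult sum_distrib_left algebra_simps)
lemma kd_sum: "kd A a (%J. \<Sum>b\<in>B. z b J) J = (\<Sum>b\<in>B. kd A a (z b) J)"
 unfolding kd_def iota_sum sum_distrib_left by (rule sum.swap)
lemma kd_zero: "kd A a (%J. 0) J = 0" by (simp add: kd_def iota_zero)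
lemma wd_add: "wd A a (%J. z J + y J) J = wd A a z J + wd A a y J"
 by (simp add: wd_def eps_add distrib_left sum.distrib)
lemma wd_mult: "wd A a (%J. c * z J) J = c * wd A a z J"
 by (simp add: wd_def eps_mult sum_distrib_left algebra_simps)
lemma wd_zero: "wd A a (%J. 0) J = 0" by (simp add: wd_def eps_zero)

lemma iota_kd: "iota i (kd A a z) J = - kd A a (iota i z) J"
 unfolding kd_fun iota_sum iota_mult by (simp add: iota_iota[of i] sum_negf)

lemma kd_kd: assumes "finite A" shows "kd A a (kd A a z) J = 0"
proof -
 have "kd A a (kd A a z) J = (\<Sum>i\<in>A. \<Sum>j\<in>A. a i * (a j * iota i (iota j z) J))"
  by (simp add: kd_fun iota_sum iota_mult sum_distrib_left)
 also have "\<dots> = 0"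
  by (rule antisym_sum[OF assms])
   (metis (no_types, opaque_lifting) iota_iota mult.left_commute mult_minus_right, simp add: iota_same)
 finally show ?thesis .
qed

lemma wd_wd: assumes "finite A" shows "wd A a (wd A a z) J = 0"
proof -
 have "wd A a (wd A a z) J = (\<Sum>i\<in>A. \<Sum>j\<in>A. a i * (a j * eps i (eps j z) J))"
  by (simp add: wd_fun eps_sum eps_mult sum_distrib_left)
 also have "\<dots> = 0"
  by (rule antisym_sum[OF assms])
   (metis (no_types, opaque_lifting) eps_eps mult.left_commute mult_minus_right, simp add: eps_same)
 finally show ?thesis .
qed

lemma eps_kd:
 assumes "finite A" shows "eps i (kd A a z) J + kd A a (eps i z) J = (if i \<in> A then a i * z J else 0)"
proof -
 have "eps i (kd A a z) J + kd A a (eps i z) J = (\<Sum>j\<in>A. a j * (eps i (iota j z) J + iota j (eps i z) J))"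
  by (simp add: kd_fun eps_sum eps_mult distrib_left sum.distrib)
 also have "\<dots> = (\<Sum>j\<in>A. if i = j then a j * z J else 0)"
  by (intro sum.cong) (auto simp: eps_iota)
 finally show ?thesis using assms by simp
qed

text \<open>Termwise the Clifford relation. For a relation \<Sum> T_i a_i = 0 the two maps
  anticommute, which makes the differential of the Tate complex square to zero.\<close>

lemma wd_kd:
 assumes "finite A" "finite B"
 shows "wd B T (kd A a z) J + kd A a (wd B T z) J = (\<Sum>i\<in>A \<inter> B. T i * a i) * z J"
proof -
 have "kd A a (wd B T z) J = (\<Sum>i\<in>B. T i * kd A a (eps i z) J)"
  unfolding wd_fun kd_sum kd_mult ..
 hence "wd B T (kd A a z) J + kd A a (wd B T z) J = (\<Sum>i\<in>B. T i * (eps i (kd A a z) J + kd A a (eps i z) J))"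
  by (simp add: wd_def distrib_left sum.distrib)
 also have "\<dots> = (\<Sum>i\<in>B. if i \<in> A then T i * a i * z J else 0)"
  by (intro sum.cong) (auto simp: eps_kd[OF assms(1)] mult.assoc)
 also have "\<dots> = (\<Sum>i\<in>A \<inter> B. T i * a i * z J)"
  using assms by (simp add: sum.inter_restrict Int_commute[of A B])
 finally show ?thesis by (simp add: sum_distrib_right)
qed

section \<open>A double complex chase\<close>

text \<open>q is the degree for D and s the one for \<delta>. A solution e of D e = \<delta> h is
  corrected along the diagonal: its defect is lifted to higher s until it meets the vanishing column
  n + 1, and exactness of \<delta> brings the corrections back.\<close>

lemma double_complex_chase:
 fixes C :: "nat => nat => 'c::ab_group_add set" and D \<delta> :: "'c => 'c"
 assumes D_diff: "!!x y. D (x - y) = D x - D y" and \<delta>_diff: "!!x y. \<delta> (x - y) = \<delta> x - \<delta> y"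
  and \<delta>\<delta>: "!!x. \<delta> (\<delta> x) = 0" and DD: "!!x. D (D x) = 0" and comm: "!!x. D (\<delta> x) = \<delta> (D x)"
  and C_diff: "!!q s x y. x \<in> C q s ==> y \<in> C q s ==> x - y \<in> C q s" and C_0: "!!q s. 0 \<in> C q s"
  and CD: "!!q s x. x \<in> C (Suc q) s ==> D x \<in> C q s" and C\<delta>: "!!q s x. x \<in> C q s ==> \<delta> x \<in> C q (Suc s)"
  and Dex: "!!q s x. q \<ge> 1 ==> s \<ge> 1 ==> x \<in> C q s ==> D x = 0 ==> EX y:C (Suc q) s. D y = x"
  and \<delta>ex: "!!s x. s < n ==> x \<in> C (q0 + Suc s) (Suc s) ==> \<delta> x = 0 ==> EX y:C (q0 + Suc s) s. \<delta> y = x"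
  and \<delta>inj: "!!x. x \<in> C q0 0 ==> \<delta> x = 0 ==> x = 0"
  and top: "!!q x. x \<in> C q (Suc n) ==> x = 0"
  and h: "h \<in> C q0 0" and e: "e \<in> C (Suc q0) 1" "D e = \<delta> h"
 shows "EX b:C (Suc q0) 0. D b = h"
proof -
 have D_0: "D 0 = 0" and \<delta>_0: "\<delta> 0 = 0" using D_diff[of 0 0] \<delta>_diff[of 0 0] by auto
 have claim: "EX b:C (q0 + Suc s) s. EX y:C (q0 + Suc (Suc s)) (Suc s). x = \<delta> b + D y"
  if "x \<in> C (q0 + Suc s) (Suc s)" "D (\<delta> x) = 0" "s \<le> n" for s x
  using that(3,1,2)
 proof (induction arbitrary: x rule: inc_induct)
  case base
  hence "x = 0" using top by blast
  thus ?case using C_0 D_0 \<delta>_0 by (intro bexI[of _ 0]) auto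
 next
  case (step s)
  obtain x' where x': "x' \<in> C (q0 + Suc (Suc s)) (Suc (Suc s))" "D x' = \<delta> x"
   using Dex[of "q0 + Suc s" "Suc (Suc s)" "\<delta> x"] C\<delta>[OF step.prems(1)] step.prems by auto
  have "D (\<delta> x') = 0" by (simp add: comm x' \<delta>\<delta>)
  then obtain b' y' where b': "b' \<in> C (q0 + Suc (Suc s)) (Suc s)" "y' \<in> C (q0 + Suc (Suc (Suc s))) (Suc (Suc s))"
   and xe: "x' = \<delta> b' + D y'" using step.IH[OF x'(1)] by auto
  have "\<delta> (D b') = D (\<delta> b')" by (simp add: comm)
  also have "\<dots> = D (x' - D y')" using xe by simp
  also have "\<dots> = \<delta> x - D (D y')" by (simp add: D_diff x')
  finally have d: "\<delta> (x - D b') = 0" by (simp add: \<delta>_diff DD)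
  have "D b' \<in> C (q0 + Suc s) (Suc s)" using CD[of b' "q0 + Suc s"] b'(1) by simp
  hence m: "x - D b' \<in> C (q0 + Suc s) (Suc s)" using C_diff step.prems(1) by blast
  show ?case
  proof (cases "s < n")
   case True
   then obtain y where "y \<in> C (q0 + Suc s) s" "\<delta> y = x - D b'" using \<delta>ex[OF True m d] by blast
   thus ?thesis using b'(1) by (intro bexI[of _ y] bexI[of _ b']) auto
  next
   case False
   thus ?thesis using step by simp
  qed
 qed
 obtain b y where b: "b \<in> C (Suc q0) 0" and y: "y \<in> C (Suc (Suc q0)) (Suc 0)" and eb: "e = \<delta> b + D y"
  using claim[of e 0] e by (auto simp: comm[symmetric] \<delta>\<delta> comm)
 have "\<delta> (D b) = D (\<delta> b)" by (simp add: comm)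
 also have "\<dots> = D (e - D y)" using eb by simp
 also have "\<dots> = \<delta> h" by (simp add: D_diff DD e)
 finally have "\<delta> (h - D b) = 0" by (simp add: \<delta>_diff)
 hence "h - D b = 0" using C_diff[OF h CD[OF b]] \<delta>inj by blast
 thus ?thesis using b by auto
qed

section \<open>Laurent polynomials and the Cech complex\<close>

type_synonym ('v, 'k) laurent = "('v \<Rightarrow>\<^sub>0 int) \<Rightarrow>\<^sub>0 'k"

definition emb :: "('v, 'k::comm_ring_1) mpoly => ('v, 'k) laurent" where
 "emb = ev (sng 0) (%v. sng (sng v 1) 1)"

definition lift_exp :: "('v \<Rightarrow>\<^sub>0 nat) => ('v \<Rightarrow>\<^sub>0 int)" where
 "lift_exp t = Poly_Mapping.map int t"

lemma lookup_lift_exp: "lk (lift_exp t) v = int (lk t v)"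
 by (simp add: lift_exp_def Poly_Mapping.map.rep_eq when_def)

lemma lift_exp_simps: "lift_exp (s + t) = lift_exp s + lift_exp t" "lift_exp s = lift_exp t <-> s = t"
 by (rule poly_mapping_eqI, simp add: lookup_lift_exp lookup_add)
  (metis lookup_lift_exp of_nat_eq_iff poly_mapping_eqI)

lemma ring_map_sng0: "ring_map (sng 0 :: 'k::comm_ring_1 => ('v, 'k) laurent)"
 by (rule ring_mapI) (simp_all add: single_add mult_single)

lemma ring_map_emb: "ring_map emb"
 unfolding emb_def by (rule ring_map_ev[OF ring_map_sng0])

lemmas emb_simps = ring_map_simps[OF ring_map_emb]

lemma emb_single: "emb (sng t c) = sng (lift_exp t) c"
proof -
 have p: "sng (sng v 1) 1 ^ k = (sng (sng v (int k)) 1 :: ('a, 'b) laurent)" for v k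
  by (induction k) (simp_all add: mult_single single_add[symmetric])
 have "ev_monom (%v. sng (sng v 1) 1) t = (sng (lift_exp t) 1 :: ('a, 'b) laurent)"
 proof (induction t rule: poly_mapping_add_induct)
  case (single v k)
  have "lift_exp (sng v k) = sng v (int k)"
   by (rule poly_mapping_eqI) (simp add: lookup_lift_exp lookup_single when_def)
  thus ?case by (simp only: ev_monom_simps p)
 next
  case (add s t)
  thus ?case by (simp add: lift_exp_simps mult_single)
 qed
 thus ?thesis by (simp add: emb_def ev_single[OF ring_map_sng0] mult_single)
qed

lemma lookup_emb: "lk (emb F) (lift_exp t) = lk F t"
proof (induction F rule: poly_mapping_add_induct)
 case (single s c)
 thus ?case by (simp add: emb_single lookup_single when_def lift_exp_simps)
qed (simp add: emb_simps lookup_add)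

lemma keys_emb: "\<tau> \<in> keys (emb F) ==> EX t:keys F. \<tau> = lift_exp t"
proof -
 assume \<tau>: "\<tau> \<in> keys (emb F)"
 have "emb F = (\<Sum>t\<in>keys F. sng (lift_exp t) (lk F t))"
  by (subst poly_mapping_sum_single) (simp add: emb_simps emb_single)
 hence "(\<Sum>t\<in>keys F. lk (sng (lift_exp t) (lk F t)) \<tau>) ~= 0" using \<tau> by (simp add: in_keys_iff lookup_sum)
 then obtain t where "t \<in> keys F" "lk (sng (lift_exp t) (lk F t)) \<tau> ~= 0" by (rule sum.not_neutral_contains_not_neutral)
 thus ?thesis by (auto simp: lookup_single when_def split: if_splits)
qed

lemma emb_inj: "emb F = emb G ==> F = G"
 by (rule poly_mapping_eqI) (metis lookup_emb)

text \<open>\<open>lau V\<close>: only the variables in \<open>V\<close> may occur in denominators.\<close>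

definition lau :: "'v set => ('v, 'k::comm_ring_1) laurent => bool" where
 "lau V F <-> (ALL \<tau>:keys F. ALL v. lk \<tau> v < 0 --> v \<in> V)"

lemma lau_emb: "lau V (emb F)"
 by (auto simp: lau_def lookup_lift_exp dest!: keys_emb)

lemma lau_empty: assumes "lau {} F" obtains G where "F = emb G"
proof -
 have "sng \<tau> (lk F \<tau>) = emb (sng (Poly_Mapping.map nat \<tau>) (lk F \<tau>))" if "\<tau> \<in> keys F" for \<tau>
 proof -
  have "lift_exp (Poly_Mapping.map nat \<tau>) = \<tau>"
  proof (rule poly_mapping_eqI)
   fix v
   have "lk \<tau> v \<ge> 0" using assms that by (auto simp: lau_def not_less[symmetric])
   thus "lk (lift_exp (Poly_Mapping.map nat \<tau>)) v = lk \<tau> v"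
    by (simp add: lookup_lift_exp Poly_Mapping.map.rep_eq when_def)
  qed
  thus ?thesis by (simp add: emb_single)
 qed
 hence "F = emb (\<Sum>\<tau>\<in>keys F. sng (Poly_Mapping.map nat \<tau>) (lk F \<tau>))"
  using poly_mapping_sum_single[of F] by (simp add: emb_simps)
 thus ?thesis using that by blast
qed

lemma lau_add: "lau V F ==> lau V G ==> lau V (F + G)"
 using Poly_Mapping.keys_add[of F G] unfolding lau_def by blast
lemma lau_0: "lau V 0" by (simp add: lau_def)
lemma lau_uminus: "lau V F ==> lau V (- F)" by (simp add: lau_def)
lemma lau_diff: "lau V F ==> lau V G ==> lau V (F - G)"
 using lau_add[of V F "- G"] lau_uminus[of V G] by simp
lemma lau_sum: "(!!i. i \<in> I ==> lau V (f i)) ==> lau V (sum f I)"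
 by (induction I rule: infinite_finite_induct) (auto simp: lau_0 lau_add)
lemma lau_mult: assumes "lau V F" "lau V G" shows "lau V (F * G)"
 unfolding lau_def
proof (intro ballI allI impI)
 fix \<tau> v assume "\<tau> \<in> keys (F * G)" and n: "lk \<tau> v < 0"
 then obtain r s where "\<tau> = r + s" and rs: "r \<in> keys F" "s \<in> keys G" using keys_mult[of F G] by blast
 hence "lk r v < 0 \<or> lk s v < 0" using n by (auto simp: lookup_add)
 thus "v \<in> V" using rs assms by (auto simp: lau_def)
qed
lemma lau_sg: "lau V F ==> lau V (sg i J F)" by (simp add: sg_def lau_uminus)

definition mono :: "('v \<Rightarrow>\<^sub>0 int) => ('v, 'k::comm_ring_1) laurent" where "mono \<tau> = sng \<tau> 1"

lemma mono_mult: "mono \<sigma> * mono \<tau> = mono (\<sigma> + \<tau>)" and mono_0: "mono 0 = 1"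
 by (simp_all add: mono_def mult_single)

lemma emb_var_power: "emb (var v ^ M) = mono (sng v (int M))"
proof -
 have "emb (var v ^ M) = emb (sng (sng v M) 1)" by (simp add: single_eq_const_prod) (simp add: const_def)
 also have "\<dots> = mono (sng v (int M))"
 proof -
  have "lift_exp (sng v M) = sng v (int M)"
   by (rule poly_mapping_eqI) (simp add: lookup_lift_exp lookup_single when_def)
  thus ?thesis by (simp add: emb_single mono_def)
 qed
 finally show ?thesis .
qed

lemma lau_mono: "(!!v. lk \<tau> v < 0 ==> v \<in> V) ==> lau V (mono \<tau>)"
 by (simp add: lau_def mono_def)

lemma clear_denominators:
 assumes "finite S" "finite V" "!!F. F \<in> S ==> lau V F"
 shows "EX \<tau>. keys \<tau> \<subseteq> V & (ALL v. lk \<tau> v \<ge> 0) & (ALL F:S. lau {} (mono \<tau> * F))"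
proof -
 define T where "T = (\<Union>F\<in>S. keys F)"
 have fT: "finite T" using assms by (simp add: T_def)
 define m where "m v = (\<Sum>\<sigma>\<in>T. \<bar>lk \<sigma> v\<bar>)" for v
 define \<tau> where "\<tau> = (\<Sum>v\<in>V. sng v (m v))"
 have l: "lk \<tau> v = (if v \<in> V then m v else 0)" for v
  using assms(2) by (simp add: \<tau>_def lookup_sum lookup_single when_def)
 have m0: "m v \<ge> 0" for v by (simp add: m_def sum_nonneg)
 have "lau {} (mono \<tau> * F)" if F: "F \<in> S" for F
  unfolding lau_def
 proof (intro ballI allI impI)
  fix \<rho> v assume "\<rho> \<in> keys (mono \<tau> * F)" and n: "lk \<rho> v < 0"
  then obtain \<sigma> where \<rho>: "\<rho> = \<tau> + \<sigma>" and \<sigma>: "\<sigma> \<in> keys F"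
   using keys_mult[of "mono \<tau>" F] by (auto simp: mono_def)
  have "\<bar>lk \<sigma> v\<bar> \<le> m v" unfolding m_def using F \<sigma> fT by (intro member_le_sum) (auto simp: T_def)
  moreover have "v ~: V ==> lk \<sigma> v \<ge> 0" using assms(3)[OF F] \<sigma> by (force simp: lau_def)
  ultimately have "lk \<rho> v \<ge> 0" by (cases "v \<in> V") (auto simp: \<rho> lookup_add l)
  thus "v \<in> {}" using n by simp
 qed
 moreover have "keys \<tau> \<subseteq> V" by (auto simp: in_keys_iff l split: if_splits)
 moreover have "lk \<tau> v \<ge> 0" for v by (simp add: l m0)
 ultimately show ?thesis by blast
qed

definition res :: "'t set => ('t \<Rightarrow>\<^sub>0 'k::comm_monoid_add) => ('t \<Rightarrow>\<^sub>0 'k)" where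
 "res A F = (\<Sum>\<tau>\<in>keys F \<inter> A. sng \<tau> (lk F \<tau>))"

lemma lookup_res: "lk (res A F) \<tau> = (if \<tau> \<in> A then lk F \<tau> else 0)"
proof -
 have "lk (res A F) \<tau> = (\<Sum>\<sigma>\<in>keys F \<inter> A. if \<sigma> = \<tau> then lk F \<tau> else 0)"
  by (simp add: res_def lookup_sum lookup_single when_def cong: if_cong sum.cong)
 also have "\<dots> = (if \<tau> \<in> keys F \<inter> A then lk F \<tau> else 0)" by simp
 finally show ?thesis by (simp add: in_keys_iff)
qed

lemma res_0: "res A 0 = 0" by (simp add: res_def)
lemma res_sg: "res A (sg i J F) = sg i J (res A F)" for F :: "'t \<Rightarrow>\<^sub>0 'k::ab_group_add"
 by (rule poly_mapping_eqI) (simp add: lookup_res sg_def)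
lemma res_add: "res A (F + G) = res A F + res A G"
 by (rule poly_mapping_eqI) (simp add: lookup_res lookup_add)
lemma keys_res: "keys (res A F) = keys F \<inter> A" by (auto simp: in_keys_iff lookup_res split: if_splits)
lemma lau_res: "lau V F ==> lau V (res A F)" by (auto simp: lau_def keys_res)

text \<open>Exactness of a complex of Laurent polynomials descends to polynomials, provided that it
  holds after inverting any of the variables \<open>vn i\<close> and that no obstruction in the top Cech
  cohomology occurs.\<close>

lemma cech_descent:
 fixes Xq :: "nat => ('b => ('v, 'k::comm_ring_1) laurent) set" and DD and vn :: "nat => 'v"
 assumes vn: "inj_on vn {..<N}" and N: "N \<ge> 1"
  and DD_add: "!!z y. DD (z + y) = DD z + DD y" and DDDD: "!!z. DD (DD z) = 0"
  and DDX: "!!q z. z \<in> Xq (Suc q) ==> DD z \<in> Xq q"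
  and DDl: "!!V z. (ALL b. lau V (z b)) ==> (ALL b. lau V (DD z b))"
  and X_add: "!!q z y. z \<in> Xq q ==> y \<in> Xq q ==> z + y \<in> Xq q" and X_minus: "!!q z. z \<in> Xq q ==> - z \<in> Xq q"
  and X_res: "!!q z A. z \<in> Xq q ==> (%b. res A (z b)) \<in> Xq q" and X_0: "!!q. 0 \<in> Xq q"
  and loc: "!!q z J. q \<ge> 1 ==> J ~= {} ==> J \<subseteq> {..<N} ==> z \<in> Xq q ==> ALL b. lau (vn ` J) (z b) ==> DD z = 0 ==>
    EX y:Xq (Suc q). (ALL b. lau (vn ` J) (y b)) & DD y = z"
  and top: "!!z b \<tau>. z \<in> Xq (q0 + N) ==> \<tau> \<in> keys (z b) ==> EX i<N. lk \<tau> (vn i) \<ge> 0"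
  and h: "h \<in> Xq q0" "ALL b. lau {} (h b)" "!!i. i < N ==> EX y:Xq (Suc q0). (ALL b. lau {vn i} (y b)) & DD y = h"
 shows "EX y:Xq (Suc q0). (ALL b. lau {} (y b)) & DD y = h"
proof -
 \<comment> \<open>C q s: families over the s-element sets J with denominators only in the variables
   indexed by J. The empty J carries the polynomials themselves, so the complex is
   augmented.\<close>
 define C where "C q s = {c :: nat set => 'b => ('v, 'k) laurent. ALL J. (c J ~= 0 --> J \<subseteq> {..<N} & card J = s) &
   c J \<in> Xq q & (ALL b. lau (vn ` J) (c J b))}" for q s
 define D where "D c = (%J. DD (c J))" for c :: "nat set => 'b => ('v, 'k) laurent"
 define \<delta> where "\<delta> c = (%J. \<Sum>i<N. eps i c J)" for c :: "nat set => 'b => ('v, 'k) laurent"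
 have DD_0: "DD 0 = 0" using DD_add[of 0 0] by simp
 have DD_minus: "DD (- z) = - DD z" for z using DD_add[of z "- z"] DD_0 by (simp add: eq_neg_iff_add_eq_0 add.commute)
 have DD_sg: "DD (sg i J z) = sg i J (DD z)" for i J z by (simp add: sg_def DD_minus)
 have DD_sum: "DD (sum f A) = (\<Sum>a\<in>A. DD (f a))" for f and A :: "nat set"
 proof (induction A rule: infinite_finite_induct)
  case (insert a A)
  have "DD (sum f (insert a A)) = DD (f a + sum f A)" using insert by (subst sum.insert) auto
  thus ?case unfolding DD_add insert.IH using insert by (subst sum.insert) auto
 next
  case empty
  show ?case using DD_0 by (metis sum.empty)
 next
  case (infinite A)
  thus ?case using DD_0 by (metis sum.infinite)
 qed
 have X_sg: "z \<in> Xq q ==> sg i J z \<in> Xq q" for z q i J by (simp add: sg_def X_minus)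
 have X_sum: "(!!a. a \<in> A ==> f a \<in> Xq q) ==> sum f A \<in> Xq q" for f q and A :: "nat set"
  by (induction A rule: infinite_finite_induct) (auto simp: X_0 X_add)
 have lau_sgf: "ALL b. lau V (z b) ==> ALL b. lau V (sg i J z b)" for V z i J
  by (simp add: sg_def lau_uminus)
 have sg_app: "sg i J z b = sg i J (z b)" for i J and z :: "'b => ('v, 'k) laurent" and b by (simp add: sg_def)
 have "EX b:C (Suc q0) 0. D b = (%J. if J = {} then h else 0)"
 proof (rule double_complex_chase[where \<delta> = \<delta> and n = N and e = "%J. if EX i<N. J = {i} then SOME y. y \<in> Xq (Suc q0) & (ALL b. lau (vn ` J) (y b)) & DD y = h else 0"])
  show "D (x - y) = D x - D y" for x y
  proof
   fix J show "D (x - y) J = (D x - D y) J"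
    using DD_add[of "x J" "- y J"] by (simp add: D_def DD_minus fun_diff_def)
  qed
  have eps_minus: "eps i (- y) J = - eps i y J" for i J and y :: "nat set => 'b => ('v, 'k) laurent" by (simp add: eps_def)
  show "\<delta> (x - y) = \<delta> x - \<delta> y" for x y
  proof
   fix J
   have "eps i (x - y) J = eps i x J - eps i y J" for i
    using eps_add[of i x "- y" J] by (simp add: eps_minus fun_eq_iff fun_diff_def plus_fun_def eps_def sg_def)
   thus "\<delta> (x - y) J = (\<delta> x - \<delta> y) J" by (simp add: \<delta>_def sum_subtractf)
  qed
  show "\<delta> (\<delta> x) = 0" for x
  proof
   fix J
   have "\<delta> (\<delta> x) J = (\<Sum>i<N. \<Sum>j<N. eps i (eps j x) J)" by (simp add: \<delta>_def eps_sum)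
   also have "\<dots> = 0" by (rule antisym_sum) (auto simp: eps_same intro: eps_eps)
   finally show "\<delta> (\<delta> x) J = 0 J" by simp
  qed
  show "D (D x) = 0" for x by (rule ext) (simp add: D_def DDDD)
  show "D (\<delta> x) = \<delta> (D x)" for x
   by (rule ext) (auto simp: D_def \<delta>_def DD_sum eps_def DD_sg DD_0 intro!: sum.cong)
  show "x - y \<in> C q s" if "x \<in> C q s" "y \<in> C q s" for q s x y
   unfolding C_def
  proof (intro CollectI allI conjI impI)
   fix J
   have "x J - y J \<in> Xq q" using that X_add[of "x J" q "- y J"] X_minus by (auto simp: C_def)
   thus "(x - y) J \<in> Xq q" by simp
   show "J \<subseteq> {..<N}" "card J = s" if "(x - y) J ~= 0"
   proof -
    have "x J ~= 0 \<or> y J ~= 0" using that by auto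
    thus "J \<subseteq> {..<N}" "card J = s" using \<open>x \<in> C q s\<close> \<open>y \<in> C q s\<close> unfolding C_def by blast+
   qed
  qed (use that in \<open>simp add: C_def lau_diff\<close>)
  show z0: "0 \<in> C q s" for q s by (simp add: C_def X_0 lau_0)
  show "D x \<in> C q s" if x: "x \<in> C (Suc q) s" for q s x
   unfolding C_def
  proof (intro CollectI allI conjI impI)
   fix J
   show "D x J \<in> Xq q" using x by (simp add: C_def D_def DDX)
   show "lau (vn ` J) (D x J b)" for b using x DDl[of "vn ` J" "x J"] by (simp add: C_def D_def)
   show "J \<subseteq> {..<N}" "card J = s" if "D x J ~= 0"
   proof -
    have "x J ~= 0" using that DD_0 by (auto simp: D_def)
    thus "J \<subseteq> {..<N}" "card J = s" using x by (auto simp: C_def)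
   qed
  qed
  show "\<delta> x \<in> C q (Suc s)" if x: "x \<in> C q s" for q s x
   unfolding C_def
  proof (intro CollectI allI conjI impI)
   fix J
   have e: "eps i x J \<in> Xq q" for i using x by (auto simp: eps_def C_def X_0 intro: X_sg)
   show "\<delta> x J \<in> Xq q" unfolding \<delta>_def by (intro X_sum e)
   have "lau (vn ` J) (eps i x J b)" if "i < N" for i b
   proof (cases "i \<in> J")
    case True
    hence "lau (vn ` (J - {i})) (x (J - {i}) b)" using x by (auto simp: C_def)
    hence "lau (vn ` J) (x (J - {i}) b)" by (auto simp: lau_def)
    thus ?thesis using True by (simp add: eps_def sg_app lau_sg)
   qed (simp add: eps_def lau_0)
   thus "lau (vn ` J) (\<delta> x J b)" for b unfolding \<delta>_def sum_fun_apply by (rule lau_sum) simp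
   assume "\<delta> x J ~= 0"
   then obtain i where i: "i < N" "eps i x J ~= 0" unfolding \<delta>_def by (metis lessThan_iff sum.neutral)
   hence "i \<in> J" "x (J - {i}) ~= 0" by (auto simp: eps_def split: if_splits)
   hence J: "J - {i} \<subseteq> {..<N}" "card (J - {i}) = s" using x by (auto simp: C_def)
   show "J \<subseteq> {..<N}" using i J(1) by blast
   hence "finite J" using finite_subset by blast
   thus "card J = Suc s" using card_Suc_Diff1[OF _ \<open>i \<in> J\<close>] J(2) by simp
  qed
  show "EX y:C (Suc q) s. D y = x" if q: "q \<ge> 1" "s \<ge> 1" and x: "x \<in> C q s" "D x = 0" for q s x
  proof -
   have "EX y. y \<in> Xq (Suc q) & (ALL b. lau (vn ` J) (y b)) & DD y = x J & (x J = 0 --> y = 0)" for J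
   proof (cases "x J = 0")
    case True thus ?thesis by (intro exI[of _ 0]) (simp add: X_0 lau_0 DD_0)
   next
    case False
    hence J: "J \<subseteq> {..<N}" "card J = s" using x by (auto simp: C_def)
    hence "J ~= {}" using q by auto
    moreover have "DD (x J) = 0" using fun_cong[OF x(2), of J] by (simp add: D_def)
    ultimately show ?thesis using loc[OF q(1) _ J(1), of "x J"] x False by (auto simp: C_def)
   qed
   then obtain y where y: "!!J. y J \<in> Xq (Suc q) & (ALL b. lau (vn ` J) (y J b)) & DD (y J) = x J & (x J = 0 --> y J = 0)" by metis
   have "y \<in> C (Suc q) s" using x y unfolding C_def by blast
   moreover have "D y = x" by (rule ext) (simp add: D_def y)
   ultimately show ?thesis by blast
  qed
  show "EX y:C (q0 + Suc s) s. \<delta> y = x" if s: "s < N" and x: "x \<in> C (q0 + Suc s) (Suc s)" "\<delta> x = 0" for s x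
  proof -
   \<comment> \<open>Every exponent is assigned to the first variable \<open>vn i\<close> in which
     it is nonnegative. On the part A i the variable \<open>vn i\<close> needs no denominator, so
     contraction by e_i stays inside the complex and gives a homotopy.\<close>
   define A where "A i = {\<tau>. i < N & lk \<tau> (vn i) \<ge> 0 & (\<forall>j<i. lk \<tau> (vn j) < (0::int))}" for i
   define y where "y = (%J b. \<Sum>i<N. res (A i) (iota i x J b))"
   \<comment> \<open>Some variable is nonnegative: one outside J if J is not full, and by the
     hypothesis \<open>top\<close> otherwise.\<close>
   have nn: "EX i<N. lk \<tau> (vn i) \<ge> 0" if \<tau>: "\<tau> \<in> keys (x J b)" for J b \<tau>
   proof (cases "Suc s = N")
    case True thus ?thesis using top[of "x J" \<tau> b] x \<tau> by (auto simp: C_def)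
   next
    case False
    have "x J ~= 0" using \<tau> by auto
    hence J: "J \<subseteq> {..<N}" "card J = Suc s" "lau (vn ` J) (x J b)" using x by (auto simp: C_def)
    hence "J ~= {..<N}" using False by auto
    then obtain i where i: "i < N" "i ~: J" using J by auto
    hence "vn i ~: vn ` J" using vn J(1) by (auto dest!: inj_onD)
    thus ?thesis using J(3) \<tau> i by (auto simp: lau_def not_less[symmetric])
   qed
   have part: "(\<Sum>i<N. res (A i) (x J b)) = x J b" for J b
   proof (rule poly_mapping_eqI)
    fix \<tau>
    show "lk (\<Sum>i<N. res (A i) (x J b)) \<tau> = lk (x J b) \<tau>"
    proof (cases "\<tau> \<in> keys (x J b)")
     case True
     define i where "i = (LEAST i. i < N & lk \<tau> (vn i) \<ge> 0)"
     have i: "i < N & lk \<tau> (vn i) \<ge> 0" using nn[OF True] unfolding i_def by (rule LeastI_ex)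
     have "lk \<tau> (vn j) < 0" if "j < i" for j using not_less_Least[of j "%i. i < N & lk \<tau> (vn i) \<ge> 0"] that i unfolding i_def by auto
     hence "\<tau> \<in> A j <-> j = i" for j using i unfolding A_def mem_Collect_eq by (metis linorder_neqE_nat not_le)
     thus ?thesis using i by (simp add: lookup_sum lookup_res)
    next
     case False thus ?thesis by (simp add: lookup_sum lookup_res in_keys_iff cong: if_cong)
    qed
   qed
   have "\<delta> y J b = x J b" for J b
   proof -
    have r: "eps j y J b = (\<Sum>i<N. res (A i) (eps j (iota i x) J b))" for j
    proof (cases "j \<in> J")
     case True
     thus ?thesis
      by (simp add: eps_def sg_app y_def res_sg) (simp add: sg_def sum_negf)
    qed (simp add: eps_def res_0)
    have rs: "res (A i) (\<Sum>j<N. f j) = (\<Sum>j<N. res (A i) (f j))" for i and f :: "nat => ('v, 'k) laurent"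
     by (rule poly_mapping_eqI) (simp add: lookup_res lookup_sum)
    have "\<delta> y J b = (\<Sum>j<N. \<Sum>i<N. res (A i) (eps j (iota i x) J b))" by (simp add: \<delta>_def sum_fun_apply r)
    also have "\<dots> = (\<Sum>i<N. res (A i) (\<Sum>j<N. eps j (iota i x) J b))" by (subst sum.swap) (simp add: rs)
    also have "\<dots> = (\<Sum>i<N. res (A i) (x J b))"
    proof (rule sum.cong[OF refl], rule arg_cong[where f = "res _"])
     fix i assume "i \<in> {..<N}"
     have "(\<Sum>j<N. eps j (iota i x) J) + iota i (\<delta> x) J = (\<Sum>j<N. eps j (iota i x) J + iota i (eps j x) J)"
      unfolding \<delta>_def iota_sum by (simp add: sum.distrib)
     also have "\<dots> = (\<Sum>j<N. if j = i then x J else 0)" by (simp add: eps_iota)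
     also have "\<dots> = x J" using \<open>i \<in> {..<N}\<close> by simp
     finally have "(\<Sum>j<N. eps j (iota i x) J) + iota i (\<delta> x) J = x J" .
     moreover have "iota i (\<delta> x) J = 0" unfolding x(2) by (simp add: iota_def zero_fun_def sg_def)
     ultimately have "(\<Sum>j<N. eps j (iota i x) J) = x J" by simp
     from fun_cong[OF this, of b] show "(\<Sum>j<N. eps j (iota i x) J b) = x J b" by (simp add: sum_fun_apply)
    qed
    finally show ?thesis by (simp add: part)
   qed
   hence "\<delta> y = x" by (simp add: fun_eq_iff)
   moreover have "y \<in> C (q0 + Suc s) s"
    unfolding C_def
   proof (intro CollectI allI conjI impI)
    fix J
    have "(%b. res (A i) (iota i x J b)) \<in> Xq (q0 + Suc s)" for i
    proof -
     have "iota i x J \<in> Xq (q0 + Suc s)" using x by (auto simp: iota_def C_def X_0 intro: X_sg)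
     thus ?thesis by (rule X_res)
    qed
    hence "(\<Sum>i<N. (%b. res (A i) (iota i x J b))) \<in> Xq (q0 + Suc s)" by (intro X_sum)
    also have "(\<Sum>i<N. (%b. res (A i) (iota i x J b))) = y J" by (rule ext) (simp add: y_def sum_fun_apply)
    finally show "y J \<in> Xq (q0 + Suc s)" .
    show "lau (vn ` J) (y J b)" for b
     unfolding y_def
    proof (rule lau_sum)
     fix i assume "i \<in> {..<N}"
     show "lau (vn ` J) (res (A i) (iota i x J b))"
     proof (cases "i \<in> J")
      case True thus ?thesis by (simp add: iota_def res_0 lau_0)
     next
      case False
      have "lau (vn ` insert i J) (x (insert i J) b)" using x unfolding C_def by blast
      hence l: "lau (vn ` insert i J) (iota i x J b)" using False by (simp add: iota_def sg_app lau_sg)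
      show ?thesis
       unfolding lau_def keys_res
      proof (intro ballI allI impI)
       fix \<tau> v assume \<tau>: "\<tau> \<in> keys (iota i x J b) \<inter> A i" "lk \<tau> v < 0"
       hence "v \<in> vn ` insert i J" using l unfolding lau_def by blast
       moreover have "v ~= vn i" using \<tau> by (auto simp: A_def)
       ultimately show "v \<in> vn ` J" by auto
      qed
     qed
    qed
    assume "y J ~= 0"
    then obtain b where "y J b ~= 0" by (auto simp: fun_eq_iff)
    hence "(\<Sum>i<N. res (A i) (iota i x J b)) ~= 0" by (simp add: y_def)
    then obtain i where "i \<in> {..<N}" "res (A i) (iota i x J b) ~= 0"
     by (rule sum.not_neutral_contains_not_neutral)
    hence "iota i x J b ~= 0" using res_0 by metis
    hence "iota i x J ~= 0" by (metis zero_fun_apply)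
    hence "i ~: J" "x (insert i J) ~= 0" by (auto simp: iota_def split: if_splits)
    hence J: "insert i J \<subseteq> {..<N}" "card (insert i J) = Suc s" using x(1) unfolding C_def by blast+
    hence "finite J" using finite_subset[of "insert i J" "{..<N}"] by simp
    thus "J \<subseteq> {..<N}" "card J = s" using \<open>i ~: J\<close> J by simp_all
   qed
   ultimately show ?thesis by blast
  qed
  show "x = 0" if x: "x \<in> C q0 0" "\<delta> x = 0" for x
  proof
   fix J
   have "\<delta> x {0} = (\<Sum>i<N. if i = 0 then sg 0 {} (x {}) else 0)" unfolding \<delta>_def by (intro sum.cong) (auto simp: eps_def)
   hence "\<delta> x {0} = x {}" using N by (simp add: sg_def)
   hence "x {} = 0" using x(2) by simp
   moreover have "J = {}" if "x J ~= 0"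
   proof -
    have J: "J \<subseteq> {..<N}" "card J = 0" using x(1) that unfolding C_def by blast+
    thus ?thesis using finite_subset[OF J(1)] by simp
   qed
   ultimately have "x J = 0" by metis
   thus "x J = 0 J" by (simp add: zero_fun_def)
  qed
  show "x = 0" if "x \<in> C q (Suc N)" for q x
  proof
   fix J show "x J = 0 J"
   proof (rule ccontr)
    assume "x J ~= 0 J"
    hence "x J ~= 0" by (simp add: zero_fun_def)
    hence "J \<subseteq> {..<N}" "card J = Suc N" using that unfolding C_def by blast+
    thus False using card_mono[of "{..<N}" J] by simp
   qed
  qed
  show "(%J. if J = {} then h else 0) \<in> C q0 0" using h by (auto simp: C_def X_0 lau_0)
  let ?e = "%J. if EX i<N. J = {i} then SOME y. y \<in> Xq (Suc q0) & (ALL b. lau (vn ` J) (y b)) & DD y = h else 0"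
  have e: "?e {i} \<in> Xq (Suc q0) & (ALL b. lau (vn ` {i}) (?e {i} b)) & DD (?e {i}) = h" if "i < N" for i
   using someI_ex[of "%y. y \<in> Xq (Suc q0) & (ALL b. lau (vn ` {i}) (y b)) & DD y = h"] h(3)[OF that] that by auto
  show "?e \<in> C (Suc q0) 1"
   unfolding C_def
  proof (intro CollectI allI conjI impI)
   fix J
   show "?e J \<in> Xq (Suc q0)" by (cases "EX i<N. J = {i}") (use e X_0 in auto)
   show "lau (vn ` J) (?e J b)" for b by (cases "EX i<N. J = {i}") (use e lau_0 in auto)
  qed (auto split: if_splits)
  show "D ?e = \<delta> (%J. if J = {} then h else 0)"
  proof
   fix J
   have "\<delta> (%J. if J = {} then h else 0) J = (\<Sum>i<N. if J = {i} then h else 0)"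
    unfolding \<delta>_def by (intro sum.cong) (auto simp: eps_def sg_def)
   also have "\<dots> = (if EX i<N. J = {i} then h else 0)"
   proof (cases "EX i<N. J = {i}")
    case True
    then obtain j where j: "j < N" "J = {j}" by blast
    have "(\<Sum>i<N. if J = {i} then h else 0) = (\<Sum>i<N. if i = j then h else 0)"
     unfolding j(2) by (intro sum.cong) auto
    thus ?thesis using j True by simp
   next
    case False
    thus ?thesis by (intro trans[OF sum.neutral]) auto
   qed
   also have "\<dots> = DD (?e J)" by (cases "EX i<N. J = {i}") (use e DD_0 in auto)
   finally show "D ?e J = \<delta> (%J. if J = {} then h else 0) J" by (simp add: D_def)
  qed
 qed
 then obtain c where c: "c \<in> C (Suc q0) 0" "D c = (%J. if J = {} then h else 0)" by blast
 have "DD (c {}) = h" using fun_cong[OF c(2), of "{}"] by (simp add: D_def)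
 moreover have "c {} \<in> Xq (Suc q0) & (ALL b. lau (vn ` {}) (c {} b))" using c(1) unfolding C_def by blast
 ultimately show ?thesis by auto
qed

section \<open>Koszul complexes and complete intersections\<close>

definition kos :: "nat set => nat => (nat set => 'a::comm_ring_1) set" where
 "kos A q = {z. ALL J. z J ~= 0 --> J \<subseteq> A & card J = q}"

definition koszul_exact :: "nat set => (nat => 'a::comm_ring_1) => bool" where
 "koszul_exact A a <-> (\<forall>q\<ge>1. ALL z:kos A q. kd A a z = (%J. 0) --> (EX y:kos A (Suc q). kd A a y = z))"

lemma kos_D: "z \<in> kos A q ==> z J ~= 0 ==> J \<subseteq> A & card J = q" by (simp add: kos_def)

lemma kos_iff: "z \<in> kos A q <-> (ALL J. J \<subseteq> A & card J = q \<or> z J = 0)" by (auto simp: kos_def)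

lemma iota_nonzero: "iota i z J ~= 0 ==> i ~: J & z (insert i J) ~= 0"
 by (auto simp: iota_def split: if_splits)

lemma eps_nonzero: "eps i z J ~= 0 ==> i \<in> J & z (J - {i}) ~= 0"
 by (auto simp: eps_def split: if_splits)

lemma iota_kos: assumes "finite A" "z \<in> kos A (Suc q)" shows "iota i z \<in> kos A q"
 unfolding kos_def
proof (intro CollectI allI impI)
 fix J assume "iota i z J ~= 0"
 hence i0: "i ~: J" "z (insert i J) ~= 0" using iota_nonzero by blast+
 have i: "i ~: J" "insert i J \<subseteq> A" "card (insert i J) = Suc q" using i0(1) kos_D[OF assms(2) i0(2)] by simp_all
 thus "J \<subseteq> A & card J = q" using finite_subset[OF i(2) assms(1)] by auto
qed

lemma kd_kos: assumes "finite A" "z \<in> kos A (Suc q)" shows "kd A a z \<in> kos A q"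
 unfolding kos_def
proof (intro CollectI allI impI)
 fix J assume "kd A a z J ~= 0"
 then obtain i where "a i * iota i z J ~= 0" unfolding kd_def by (rule sum.not_neutral_contains_not_neutral)
 hence "iota i z J ~= 0" by auto
 thus "J \<subseteq> A & card J = q" using kos_D[OF iota_kos[OF assms]] by blast
qed

lemma eps_kos: assumes "finite A" "z \<in> kos A q" "i \<in> A" shows "eps i z \<in> kos A (Suc q)"
 unfolding kos_def
proof (intro CollectI allI impI)
 fix J assume "eps i z J ~= 0"
 hence i0: "i \<in> J" "z (J - {i}) ~= 0" using eps_nonzero by blast+
 have i: "i \<in> J" "J - {i} \<subseteq> A" "card (J - {i}) = q" using i0(1) kos_D[OF assms(2) i0(2)] by simp_all
 hence "J \<subseteq> A" using assms(3) by blast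
 thus "J \<subseteq> A & card J = Suc q" using card_Suc_Diff1[of J i] i finite_subset[OF _ assms(1)] by auto
qed

lemma wd_kos: assumes "finite A" "z \<in> kos A q" "B \<subseteq> A" shows "wd B T z \<in> kos A (Suc q)"
 unfolding kos_def
proof (intro CollectI allI impI)
 fix J assume "wd B T z J ~= 0"
 then obtain i where "i \<in> B" "T i * eps i z J ~= 0" unfolding wd_def by (rule sum.not_neutral_contains_not_neutral)
 hence "i \<in> B" "eps i z J ~= 0" by auto
 thus "J \<subseteq> A & card J = Suc q" using kos_D[OF eps_kos[OF assms(1,2)]] assms(3) by blast
qed

lemma kos_mult: "z \<in> kos A q ==> (%J. c * z J) \<in> kos A q" unfolding kos_iff by (metis mult_zero_right)

lemma kos_add: "z \<in> kos A q ==> y \<in> kos A q ==> (%J. z J + y J) \<in> kos A q"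
 unfolding kos_iff by (metis add.right_neutral)
lemma kos_diff: "z \<in> kos A q ==> y \<in> kos A q ==> (%J. z J - y J) \<in> kos A q"
 unfolding kos_iff by (metis diff_zero)
lemma kos_0: "(%J. 0) \<in> kos A q" by (auto simp: kos_def)
lemma kos_sum: "(!!i. i \<in> I ==> z i \<in> kos A q) ==> (%J. \<Sum>i\<in>I. z i J) \<in> kos A q"
 by (induction I rule: infinite_finite_induct) (simp_all add: kos_0 kos_add)

lemma kd_ring_map: "ring_map h ==> kd A (%i. h (a i)) (%J. h (z J)) J = h (kd A a z J)"
 by (auto simp: kd_def iota_def sg_def ring_map_simps intro!: sum.cong)

lemma wd_ring_map: "ring_map h ==> wd A (%i. h (a i)) (%J. h (z J)) J = h (wd A a z J)"
 by (auto simp: wd_def eps_def sg_def ring_map_simps intro!: sum.cong)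

lemma kd_lau: "(ALL J. lau V (z J)) ==> lau V (kd A (%i. emb (a i)) z J)"
 unfolding kd_def by (intro lau_sum lau_mult lau_emb) (auto simp: iota_def lau_0 lau_sg)

lemma wd_lau: "(ALL J. lau V (z J)) ==> lau V (wd A (%i. emb (a i)) z J)"
 unfolding wd_def by (intro lau_sum lau_mult lau_emb) (auto simp: eps_def lau_0 lau_sg)

text \<open>Once a variable is inverted, a power of it, being a combination of the a, contracts the
  complex. The top obstruction sits in degree q + N for N variables, where nothing is left because A
  has at most N elements and q is positive.\<close>

lemma koszul_exact_rad:
 fixes a :: "nat => ('v::finite, 'k::field) mpoly"
 assumes A: "finite A" "card A \<le> CARD('v)" and rad: "rad_all (gen (a ` A))"
 shows "koszul_exact A a"
 unfolding koszul_exact_def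
proof (intro allI ballI impI)
 fix q0 :: nat and h :: "nat set => ('v, 'k) mpoly"
 assume q0: "1 \<le> q0" and h: "h \<in> kos A q0" and kh: "kd A a h = (%J. 0)"
 let ?N = "CARD('v)"
 obtain vn :: "nat => 'v" where vn: "bij_betw vn {..<?N} UNIV"
  using ex_bij_betw_nat_finite[of "UNIV :: 'v set"] by (auto simp: atLeast0LessThan)
 define DD where "DD = kd A (%i. emb (a i))"
 have loc: "EX y:kos A (Suc q). (ALL b. lau (vn ` J) (y b)) & DD y = z"
  if J: "J ~= {}" and z: "z \<in> kos A q" "ALL b. lau (vn ` J) (z b)" "DD z = 0" for q z J
 proof -
  obtain i where i: "i \<in> J" using J by blast
  let ?v = "vn i"
  obtain M where "var ?v ^ M \<in> gen (a ` A)" using rad by (auto simp: rad_all_def)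
  then obtain r where r: "var ?v ^ M = (\<Sum>l\<in>A. r l * a l)" unfolding gen_image[OF A(1)] by auto
  define m where "m = (mono (sng ?v (- int M)) :: ('v, 'k) laurent)"
  define y where "y = (%J. m * (\<Sum>l\<in>A. emb (r l) * eps l z J))"
  have "y \<in> kos A (Suc q)" unfolding y_def by (intro kos_mult kos_sum eps_kos A z)
  moreover have "lau (vn ` J) (y b)" for b
   unfolding y_def m_def using z(2) i
   by (intro lau_mult lau_sum lau_emb lau_mono) (auto simp: eps_def lau_0 lau_sg lookup_single when_def split: if_splits)
  moreover have "DD y = z"
  proof
   fix K
   have "DD y K = m * (\<Sum>l\<in>A. emb (r l) * kd A (%i. emb (a i)) (eps l z) K)"
    by (simp add: DD_def y_def kd_mult kd_sum)
   also have "\<dots> = m * (\<Sum>l\<in>A. emb (r l) * (emb (a l) * z K))"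
   proof -
    have z0: "eps l (kd A (%i. emb (a i)) z) K = 0" for l
     using z(3) by (simp add: DD_def eps_def)
    show ?thesis
     using eps_kd[OF A(1), of _ "%i. emb (a i)" z K]
     by (intro arg_cong[where f = "(*) m"] sum.cong refl arg_cong[where f = "(*) _"]) (simp add: z0)
   qed
   also have "\<dots> = m * emb (\<Sum>l\<in>A. r l * a l) * z K" by (simp add: emb_simps sum_distrib_right mult.assoc)
   also have "m * emb (\<Sum>l\<in>A. r l * a l) = 1"
    unfolding r[symmetric] emb_var_power m_def mono_mult by (simp add: single_add[symmetric] mono_0)
   finally show "DD y K = z K" by simp
  qed
  ultimately show ?thesis by blast
 qed
 have "EX y:kos A (Suc q0). (ALL b. lau {} (y b)) & DD y = (%J. emb (h J))"
 proof (rule cech_descent[where vn = vn and N = ?N and Xq = "kos A"])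
  show "inj_on vn {..<?N}" using vn by (simp add: bij_betw_def)
  show "DD (z + y) = DD z + DD y" for z y
   using kd_add[of A _ z y] by (simp add: DD_def fun_eq_iff plus_fun_def)
  show "DD (DD z) = 0" for z by (simp add: DD_def fun_eq_iff kd_kd[OF A(1)])
  show "DD z \<in> kos A q" if "z \<in> kos A (Suc q)" for q z unfolding DD_def by (rule kd_kos[OF A(1) that])
  show "ALL b. lau V (DD z b)" if "ALL b. lau V (z b)" for V z using that by (simp add: DD_def kd_lau)
  show "z + y \<in> kos A q" if "z \<in> kos A q" "y \<in> kos A q" for q and z y :: "nat set => ('v, 'k) laurent"
   using kos_add[OF that] by (simp add: plus_fun_def)
  show "- z \<in> kos A q" if "z \<in> kos A q" for q and z :: "nat set => ('v, 'k) laurent"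
   using that by (simp add: kos_def)
  show "(%b. res B (z b)) \<in> kos A q" if "z \<in> kos A q" for q B and z :: "nat set => ('v, 'k) laurent"
  proof -
   have "res B (z J) = 0" if "z J = 0" for J using that res_0 by simp
   thus ?thesis using \<open>z \<in> kos A q\<close> unfolding kos_iff by blast
  qed
  show "0 \<in> kos A q" for q using kos_0 by (simp add: zero_fun_def)
  show "EX i<?N. 0 \<le> lk \<tau> (vn i)" if z: "z \<in> kos A (q0 + ?N)" "\<tau> \<in> keys (z b)" for z b \<tau>
  proof -
   have "z b ~= 0" using z(2) by auto
   hence "b \<subseteq> A" "card b = q0 + ?N" using kos_D[OF z(1)] by auto
   hence "q0 + ?N \<le> ?N" using card_mono[OF A(1), of b] A(2) by simp
   thus ?thesis using q0 by simp
  qed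
  show k: "(%J. emb (h J)) \<in> kos A q0" using h unfolding kos_iff by (auto simp: emb_simps)
  show l: "ALL b. lau {} (emb (h b))" by (simp add: lau_emb)
  have 0: "DD (%J. emb (h J)) = 0"
   using kd_ring_map[OF ring_map_emb, of A a h] kh by (simp add: DD_def fun_eq_iff emb_simps)
  show "EX y:kos A (Suc q0). (ALL b. lau {vn i} (y b)) & DD y = (%J. emb (h J))" for i
   using loc[of "{i}", OF _ k _ 0] by (simp add: lau_emb)
 qed (use loc in auto)
 then obtain y where y: "y \<in> kos A (Suc q0)" "ALL b. lau {} (y b)" "DD y = (%J. emb (h J))" by (elim bexE conjE)
 have "EX G. y b = emb G" for b using y(2) lau_empty[of "y b"] by blast
 then obtain G where G: "!!b. y b = emb (G b)" by metis
 have "G \<in> kos A (Suc q0)"   proof -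
  have "G J = 0" if "y J = 0" for J using that G[of J] emb_inj[of "G J" 0] by (simp add: emb_simps)
  thus ?thesis using y(1) unfolding kos_iff by blast
 qed
 moreover have "kd A a G = h"
 proof
  fix J
  have "emb (kd A a G J) = emb (h J)"
  proof -
   have "y = (%J. emb (G J))" using G by (rule ext)
   thus ?thesis using fun_cong[OF y(3), of J] kd_ring_map[OF ring_map_emb, of A a G J] by (simp only: DD_def)
  qed
  thus "kd A a G J = h J" by (rule emb_inj)
 qed
 ultimately show "EX y:kos A (Suc q0). kd A a y = h" by blast
qed

lemma hcomp_ext: "(!!e. hcomp w e F = hcomp w e G) ==> F = G"
proof -
 assume "!!e. hcomp w e F = hcomp w e G"
 hence "homog_map w F = homog_map w G" by (intro poly_eqI) (simp add: hcomp_def)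
 thus "F = G" using sum_hcomp[of F w] sum_hcomp[of G w] by (simp add: hcomp_def)
qed

text \<open>Graded Nakayama. Split a solution in the larger complex as y0 + e_c w. Then w is a
  cycle, z is homologous to a c * w, and the degree of w is smaller than that of z by the positive
  degree of a c.\<close>

lemma koszul_exact_drop:
 fixes a :: "nat => ('v, 'k::comm_ring_1) mpoly"
 assumes A: "finite A" "c ~: A" and ex: "koszul_exact (insert c A) a"
  and a: "!!i. i \<in> insert c A ==> homog w1 (d i) (a i)" and dc: "d c \<ge> 1"
 shows "koszul_exact A a"
 unfolding koszul_exact_def
proof (intro allI ballI impI)
 let ?A' = "insert c A"
 fix q :: nat and z :: "nat set => ('v, 'k) mpoly"
 assume q: "1 \<le> q" and z: "z \<in> kos A q" and kz: "kd A a z = (%J. 0)"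
 \<comment> \<open>\<open>tz D z\<close> bounds the total degree of z by D, where e_i counts with
   degree d i.\<close>
 define tz where "tz D z <-> (ALL J e. D < e + sum d J --> hcomp w1 e (z J :: ('v, 'k) mpoly) = 0)" for D z
 have claim: "EX y:kos A (Suc q). kd A a y = z" if "z \<in> kos A q" "kd A a z = (%J. 0)" "tz D z" for z D
  using that
 proof (induction D arbitrary: z rule: less_induct)
  case (less D)
  have zc: "z J = 0" if "c \<in> J" for J using kos_D[OF less.prems(1), of J] that A by auto
  have z': "z \<in> kos ?A' q" using less.prems(1) by (fastforce simp: kos_def)
  have "kd ?A' a z J = 0" for J
   using A fun_cong[OF less.prems(2), of J] by (simp add: kd_def) (simp add: iota_def zc)
  then obtain y where y: "y \<in> kos ?A' (Suc q)" "kd ?A' a y = z"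
   using ex q z' unfolding koszul_exact_def by blast
  \<comment> \<open>Truncation of y to total degree at most D; as the differential preserves the
    total degree, it still maps to z.\<close>
  define y' where "y' J = (\<Sum>e<D + 1 - sum d J. hcomp w1 e (y J))" for J
  have hy': "hcomp w1 e (y' J) = (if e + sum d J \<le> D then hcomp w1 e (y J) else 0)" for e J
  proof -
   have "hcomp w1 e (y' J) = (\<Sum>e'<D + 1 - sum d J. if e' = e then hcomp w1 e (y J) else 0)"
    by (simp add: y'_def hcomp_sum hcomp_hcomp eq_commute[of e] cong: if_cong)
   thus ?thesis by (auto simp: less_diff_conv)
  qed
  have y'k: "y' \<in> kos ?A' (Suc q)"     proof -
   have "y' J = 0" if "y J = 0" for J using that by (simp add: y'_def hcomp_0)
   thus ?thesis using y(1) unfolding kos_iff by blast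
  qed
  have hi: "hcomp w1 e (iota i y' J) = (if e + d i + sum d J \<le> D then hcomp w1 e (iota i y J) else 0)" for e i J
  proof (cases "i \<in> J \<or> infinite J")
   case True
   have "y (insert i J) = 0" if "infinite J" using kos_D[OF y(1), of "insert i J"] that by auto
   moreover have "y' (insert i J) = 0" if "infinite J" using kos_D[OF y'k, of "insert i J"] that by auto
   ultimately show ?thesis using True by (auto simp: iota_def hcomp_0)
  next
   case False
   hence "sum d (insert i J) = d i + sum d J" by simp
   thus ?thesis using False by (auto simp: iota_def sg_def hcomp_minus hy')
  qed
  have ky': "kd ?A' a y' = z"
  proof (rule ext, rule hcomp_ext[where w = w1])
   fix J e
   have h: "hcomp w1 e (kd ?A' a u J) = (\<Sum>i\<in>?A'. if d i \<le> e then a i * hcomp w1 (e - d i) (iota i u J) else 0)" for u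
    unfolding kd_def hcomp_sum by (intro sum.cong refl) (simp add: hcomp_mult_homog[OF a])
   show "hcomp w1 e (kd ?A' a y' J) = hcomp w1 e (z J)"
   proof (cases "e + sum d J \<le> D")
    case True
    have "hcomp w1 e (kd ?A' a y' J) = hcomp w1 e (kd ?A' a y J)"
     unfolding h using True by (intro sum.cong refl) (auto simp: hi)
    thus ?thesis using y(2) by simp
   next
    case False
    hence "hcomp w1 e (kd ?A' a y' J) = 0"
     unfolding h by (intro sum.neutral) (auto simp: hi)
    thus ?thesis using False less.prems(3) by (simp add: tz_def)
   qed
  qed
  define w where "w = iota c y'"
  define y0 where "y0 J = (if c \<in> J then 0 else y' J)" for J
  have wk: "w \<in> kos A q"
   unfolding kos_def
  proof (intro CollectI allI impI)
   fix J assume "w J ~= 0"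
   hence "c ~: J" using iota_nonzero w_def by blast
   thus "J \<subseteq> A & card J = q" using kos_D[OF iota_kos[OF _ y'k, of c], of J] A \<open>w J ~= 0\<close> by (auto simp: w_def)
  qed
  have y0k: "y0 \<in> kos A (Suc q)" using y'k by (auto simp: kos_def y0_def split: if_splits)
  have kw: "kd A a w J = 0" for J
  proof -
   have "kd ?A' a w J = - iota c (kd ?A' a y') J" by (simp add: w_def iota_kd)
   also have "\<dots> = 0" by (simp add: ky' iota_def zc)
   finally show ?thesis using A by (simp add: kd_def) (simp add: w_def iota_same)
  qed
  have dec: "z J = kd A a y0 J + a c * w J" for J
  proof (cases "c \<in> J")
   case True
   have "kd A a y0 J = 0" unfolding kd_def using True by (intro sum.neutral) (auto simp: iota_def y0_def)
   thus ?thesis using True by (simp add: zc w_def iota_def)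
  next
   case False
   have "kd A a y0 J = kd A a y' J" unfolding kd_def using False A by (intro sum.cong) (auto simp: iota_def y0_def)
   thus ?thesis using fun_cong[OF ky', of J] A by (simp add: kd_def w_def add.commute)
  qed
  have wtz: "hcomp w1 e (w J) = 0" if "D < e + d c + sum d J" for e J
   using hi[of e c J] that by (simp add: w_def)
  show ?case
  proof (cases "d c \<le> D")
   case True
   have "tz (D - d c) w" using wtz True by (simp add: tz_def)
   then obtain u where u: "u \<in> kos A (Suc q)" "kd A a u = w"
   proof -
    have "D - d c < D" using dc True by linarith
    moreover have "kd A a w = (%J. 0)" using kw by (rule ext)
    ultimately have "EX u:kos A (Suc q). kd A a u = w" using \<open>tz (D - d c) w\<close> wk by (intro less.IH)
    thus ?thesis using that by blast
   qed
   have "kd A a (%J. y0 J + a c * u J) J = z J" for J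
    unfolding kd_add kd_mult u(2) by (rule dec[symmetric])
   hence "kd A a (%J. y0 J + a c * u J) = z" by (rule ext)
   thus ?thesis using kos_add[OF y0k kos_mult[OF u(1)]] by blast
  next
   case False
   hence "w J = 0" for J by (rule_tac hcomp_ext[where w = w1], subst wtz) (simp_all add: hcomp_0)
   hence "kd A a y0 = z" using dec by (intro ext) simp
   thus ?thesis using y0k by blast
  qed
 qed
 define D where "D = (\<Sum>J\<in>Pow A. degree (homog_map w1 (z J)) + sum d J)"
 have "tz D z"
  unfolding tz_def
 proof (intro allI impI)
  fix J e assume D: "D < e + sum d J"
  show "hcomp w1 e (z J) = 0"
  proof (cases "z J = 0")
   case False
   hence "J \<in> Pow A" using kos_D[OF z] by blast
   hence "degree (homog_map w1 (z J)) + sum d J \<le> D"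
    unfolding D_def using A by (intro member_le_sum[of _ _ "%J. degree (homog_map w1 (z J)) + sum d J"]) auto
   thus ?thesis using D by (simp add: hcomp_def coeff_eq_0)
  qed (simp add: hcomp_0)
 qed
 thus "EX y:kos A (Suc q). kd A a y = z" using claim z kz by blast
qed

text \<open>A relation for a c is a cycle of degree one in the larger complex. It is a boundary, and
  the coefficient of a boundary at c involves only the other a.\<close>

lemma koszul_exact_nzd:
 assumes A: "finite A" "c ~: A" and ex: "koszul_exact (insert c A) a" and h: "a c * h \<in> gen (a ` A)"
 shows "h \<in> gen (a ` A)"
proof -
 let ?A' = "insert c A"
 obtain r where r: "a c * h = (\<Sum>i\<in>A. r i * a i)" using h unfolding gen_image[OF A(1)] by auto
 define z where "z J = (if J = {c} then h else if EX i:A. J = {i} then - r (the_elem J) else 0)" for J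
 have z: "z \<in> kos ?A' 1" by (auto simp: kos_def z_def)
 have zi: "z {c} = h" "i \<in> A ==> z {i} = - r i" for i using A by (auto simp: z_def)
 have "kd ?A' a z J = 0" for J
 proof (cases "J = {}")
  case True
  have "kd ?A' a z J = a c * h + (\<Sum>i\<in>A. a i * (- r i))"
   using A True by (simp add: kd_def iota_def sg_def zi)
  thus ?thesis using r by (simp add: sum_negf mult.commute)
 next
  case False
  have "iota i z J = 0" for i
  proof (rule ccontr)
   assume "iota i z J ~= 0"
   hence i: "i ~: J" "z (insert i J) ~= 0" using iota_nonzero by blast+
   hence "card (insert i J) = 1" using kos_D[OF z] by blast
   then obtain x where "insert i J = {x}" by (rule card_1_singletonE)
   hence "J \<subseteq> {}" using i(1) by blast
   thus False using False by simp
  qed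
  thus ?thesis by (simp add: kd_def)
 qed
 then obtain y where y: "kd ?A' a y = z" using ex z   proof -
  have "kd ?A' a z = (%J. 0)" using \<open>!!J. kd ?A' a z J = 0\<close> by (rule ext)
  thus ?thesis using ex z that unfolding koszul_exact_def by blast
 qed
 have "h = kd ?A' a y {c}" using y zi by simp
 also have "\<dots> = (\<Sum>i\<in>A. a i * iota i y {c})" using A by (simp add: kd_def) (simp add: iota_def)
 also have "\<dots> = (\<Sum>i\<in>A. iota i y {c} * a i)" by (simp only: mult.commute)
 finally show ?thesis unfolding gen_image[OF A(1)] by (auto intro!: exI[of _ "%i. iota i y {c}"])
qed

lemma koszul_exact_initial:
 fixes a :: "nat => ('v, 'k::comm_ring_1) mpoly"
 assumes A: "finite A" "!!i. i \<in> A ==> i < b"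
  and "koszul_exact (A Un {b..<n}) a" "!!i. i \<in> A Un {b..<n} ==> homog w1 (d i) (a i) & d i \<ge> 1" "b \<le> m" "m \<le> n"
 shows "koszul_exact (A Un {b..<m}) a"
 using assms(6,3,4,5)
proof (induction rule: inc_induct)
 case (step k)
 have "A Un {b..<Suc k} = insert k (A Un {b..<k})" using step by auto
 hence "koszul_exact (insert k (A Un {b..<k})) a" using step by simp
 thus ?case by (rule koszul_exact_drop[rotated 2, where d = d]) (use step A in \<open>auto dest: A(2)\<close>)
qed

section \<open>Complete intersections: exactness and unmixedness\<close>

lemma rad_all_mono: "rad_all J ==> J \<subseteq> J' ==> rad_all J'"
 unfolding rad_all_def by (meson subsetD)

lemma complete_intersection_aux:
 fixes a :: "nat => ('v::finite, 'k::field) mpoly"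
 assumes inf: "infinite (UNIV :: 'k set)" and A: "finite A" and c: "c = card A" "c \<le> CARD('v)"
  and a: "!!i. i \<in> A ==> homog w1 (d i) (a i) & d i \<ge> 1"
  and dim: "!!Q. pr Q ==> hideal w1 Q ==> a ` A \<subseteq> Q ==> \<not> ind Q (Suc (CARD('v) - c))"
 shows "hideal w1 (gen (a ` A))"
  "EX y. (ALL i. homog w1 1 (y i)) & rad_all (gen (gen (a ` A) Un y ` {..<CARD('v) - c}))"
proof -
 show h: "hideal w1 (gen (a ` A))" by (rule hideal_gen) (use a in auto)
 show "EX y. (ALL i. homog w1 1 (y i)) & rad_all (gen (gen (a ` A) Un y ` {..<CARD('v) - c}))"
 proof (rule noether_normalization[OF inf h])
  fix Q assume "pr Q" "hideal w1 Q" "gen (a ` A) \<subseteq> Q"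
  moreover hence "a ` A \<subseteq> Q" using gen_incl[of "a ` A"] by blast
  ultimately show "\<not> ind Q (Suc (CARD('v) - c))" by (intro dim)
 qed
qed

text \<open>Noether normalization completes the a by linear forms to a sequence whose ideal contains
  powers of all variables. The Koszul complex of the long sequence is exact, and the linear forms
  are dropped again.\<close>

lemma complete_intersection_koszul:
 fixes a :: "nat => ('v::finite, 'k::field) mpoly"
 assumes inf: "infinite (UNIV :: 'k set)" and A: "finite A" and c: "c = card A" "c \<le> CARD('v)"
  and a: "!!i. i \<in> A ==> homog w1 (d i) (a i) & d i \<ge> 1"
  and dim: "!!Q. pr Q ==> hideal w1 Q ==> a ` A \<subseteq> Q ==> \<not> ind Q (Suc (CARD('v) - c))"
 shows "koszul_exact A a"
proof -
 let ?N = "CARD('v)"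
 obtain y where y: "ALL i. homog w1 1 (y i)" "rad_all (gen (gen (a ` A) Un y ` {..<?N - c}))"
  using complete_intersection_aux(2)[where a = a and d = d, OF inf A c a dim] by blast
 obtain b where b: "!!i. i \<in> A ==> i < b" using finite_nat_bounded[OF A] by auto
 let ?B = "A Un {b..<b + (?N - c)}"
 have cB: "card ?B \<le> ?N" using card_Un_le[of A "{b..<b + (?N - c)}"] c by simp
 \<comment> \<open>The linear forms occupy the indices from b on, beyond those of A.\<close>
 define a' where "a' i = (if i \<in> A then a i else y (i - b))" for i
 have "gen (gen (a ` A) Un y ` {..<?N - c}) \<subseteq> gen (a' ` ?B)"
 proof (rule gen_subI)
  have "a i \<in> a' ` ?B" if "i \<in> A" for i using that by (auto simp: a'_def intro!: image_eqI[of _ _ i])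
  hence "gen (a ` A) \<subseteq> gen (a' ` ?B)" by (intro gen_mono) auto
  moreover have "y i \<in> a' ` ?B" if "i < ?N - c" for i
   using that b[of "b + i"] by (auto simp: a'_def intro!: image_eqI[of _ _ "b + i"])
  ultimately show "gen (a ` A) Un y ` {..<?N - c} \<subseteq> gen (a' ` ?B)" by (auto intro: genI)
 qed
 hence "rad_all (gen (a' ` ?B))" by (rule rad_all_mono[OF y(2)])
 hence "koszul_exact ?B a'" using A cB by (intro koszul_exact_rad) auto
 moreover have "homog w1 (if i \<in> A then d i else 1) (a' i) & (if i \<in> A then d i else 1) \<ge> 1" for i
  using a[of i] y(1) by (auto simp: a'_def)
 ultimately have "koszul_exact (A Un {b..<b}) a'"
  using koszul_exact_initial[of A b "b + (?N - c)" a' "%i. if i \<in> A then d i else 1" b] A b by simp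
 moreover have "kd A a' = kd A a" by (intro ext) (simp add: kd_def a'_def)
 ultimately show ?thesis by (simp add: koszul_exact_def)
qed

text \<open>The annihilator of a component of h modulo the a has too small a dimension, so it
  contains a polynomial g in the parameters y. The a and g are again part of a system of parameters,
  so g is a nonzerodivisor modulo the a, and the component lies in their ideal.\<close>

lemma complete_intersection_unmixed:
 fixes a :: "nat => ('v::finite, 'k::field) mpoly"
 assumes inf: "infinite (UNIV :: 'k set)" and A: "finite A" and c: "c = card A" "c \<le> CARD('v)"
  and a: "!!i. i \<in> A ==> homog w1 (d i) (a i) & d i \<ge> 1"
  and dim: "!!Q. pr Q ==> hideal w1 Q ==> a ` A \<subseteq> Q ==> \<not> ind Q (Suc (CARD('v) - c))"
  and E: "!!g. g \<in> E ==> EX e. homog w1 e g" "!!g. g \<in> E ==> EX M. g ^ M * h \<in> gen (a ` A)"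
  and dimE: "!!Q. pr Q ==> hideal w1 Q ==> a ` A Un E \<subseteq> Q ==> \<not> ind Q (CARD('v) - c)"
 shows "h \<in> gen (a ` A)"
proof -
 let ?N = "CARD('v)" and ?b = "gen (a ` A)"
 have hb: "hideal w1 ?b" by (rule complete_intersection_aux(1)[where a = a and d = d, OF inf A c a dim])
 have b: "idl ?b" by (rule idl_gen)
 obtain y where y: "ALL i. homog w1 1 (y i)" "rad_all (gen (?b Un y ` {..<?N - c}))"
  using complete_intersection_aux(2)[where a = a and d = d, OF inf A c a dim] by blast
 have "hcomp w1 e h \<in> ?b" for e
 proof -
  let ?h = "hcomp w1 e h"
  define B where "B = {F. F * ?h \<in> ?b}"
  have bB: "?b \<subseteq> B" by (auto simp: B_def idl_multr[OF b])
  have iB: "idl B" by (rule idlI) (auto simp: B_def distrib_right mult.assoc idl_D[OF b])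
  have "hcomp w1 k F \<in> B" if "F \<in> B" for k F
  proof -
   have "hcomp w1 (k + e) (F * ?h) \<in> ?b" using that hb by (auto simp: B_def hideal_def)
   thus ?thesis by (simp add: B_def hcomp_mult_homog2[OF homog_hcomp])
  qed
  hence hB: "hideal w1 B" using iB by (simp add: hideal_def)
  have "\<not> ind Q (?N - c)" if Q: "pr Q" "hideal w1 Q" "B \<subseteq> Q" for Q
  proof (rule dimE[OF Q(1,2)])
   have "g \<in> Q" if g: "g \<in> E" for g
   proof -
    obtain d' where d': "homog w1 d' g" using E(1)[OF g] by blast
    obtain M where M: "g ^ M * h \<in> ?b" using E(2)[OF g] by blast
    have "hcomp w1 (M * d' + e) (g ^ M * h) \<in> ?b" using M hb by (auto simp: hideal_def)
    hence "g ^ M \<in> B" by (simp add: B_def hcomp_mult_homog[OF homog_power[OF d']])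
    hence "g ^ M \<in> Q" using Q(3) by blast
    thus ?thesis by (rule pr_power[OF Q(1)])
   qed
   moreover have "a ` A \<subseteq> Q" using subset_trans[OF gen_incl subset_trans[OF bB Q(3)]] .
   ultimately show "a ` A Un E \<subseteq> Q" by (simp add: subset_iff)
  qed
  from relation_or_prime[OF hB this] obtain G where G: "G ~= 0" "vars_in {..<?N - c} G" "sub y G \<in> B" by blast
  show ?thesis
  proof (cases "?N - c")
   \<comment> \<open>No parameters are left: G is a nonzero constant, so 1 lies in B.\<close>
   case 0
   hence "vars_in {} G" using G(2) by (simp add: lessThan_0)
   then obtain u where u: "G = const u" by (rule vars_in_empty)
   hence "u ~= 0" using G(1) by (auto simp: const_simps)
   hence "const (1 / u) * sub y G = 1" by (simp add: u sub_simps const_simps[symmetric]) (simp add: const_def)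
   hence "1 \<in> B" using idl_mult[OF iB G(3)] by metis
   thus ?thesis by (simp add: B_def)
  next
   case (Suc r)
   obtain G \<delta> where G: "G ~= 0" "vars_in {..<Suc r} G" "homog w1 \<delta> G" "sub y G \<in> B"
    using homog_relation[OF hB _ G] y(1) Suc by auto
   have v0: "lk (var 0 :: (nat, 'k) mpoly) (sng 0 1) = 1" by (simp add: var_def)
   hence "(var 0 :: (nat, 'k) mpoly) ~= 0" by (metis lookup_zero one_neq_zero)
   \<comment> \<open>The factor \<open>var 0\<close> gives the new parameter positive degree, which
     is required when the elements behind it are dropped from the Koszul complex.\<close>
   hence G0: "G * var 0 ~= 0" using G(1) by simp
   let ?g = "sub y (G * var 0)"
   have G1: "vars_in {..<Suc r} (G * var 0)" by (intro vars_in_mult G vars_in_var) simp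
   have G2: "homog w1 (\<delta> + 1) (G * var 0)" using homog_mult[OF G(3) homog_var[of w1 0]] by simp
   have gB: "?g \<in> B" using G(4) by (simp add: sub_simps idl_multr[OF iB])
   have hg: "homog w1 (\<delta> + 1) ?g" by (rule homog_sub[OF _ G2]) (use y(1) in simp)
   have "rad_all (gen (gen (?b Un {?g}) Un y ` {..<Suc r}))"
   proof -
    have "gen (?b Un y ` {..<?N - c}) \<subseteq> gen (gen (?b Un {?g}) Un y ` {..<Suc r})"
     using Suc gen_incl[of "?b Un {?g}"] by (intro gen_mono) auto
    thus ?thesis by (rule rad_all_mono[OF y(2)])
   qed
   then obtain y' where y': "ALL i. homog w1 1 (y' i)" "rad_all (gen (gen (?b Un {?g}) Un y' ` {..<r}))"
    using noether_step[OF inf idl_gen y(1)[rule_format] G0 G1 G2] by (meson UnI2 genI insertI1)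
   obtain b where b: "!!i. i \<in> A ==> i < b" using finite_nat_bounded[OF A] by auto
   let ?B = "A Un {b..<b + Suc r}"
   have cB: "card ?B \<le> ?N" using card_Un_le[of A "{b..<b + Suc r}"] c Suc by simp
   have bA: "b ~: A" "b + k ~: A" for k using b[of b] b[of "b + k"] by auto
   define a' where "a' i = (if i \<in> A then a i else if i = b then ?g else y' (i - Suc b))" for i
   have "gen (gen (?b Un {?g}) Un y' ` {..<r}) \<subseteq> gen (a' ` ?B)"
   proof (rule gen_subI)
    have "a i \<in> a' ` ?B" if "i \<in> A" for i using that by (auto simp: a'_def intro!: image_eqI[of _ _ i])
    hence "?b \<subseteq> gen (a' ` ?B)" by (intro gen_mono) auto
    moreover have "?g \<in> a' ` ?B" using bA by (auto simp: a'_def intro!: image_eqI[of _ _ b])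
    ultimately have "gen (?b Un {?g}) \<subseteq> gen (a' ` ?B)" by (intro gen_subI) (auto intro: genI)
    moreover have "y' i \<in> a' ` ?B" if "i < r" for i
     using that bA(2)[of "Suc i"] by (auto simp: a'_def intro!: image_eqI[of _ _ "b + Suc i"])
    ultimately show "gen (?b Un {?g}) Un y' ` {..<r} \<subseteq> gen (a' ` ?B)" by (auto intro: genI)
   qed
   hence "rad_all (gen (a' ` ?B))" by (rule rad_all_mono[OF y'(2)])
   hence "koszul_exact ?B a'" using A cB by (intro koszul_exact_rad) auto
   moreover have "homog w1 (if i \<in> A then d i else if i = b then \<delta> + 1 else 1) (a' i) &
     (if i \<in> A then d i else if i = b then \<delta> + 1 else 1) \<ge> 1" for i
    using a[of i] y'(1) hg by (auto simp: a'_def)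
   ultimately have "koszul_exact (A Un {b..<Suc b}) a'"
    using koszul_exact_initial[of A b "b + Suc r" a' "%i. if i \<in> A then d i else if i = b then \<delta> + 1 else 1" "Suc b"]
     A b by simp
   moreover have ac: "a' b = ?g" "a' ` A = a ` A" using bA by (auto simp: a'_def)
   ultimately show ?thesis
    using koszul_exact_nzd[of A b a' ?h] gB A bA by (simp add: B_def ac)
  qed
 qed
 thus ?thesis using hideal_hcompI[OF hb] by blast
qed

section \<open>The Tate complex of an almost complete intersection\<close>

text \<open>Given a relation \<open>\<Sum> T\<^sub>i a\<^sub>i = 0\<close>, a divided power variable with differential \<open>\<Sum> T\<^sub>i e\<^sub>i\<close> is
  adjoined to the Koszul complex; the first argument is the exponent of that variable.\<close>

definition tate_d :: "nat set => nat set => (nat => 'a::comm_ring_1) => (nat => 'a) => (nat \<times> nat set => 'a) =>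
  nat \<times> nat set => 'a" where
 "tate_d A B a T z = (%(r, J). kd A a (%J. z (r, J)) J + wd B T (%J. z (Suc r, J)) J)"

text \<open>Homological degree q: the divided power variable has degree two, so its exponent r
  counts twice.\<close>

definition tate :: "nat set => nat => (nat \<times> nat set => 'a::comm_ring_1) set" where
 "tate A q = {z. ALL r J. J \<subseteq> A & card J + 2 * r = q \<or> z (r, J) = 0}"

lemma tate_D: "z \<in> tate A q ==> J \<subseteq> A & card J + 2 * r = q \<or> z (r, J) = 0" by (auto simp: tate_def)

lemma tate_kos: "z \<in> tate A q ==> (%J. z (r, J)) \<in> kos A (q - 2 * r)"
 unfolding kos_iff
proof
 fix J assume z: "z \<in> tate A q"
 show "J \<subseteq> A & card J = q - 2 * r \<or> z (r, J) = 0" using tate_D[OF z, of J r] by auto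
qed

lemma tate_kosI:
 assumes "!!r. 2 * r \<le> q ==> (%J. z (r, J)) \<in> kos A (q - 2 * r)" "!!r J. q < 2 * r ==> z (r, J) = 0"
 shows "z \<in> tate A q"
 unfolding tate_def
proof (intro CollectI allI)
 fix r J
 show "J \<subseteq> A & card J + 2 * r = q \<or> z (r, J) = 0"
 proof (cases "2 * r \<le> q")
  case True
  thus ?thesis using assms(1)[OF True] by (auto simp: kos_def)
 qed (use assms(2) in auto)
qed

lemma tate_d_tate:
 assumes A: "finite A" "B \<subseteq> A" and z: "z \<in> tate A (Suc q)" shows "tate_d A B a T z \<in> tate A q"
proof (rule tate_kosI)
 fix r assume r: "2 * r \<le> q"
 have "(%J. z (r, J)) \<in> kos A (Suc (q - 2 * r))" using tate_kos[OF z, of r] r by (simp add: Suc_diff_le)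
 hence 1: "kd A a (%J. z (r, J)) \<in> kos A (q - 2 * r)" by (rule kd_kos[OF A(1)])
 have 2: "wd B T (%J. z (Suc r, J)) \<in> kos A (q - 2 * r)"
 proof (cases "2 * r < q")
  case True
  hence "(%J. z (Suc r, J)) \<in> kos A (q - 2 * r - 1)" using tate_kos[OF z, of "Suc r"] by simp
  moreover have "q - 2 * r = Suc (q - 2 * r - 1)" using True by simp
  ultimately show ?thesis using wd_kos[OF A(1) _ A(2)] by metis
 next
  case False
  hence "z (Suc r, J) = 0" for J using tate_D[OF z, of J "Suc r"] by auto
  thus ?thesis by (simp add: wd_zero kos_0 wd_fun eps_zero)
 qed
 show "(%J. tate_d A B a T z (r, J)) \<in> kos A (q - 2 * r)" using kos_add[OF 1 2] by (simp add: tate_d_def)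
next
 fix r J assume r: "q < 2 * r"
 have "z (r, K) = 0" if "K ~= {}" for K
  using tate_D[OF z, of K r] that r A finite_subset[of K A] by (cases "card K = 0") auto
 hence "iota i (%J. z (r, J)) J = 0" for i by (simp add: iota_def)
 moreover have "z (Suc r, K) = 0" for K using tate_D[OF z, of K "Suc r"] r by auto
 ultimately show "tate_d A B a T z (r, J) = 0" by (simp add: tate_d_def kd_def wd_fun eps_zero)
qed

lemma tate_d_tate_d:
 assumes "finite A" "finite B" "B \<subseteq> A" "(\<Sum>i\<in>B. T i * a i) = 0"
 shows "tate_d A B a T (tate_d A B a T z) b = 0"
proof (cases b)
 case (Pair r J)
 have "A \<inter> B = B" using assms(3) by blast
 hence m: "wd B T (kd A a u) J + kd A a (wd B T u) J = 0" for u
  using wd_kd[OF assms(1,2), of T a u J] assms(4) by simp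
 have "tate_d A B a T (tate_d A B a T z) (r, J) = kd A a (kd A a (%J. z (r, J))) J
   + (wd B T (kd A a (%J. z (Suc r, J))) J + kd A a (wd B T (%J. z (Suc r, J))) J) + wd B T (wd B T (%J. z (Suc (Suc r), J))) J"
  by (simp add: tate_d_def kd_add wd_add)
 thus ?thesis using m by (simp add: Pair kd_kd wd_wd assms)
qed

lemma tate_d_add: "tate_d A B a T (%b. z b + y b) b = tate_d A B a T z b + tate_d A B a T y b"
 by (simp add: tate_d_def kd_add wd_add split: prod.split)
lemma tate_d_mult: "tate_d A B a T (%b. c * z b) b = c * tate_d A B a T z b"
 by (simp add: tate_d_def kd_mult wd_mult distrib_left split: prod.split)

lemma tate_add: "z \<in> tate A q ==> y \<in> tate A q ==> (%b. z b + y b) \<in> tate A q"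
 unfolding tate_def by (simp, metis add.right_neutral)
lemma tate_mult: "z \<in> tate A q ==> (%b. c * z b) \<in> tate A q"
 unfolding tate_def by (simp, metis mult_zero_right)

lemma iota_wd:
 assumes "finite B" "i \<in> B" shows "iota i (wd B T s) J + wd B T (iota i s) J = T i * s J"
proof -
 have "iota i (wd B T s) J + wd B T (iota i s) J = (\<Sum>j\<in>B. T j * (eps j (iota i s) J + iota i (eps j s) J))"
  by (simp add: wd_fun iota_sum iota_mult sum.distrib distrib_left add.commute)
 also have "\<dots> = (\<Sum>j\<in>B. if j = i then T j * s J else 0)" by (intro sum.cong) (auto simp: eps_iota)
 finally show ?thesis using assms by simp
qed

lemma kd_restrict:
 assumes "finite A" "!!J. i \<in> J ==> u J = 0" "i \<in> A" shows "kd A a u J = kd (A - {i}) a u J"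
 using assms by (simp add: kd_def sum.remove[of A i]) (simp add: iota_def)

text \<open>Up to powers of T i the relation eliminates a i, and the complex behaves like the Koszul
  complex of the other a. A cycle is reduced from its top exponent of the divided power variable
  downwards; R is a strict bound for the exponents, and each step costs a factor T i.\<close>

lemma tate_torsion:
 assumes A: "finite A" "B \<subseteq> A" "i \<in> B" and rel: "(\<Sum>i\<in>B. T i * a i) = 0" and ex: "koszul_exact (A - {i}) a"
  and q: "q \<ge> 1"
 shows "z \<in> tate A q ==> (!!b. tate_d A B a T z b = 0) ==> (!!r J. R \<le> r ==> z (r, J) = 0) ==>
  EX M. EX y:tate A (Suc q). ALL b. tate_d A B a T y b = T i ^ M * z b"
proof (induction R arbitrary: z)
 case 0
 hence "z b = 0" for b by (cases b) auto
 thus ?case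
  by (intro exI[of _ 0] bexI[of _ "%_. 0"]) (auto simp: tate_def tate_d_def kd_zero wd_zero)
next
 case (Suc R)
 have fB: "finite B" using A finite_subset by blast
 let ?D = "tate_d A B a T"
 define zR where "zR = (%J. z (R, J))"
 have "EX c s. (%b. if fst b = R then c (snd b) else if fst b = Suc R then s (snd b) else 0) \<in> tate A (Suc q) &
   (ALL J. kd A a c J + wd B T s J = T i * zR J) & (ALL J. kd A a s J = 0)"
 proof (cases "2 * R \<le> q")
  case False
  hence "zR J = 0" for J using tate_D[OF Suc.prems(1), of J R] by (auto simp: zR_def)
  thus ?thesis by (intro exI[of _ "%_. 0"]) (auto simp: tate_def kd_zero wd_zero)
 next
  case le: True
  define p where "p = q - 2 * R"
  have zk: "zR \<in> kos A p" unfolding zR_def p_def by (rule tate_kos) fact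
  have "?D z (R, J) = 0" for J by (rule Suc.prems(2))
  hence dz: "kd A a zR J = 0" for J by (simp add: tate_d_def zR_def Suc.prems(3) wd_zero)
  show ?thesis
  proof (cases p)
   case (Suc p')
   define s where "s = iota i zR"
   have sk: "s \<in> kos A p'" unfolding s_def using iota_kos[OF A(1)] zk Suc by simp
   have ks: "kd A a s J = 0" for J
   proof -
    have "iota i (kd A a zR) J = 0" using dz by (simp add: iota_def)
    thus ?thesis using iota_kd[of i A a zR J] by (simp add: s_def)
   qed
   \<comment> \<open>u is a cycle free of e_i: by the Clifford relation \<open>wd B T s\<close> has
     the same e_i-part as T i * zR. Hence it is a boundary over A without i.\<close>
   define u where "u = (%J. T i * zR J - wd B T s J)"
   have wk: "wd B T s \<in> kos A p" using wd_kos[OF A(1) sk A(2)] Suc by simp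
   have uk: "u \<in> kos A p" unfolding u_def using kos_diff[OF kos_mult[OF zk] wk] .
   have iu: "iota i u J = 0" for J
   proof -
    have "iota i u J = T i * iota i zR J - iota i (wd B T s) J" by (simp add: u_def iota_def sg_def algebra_simps)
    also have "iota i (wd B T s) J = T i * s J - wd B T (iota i s) J" using iota_wd[OF fB A(3), of T s J] by (simp add: eq_diff_eq)
    moreover have "iota i s = (%J. 0)" by (rule ext) (simp add: s_def iota_same)
    ultimately show ?thesis by (simp add: wd_zero s_def)
   qed
   have ui: "u J = 0" if "i \<in> J" for J
   proof -
    have "sg i (J - {i}) (u J) = 0" using iu[of "J - {i}"] that by (simp add: iota_def insert_absorb)
    thus ?thesis by (auto simp: sg_def split: if_splits)
   qed
   have ku: "kd A a u J = 0" for J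
   proof -
    have "wd B T (kd A a s) J + kd A a (wd B T s) J = 0"
     using wd_kd[OF A(1) fB, of T a s J] rel A(2) by (simp add: Int_absorb1)
    moreover have "wd B T (kd A a s) J = 0" proof -
     have "kd A a s = (%J. 0)" using ks by (rule ext)
     thus ?thesis by (simp add: wd_zero)
    qed
    moreover have "kd A a u J = T i * kd A a zR J - kd A a (wd B T s) J"
     using kd_add[of A a "%J. T i * zR J" "%J. (-1) * wd B T s J" J] kd_mult[of A a "-1" "wd B T s" J]
     by (simp add: u_def kd_mult)
    ultimately show ?thesis by (simp add: dz)
   qed
   have iA: "i \<in> A" using A by blast
   have "u \<in> kos (A - {i}) p" using uk ui unfolding kos_iff by blast
   moreover have "kd (A - {i}) a u = (%J. 0)" using kd_restrict[OF A(1) ui iA] ku by (simp add: fun_eq_iff)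
   ultimately obtain c where c: "c \<in> kos (A - {i}) (Suc p)" "kd (A - {i}) a c = u"
    using ex Suc unfolding koszul_exact_def by (metis One_nat_def Suc_le_mono le0)
   have ci: "c J = 0" if "i \<in> J" for J using c(1) that unfolding kos_iff by blast
   have ck: "c \<in> kos A (Suc p)" using c(1) unfolding kos_iff by blast
   have "kd A a c J + wd B T s J = T i * zR J" for J
    using kd_restrict[OF A(1) ci iA, where a = a] fun_cong[OF c(2), of J] by (simp add: u_def)
   moreover have "(%b. if fst b = R then c (snd b) else if fst b = Suc R then s (snd b) else 0) \<in> tate A (Suc q)"
   proof -
    have "J \<subseteq> A & card J + 2 * R = Suc q" if "c J ~= 0" for J
     using kos_D[OF ck that] le by (auto simp: p_def)
    moreover have "J \<subseteq> A & card J + 2 * Suc R = Suc q" if "s J ~= 0" for J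
     using kos_D[OF sk that] le Suc by (auto simp: p_def)
    ultimately show ?thesis unfolding tate_def by simp (metis (no_types, lifting))
   qed
   ultimately show ?thesis using ks by blast
  next
   case 0
   \<comment> \<open>The top coefficient is a scalar here. That the differential of z vanishes at
     exponent R' and index set {i} expresses T i times this scalar by the a.\<close>
   then obtain R' where R': "R = Suc R'" using q le by (cases R) (auto simp: p_def)
   define c where "c = iota i (%J. z (R', J))"
   have ck: "c \<in> kos A 1"
   proof -
    have "q - 2 * R' = Suc 1" using 0 le R' by (simp add: p_def)
    thus ?thesis using iota_kos[OF A(1)] tate_kos[OF Suc.prems(1), of R'] unfolding c_def by metis
   qed
   have "kd A a c J = T i * zR J" for J
   proof (cases "J = {}")
    case True
    have "?D z (R', {i}) = 0" by (rule Suc.prems(2))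
    hence e: "kd A a (%J. z (R', J)) {i} + wd B T zR {i} = 0" by (simp add: tate_d_def zR_def R')
    have "wd B T zR {i} = (\<Sum>j\<in>B. if j = i then T j * zR {} else 0)"
     unfolding wd_def by (intro sum.cong) (auto simp: eps_def sg_def)
    hence "wd B T zR {i} = T i * zR {}" using A fB by simp
    moreover have "kd A a c {} = - kd A a (%J. z (R', J)) {i}"
     using iota_kd[of i A a "%J. z (R', J)" "{}"] by (simp add: c_def iota_def sg_def)
    ultimately show ?thesis using e True by (simp add: add_eq_0_iff2)
   next
    case False
    have "zR J = 0"
    proof (rule ccontr)
     assume "zR J ~= 0"
     from kos_D[OF zk this] 0 have "J \<subseteq> A" "card J = 0" by auto
     thus False using False finite_subset[OF _ A(1)] by auto
    qed
    moreover have "kd A a c J = 0"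
    proof (rule ccontr)
     assume "kd A a c J ~= 0"
     from kos_D[OF kd_kos[OF A(1), of c 0] this] ck have "J \<subseteq> A" "card J = 0" by auto
     thus False using False finite_subset[OF _ A(1)] by auto
    qed
    ultimately show ?thesis by simp
   qed
   moreover have "(%b. if fst b = R then c (snd b) else if fst b = Suc R then 0 else 0) \<in> tate A (Suc q)"
   proof -
    have "J \<subseteq> A & card J + 2 * R = Suc q" if "c J ~= 0" for J
     using kos_D[OF ck that] le 0 by (auto simp: p_def)
    thus ?thesis unfolding tate_def by auto
   qed
   ultimately show ?thesis by (intro exI[of _ c] exI[of _ "%_. 0"]) (simp add: kd_zero wd_zero)
  qed
 qed
 then obtain c s where y1: "(%b. if fst b = R then c (snd b) else if fst b = Suc R then s (snd b) else 0) \<in> tate A (Suc q)"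
  and cs: "!!J. kd A a c J + wd B T s J = T i * zR J" "!!J. kd A a s J = 0" by blast
 define y where "y = (%b :: nat \<times> nat set. if fst b = R then c (snd b) else if fst b = Suc R then s (snd b) else 0)"
 define z2 where "z2 = (%b. T i * z b + (-1) * ?D y b)"
 have yt: "y \<in> tate A (Suc q)" using y1 by (simp add: y_def)
 have "z2 \<in> tate A q" unfolding z2_def by (intro tate_add tate_mult Suc.prems(1) tate_d_tate[OF A(1,2) yt])
 moreover have "?D z2 b = 0" for b
  unfolding z2_def tate_d_add tate_d_mult by (simp add: Suc.prems(2) tate_d_tate_d[OF A(1) fB A(2) rel])
 moreover have "z2 (r, J) = 0" if "R \<le> r" for r J
 proof (cases "r = R")
  case True
  thus ?thesis using cs(1)[of J] by (simp add: z2_def tate_d_def y_def zR_def)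
 next
  case False
  hence r: "Suc R \<le> r" using that by simp
  show ?thesis
  proof (cases "r = Suc R")
   case True
   thus ?thesis using cs(2)[of J] Suc.prems(3)[OF r] by (simp add: z2_def tate_d_def y_def wd_zero)
  next
   case False
   thus ?thesis using Suc.prems(3)[OF r] r by (simp add: z2_def tate_d_def y_def wd_zero kd_zero)
  qed
 qed
 ultimately obtain M u where u: "u \<in> tate A (Suc q)" "!!b. ?D u b = T i ^ M * z2 b"
  using Suc.IH[of z2] by blast
 have "?D (%b. u b + T i ^ M * y b) b = T i ^ Suc M * z b" for b
  unfolding tate_d_add tate_d_mult u(2) by (simp add: z2_def algebra_simps)
 thus ?case using tate_add[OF u(1) tate_mult[OF yt]] by blast
qed

lemma tate_d_ring_map:
 "ring_map h ==> tate_d A B (%i. h (a i)) (%i. h (T i)) (%b. h (z b)) b = h (tate_d A B a T z b)"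
proof -
 assume h: "ring_map h"
 obtain r J where "b = (r, J)" by (cases b)
 thus ?thesis
  using kd_ring_map[OF h, of A a "%J. z (r, J)" J] wd_ring_map[OF h, of B T "%J. z (Suc r, J)" J]
  by (simp add: tate_d_def ring_map_simps[OF h])
qed

section \<open>Laurent degrees and torsion with respect to the T\<close>

definition ldeg :: "('v => nat) => ('v::finite \<Rightarrow>\<^sub>0 int) => int" where
 "ldeg w \<tau> = (\<Sum>v. int (w v) * lk \<tau> v)"

lemma ldeg_add: "ldeg w (\<sigma> + \<tau>) = ldeg w \<sigma> + ldeg w \<tau>"
 by (simp add: ldeg_def lookup_add distrib_left sum.distrib)

lemma ldeg_emb: "homog w d F ==> \<tau> \<in> keys (emb F) ==> ldeg w \<tau> = int d"
proof -
 assume h: "homog w d F" and "\<tau> \<in> keys (emb F)"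
 then obtain t where t: "t \<in> keys F" "\<tau> = lift_exp t" using keys_emb by blast
 have "ldeg w \<tau> = (\<Sum>v. int (w v * lk t v))" by (simp add: ldeg_def t(2) lookup_lift_exp)
 also have "\<dots> = (\<Sum>v\<in>keys t. int (w v * lk t v))" by (rule sum.mono_neutral_right) (auto simp: in_keys_iff)
 also have "\<dots> = int d" using h t(1) unfolding homog_iff by (metis of_nat_sum)
 finally show ?thesis .
qed

lemma res_mult:
 assumes "!!\<tau>. \<tau> \<in> keys G ==> ldeg w \<tau> = e"
 shows "res {\<tau>. ldeg w \<tau> = D} (G * F) = G * res {\<tau>. ldeg w \<tau> = D - e} (F :: ('v::finite, 'k::comm_ring_1) laurent)"
proof (induction F rule: poly_mapping_add_induct)
 case (single \<sigma> c)
 have k: "ldeg w \<tau> = e + ldeg w \<sigma>" if "\<tau> \<in> keys (G * sng \<sigma> c)" for \<tau>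
  using that keys_mult[of G "sng \<sigma> c"] assms by (fastforce simp: ldeg_add split: if_splits)
 have r: "res {\<tau>. ldeg w \<tau> = D - e} (sng \<sigma> c) = (if ldeg w \<sigma> = D - e then sng \<sigma> c else 0)"
  by (rule poly_mapping_eqI) (auto simp: lookup_res lookup_single when_def)
 have "res {\<tau>. ldeg w \<tau> = D} (G * sng \<sigma> c) = (if ldeg w \<sigma> = D - e then G * sng \<sigma> c else 0)"
 proof (rule poly_mapping_eqI)
  fix \<tau>
  show "lk (res {\<tau>. ldeg w \<tau> = D} (G * sng \<sigma> c)) \<tau> = lk (if ldeg w \<sigma> = D - e then G * sng \<sigma> c else 0) \<tau>"
  proof (cases "\<tau> \<in> keys (G * sng \<sigma> c)")
   case True
   thus ?thesis using k[OF True] by (auto simp: lookup_res)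
  next
   case False
   hence "lk (G * sng \<sigma> c) \<tau> = 0" unfolding in_keys_iff by simp
   thus ?thesis by (simp add: lookup_res)
  qed
 qed
 thus ?case by (simp add: r)
next
 case (add F F')
 thus ?case by (simp add: res_add distrib_left)
qed

lemma res_sum: "res A (sum f I) = (\<Sum>i\<in>I. res A (f i))"
 by (rule poly_mapping_eqI) (simp add: lookup_res lookup_sum)

text \<open>Cech descent for the Tate complex in one fixed T-degree. An obstruction would need a
  Laurent monomial in which all n of the T have negative exponents, hence of T-degree at most -n,
  whereas only T-degrees from e - n on occur and e is positive.\<close>

lemma almost_complete_intersection_torsion:
 fixes a :: "nat => ('v::finite, 'k::field) mpoly" and Tn :: "nat => 'v"
 assumes Tn: "inj_on Tn {..<n}" and n: "n \<ge> 1"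
  and wt: "!!v. w v = (if v \<in> Tn ` {..<n} then 1 else 0 :: nat)"
  and a: "!!i. i < n ==> homog w 1 (a i)" "homog w 0 (a n)"
  and rel: "(\<Sum>i<n. var (Tn i) * a i) = 0"
  and ex: "!!i. i < n ==> koszul_exact ({..n} - {i}) a"
  and h: "homog w e h" "e \<ge> 1" "!!i. i < n ==> var (Tn i) * h \<in> gen (a ` {..n})"
 shows "h \<in> gen (a ` {..n})"
proof -
 let ?A = "{..n}" and ?B = "{..<n}"
 define a' where "a' i = emb (a i)" for i
 define T' where "T' i = (emb (var (Tn i)) :: ('v, 'k) laurent)" for i
 define DD where "DD = tate_d ?A ?B a' T'"
 \<comment> \<open>The T-degree required of a coefficient in homological degree q. As the divided
   power variable has T-degree two, only q and the missing weight of e_n enter.\<close>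
 define dg where "dg q J = int e - int q + (if n \<in> J then 1 else 0)" for q and J :: "nat set"
 define Xq where "Xq q = {z :: nat \<times> nat set => ('v, 'k) laurent.
  z \<in> tate ?A q & (ALL r J. ALL \<tau>:keys (z (r, J)). ldeg w \<tau> = dg q J)}" for q
 have BA: "?B \<subseteq> ?A" by auto
 have rel': "(\<Sum>i<n. T' i * a' i) = 0"
  using arg_cong[OF rel, of emb] by (simp add: emb_simps T'_def a'_def)
 have a'd: "ldeg w \<tau> = (if i = n then 0 else 1)" if "i \<in> ?A" "\<tau> \<in> keys (a' i)" for i \<tau>
  using that a ldeg_emb[of w 0 "a i" \<tau>] ldeg_emb[of w 1 "a i" \<tau>] unfolding a'_def by (cases "i = n") auto
 have T'd: "ldeg w \<tau> = 1" if "i < n" "\<tau> \<in> keys (T' i)" for i \<tau>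
 proof -
  have "homog w 1 (var (Tn i))" using homog_var[of w "Tn i"] that by (simp add: wt)
  thus ?thesis using ldeg_emb that by (fastforce simp: T'_def)
 qed
 have DD_add: "DD (z + y) = DD z + DD y" for z y
  using tate_d_add[of ?A ?B a' T' z y] by (simp add: DD_def fun_eq_iff plus_fun_def)
 have DDDD: "DD (DD z) = 0" for z
  using tate_d_tate_d[OF _ _ BA rel', of z] by (simp add: DD_def fun_eq_iff)
 text \<open>The differential lowers the homological degree by one and preserves the \<open>T\<close>-degree, where
    \<open>e\<^sub>i\<close> has \<open>T\<close>-degree one for \<open>i < n\<close> and zero for \<open>i = n\<close>.\<close>
 define pj where "pj q z = (%(r, J). res {\<tau>. ldeg w \<tau> = dg q J} (z (r, J)))"
  for q and z :: "nat \<times> nat set => ('v, 'k) laurent"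
 have DDpj: "DD (pj (Suc q) z) = pj q (DD z)" for q z
 proof
  fix b :: "nat \<times> nat set"
  obtain r J where b: "b = (r, J)" by (cases b)
  have 1: "a' i * iota i (%J. pj (Suc q) z (r, J)) J = res {\<tau>. ldeg w \<tau> = dg q J} (a' i * iota i (%J. z (r, J)) J)"
   if i: "i \<in> ?A" for i
  proof (cases "i \<in> J")
   case True thus ?thesis by (simp add: iota_def res_0)
  next
   case False
   have "dg (Suc q) (insert i J) = dg q J - (if i = n then 0 else 1)" using False by (auto simp: dg_def)
   moreover have "res {\<tau>. ldeg w \<tau> = dg q J} (a' i * iota i (%J. z (r, J)) J) =
     a' i * res {\<tau>. ldeg w \<tau> = dg q J - (if i = n then 0 else 1)} (iota i (%J. z (r, J)) J)"
    by (rule res_mult) (rule a'd[OF i])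
   ultimately show ?thesis using False by (simp add: iota_def pj_def res_sg)
  qed
  have 2: "T' i * eps i (%J. pj (Suc q) z (Suc r, J)) J = res {\<tau>. ldeg w \<tau> = dg q J} (T' i * eps i (%J. z (Suc r, J)) J)"
   if i: "i < n" for i
  proof (cases "i \<in> J")
   case False thus ?thesis by (simp add: eps_def res_0)
  next
   case True
   have "dg (Suc q) (J - {i}) = dg q J - 1" using i by (auto simp: dg_def)
   moreover have "res {\<tau>. ldeg w \<tau> = dg q J} (T' i * eps i (%J. z (Suc r, J)) J) =
     T' i * res {\<tau>. ldeg w \<tau> = dg q J - 1} (eps i (%J. z (Suc r, J)) J)"
    by (rule res_mult) (rule T'd[OF i])
   ultimately show ?thesis using True by (simp add: eps_def pj_def res_sg)
  qed
  have "DD (pj (Suc q) z) (r, J) = (\<Sum>i\<in>?A. a' i * iota i (%J. pj (Suc q) z (r, J)) J) + (\<Sum>i\<in>?B. T' i * eps i (%J. pj (Suc q) z (Suc r, J)) J)"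
   by (simp add: DD_def tate_d_def kd_def wd_def)
  also have "\<dots> = res {\<tau>. ldeg w \<tau> = dg q J} (DD z (r, J))"
   unfolding DD_def tate_d_def prod.case kd_def wd_def res_add res_sum
   by (intro arg_cong2[where f = "(+)"] sum.cong refl) (use 1 2 in auto)
  finally show "DD (pj (Suc q) z) b = pj q (DD z) b" by (simp add: b pj_def)
 qed
 have pjX: "pj q z = z" if "z \<in> Xq q" for q z
 proof
  fix b :: "nat \<times> nat set"
  obtain r J where b: "b = (r, J)" by (cases b)
  show "pj q z b = z b" unfolding b pj_def prod.case
  proof (rule poly_mapping_eqI)
   fix \<tau>
   have "lk (z (r, J)) \<tau> ~= 0 ==> ldeg w \<tau> = dg q J" using that unfolding Xq_def in_keys_iff[symmetric] by blast
   thus "lk (res {\<tau>. ldeg w \<tau> = dg q J} (z (r, J))) \<tau> = lk (z (r, J)) \<tau>" by (auto simp: lookup_res)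
  qed
 qed
 have pj_in: "pj q z \<in> Xq q" if "z \<in> tate ?A q" for q z
 proof -
  have "pj q z (r, J) = 0" if "z (r, J) = 0" for r J using that by (simp add: pj_def res_0)
  hence "pj q z \<in> tate ?A q" using that unfolding tate_def by blast
  thus ?thesis by (auto simp: Xq_def pj_def keys_res)
 qed
 have lauD: "ALL b. lau V (DD z b)" if "ALL b. lau V (z b)" for V z
 proof
  fix b show "lau V (DD z b)"
   using that unfolding DD_def tate_d_def a'_def T'_def by (cases b) (auto intro!: lau_add kd_lau wd_lau)
 qed
 have loc: "EX y:Xq (Suc q). (ALL b. lau (Tn ` J) (y b)) & DD y = z"
  if q: "q \<ge> 1" and J: "J ~= {}" "J \<subseteq> {..<n}" and z: "z \<in> Xq q" "ALL b. lau (Tn ` J) (z b)" "DD z = 0" for q z J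
 proof -
  obtain i where i: "i \<in> J" using J by blast
  have fJ: "finite J" using J finite_subset by blast
  have zt: "z \<in> tate ?A q" using z(1) by (simp add: Xq_def)
  define S where "S = z ` ({..q} \<times> Pow ?A)"
  have "finite S" by (simp add: S_def)
  then obtain \<tau> where \<tau>: "keys \<tau> \<subseteq> Tn ` J" "ALL F:S. lau {} (mono \<tau> * F)"
   using clear_denominators[of S "Tn ` J"] fJ z(2) unfolding S_def by blast
  have "EX G. mono \<tau> * z b = emb G" for b
  proof (cases "z b = 0")
   case True thus ?thesis by (intro exI[of _ 0]) (simp add: emb_simps)
  next
   case False
   obtain r K where b: "b = (r, K)" by (cases b)
   hence "K \<subseteq> ?A" "r \<le> q" using tate_D[OF zt, of K r] False by auto
   hence "z b \<in> S" by (auto simp: S_def b)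
   thus ?thesis using \<tau>(2) lau_empty by metis
  qed
  then obtain G where G: "!!b. mono \<tau> * z b = emb (G b)" by metis
  have "G b = 0" if "z b = 0" for b using that G[of b] emb_inj[of "G b" 0] by (simp add: emb_simps)
  hence Gt: "G \<in> tate ?A q" using zt unfolding tate_def by blast
  have "tate_d ?A ?B a (%i. var (Tn i)) G b = 0" for b
  proof -
   have "emb (tate_d ?A ?B a (%i. var (Tn i)) G b) = tate_d ?A ?B a' T' (%b. mono \<tau> * z b) b"
    unfolding G a'_def T'_def by (simp add: tate_d_ring_map[OF ring_map_emb])
   also have "\<dots> = emb 0" using z(3) by (simp add: tate_d_mult DD_def emb_simps)
   finally show ?thesis by (rule emb_inj)
  qed
  moreover have "G (r, K) = 0" if "Suc q \<le> r" for r K using tate_D[OF Gt, of K r] that by auto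
  moreover have "i < n" using i J by blast
  ultimately have "EX M. EX y:tate ?A (Suc q). ALL b. tate_d ?A ?B a (%i. var (Tn i)) y b = var (Tn i) ^ M * G b"
   using BA rel ex q Gt by (intro tate_torsion[where R = "Suc q"]) auto
  then obtain M y where y: "y \<in> tate ?A (Suc q)" "!!b. tate_d ?A ?B a (%i. var (Tn i)) y b = var (Tn i) ^ M * G b" by blast
  define m where "m = (mono (sng (Tn i) (- int M) - \<tau>) :: ('v, 'k) laurent)"
  define y' where "y' = (%b. m * emb (y b))"
  have mm: "m * (emb (var (Tn i) ^ M) * mono \<tau>) = 1"
  proof -
   have "sng (Tn i) (- int M) - \<tau> + (sng (Tn i) (int M) + \<tau>) = 0"
    by (rule poly_mapping_eqI) (simp add: lookup_add lookup_minus lookup_single when_def)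
   thus ?thesis unfolding m_def emb_var_power mono_mult by (simp add: mono_0)
  qed
  have y't: "y' \<in> tate ?A (Suc q)"
  proof -
   have "emb (y b) = 0" if "y b = 0" for b using that by (simp add: emb_simps)
   hence "(%b. emb (y b)) \<in> tate ?A (Suc q)" using y(1) unfolding tate_def by blast
   thus ?thesis unfolding y'_def by (rule tate_mult)
  qed
  have "DD y' b = z b" for b
  proof -
   have "DD y' b = m * emb (tate_d ?A ?B a (%i. var (Tn i)) y b)"
    unfolding DD_def y'_def tate_d_mult a'_def T'_def by (simp add: tate_d_ring_map[OF ring_map_emb])
   also have "\<dots> = m * (emb (var (Tn i) ^ M) * mono \<tau>) * z b" by (simp add: y(2) emb_simps G[symmetric] mult.assoc)
   finally show ?thesis using mm by simp
  qed
  hence "DD y' = z" by (rule ext)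
  hence "DD (pj (Suc q) y') = z" using DDpj[of q y'] pjX[OF z(1)] by simp
  moreover have "lau (Tn ` J) (pj (Suc q) y' b)" for b
  proof -
   have "lau (Tn ` J) (y' b)"
    unfolding y'_def m_def
   proof (intro lau_mult lau_emb lau_mono)
    fix v assume "lk (sng (Tn i) (- int M) - \<tau>) v < 0"
    hence "v = Tn i \<or> v \<in> keys \<tau>" by (auto simp: lookup_minus lookup_single when_def in_keys_iff split: if_splits)
    thus "v \<in> Tn ` J" using i \<tau>(1) by blast
   qed
   thus ?thesis by (cases b) (simp add: pj_def lau_res)
  qed
  ultimately show ?thesis using pj_in[OF y't] by blast
 qed
 define h' where "h' = (%b :: nat \<times> nat set. if b = (0, {}) then emb h else 0)"
 have "EX y:Xq (Suc 0). (ALL b. lau {} (y b)) & DD y = h'"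
 proof (rule cech_descent[where vn = Tn and N = n])
  show "z + y \<in> Xq q" if zy: "z \<in> Xq q" "y \<in> Xq q" for q z y
   unfolding Xq_def
  proof (intro CollectI conjI allI ballI)
   show "z + y \<in> tate {..n} q" using tate_add[of z ?A q y] zy by (simp add: Xq_def plus_fun_def)
   fix r J \<tau> assume "\<tau> \<in> keys ((z + y) (r, J))"
   hence "\<tau> \<in> keys (z (r, J)) \<or> \<tau> \<in> keys (y (r, J))" using Poly_Mapping.keys_add[of "z (r, J)" "y (r, J)"] by auto
   thus "ldeg w \<tau> = dg q J" using zy unfolding Xq_def by blast
  qed
  show "- z \<in> Xq q" if "z \<in> Xq q" for q z using that by (auto simp: Xq_def tate_def)
  show "(%b. res B (z b)) \<in> Xq q" if "z \<in> Xq q" for q z B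
  proof -
   have "res B (z b) = 0" if "z b = 0" for b using that by (simp add: res_0)
   hence "(%b. res B (z b)) \<in> tate ?A q" using \<open>z \<in> Xq q\<close> unfolding Xq_def tate_def by blast
   thus ?thesis using that by (auto simp: Xq_def keys_res)
  qed
  show "0 \<in> Xq q" for q by (simp add: Xq_def tate_def)
  show "DD z \<in> Xq q" if "z \<in> Xq (Suc q)" for q z
  proof -
   have "DD z \<in> tate ?A q" unfolding DD_def by (rule tate_d_tate[OF _ BA]) (use that in \<open>auto simp: Xq_def\<close>)
   from pj_in[OF this] show ?thesis using DDpj[of q z] pjX[OF that] by simp
  qed
  show "\<exists>i<n. 0 \<le> lk \<tau> (Tn i)" if z: "z \<in> Xq (0 + n)" "\<tau> \<in> keys (z b)" for z b \<tau>
  proof (rule ccontr)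
   assume *: "\<not> ?thesis"
   have "ldeg w \<tau> = (\<Sum>v\<in>Tn ` {..<n}. lk \<tau> v)"
    unfolding ldeg_def by (intro sum.mono_neutral_cong_right) (auto simp: wt)
   also have "\<dots> = (\<Sum>i<n. lk \<tau> (Tn i))" using Tn by (simp add: sum.reindex)
   also have "\<dots> \<le> (\<Sum>i<n. - 1)" using * by (intro sum_mono) force
   finally have "ldeg w \<tau> \<le> - int n" by simp
   moreover have "ldeg w \<tau> \<ge> int e - int n" using z by (cases b) (auto simp: Xq_def dg_def)
   ultimately show False using h(2) by simp
  qed
  show h'X: "h' \<in> Xq 0" using ldeg_emb[OF h(1)] by (auto simp: Xq_def h'_def tate_def dg_def)
  show "ALL b. lau {} (h' b)" by (simp add: h'_def lau_emb lau_0)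
  show "EX y:Xq (Suc 0). (ALL b. lau {Tn i} (y b)) & DD y = h'" if i: "i < n" for i
  proof -
   obtain r where r: "var (Tn i) * h = (\<Sum>l\<in>?A. r l * a l)" using h(3)[OF i] unfolding gen_image[OF finite_atMost] by auto
   define m where "m = (mono (sng (Tn i) (- int 1)) :: ('v, 'k) laurent)"
   define y where "y = (%b :: nat \<times> nat set. if fst b = 0 & (EX l:?A. snd b = {l}) then m * emb (r (the_elem (snd b))) else 0)"
   have yt: "y \<in> tate ?A 1" by (auto simp: tate_def y_def)
   have m1: "m * emb (var (Tn i)) = 1"
   proof -
    have e: "emb (var (Tn i)) = mono (sng (Tn i) (int 1))" using emb_var_power[of "Tn i" 1] by (simp only: power_one_right)
    have "sng (Tn i) (- int 1) + sng (Tn i) (int 1) = (0 :: 'v \<Rightarrow>\<^sub>0 int)"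
     unfolding single_add[symmetric] by simp
    thus ?thesis unfolding e m_def mono_mult by (simp only: mono_0)
   qed
   have "DD y b = h' b" for b
   proof -
    obtain s J where b: "b = (s, J)" by (cases b)
    have "wd ?B T' (%J. y (Suc s, J)) J = 0" by (simp add: y_def wd_zero)
    hence "DD y b = (\<Sum>l\<in>?A. a' l * iota l (%J. y (s, J)) J)" by (simp add: DD_def tate_d_def b kd_def)
    also have "\<dots> = (\<Sum>l\<in>?A. if s = 0 & J = {} then a' l * (m * emb (r l)) else 0)"
    proof (intro sum.cong refl)
     fix l assume l: "l \<in> ?A"
     have "insert l J = {l'} ==> l ~: J ==> J = {}" for l' by blast
     thus "a' l * iota l (%J. y (s, J)) J = (if s = 0 & J = {} then a' l * (m * emb (r l)) else 0)"
      using l by (auto simp: iota_def y_def sg_def)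
    qed
    also have "\<dots> = (if s = 0 & J = {} then m * emb (\<Sum>l\<in>?A. r l * a l) else 0)"
     by (simp add: emb_simps a'_def sum_distrib_left mult.commute mult.left_commute)
    also have "\<dots> = h' b" unfolding r[symmetric] emb_simps(3) mult.assoc[symmetric] m1 by (simp add: h'_def b)
    finally show ?thesis .
   qed
   hence "DD y = h'" by (rule ext)
   hence "DD (pj (Suc 0) y) = h'" using DDpj[of 0 y] pjX[OF h'X] by simp
   moreover have "lau {Tn i} (pj (Suc 0) y b)" for b
   proof -
    have "lau {Tn i} m" unfolding m_def by (rule lau_mono) (auto simp: lookup_single when_def split: if_splits)
    hence "lau {Tn i} (y b)" by (simp add: y_def lau_mult lau_emb lau_0)
    thus ?thesis by (cases b) (simp add: pj_def lau_res)
   qed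
   ultimately show ?thesis using pj_in[of y "Suc 0"] yt by auto
  qed
 qed (use Tn n DD_add DDDD lauD loc in auto)
 then obtain y where y: "y \<in> Xq (Suc 0)" "ALL b. lau {} (y b)" "DD y = h'" by (elim bexE conjE)
 have "EX G. y b = emb G" for b using y(2) lau_empty[of "y b"] by blast
 then obtain G where G: "!!b. y b = emb (G b)" by metis
 have "y (Suc 0, J) = 0" for J using y(1) tate_D[of y ?A "Suc 0" J "Suc 0"] by (auto simp: Xq_def)
 hence "DD y (0, {}) = (\<Sum>l\<in>?A. a' l * y (0, {l}))"
  by (simp add: DD_def tate_d_def kd_def iota_def sg_def wd_zero)
 also have "\<dots> = emb (\<Sum>l\<in>?A. G (0, {l}) * a l)" by (simp add: G a'_def emb_simps mult.commute)
 finally have "emb h = emb (\<Sum>l\<in>?A. G (0, {l}) * a l)" using y(3) by (simp add: h'_def)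
 hence "h = (\<Sum>l\<in>?A. G (0, {l}) * a l)" by (rule emb_inj)
 thus ?thesis unfolding gen_image[OF finite_atMost] by (auto intro!: exI[of _ "%l. G (0, {l})"])
qed

no_notation fps_nth (infixl \<open>$\<close> 75)

section \<open>Cofactors\<close>

definition rdet :: "'a::comm_ring_1^'n^'n => 'n => 'a^'n => 'a" where
 "rdet B k w = det (\<chi> i. if i = k then w else B $ i)"

lemma rdet_add: "rdet B k (v + w) = rdet B k v + rdet B k w"
 unfolding rdet_def by (rule det_row_add)

lemma rdet_mult: "rdet B k (c *s w) = c * rdet B k w"
 unfolding rdet_def by (rule det_row_mul)

lemma rdet_0: "rdet B k 0 = 0" using rdet_mult[of B k 0 0] by simp

lemma rdet_minus: "rdet B k (- w) = - rdet B k w"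
proof -
 have "- w = (-1) *s w" by (simp add: vec_eq_iff)
 thus ?thesis using rdet_mult[of B k "-1" w] by simp
qed

lemma rdet_diff: "rdet B k (v - w) = rdet B k v - rdet B k w"
 using rdet_add[of B k v "- w"] by (simp add: rdet_minus)

lemma rdet_sum: "rdet B k (\<Sum>a\<in>A. w a) = (\<Sum>a\<in>A. rdet B k (w a))"
 by (induction A rule: infinite_finite_induct) (simp_all add: rdet_0 rdet_add)

lemma rdet_row: "rdet B k (B $ i) = (if i = k then det B else 0)"
proof (cases "i = k")
 case True
 hence "(\<chi> j. if j = k then B $ i else B $ j) = B" by (simp add: vec_eq_iff)
 thus ?thesis using True unfolding rdet_def by simp
next
 case False
 hence "det (\<chi> j. if j = k then B $ i else B $ j) = 0"
  by (intro det_identical_rows[of k i]) (simp_all add: row_def vec_eq_iff)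
 thus ?thesis using False by (simp add: rdet_def)
qed

lemma det_swap_rows:
 assumes "i ~= k"
 shows "det (\<chi> r. if r = k then u else if r = i then v else B $ r) = - det (\<chi> r. if r = k then v else if r = i then u else (B :: 'a::comm_ring_1^'n^'n) $ r)"
proof -
 let ?A = "\<chi> r. if r = k then v else if r = i then u else B $ r"
 have "det (\<chi> j. ?A $ Transposition.transpose i k j) = of_int (sign (Transposition.transpose i k)) * det ?A"
  by (rule det_permute_rows) (simp add: permutes_swap_id)
 moreover have "(\<chi> j. ?A $ Transposition.transpose i k j) = (\<chi> r. if r = k then u else if r = i then v else B $ r)"
  using assms by (simp add: vec_eq_iff Transposition.transpose_def)
 ultimately show ?thesis using assms by (simp add: sign_swap_id)
qed

text \<open>Put w into row k and replace y i times row i by l minus the other terms; only row k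
  contributes again, with two rows swapped. For l = 0 the right-hand side vanishes, so the cofactors
  are proportional to the relation y.\<close>

lemma cofactor_relation:
 fixes B :: "'a::comm_ring_1^'n^'n"
 assumes ik: "i ~= k" and y: "(\<Sum>r. y r *s B $ r) = l"
 shows "y i * rdet B k w - y k * rdet B i w = det (\<chi> r. if r = k then w else if r = i then l else B $ r)"
proof -
 define B' where "B' = (\<chi> r. if r = k then w else B $ r)"
 have e: "rdet B' i v = det (\<chi> r. if r = k then w else if r = i then v else B $ r)" for v
  unfolding rdet_def B'_def using ik by (intro arg_cong[where f = det]) (simp add: vec_eq_iff)
 have "y i * rdet B k w = y i * rdet B' i (B $ i)"
  using ik rdet_row[of B' i i] by (simp add: B'_def rdet_def)
 also have "\<dots> = rdet B' i (y i *s B $ i)" by (simp add: rdet_mult)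
 also have "y i *s B $ i = l - (\<Sum>r\<in>UNIV - {i}. y r *s B $ r)"
  unfolding y[symmetric] by (simp add: sum.remove[of UNIV i])
 also have "rdet B' i \<dots> = rdet B' i l - (\<Sum>r\<in>UNIV - {i}. y r * rdet B' i (B $ r))"
  by (simp add: rdet_diff rdet_sum rdet_mult)
 also have "(\<Sum>r\<in>UNIV - {i}. y r * rdet B' i (B $ r)) = (\<Sum>r\<in>{k}. y r * rdet B' i (B $ r))"
 proof (rule sum.mono_neutral_right)
  show "ALL r:UNIV - {i} - {k}. y r * rdet B' i (B $ r) = 0"
  proof
   fix r assume r: "r \<in> UNIV - {i} - {k}"
   hence "B $ r = B' $ r" by (simp add: B'_def)
   thus "y r * rdet B' i (B $ r) = 0" using rdet_row[of B' i r] r by simp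
  qed
 qed (use ik in auto)
 finally have "y i * rdet B k w = rdet B' i l - y k * rdet B' i (B $ k)" by simp
 moreover have "rdet B' i (B $ k) = - rdet B i w"
 proof -
  have "(\<chi> r. if r = k then B $ k else if r = i then w else B $ r) = (\<chi> r. if r = i then w else B $ r)"
   using ik by (simp add: vec_eq_iff)
  thus ?thesis unfolding e by (subst det_swap_rows[OF ik]) (simp add: rdet_def)
 qed
 ultimately show ?thesis by (simp add: e)
qed

abbreviation transp :: "'a^'n^'m => 'a^'m^'n" where "transp \<equiv> Finite_Cartesian_Product.transpose"

definition cof :: "'a::comm_ring_1^'n^'n => 'n => 'n => 'a" where
 "cof B k l = rdet B k (axis l 1)"

lemma vec_sum_axis:
 fixes w :: "'a::comm_ring_1^'n"
 shows "w = (\<Sum>j. w $ j *s axis j 1)"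
 by (simp add: vec_eq_iff axis_def if_distrib[of "%x. _ * x"] cong: if_cong)

lemma rdet_cof: "rdet B k w = (\<Sum>j. w $ j * cof B k j)"
 by (subst vec_sum_axis[of w]) (simp only: rdet_sum rdet_mult cof_def)

lemma row_cof: "(\<Sum>j. B $ i $ j * cof B k j) = (if i = k then det B else 0)"
 using rdet_row[of B k i] by (simp add: rdet_cof)

lemma cof_transpose: "cof (transp B) l k = cof (B :: 'a::comm_ring_1^'n^'n) k l"
proof -
 let ?P = "%p. if p k = l then (\<Prod>i\<in>UNIV - {k}. B $ i $ p i) else 0"
 have 1: "(\<Prod>i\<in>UNIV. (\<chi> i. if i = k then axis l 1 else B $ i) $ i $ p i) = ?P p" for p
 proof -
  have "(\<Prod>i\<in>UNIV. (\<chi> i. if i = k then axis l 1 else B $ i) $ i $ p i) =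
   (axis l 1 :: 'a^'n) $ p k * (\<Prod>i\<in>UNIV - {k}. (\<chi> i. if i = k then axis l 1 else B $ i) $ i $ p i)"
   by (subst prod.remove[of UNIV k]) auto
  also have "(\<Prod>i\<in>UNIV - {k}. (\<chi> i. if i = k then axis l 1 else B $ i) $ i $ p i) = (\<Prod>i\<in>UNIV - {k}. B $ i $ p i)"
   by (rule prod.cong) auto
  finally show ?thesis by (auto simp: axis_def)
 qed
 let ?M = "\<chi> i j. if j = l then (if i = k then 1 else 0) else B $ i $ j"
 have 2: "(\<Prod>i\<in>UNIV. ?M $ i $ p i) = ?P p" if p: "p permutes UNIV" for p
 proof (cases "p k = l")
  case True
  have ne: "p i ~= l" if "i ~= k" for i using that True permutes_inj[OF p] by (metis injD)
  have "(\<Prod>i\<in>UNIV. ?M $ i $ p i) = ?M $ k $ p k * (\<Prod>i\<in>UNIV - {k}. ?M $ i $ p i)" by (subst prod.remove[of UNIV k]) auto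
  also have "(\<Prod>i\<in>UNIV - {k}. ?M $ i $ p i) = (\<Prod>i\<in>UNIV - {k}. B $ i $ p i)" using ne by (intro prod.cong) auto
  finally show ?thesis using True by simp
 next
  case False
  obtain i where i: "p i = l" using permutes_surj[OF p] by (metis surjD)
  hence "?M $ i $ p i = 0" using False by auto
  hence "(\<Prod>i\<in>UNIV. ?M $ i $ p i) = 0" by (intro prod_zero finite bexI[of _ i]) simp_all
  thus ?thesis using False by simp
 qed
 have "cof (transp B) l k = det ?M"
  unfolding cof_def rdet_def
  by (subst det_transpose[symmetric], rule arg_cong[where f = det]) (simp add: vec_eq_iff Finite_Cartesian_Product.transpose_def axis_def)
 also have "\<dots> = cof B k l" unfolding cof_def rdet_def det_def by (intro sum.cong refl arg_cong2[where f = "(*)"]) (use 1 2 in auto)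
 finally show ?thesis .
qed

lemma col_cof: "(\<Sum>i. B $ i $ j * cof B i k) = (if j = k then det B else 0)"
 using row_cof[of "transp B" j k]
 by (simp only: cof_transpose det_transpose) (simp add: Finite_Cartesian_Product.transpose_def)

lemma prod_cong_idl:
 assumes "idl J" "!!i. i \<in> A ==> x i - y i \<in> J" shows "prod x A - prod y A \<in> J"
 using assms(2)
proof (induction A rule: infinite_finite_induct)
 case (insert a A)
 have "prod x (insert a A) - prod y (insert a A) = x a * (prod x A - prod y A) + (x a - y a) * prod y A"
  using insert by (simp add: algebra_simps)
 thus ?case using insert by (simp add: idl_D[OF assms(1)])
qed (simp_all add: idl_0[OF assms(1)])

lemma det_cong_idl:
 assumes "idl J" "!!i j. M $ i $ j - N $ i $ j \<in> J" shows "det M - det N \<in> J"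
proof -
 have "det M - det N = (\<Sum>p | p permutes UNIV. of_int (sign p) * ((\<Prod>i\<in>UNIV. M $ i $ p i) - (\<Prod>i\<in>UNIV. N $ i $ p i)))"
  by (simp add: det_def right_diff_distrib sum_subtractf)
 thus ?thesis using assms(2)
  by (auto intro!: idl_sum[OF assms(1)] idl_mult[OF assms(1)] prod_cong_idl[OF assms(1)])
qed

text \<open>If all cofactors of a singular matrix vanish modulo a prime, its left kernel modulo the
  prime has dimension at least two.\<close>

lemma two_kernel_vectors:
 fixes B :: "'a::comm_ring_1^'n^'n"
 assumes q: "pr q" and B: "det B \<in> q" "!!k l. cof B k l \<in> q"
 shows "EX v1 v2 i1 i2. (ALL l. (\<Sum>r. v1 r * B $ r $ l) \<in> q) & (ALL l. (\<Sum>r. v2 r * B $ r $ l) \<in> q) &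
   v1 i1 * v2 i2 - v1 i2 * v2 i1 ~: q"
proof -
 \<comment> \<open>E replaces the rows in Z by unit vectors. The least size m of Z for which the
   determinant leaves q is the corank modulo q, and the hypotheses exclude the values 0 and
   1.\<close>
 define E where "E Z g = (\<chi> i. if i \<in> Z then axis (g i) 1 else B $ i)" for Z :: "'n set" and g :: "'n => 'n"
 define P where "P m <-> (EX Z g. card Z = m & det (E Z g) ~: q)" for m
 have I: "idl q" using pr_idl[OF q] .
 have "E UNIV id = mat 1" by (simp add: E_def vec_eq_iff mat_def axis_def)
 hence "P CARD('n)" using pr_1[OF q] unfolding P_def by (metis det_I)
 define m where "m = (LEAST m. P m)"
 have "P m" unfolding m_def by (rule LeastI) fact
 then obtain Z g where Z: "card Z = m" and D: "det (E Z g) ~: q" by (auto simp: P_def)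
 have least: "det (E Y h) \<in> q" if "card Y < m" for Y h
  using not_less_Least[of "card Y" P] that unfolding m_def[symmetric] by (auto simp: P_def)
 have "E {} h = B" for h by (simp add: E_def vec_eq_iff)
 hence "Z ~= {}" using D B(1) by auto
 moreover have "Z ~= {i}" for i
 proof
  assume "Z = {i}"
  hence "det (E Z g) = cof B i (g i)" unfolding cof_def rdet_def E_def by (intro arg_cong[where f = det]) (simp add: vec_eq_iff)
  thus False using D B(2) by simp
 qed
 ultimately obtain i1 i2 where i12: "i1 \<in> Z" "i2 \<in> Z" "i1 ~= i2" by blast
 let ?E = "E Z g" let ?d = "det ?E"
 have left: "(\<Sum>r. rdet ?E r w * ?E $ r $ l) = ?d * w $ l" for w l
 proof -
  have "(\<Sum>r. rdet ?E r w * ?E $ r $ l) = (\<Sum>j. w $ j * (\<Sum>r. ?E $ r $ l * cof ?E r j))"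
   unfolding rdet_cof sum_distrib_left sum_distrib_right by (subst sum.swap) (simp add: ac_simps)
  also have "\<dots> = (\<Sum>j. if l = j then w $ j * ?d else 0)" unfolding col_cof by (intro sum.cong) auto
  finally show ?thesis by (simp add: mult.commute)
 qed
 \<comment> \<open>Putting row i of B back leaves one unit vector fewer, so minimality of m puts the
   determinant into q.\<close>
 have small: "rdet ?E r (B $ i) \<in> q" if i: "i \<in> Z" and r: "r \<in> Z" for i r
 proof (cases "r = i")
  case True
  have "rdet ?E i (B $ i) = det (E (Z - {i}) g)"
   unfolding rdet_def E_def by (intro arg_cong[where f = det]) (auto simp: vec_eq_iff)
  moreover have "card (Z - {i}) < m" using i Z by (metis card_Diff1_less finite_class.finite)
  ultimately show ?thesis using least True by simp
 next
  case False
  have "rdet ?E r (B $ i) = det (\<chi> j. if j = r then B $ i else if j = i then axis (g i) 1 else ?E $ j)"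
   unfolding rdet_def using i by (intro arg_cong[where f = det]) (auto simp: vec_eq_iff E_def)
  also have "\<dots> = - det (\<chi> j. if j = r then axis (g i) 1 else if j = i then B $ i else ?E $ j)"
   by (rule det_swap_rows) (use False in auto)
  also have "(\<chi> j. if j = r then axis (g i) 1 else if j = i then B $ i else ?E $ j) = E (Z - {i}) (g(r := g i))"
   unfolding E_def using r False by (auto simp: vec_eq_iff)
  finally have "rdet ?E r (B $ i) = - det (E (Z - {i}) (g(r := g i)))" .
  moreover have "card (Z - {i}) < m" using i Z by (metis card_Diff1_less finite_class.finite)
  ultimately show ?thesis using least idl_minus[OF I] by simp
 qed
 \<comment> \<open>Cramer's rule expresses row i by the rows outside Z, up to the common factor d.
   On the positions i1 and i2 the two vectors form d times the identity.\<close>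
 define v where "v i r = (if r = i then ?d else if r \<in> Z then 0 else - rdet ?E r (B $ i))" for i r
 have "(\<Sum>r. v i r * B $ r $ l) \<in> q" if i: "i \<in> Z" for i l
 proof -
  have "(\<Sum>r. v i r * B $ r $ l) = ?d * B $ i $ l - (\<Sum>r\<in>-Z. rdet ?E r (B $ i) * ?E $ r $ l)"
  proof -
   have "(\<Sum>r. v i r * B $ r $ l) = (\<Sum>r\<in>Z. v i r * B $ r $ l) + (\<Sum>r\<in>-Z. v i r * B $ r $ l)"
    by (subst sum.union_disjoint[symmetric]) (auto simp: Compl_partition)
   also have "(\<Sum>r\<in>Z. v i r * B $ r $ l) = (\<Sum>r\<in>{i}. v i r * B $ r $ l)"
    using i by (intro sum.mono_neutral_right) (auto simp: v_def)
   also have "(\<Sum>r\<in>-Z. v i r * B $ r $ l) = - (\<Sum>r\<in>-Z. rdet ?E r (B $ i) * ?E $ r $ l)"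
    unfolding sum_negf[symmetric] using i by (intro sum.cong) (auto simp: v_def E_def)
   finally show ?thesis by (simp add: v_def)
  qed
  also have "\<dots> = (\<Sum>r\<in>Z. rdet ?E r (B $ i) * ?E $ r $ l)"
  proof -
   have "(\<Sum>r\<in>Z. rdet ?E r (B $ i) * ?E $ r $ l) + (\<Sum>r\<in>-Z. rdet ?E r (B $ i) * ?E $ r $ l) = ?d * B $ i $ l"
    unfolding left[of "B $ i" l, symmetric] by (subst sum.union_disjoint[symmetric]) (auto simp: Compl_partition)
   thus ?thesis by (simp add: algebra_simps)
  qed
  also have "\<dots> \<in> q" using small[OF i] by (intro idl_sum[OF I] idl_multr[OF I])
  finally show ?thesis .
 qed
 moreover have "v i1 i1 * v i2 i2 - v i1 i2 * v i2 i1 = ?d * ?d" using i12 by (simp add: v_def)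
 moreover have "?d * ?d ~: q" using D pr_mult[OF q] by blast
 ultimately show ?thesis using i12
  by (intro exI[of _ "v i1"] exI[of _ "v i2"] exI[of _ i1] exI[of _ i2]) simp
qed

section \<open>Dimension of the symmetric algebra\<close>

lemma hcomp_zero: "hcomp w1 0 F = const (ev (%x. x) (%_. 0) F)"
proof -
 have "ring_map (%F. poly (homog_map w1 F) 0)" by (rule ring_map_comp[OF ring_map_poly ring_map_homog_map])
 hence "ring_map (hcomp w1 0)" by (simp add: hcomp_def[abs_def] poly_0_coeff_0)
 thus ?thesis
  by (rule ring_map_eqI[OF _ ring_map_comp[OF ring_map_const ring_map_ev[OF ring_map_id]]])
   (simp_all add: hcomp_homog[OF homog_const] hcomp_homog[OF homog_var] ev_simps[OF ring_map_id] const_simps)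
qed

definition max_ideal :: "('v, 'k::field) mpoly set" where
 "max_ideal = ev (%x. x) (%_. 0) -` {0}"

lemma pr_max_ideal: "pr (max_ideal :: ('v, 'k::field) mpoly set)"
 unfolding max_ideal_def by (rule pr_vimage[OF ring_map_ev[OF ring_map_id] pr_zero_idom])

lemma hprime_subset_max: "pr P ==> hideal w1 P ==> P \<subseteq> max_ideal"
proof
 fix F assume "pr P" "hideal w1 P" "F \<in> P"
 hence "const (ev (%x. x) (%_. 0) F) \<in> P" using hcomp_zero[of F] by (metis hideal_def)
 thus "F \<in> max_ideal" using const_in_prime[OF \<open>pr P\<close>] by (simp add: max_ideal_def)
qed

lemma var_in_max: "var v \<in> max_ideal" by (simp add: max_ideal_def ev_simps[OF ring_map_id])

lemma pr_zero: "pr {0 :: ('v::finite, 'k::field) mpoly}"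
proof -
 obtain vs :: "'v list" where "set vs = UNIV" using finite_list[of "UNIV :: 'v set"] by auto
 from rem_list_all[OF pr_max_ideal this] pr_rem_list[OF pr_max_ideal, of vs] show ?thesis by metis
qed

lemma mpoly_mult_eq_0: "(F :: ('v::finite, 'k::field) mpoly) * G = 0 ==> F = 0 \<or> G = 0"
 using pr_mult[OF pr_zero, of F G] by simp

lemma td_pos: "pr P ==> hideal w1 P ==> var v ~: P ==> td P \<ge> 1"
 using td_strict[OF _ pr_max_ideal, of P] hprime_subset_max[of P] var_in_max[of v] by fastforce

lemma td_max: assumes P: "pr P" "hideal w1 P" "!!v. var v \<in> P" shows "td P = 0"
proof -
 have "\<not> ind P (Suc (card ({} :: nat set)))"
  by (rule not_ind_integral[OF P(2), where y = "%_. 0" and M = 1]) (use P(3) in \<open>auto intro: genI\<close>)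
 hence "\<not> Suc 0 \<le> td P" using ind_mono[OF td_ind[OF P(1)], of P "Suc 0"] by auto
 thus ?thesis by simp
qed

lemma td_nonzero:
 fixes P :: "('v::finite, 'k::field) mpoly set"
 assumes P: "pr P" "F \<in> P" "F ~= 0" shows "td P + 1 \<le> CARD('v)"
proof -
 have "{0} \<subset> P" using P idl_0[OF pr_idl[OF P(1)]] by auto
 from td_strict[OF pr_zero P(1) this] td_le[of "{0 :: ('v, 'k) mpoly}", OF pr_zero] show ?thesis by simp
qed

lemma hideal_vimage_sx:
 "hideal w1 Q ==> hideal w1 (sx -` Q)"
 unfolding hideal_def
proof (intro conjI ballI allI)
 assume Q: "idl Q & (ALL F:Q. ALL d. hcomp w1 d F \<in> Q)"
 thus "idl (sx -` Q)" by (intro idl_vimage ring_map_sub) auto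
 fix F d assume "F \<in> sx -` Q"
 moreover have "hcomp w1 d (sx F) = sx (hcomp w1 d F)" by (rule hcomp_sub) (rule homog_var[of w1, simplified])
 ultimately show "hcomp w1 d F \<in> sx -` Q" using Q by (metis vimage_eq)
qed

abbreviation Tv :: "'m => ('n + 'm, 'k::comm_ring_1) mpoly" where "Tv j \<equiv> var (Inr j)"
abbreviation xv :: "'n => ('n + 'm, 'k::comm_ring_1) mpoly" where "xv j \<equiv> var (Inl j)"

lemma var_neq_0: "var v ~= (0 :: ('v, 'k::field) mpoly)"
proof
 assume "var v = (0 :: ('v, 'k) mpoly)"
 hence "lk (var v :: ('v, 'k) mpoly) (sng v 1) = 0" by (simp only: lookup_zero)
 thus False by (simp add: var_def)
qed

lemma alternating_card:
 fixes psi :: "'n::finite => 'n => ('n, 'k::field) mpoly"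
 assumes "!!i. psi i i = 0" "!!v. var v \<in> gen (range (%(i, j). psi i j))"
 shows "CARD('n) \<ge> 2"
proof (rule ccontr)
 assume "\<not> ?thesis"
 hence "CARD('n) = 1" using zero_less_card_finite[where 'a = 'n] by linarith
 hence eq: "i = j" for i j :: 'n by (metis (full_types) UNIV_I card_1_singletonE singletonD)
 have "psi i j = 0" for i j unfolding eq[of j i] by (rule assms(1))
 hence "gen (range (%(i, j). psi i j)) \<subseteq> {0}" by (intro gen_least idl_zero) auto
 hence "var undefined = (0 :: ('n, 'k) mpoly)" using assms(2) by blast
 thus False by (simp add: var_neq_0)
qed

lemma ex_neq: "CARD('n) \<ge> 2 ==> EX i. i ~= (j :: 'n::finite)"
 by (metis (full_types) UNIV_I card_le_Suc0_iff_eq finite_class.finite_UNIV not_less_eq_eq numeral_2_eq_2)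

text \<open>The situation after passing to homogeneous generators p, with S/(f) present only through
  congruences modulo f. \<open>syz\<close> is exactness of the presentation, and \<open>reg\<close>
  says that the p have no common annihilator. \<open>locgen\<close> is G_d at homogeneous primes
  other than the origin: locally at P at most n - 1 - td P elements, with coordinate vectors
  \<gamma> k, generate, and s is a common denominator.\<close>

locale linear_gorenstein =
 fixes f :: "('n::finite, 'k::field) mpoly" and m e :: nat
  and psi :: "'n => 'n => ('n, 'k) mpoly" and p :: "'n => ('n, 'k) mpoly"
 assumes inf: "infinite (UNIV :: 'k set)"
  and m: "m \<ge> 1" and f_homog: "homog w1 m f" and f0: "f ~= 0"
  and psi_alt: "!!i j. psi i j = - psi j i" and psi_diag: "!!i. psi i i = 0"
  and psi_homog: "!!i j. homog w1 1 (psi i j)"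
  and psi_max: "!!v. var v \<in> gen (range (%(i, j). psi i j))"
  and e: "e \<ge> 1" and p_homog: "!!j. homog w1 e (p j)"
  and syz: "!!v. (\<Sum>j. p j * v j) \<in> gen {f} <-> (EX w c. ALL i. v i = (\<Sum>j. psi i j * w j) + f * c i)"
  and reg: "!!r. (!!j. r * p j \<in> gen {f}) ==> r \<in> gen {f}"
  and locgen: "!!P v. pr P ==> hideal w1 P ==> f \<in> P ==> (!!j. p j \<in> P) ==> var v ~: P ==>
   \<exists>(K :: 'n set) \<gamma> \<beta> s. card K + td P + 1 \<le> CARD('n) & s ~: P &
    (ALL j. EX w c. ALL i. (if i = j then s else 0) = (\<Sum>k\<in>K. \<beta> k j * \<gamma> k i) + (\<Sum>l. psi i l * w l) + f * c i)"
begin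

definition l :: "'n => ('n + 'n, 'k) mpoly" where
 "l j = (\<Sum>i. Tv i * sx (psi i j))"

definition L0 :: "('n + 'n, 'k) mpoly set" where "L0 = gen (range l)"
definition L :: "('n + 'n, 'k) mpoly set" where "L = gen (insert (sx f) (range l))"

lemma idl_L: "idl L" and idl_L0: "idl L0" by (simp_all add: L_def L0_def idl_gen)
lemma f_L: "sx f \<in> L" and l_L: "l j \<in> L" and l_L0: "l j \<in> L0" by (auto simp: L_def L0_def intro: genI)
lemma L0_L: "L0 \<subseteq> L" unfolding L_def L0_def by (rule gen_mono) auto

lemma homog_sx: "homog w1 d F ==> homog w1 d (sx F)"
 by (rule homog_sub[of w1 w1]) (use homog_var[of w1] in auto)
lemma homog_sT: "homog w1 d F ==> homog w1 d (sT F)"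
 by (rule homog_sub[of w1 w1]) (use homog_var[of w1] in auto)

lemma l_homog: "homog w1 2 (l j)"
proof -
 have "homog w1 (1 + 1) (Tv i * sx (psi i j))" for i
  using homog_mult[OF homog_var[of w1 "Inr i"] homog_sx[OF psi_homog]] by simp
 thus ?thesis unfolding l_def by (intro homog_sum) (simp add: numeral_2_eq_2)
qed

lemma hideal_L: "hideal w1 L"
 unfolding L_def by (rule hideal_gen) (use l_homog homog_sx[OF f_homog] in blast)
lemma hideal_L0: "hideal w1 L0"
 unfolding L0_def by (rule hideal_gen) (use l_homog in blast)

lemma sum_T_l: "(\<Sum>j. Tv j * l j) = 0"
proof -
 have "(\<Sum>j. Tv j * l j) = (\<Sum>i. \<Sum>j. Tv i * (Tv j * sx (psi i j)))"
  unfolding l_def sum_distrib_left by (subst sum.swap) (simp add: ac_simps)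
 also have "\<dots> = 0"
 proof (rule antisym_sum)
  fix i j
  have "sx (psi i j) = (- sx (psi j i) :: ('n + 'n, 'k) mpoly)" by (subst psi_alt) (simp add: sub_simps)
  thus "(Tv i * (Tv j * sx (psi i j)) :: ('n + 'n, 'k) mpoly) = - (Tv j * (Tv i * sx (psi j i)))"
   by (simp add: mult.left_commute)
 qed (simp_all add: psi_diag sub_simps)
 finally show ?thesis .
qed

text \<open>Pairing with the T sends the columns of psi to the l_j. Identities between generators
  thereby become relations in the symmetric algebra.\<close>

lemma T_dot:
 assumes "!!i. v i = (\<Sum>k\<in>K. \<beta> k * \<gamma> k i) + (\<Sum>j. psi i j * w j) + f * c i"
 shows "(\<Sum>i. Tv i * sx (v i)) = (\<Sum>k\<in>K. sx (\<beta> k) * (\<Sum>i. Tv i * sx (\<gamma> k i))) +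
   (\<Sum>j. l j * sx (w j)) + sx f * (\<Sum>i. Tv i * sx (c i))"
proof -
 have 1: "(\<Sum>i. Tv i * (\<Sum>k\<in>K. sx (\<beta> k) * sx (\<gamma> k i))) = (\<Sum>k\<in>K. sx (\<beta> k) * (\<Sum>i. Tv i * sx (\<gamma> k i)))"
  unfolding sum_distrib_left by (subst sum.swap) (simp add: ac_simps)
 have 2: "(\<Sum>i. Tv i * (\<Sum>j. sx (psi i j) * sx (w j))) = (\<Sum>j. l j * sx (w j))"
  unfolding l_def sum_distrib_left sum_distrib_right by (subst sum.swap) (simp add: ac_simps)
 have 3: "(\<Sum>i. Tv i * (sx f * sx (c i))) = sx f * (\<Sum>i. Tv i * sx (c i))"
  unfolding sum_distrib_left by (simp add: ac_simps)
 show ?thesis unfolding assms sub_simps distrib_left sum.distrib 1[symmetric] 2[symmetric] 3[symmetric] by simp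
qed

lemma T_dot_unit: "(\<Sum>i. Tv i * sx (if i = j then s else 0)) = (sx s * Tv j :: ('n + 'n, 'k) mpoly)"
proof -
 have "(\<Sum>i. Tv i * sx (if i = j then s else 0)) = (\<Sum>i. if i = j then sx s * Tv j else 0)"
  by (intro sum.cong) (auto simp: sub_simps)
 thus ?thesis by simp
qed

lemma koszul_relation: "EX w c. ALL i. (if i = j then p k else 0) = (if i = k then p j else 0) + (\<Sum>a. psi i a * w a) + f * c i"
proof -
 have "(\<Sum>i. p i * ((if i = j then p k else 0) - (if i = k then p j else 0))) = 0"
  by (simp add: right_diff_distrib sum_subtractf if_distrib[of "%x. _ * x"] mult.commute cong: if_cong)
 hence "(\<Sum>i. p i * ((if i = j then p k else 0) - (if i = k then p j else 0))) \<in> gen {f}"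
  using idl_0[OF idl_gen] by simp
 then obtain w c where wc: "!!i. (if i = j then p k else 0) - (if i = k then p j else 0) = (\<Sum>a. psi i a * w a) + f * c i"
  unfolding syz by blast
 have "(if i = j then p k else 0) = (if i = k then p j else 0) + (\<Sum>a. psi i a * w a) + f * c i" for i
  using wc[of i] by (simp only: diff_eq_eq) (simp add: ac_simps)
 thus ?thesis by blast
qed

lemma p_T_L: "sx (p k) * Tv j - sx (p j) * Tv k \<in> L"
proof -
 obtain w c where *: "!!i. (if i = j then p k else 0) = (if i = k then p j else 0) + (\<Sum>a. psi i a * w a) + f * c i"
  using koszul_relation by blast
 have "(\<Sum>i. Tv i * sx (if i = j then p k else 0)) = (\<Sum>b\<in>{k}. sx (p j) * (\<Sum>i. Tv i * sx (if i = b then 1 else 0))) +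
   (\<Sum>j. l j * sx (w j)) + sx f * (\<Sum>i. Tv i * sx (c i))"
  by (rule T_dot) (use * in \<open>simp add: if_distrib[of "%x. _ * x"] cong: if_cong\<close>)
 hence "sx (p k) * Tv j - sx (p j) * Tv k = (\<Sum>j. l j * sx (w j)) + sx f * (\<Sum>i. Tv i * sx (c i))"
  by (simp add: T_dot_unit sub_simps)
 thus ?thesis by (auto intro!: idl_add[OF idl_L] idl_sum[OF idl_L] idl_multr[OF idl_L] l_L f_L)
qed

lemma N2: "CARD('n) \<ge> 2" by (rule alternating_card[OF psi_diag psi_max])

lemma locgen_prime:
 assumes "pr P" "hideal w1 P" "f \<in> P" "!!j. p j \<in> P" "var v ~: P"
 obtains K :: "'n set" and \<gamma> \<beta> s where "card K + td P + 1 \<le> CARD('n)" "s ~: P"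
  "!!j. EX w c. ALL i. (if i = j then s else 0) = (\<Sum>k\<in>K. \<beta> k j * \<gamma> k i) + (\<Sum>l. psi i l * w l) + f * c i"
 using locgen[of P v] assms by blast

section \<open>Dimension of the primes over L, stratum by stratum\<close>

lemma td_all_x:
 fixes Q :: "('n + 'n, 'k) mpoly set"
 assumes Q: "pr Q" "hideal w1 Q" "!!v. xv v \<in> Q" shows "td Q \<le> CARD('n)"
proof -
 have "td Q \<le> td (sx -` Q :: ('n, 'k) mpoly set) + card (UNIV :: 'n set)"
 proof (rule td_le_fibre[OF Q(1)])
  show "sx 1 ~: Q" using pr_1[OF Q(1)] by (simp add: sub_simps)
  have "sx (if k = j then 1 else 0) * Tv k = (if k = j then Tv k else (0 :: ('n + 'n, 'k) mpoly))" for k j :: 'n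
   by (simp add: sub_simps)
  thus "sx 1 * Tv j - (\<Sum>k. sx (if k = j then 1 else 0) * Tv k) \<in> Q" for j
   using idl_0[OF pr_idl[OF Q(1)]] by (simp add: sub_simps)
 qed
 moreover have "td (sx -` Q :: ('n, 'k) mpoly set) = 0"
  by (rule td_max) (use Q in \<open>auto simp: sub_simps hideal_vimage_sx pr_vimage ring_map_sub\<close>)
 ultimately show ?thesis by simp
qed

lemma td_all_x_strict:
 fixes Q :: "('n + 'n, 'k) mpoly set"
 assumes Q: "pr Q" "hideal w1 Q" "!!v. xv v \<in> Q" and G: "sT G \<in> Q" "G ~= 0"
 shows "td Q < CARD('n)"
proof -
 let ?h = "sub (case_sum (%_. 0) var) :: ('n + 'n, 'k) mpoly => ('n, 'k) mpoly"
 let ?Q = "?h -` {0}"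
 have pQ: "pr ?Q" by (intro pr_vimage ring_map_sub pr_zero)
 have "?Q \<subseteq> Q"
 proof
  fix F assume F: "F \<in> ?Q"
  have "F - sT (?h F) \<in> Q"
   by (rule ring_map_cong_idl[OF ring_map_id ring_map_comp[OF ring_map_sub ring_map_sub] pr_idl[OF Q(1)]])
    (use Q idl_0[OF pr_idl[OF Q(1)]] in \<open>auto simp: sub_simps split: sum.split\<close>)
  thus "F \<in> Q" using F by (simp add: sub_simps)
 qed
 moreover have "?h (sT G) = G" by (simp add: sub_sub sub_simps sub_var)
 hence "sT G ~: ?Q" using G by simp
 ultimately have "?Q \<subset> Q" using G by blast
 hence "td Q < td ?Q" by (rule td_strict[OF pQ Q(1)])
 moreover have "hideal w1 ?Q"
  unfolding hideal_def
 proof (intro conjI ballI allI)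
  show "idl ?Q" by (rule pr_idl[OF pQ])
  fix F d assume F: "F \<in> ?Q"
  have "hcomp w1 d (?h F) = ?h (hcomp w1 d F)"
   by (rule hcomp_sub) (use homog_var[of w1] in \<open>auto simp: homog_0 split: sum.split\<close>)
  thus "hcomp w1 d F \<in> ?Q" using F by (simp add: hcomp_0)
 qed
 hence "td ?Q \<le> CARD('n)" using td_all_x[OF pQ] by (simp add: sub_simps)
 ultimately show ?thesis by simp
qed

text \<open>Off the zeros of p k every T_j is a multiple of T_k, so the fibre is spanned by one
  element.\<close>

lemma td_L_notin:
 assumes Q: "pr Q" "L \<subseteq> Q" and pk: "sx (p k) ~: Q"
 shows "td Q \<le> td (sx -` Q) + 1"
proof -
 have "td Q \<le> td (sx -` Q) + card {k}"
  by (rule td_le_fibre[OF Q(1) pk, where \<beta> = "%_ j. p j" and \<eta> = "%_. Tv k"]) (use p_T_L Q(2) in auto)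
 thus ?thesis by simp
qed

text \<open>Along the zeros of the p and away from x = 0, \<open>locgen\<close> bounds the fibre by
  card K, and G_d keeps the dimensions of base and fibre together below n.\<close>

lemma td_L_in:
 assumes Q: "pr Q" "hideal w1 Q" "L \<subseteq> Q" and pk: "!!k. sx (p k) \<in> Q" and x: "xv v ~: Q"
 shows "td Q < CARD('n)"
proof -
 let ?P = "sx -` Q :: ('n, 'k) mpoly set"
 have P: "pr ?P" "hideal w1 ?P" "f \<in> ?P" "!!j. p j \<in> ?P" "var v ~: ?P"
  using Q pk x f_L by (auto simp: pr_vimage ring_map_sub hideal_vimage_sx sub_simps)
 obtain K :: "'n set" and \<gamma> \<beta> s where K: "card K + td ?P + 1 \<le> CARD('n)" "s ~: ?P"
  "!!j. EX w c. ALL i. (if i = j then s else 0) = (\<Sum>k\<in>K. \<beta> k j * \<gamma> k i) + (\<Sum>l. psi i l * w l) + f * c i"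
  by (rule locgen_prime[OF P]) (rule that; assumption)
 have "td Q \<le> td ?P + card K"
 proof (rule td_le_fibre[OF Q(1)])
  show "sx s ~: Q" using K(2) by simp
  fix j
  obtain w c where wc: "!!i. (if i = j then s else 0) = (\<Sum>k\<in>K. \<beta> k j * \<gamma> k i) + (\<Sum>l. psi i l * w l) + f * c i"
   using K(3) by blast
  from T_dot[OF wc] show "sx s * Tv j - (\<Sum>k\<in>K. sx (\<beta> k j) * (\<Sum>i. Tv i * sx (\<gamma> k i))) \<in> Q"
   unfolding T_dot_unit
   using l_L f_L Q(3) by (auto simp: subset_iff intro!: idl_add[OF pr_idl[OF Q(1)]] idl_sum[OF pr_idl[OF Q(1)]] idl_multr[OF pr_idl[OF Q(1)]])
 qed
 thus ?thesis using K(1) by linarith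
qed

lemma td_sx_less: assumes "pr Q" "sx f \<in> Q" shows "td (sx -` Q :: ('n, 'k) mpoly set) + 1 \<le> CARD('n)"
 using td_nonzero[of "sx -` Q" f] assms f0 by (simp add: pr_vimage ring_map_sub)

lemma td_L:
 assumes Q: "pr Q" "hideal w1 Q" "L \<subseteq> Q" shows "td Q \<le> CARD('n)"
proof (cases "ALL v. xv v \<in> Q")
 case True thus ?thesis using td_all_x Q by blast
next
 case False
 then obtain v where v: "xv v ~: Q" by blast
 show ?thesis
 proof (cases "ALL k. sx (p k) \<in> Q")
  case True thus ?thesis using td_L_in[OF Q _ v] by simp
 next
  case False
  then obtain k where "sx (p k) ~: Q" by blast
  from td_L_notin[OF Q(1,3) this] td_sx_less[OF Q(1)] f_L Q(3) show ?thesis by fastforce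
 qed
qed

section \<open>The minimal primes of the hypersurface\<close>

text \<open>At a minimal prime of f, G_d leaves no local generators: K is empty, so s annihilates
  the p modulo f, and by \<open>reg\<close> s would lie in (f), contrary to s being outside
  P.\<close>

lemma p_notin_minimal:
 assumes P: "pr P" "hideal w1 P" "f \<in> P" and t: "CARD('n) \<le> td P + 1" shows "EX j. p j ~: P"
proof (rule ccontr)
 assume "\<not> ?thesis"
 hence pP: "!!j. p j \<in> P" by simp
 have "td P \<ge> 1" using t N2 by linarith
 then obtain v where v: "var v ~: P" using td_max[OF P(1,2)] by fastforce
 obtain K :: "'n set" and \<gamma> \<beta> s where K: "card K + td P + 1 \<le> CARD('n)" "s ~: P"
  "!!j. EX w c. ALL i. (if i = j then s else 0) = (\<Sum>k\<in>K. \<beta> k j * \<gamma> k i) + (\<Sum>l. psi i l * w l) + f * c i"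
  by (rule locgen_prime[OF P pP v]) (rule that; assumption)
 have "card K = 0" using K(1) t by linarith
 hence K0: "K = {}" by simp
 have "s * p j \<in> gen {f}" for j
 proof -
  have "EX w c. ALL i. (if i = j then s else 0) = (\<Sum>l. psi i l * w l) + f * c i" using K(3)[of j] by (simp add: K0)
  hence "(\<Sum>i. p i * (if i = j then s else 0)) \<in> gen {f}" unfolding syz .
  thus ?thesis by (simp add: mult.commute if_distrib[of "%x. _ * x"] cong: if_cong)
 qed
 hence "s \<in> gen {f}" by (rule reg)
 moreover have "gen {f} \<subseteq> P" using P by (intro gen_least pr_idl) auto
 ultimately show False using K(2) by blast
qed

end

section \<open>Finitely many minimal primes of f, and a basis adapted to them\<close>

lemma in_span_all:
 fixes Q :: "('v::finite, 'k::field) mpoly set" and y :: "nat => ('v, 'k) mpoly"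
 assumes Q: "hideal w1 Q" and y: "!!i. i \<in> I ==> homog w1 (dg i) (y i) & dg i \<ge> 1" and fI: "finite I"
  and M: "!!v. var v ^ M \<in> gen (Q Un y ` I)"
 shows "EX g. (ALL b:box UNIV M. vars_in I (g b)) & F - (\<Sum>b\<in>box UNIV M. sub y (g b) * ev_monom var b) \<in> Q"
proof -
 have iQ: "idl Q" using Q by (simp add: hideal_def)
 have "in_span Q y I (box UNIV M) (degree (homog_map w1 F)) (hcomp w1 d F)" if "d \<le> degree (homog_map w1 F)" for d
  by (rule in_span_mono[OF homog_in_span[OF Q y fI M homog_hcomp] that])
 hence "in_span Q y I (box UNIV M) (degree (homog_map w1 F)) (\<Sum>d\<le>degree (homog_map w1 F). hcomp w1 d F)"
  by (intro in_span_sum[OF iQ]) simp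
 hence "in_span Q y I (box UNIV M) (degree (homog_map w1 F)) F" using sum_hcomp[of F w1] by simp
 then obtain g where g: "ALL b:box UNIV M. keys (g b) \<subseteq> box I (Suc (degree (homog_map w1 F)))"
   "F - (\<Sum>b\<in>box UNIV M. sub y (g b) * ev_monom var b) \<in> Q" by (auto simp: in_span_def)
 have "vars_in I (g b)" if "b \<in> box UNIV M" for b using g(1) that unfolding vars_in_def box_def by blast
 thus ?thesis using g(2) by blast
qed

lemma pr_prod_notin: assumes "pr P" "!!a. a \<in> A ==> g a ~: P" shows "prod g A ~: P"
 using assms(2)
proof (induction A rule: infinite_finite_induct)
 case (insert a A)
 thus ?case using pr_mult[OF assms(1), of "g a" "prod g A"] by auto
qed (use pr_1[OF assms(1)] in auto)

lemma infinite_field_avoid: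
 assumes "infinite (UNIV :: 'k set)" "finite I" "!!i s t. i \<in> I ==> R i s ==> R i t ==> s = (t :: 'k)"
  and fB: "finite B"
 shows "EX t. t ~: B & (ALL i:I. \<not> R i t)"
proof -
 have "finite {t. R i t}" if "i \<in> I" for i
 proof (cases "EX s. R i s")
  case True
  then obtain s where "R i s" by blast
  hence "{t. R i t} \<subseteq> {s}" using assms(3) that by blast
  thus ?thesis by (rule finite_subset) simp
 qed simp
 hence "finite (B Un (\<Union>i\<in>I. {t. R i t}))" using fB assms(2) by auto
 then obtain t where "t ~: B Un (\<Union>i\<in>I. {t. R i t})" using assms(1) by (metis ex_new_if_finite)
 thus ?thesis by auto
qed

lemma const_mult_cancel: "idl P ==> (c :: 'k::field) ~= 0 ==> const c * F \<in> P ==> F \<in> (P :: ('v, 'k) mpoly set)"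
proof -
 assume P: "idl P" and c: "c ~= 0" and F: "const c * F \<in> P"
 have "const (1 / c) * (const c * F) \<in> P" using idl_mult[OF P F] .
 moreover have "const (1 / c) * const c = (1 :: ('v, 'k) mpoly)"
  using c by (simp add: const_simps[symmetric]) (simp add: const_def)
 ultimately show "F \<in> P" by (simp add: mult.assoc[symmetric])
qed

context linear_gorenstein
begin

text \<open>The homogeneous minimal primes of f, described as the primes over f whose transcendence
  degree has the largest possible value n - 1.\<close>

definition bad :: "('n, 'k) mpoly set set" where
 "bad = {P. pr P & hideal w1 P & f \<in> P & CARD('n) \<le> td P + 1}"

text \<open>Modulo f everything is spanned by finitely many monomials over k[y], with n - 1 linear
  forms y. Given more such primes than monomials, take e P outside P and inside all the others. The
  e P are dependent over k[y], and a nonzero coefficient must lie in P, which makes td P too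
  small.\<close>

lemma finite_bad: "finite bad"
proof (rule ccontr)
 assume inf_bad: "infinite bad"
 let ?r = "CARD('n) - 1"
 let ?F = "gen {f}"
 have hF: "hideal w1 ?F" by (rule hideal_gen) (use f_homog in auto)
 have fF: "f \<in> ?F" by (rule genI) simp
 have "\<not> ind Q (Suc ?r)" if Q: "pr Q" "hideal w1 Q" "?F \<subseteq> Q" for Q
 proof
  assume "ind Q (Suc ?r)"
  hence "Suc ?r \<le> td Q" by (rule le_td[OF Q(1)])
  moreover have "td Q + 1 \<le> CARD('n)" using td_nonzero[OF Q(1) _ f0] fF Q(3) by blast
  ultimately show False using N2 by linarith
 qed
 then obtain y where y: "ALL i. homog w1 1 (y i)" "rad_all (gen (?F Un y ` {..<?r}))"
  using noether_normalization[OF inf hF] by blast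
 then obtain M where M: "!!v. var v ^ M \<in> gen (?F Un y ` {..<?r})" using rad_all_uniform[OF _ idl_gen] by blast
 let ?B = "box UNIV M :: ('n \<Rightarrow>\<^sub>0 nat) set"
 have fB: "finite ?B" using card_box[of "UNIV :: 'n set" M] by simp
 obtain \<P> where \<P>: "\<P> \<subseteq> bad" "finite \<P>" "card \<P> = Suc (card ?B)"
  using infinite_arbitrarily_large[OF inf_bad] by blast
 have bad_D: "pr P" "hideal w1 P" "f \<in> P" "CARD('n) \<le> td P + 1" if "P \<in> \<P>" for P
  using that \<P>(1) by (auto simp: bad_def)
 have ex: "EX c. c \<in> P' & c ~: P" if "P \<in> \<P>" "P' \<in> \<P>" "P ~= P'" for P P'
 proof (rule ccontr)
  assume "\<not> ?thesis"
  hence "P' \<subset> P" using that by blast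
  hence "td P < td P'" using td_strict bad_D that by blast
  moreover have "td P' + 1 \<le> CARD('n)" using td_nonzero[OF _ _ f0] bad_D[OF that(2)] by blast
  ultimately show False using bad_D(4)[OF that(1)] by linarith
 qed
 define c where "c P P' = (SOME c. c \<in> P' & c ~: P)" for P P' :: "('n, 'k) mpoly set"
 have c: "c P P' \<in> P' & c P P' ~: P" if "P \<in> \<P>" "P' \<in> \<P>" "P ~= P'" for P P'
  unfolding c_def by (rule someI_ex[OF ex[OF that]])
 define e where "e P = (\<Prod>P'\<in>\<P> - {P}. c P P')" for P
 have e1: "e P ~: P" if "P \<in> \<P>" for P
  unfolding e_def using c that bad_D(1)[OF that] by (intro pr_prod_notin) auto
 have e2: "e P \<in> P'" if "P \<in> \<P>" "P' \<in> \<P>" "P ~= P'" for P P'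
 proof -
  have "e P = c P P' * (\<Prod>P'\<in>\<P> - {P} - {P'}. c P P')" unfolding e_def using that \<P>(2) by (intro prod.remove) auto
  thus ?thesis using c[OF that] idl_multr[OF pr_idl[OF bad_D(1)[OF that(2)]]] by simp
 qed
 have "ALL P. EX g. (ALL b:?B. vars_in {..<?r} (g b)) & e P - (\<Sum>b\<in>?B. sub y (g b) * ev_monom var b) \<in> ?F"
  using in_span_all[OF hF _ finite_lessThan M, of "%_. 1"] y(1) by simp
 from choice[OF this] obtain g where
  g: "!!P. (ALL b:?B. vars_in {..<?r} (g P b)) & e P - (\<Sum>b\<in>?B. sub y (g P b) * ev_monom var b) \<in> ?F" by blast
 \<comment> \<open>\<sigma> kills the surplus variables, so that the coefficients of the dependence
   are polynomials in the variables that stand for the y.\<close>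
 define \<sigma> where "\<sigma> = sub (%i. if i < ?r then var i else (0 :: (nat, 'k) mpoly))"
 have r\<sigma>: "ring_map \<sigma>" unfolding \<sigma>_def by (rule ring_map_sub)
 have \<sigma>g: "\<sigma> G = G" if "vars_in {..<?r} G" for G
 proof -
  have "\<sigma> G = sub var G" unfolding \<sigma>_def by (rule ev_cong[OF ring_map_const that]) simp
  thus ?thesis by (simp add: sub_var)
 qed
 have v\<sigma>: "vars_in {..<?r} (\<sigma> G)" for G
  unfolding \<sigma>_def by (rule vars_in_sub[OF vars_in_UNIV]) (auto intro: vars_in_var vars_in_0)
 have "pr (\<sigma> -` {0})" by (rule pr_vimage[OF r\<sigma> pr_zero_idom])
 from linear_system_mod_prime[OF this fB \<P>(2), of "%b P. g P b"] \<P>(3)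
 obtain v where v: "EX P:\<P>. v P ~: \<sigma> -` {0}" "ALL b:?B. (\<Sum>P\<in>\<P>. g P b * v P) \<in> \<sigma> -` {0}" by auto
 define \<alpha> where "\<alpha> P = \<sigma> (v P)" for P
 have z: "(\<Sum>P\<in>\<P>. \<alpha> P * g P b) = 0" if "b \<in> ?B" for b
 proof -
  have "\<sigma> (\<Sum>P\<in>\<P>. g P b * v P) = 0" using v(2) that by auto
  thus ?thesis using g that by (simp add: ring_map_simps[OF r\<sigma>] \<sigma>g \<alpha>_def mult.commute)
 qed
 have "(\<Sum>P\<in>\<P>. sub y (\<alpha> P) * e P) = (\<Sum>P\<in>\<P>. sub y (\<alpha> P) * (e P - (\<Sum>b\<in>?B. sub y (g P b) * ev_monom var b)))
   + (\<Sum>P\<in>\<P>. \<Sum>b\<in>?B. sub y (\<alpha> P * g P b) * ev_monom var b)"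
  by (simp add: sub_simps algebra_simps sum_subtractf sum_distrib_left sum.distrib)
 also have "(\<Sum>P\<in>\<P>. \<Sum>b\<in>?B. sub y (\<alpha> P * g P b) * ev_monom var b) = (\<Sum>b\<in>?B. sub y (\<Sum>P\<in>\<P>. \<alpha> P * g P b) * ev_monom var b)"
  by (subst sum.swap) (simp add: sub_simps sum_distrib_right)
 also have "\<dots> = 0" using z by (intro sum.neutral) (auto simp: sub_simps)
 finally have sF: "(\<Sum>P\<in>\<P>. sub y (\<alpha> P) * e P) \<in> ?F" using g by (auto intro!: idl_sum[OF idl_gen] idl_mult[OF idl_gen])
 obtain P where P: "P \<in> \<P>" "\<alpha> P ~= 0" using v(1) by (auto simp: \<alpha>_def)
 note bP = bad_D[OF P(1)] and iP = pr_idl[OF bad_D(1)[OF P(1)]]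
 have FP: "?F \<subseteq> P" using bP iP by (intro gen_least) auto
 have "(\<Sum>P'\<in>\<P>. sub y (\<alpha> P') * e P') = sub y (\<alpha> P) * e P + (\<Sum>P'\<in>\<P> - {P}. sub y (\<alpha> P') * e P')"
  using P \<P>(2) by (intro sum.remove) auto
 moreover have r2: "(\<Sum>P'\<in>\<P> - {P}. sub y (\<alpha> P') * e P') \<in> P"
 proof (rule idl_sum[OF iP])
  fix P' assume "P' \<in> \<P> - {P}"
  thus "sub y (\<alpha> P') * e P' \<in> P" using e2[of P' P] P(1) by (intro idl_mult[OF iP]) simp
 qed
 ultimately have "sub y (\<alpha> P) * e P \<in> P" using idl_diff[OF iP subsetD[OF FP sF] r2] by simp
 hence "sub y (\<alpha> P) \<in> P" using pr_mult[OF bP(1)] e1[OF P(1)] by blast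
 then obtain G \<delta> where G: "G ~= 0" "vars_in {..<?r} G" "homog w1 \<delta> G" "sub y G \<in> P"
  using homog_relation[where y = y and b = P, OF bP(2) _ P(2), of ?r] v\<sigma> y(1) by (auto simp: \<alpha>_def)
 define r' where "r' = CARD('n) - 2"
 have r': "?r = Suc r'" using N2 by (simp add: r'_def)
 have "gen (?F Un y ` {..<?r}) \<subseteq> gen (P Un y ` {..<?r})" using FP by (intro gen_mono) auto
 hence "rad_all (gen (P Un y ` {..<Suc r'}))" using rad_all_mono[OF y(2)] r' by simp
 then obtain y' where y': "ALL i. homog w1 1 (y' i)" "rad_all (gen (P Un y' ` {..<r'}))"
  using noether_step[OF inf iP y(1)[rule_format] G(1) _ G(3,4), of r'] G(2) r' by auto
 obtain M' where M': "!!v. var v ^ M' \<in> gen (P Un y' ` {..<r'})" using rad_all_uniform[OF y'(2) idl_gen] by blast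
 have "\<not> ind P (Suc (card {..<r'}))"
  by (rule not_ind_integral[OF bP(2) _ _ M', of "%_. 1"]) (use y'(1) in auto)
 moreover have "Suc (card {..<r'}) \<le> td P" using bP(4) r' by simp
 ultimately show False using ind_mono[OF td_ind[OF bP(1)]] by blast
qed

text \<open>Prime avoidance over an infinite field. If the combination found so far lies in the next
  prime P, add a multiple of some p l outside P; each earlier prime forbids at most one
  multiplier.\<close>

lemma exists_good:
 "EX c. ALL P:bad. (\<Sum>j. const (c j) * p j) ~: P"
proof -
 have "EX c. ALL P:B. (\<Sum>j. const (c j) * p j) ~: P" if "finite B" "B \<subseteq> bad" for B
  using that
 proof (induction B rule: finite_induct)
  case (insert P B)
  then obtain c where c: "ALL P:B. (\<Sum>j. const (c j) * p j) ~: P" by auto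
  let ?cp = "\<Sum>j. const (c j) * p j"
  have prB: "pr P'" if "P' \<in> insert P B" for P' using insert.prems that by (auto simp: bad_def)
  show ?case
  proof (cases "?cp \<in> P")
   case False thus ?thesis using c by auto
  next
   case True
   obtain l where l: "p l ~: P" using p_notin_minimal[of P] insert.prems by (auto simp: bad_def)
   have "EX t. t ~: {0} & (ALL P':B. \<not> ?cp + const t * p l \<in> P')"
   proof (rule infinite_field_avoid[OF inf insert.hyps(1)])
    fix P' s t assume P': "P' \<in> B" and st: "?cp + const s * p l \<in> P'" "?cp + const t * p l \<in> P'"
    note I = pr_idl[OF prB[of P']]
    have i: "idl P'" using I P' by simp
    show "s = t"
    proof (rule ccontr)
     assume "s ~= t"
     have "(?cp + const s * p l) - (?cp + const t * p l) \<in> P'" by (rule idl_diff[OF i st])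
     moreover have "const s = const (s - t) + (const t :: ('n, 'k) mpoly)" by (simp add: const_simps[symmetric])
     ultimately have "const (s - t) * p l \<in> P'" by (simp add: algebra_simps)
     hence "p l \<in> P'" by (rule const_mult_cancel[OF i, rotated]) (use \<open>s ~= t\<close> in simp)
     hence "?cp \<in> P'" using idl_diff[OF i st(1) idl_mult[OF i, of "p l" "const s"]] by simp
     thus False using c P' by blast
    qed
   qed simp
   then obtain t where t: "t ~= 0" "ALL P':B. ?cp + const t * p l ~: P'" by auto
   define c' where "c' j = c j + (if j = l then t else 0)" for j
   have "const (c' j) * p j = const (c j) * p j + (if j = l then const t * p l else 0)" for j
    by (simp add: c'_def const_simps distrib_right)
   hence c': "(\<Sum>j. const (c' j) * p j) = ?cp + const t * p l" by (simp add: sum.distrib)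
   have iP: "idl P" using pr_idl[OF prB] by blast
   have "?cp + const t * p l ~: P"
   proof
    assume "?cp + const t * p l \<in> P"
    from idl_diff[OF iP this True] have "const t * p l \<in> P" by simp
    thus False using const_mult_cancel[OF iP t(1)] l by blast
   qed
   thus ?thesis using t(2) c' by (intro exI[of _ c']) simp
  qed
 qed auto
 thus ?thesis using finite_bad by blast
qed

lemma good_basis:
 "EX \<sigma> \<tau> :: 'n => 'n => 'k. (ALL i k. (\<Sum>j. \<sigma> i j * \<tau> j k) = (if i = k then 1 else 0)) &
   (ALL i k. (\<Sum>j. \<tau> i j * \<sigma> j k) = (if i = k then 1 else 0)) &
   (ALL i. ALL P:bad. (\<Sum>j. const (\<sigma> i j) * p j) ~: P)"
proof -
 obtain c where c: "ALL P:bad. (\<Sum>j. const (c j) * p j) ~: P" using exists_good by blast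
 let ?cp = "\<Sum>j. const (c j) * p j"
 let ?C = "\<Sum>j. c j"
 have "EX s. s ~: {0, - ?C} & (ALL iP:UNIV \<times> bad. \<not> ?cp + const s * p (fst iP) \<in> snd iP)"
 proof (rule infinite_field_avoid[OF inf])
  show "finite ((UNIV :: 'n set) \<times> bad)" using finite_bad by simp
  fix iP s t assume iP: "iP \<in> (UNIV :: 'n set) \<times> bad"
   and st: "?cp + const s * p (fst iP) \<in> snd iP" "?cp + const t * p (fst iP) \<in> snd iP"
  have i: "idl (snd iP)" using iP by (auto simp: bad_def dest: pr_idl)
  show "s = t"
  proof (rule ccontr)
   assume "s ~= t"
   have "(?cp + const s * p (fst iP)) - (?cp + const t * p (fst iP)) \<in> snd iP" by (rule idl_diff[OF i st])
   moreover have "const s = const (s - t) + (const t :: ('n, 'k) mpoly)" by (simp add: const_simps[symmetric])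
   ultimately have "const (s - t) * p (fst iP) \<in> snd iP" by (simp add: algebra_simps)
   hence "p (fst iP) \<in> snd iP" by (rule const_mult_cancel[OF i, rotated]) (use \<open>s ~= t\<close> in simp)
   hence "?cp \<in> snd iP" using idl_diff[OF i st(1) idl_mult[OF i, of "p (fst iP)" "const s"]] by simp
   thus False using c iP by auto
  qed
 qed simp
 then obtain s where s: "s ~= 0" "s ~= - ?C" "!!i P. P \<in> bad ==> ?cp + const s * p i ~: P" by auto
 have s': "s + ?C ~= 0" using s(2) by (metis add_eq_0_iff2)
 \<comment> \<open>\<sigma> is s times the identity plus a matrix all of whose rows are c; \<tau> is
   its inverse by the Sherman-Morrison formula, which needs s and s + \<Sum> c j to be
   nonzero.\<close>
 define \<sigma> where "\<sigma> i j = c j + (if i = j then s else 0)" for i j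
 define \<tau> where "\<tau> i j = ((if i = j then 1 else 0) - c j / (s + ?C)) / s" for i j
 have "(\<Sum>j. \<sigma> i j * \<tau> j k) = (if i = k then 1 else 0)" for i k
 proof -
  have "(\<Sum>j. \<sigma> i j * \<tau> j k) = (\<Sum>j. c j * \<tau> j k) + (\<Sum>j. if i = j then s * \<tau> j k else 0)"
   by (simp add: \<sigma>_def distrib_right sum.distrib if_distrib[of "%x. x * _"] cong: if_cong)
  also have "(\<Sum>j. c j * \<tau> j k) = (\<Sum>j. if j = k then c k / s else 0) - (\<Sum>j. c j * (c k / (s + ?C) / s))"
   unfolding sum_subtractf[symmetric] by (intro sum.cong) (auto simp: \<tau>_def diff_divide_distrib right_diff_distrib)
  also have "(\<Sum>j. c j * (c k / (s + ?C) / s)) = ?C * (c k / (s + ?C) / s)" by (simp only: sum_distrib_right)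
  finally have "(\<Sum>j. \<sigma> i j * \<tau> j k) = c k / s - ?C * (c k / (s + ?C) / s) + s * \<tau> i k" by simp
  also have "c k / s - ?C * (c k / (s + ?C) / s) = c k / (s + ?C)" using s(1) s' by (simp add: divide_simps) (simp add: algebra_simps)
  also have "c k / (s + ?C) + s * \<tau> i k = (if i = k then 1 else 0)" using s(1) by (simp add: \<tau>_def)
  finally show ?thesis .
 qed
 moreover have "(\<Sum>j. \<tau> i j * \<sigma> j k) = (if i = k then 1 else 0)" for i k
 proof -
  have "(\<Sum>j. \<tau> i j * \<sigma> j k) = (\<Sum>j. \<tau> i j * c k) + (\<Sum>j. if j = k then s * \<tau> i j else 0)"
   unfolding sum.distrib[symmetric] by (intro sum.cong) (auto simp: \<sigma>_def algebra_simps)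
  also have "(\<Sum>j. \<tau> i j * c k) = (\<Sum>j. \<tau> i j) * c k" by (simp only: sum_distrib_right)
  also have "(\<Sum>j. \<tau> i j) = (\<Sum>j. if i = j then 1 / s else 0) - (\<Sum>j. c j * (1 / (s + ?C) / s))"
   unfolding sum_subtractf[symmetric] by (intro sum.cong) (auto simp: \<tau>_def diff_divide_distrib)
  also have "(\<Sum>j. c j * (1 / (s + ?C) / s)) = ?C * (1 / (s + ?C) / s)" by (simp only: sum_distrib_right)
  finally have "(\<Sum>j. \<tau> i j * \<sigma> j k) = (1 / s - ?C * (1 / (s + ?C) / s)) * c k + s * \<tau> i k" by simp
  also have "1 / s - ?C * (1 / (s + ?C) / s) = 1 / (s + ?C)" using s(1) s' by (simp add: divide_simps)
  also have "1 / (s + ?C) * c k + s * \<tau> i k = (if i = k then 1 else 0)" using s(1) by (simp add: \<tau>_def)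
  finally show ?thesis .
 qed
 moreover have "(\<Sum>j. const (\<sigma> i j) * p j) ~: P" if "P \<in> bad" for i P
 proof -
  have "const (\<sigma> i j) * p j = const (c j) * p j + (if i = j then const s * p i else 0)" for j
   by (simp add: \<sigma>_def const_simps distrib_right)
  hence "(\<Sum>j. const (\<sigma> i j) * p j) = ?cp + const s * p i" by (simp add: sum.distrib)
  thus ?thesis using s(3)[OF that] by simp
 qed
 ultimately show ?thesis by blast
qed

end

section \<open>Linkage to complete intersections\<close>

lemma koszul_exact_automorphism:
 assumes h: "ring_map h" "ring_map h'" "!!x. h (h' x) = x" "!!x. h' (h x) = x"
  and ex: "koszul_exact A a"
 shows "koszul_exact A (%i. h (a i))"
 unfolding koszul_exact_def
proof (intro allI ballI impI)
 fix q :: nat and z assume q: "q \<ge> 1" "z \<in> kos A q" and kz: "kd A (%i. h (a i)) z = (%J. 0)"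
 note h0 = ring_map_simps(1)[OF h(1)] ring_map_simps(1)[OF h(2)]
 have z': "(%J. h' (z J)) \<in> kos A q"
  unfolding kos_def
 proof (intro CollectI allI impI)
  fix J assume "h' (z J) ~= 0"
  hence "z J ~= 0" using ring_map_simps[OF h(2)] by auto
  thus "J \<subseteq> A & card J = q" using kos_D[OF q(2)] by blast
 qed
 have "kd A a (%J. h' (z J)) J = 0" for J
  using kd_ring_map[OF h(2), of A "%i. h (a i)" z J] kz ring_map_simps[OF h(2)] by (simp add: h(4))
 hence "kd A a (%J. h' (z J)) = (%J. 0)" by blast
 then obtain y where y: "y \<in> kos A (Suc q)" "kd A a y = (%J. h' (z J))"
  using ex q(1) z' unfolding koszul_exact_def by blast
 have "(%J. h (y J)) \<in> kos A (Suc q)"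
  unfolding kos_def
 proof (intro CollectI allI impI)
  fix J assume "h (y J) ~= 0"
  hence "y J ~= 0" using ring_map_simps[OF h(1)] by auto
  thus "J \<subseteq> A & card J = Suc q" using kos_D[OF y(1)] by blast
 qed
 moreover have "kd A (%i. h (a i)) (%J. h (y J)) = z"
  using kd_ring_map[OF h(1), of A a y] y(2) by (auto simp: h(3))
 ultimately show "EX y:kos A (Suc q). kd A (%i. h (a i)) y = z" by blast
qed

lemma homog_weight_0: "homog (%_. 0) 0 F" by (simp add: homog_iff)

lemma homog_T_sx: "homog (case_sum (%_. 0) w) 0 (sx F)"
 using homog_var[of "case_sum (%_. 0) w" "Inl _"] by (intro homog_sub[of _ "%_. 0", OF _ homog_weight_0]) simp

lemma hcomp_T_zero: "hcomp (case_sum (%_. 0) w1) 0 F = sx (sub (case_sum var (%_. 0)) F)"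
proof -
 let ?w = "case_sum (%_. 0) w1 :: 'a + 'b => nat"
 have "ring_map (%F :: ('a + 'b, 'c) mpoly. poly (homog_map ?w F) 0)" by (rule ring_map_comp[OF ring_map_poly ring_map_homog_map])
 hence "ring_map (hcomp ?w 0 :: ('a + 'b, 'c) mpoly => _)" by (simp add: hcomp_def[abs_def] poly_0_coeff_0)
 thus ?thesis
  by (rule ring_map_eqI[OF _ ring_map_comp[OF ring_map_sub ring_map_sub]])
   (auto simp: hcomp_homog[OF homog_const] hcomp_homog[OF homog_var] sub_simps split: sum.split)
qed

lemma gen_insert_range_mult:
 fixes g :: "'i::finite => 'a::comm_ring_1"
 assumes J: "idl J" and "c * a \<in> J" "!!i. c * g i \<in> J" and F: "F \<in> gen (insert a (range g))"
 shows "c * F \<in> J"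
proof -
 have "idl {F. c * F \<in> J}" 
  by (rule idlI) (auto simp: idl_0[OF J] distrib_left idl_add[OF J] mult.left_commute idl_mult[OF J])
 hence "gen (insert a (range g)) \<subseteq> {F. c * F \<in> J}" using assms by (intro gen_least) auto
 thus ?thesis using F by auto
qed

locale linear_gorenstein_basis = linear_gorenstein f m e psi p
 for f :: "('n::finite, 'k::field) mpoly" and m e :: nat
  and psi :: "'n => 'n => ('n, 'k) mpoly" and p :: "'n => ('n, 'k) mpoly" +
 fixes \<sigma> \<tau> :: "'n => 'n => 'k"
 assumes \<sigma>\<tau>: "!!i k. (\<Sum>j. \<sigma> i j * \<tau> j k) = (if i = k then 1 else 0)"
  and \<tau>\<sigma>: "!!i k. (\<Sum>j. \<tau> i j * \<sigma> j k) = (if i = k then 1 else 0)"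
  and good: "!!i P. P \<in> bad ==> (\<Sum>j. const (\<sigma> i j) * p j) ~: P"
begin

text \<open>T is transformed by \<sigma> and l by the transposed inverse, so that the relation
  \<Sum> T_j l_j = 0 keeps its form.\<close>

definition Ts :: "'n => ('n + 'n, 'k) mpoly" where "Ts i = (\<Sum>j. const (\<sigma> i j) * Tv j)"
definition ls :: "'n => ('n + 'n, 'k) mpoly" where "ls j = (\<Sum>k. const (\<tau> k j) * l k)"

lemma const_\<tau>\<sigma>: "(\<Sum>j. const (\<tau> i j) * const (\<sigma> j k)) = (if i = k then 1 else 0 :: ('v, 'k) mpoly)"
 unfolding const_simps(2)[symmetric] const_sum[symmetric] \<tau>\<sigma> by (simp add: const_simps const_def)
lemma const_\<sigma>\<tau>: "(\<Sum>j. const (\<sigma> i j) * const (\<tau> j k)) = (if i = k then 1 else 0 :: ('v, 'k) mpoly)"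
 unfolding const_simps(2)[symmetric] const_sum[symmetric] \<sigma>\<tau> by (simp add: const_simps const_def)

lemma Tv_Ts: "Tv j = (\<Sum>i. const (\<tau> j i) * Ts i)"
proof -
 have "(\<Sum>i. const (\<tau> j i) * Ts i) = (\<Sum>k. (\<Sum>i. const (\<tau> j i) * const (\<sigma> i k)) * Tv k)"
  unfolding Ts_def sum_distrib_left sum_distrib_right by (subst sum.swap) (simp add: ac_simps)
 thus ?thesis unfolding const_\<tau>\<sigma> by (simp add: if_distrib[of "%x. x * _"] cong: if_cong)
qed

lemma l_ls: "l k = (\<Sum>j. const (\<sigma> j k) * ls j)"
proof -
 have "(\<Sum>j. const (\<sigma> j k) * ls j) = (\<Sum>a. (\<Sum>j. const (\<tau> a j) * const (\<sigma> j k)) * l a)"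
  unfolding ls_def sum_distrib_left sum_distrib_right by (subst sum.swap) (simp add: ac_simps)
 thus ?thesis unfolding const_\<tau>\<sigma> by (simp add: if_distrib[of "%x. x * _"] cong: if_cong)
qed

lemma sum_Ts_ls: "(\<Sum>j. Ts j * ls j) = 0"
proof -
 have "(\<Sum>j. Ts j * ls j) = (\<Sum>j. \<Sum>k. (const (\<sigma> j k) * ls j) * Tv k)"
  unfolding Ts_def sum_distrib_right by (simp add: ac_simps)
 also have "\<dots> = (\<Sum>k. l k * Tv k)" by (subst sum.swap) (simp only: l_ls sum_distrib_right)
 finally show ?thesis using sum_T_l by (simp add: mult.commute)
qed

lemma ls_L: "ls j \<in> L" unfolding ls_def by (intro idl_sum[OF idl_L] idl_mult[OF idl_L] l_L)

lemma L_ls: "L = gen (insert (sx f) (range ls))"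
proof
 show "L \<subseteq> gen (insert (sx f) (range ls))"
 proof -
  have "l k \<in> gen (insert (sx f) (range ls))" for k
   unfolding l_ls[of k] by (intro idl_sum[OF idl_gen] idl_mult[OF idl_gen] genI) simp
  thus ?thesis unfolding L_def by (intro gen_subI) (auto intro: genI)
 qed
 show "gen (insert (sx f) (range ls)) \<subseteq> L" using ls_L f_L by (intro gen_least idl_L) auto
qed

lemma ls_homog: "homog w1 2 (ls j)"
 unfolding ls_def using homog_mult[OF homog_const[of w1] l_homog] by (intro homog_sum) (simp add: numeral_2_eq_2)

text \<open>Off the hypersurface \<open>l\<^sup>\<sigma>\<^sub>i = 0\<close> the relation \<open>\<Sum> T\<^sup>\<sigma>\<^sub>j l\<^sup>\<sigma>\<^sub>j = 0\<close> forces \<open>T\<^sup>\<sigma>\<^sub>i = 0\<close>, and the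
  fibres grow by at most the one dimension spanned by \<open>l\<^sup>\<sigma>\<^sub>i\<close>.\<close>

lemma Ts_in:
 assumes Q: "pr Q" and ls: "!!j. j ~= i ==> ls j \<in> Q" "ls i ~: Q" shows "Ts i \<in> Q"
proof -
 have "Ts i * ls i = - (\<Sum>j\<in>UNIV - {i}. Ts j * ls j)"
  using sum_Ts_ls sum.remove[of UNIV i "%j. Ts j * ls j"] by (simp add: eq_neg_iff_add_eq_0)
 hence "Ts i * ls i \<in> Q" using ls(1) by (auto intro!: idl_minus[OF pr_idl[OF Q]] idl_sum[OF pr_idl[OF Q]] idl_mult[OF pr_idl[OF Q]])
 thus ?thesis using pr_mult[OF Q] ls(2) by blast
qed

text \<open>The fibre is generated by the elements for K and by \<open>ls i\<close>, the only
  transformed l outside reach of Q. The term with \<delta> contributes a multiple of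
  \<open>Ts i\<close>, which lies in Q.\<close>

lemma td_fibre_ls:
 fixes K :: "'n set"
 assumes Q: "pr Q" "sx f \<in> Q" and ls: "ALL j. j ~= i --> ls j \<in> Q" "Ts i \<in> Q"
  and s: "sx s ~: Q" and K: "card K < CARD('n)"
  and rel: "!!j. EX w c. ALL a. (if a = j then s else 0) = (\<Sum>k\<in>K. \<beta> k j * \<gamma> k a) + (\<Sum>l. psi a l * w l) + f * c a + \<delta> j * const (\<sigma> i a)"
 shows "td Q \<le> td (sx -` Q) + card K + 1"
proof -
 \<comment> \<open>\<open>td_le_fibre\<close> indexes its generators by a subset of
   \<open>'n\<close>; the spare index k0 is given to \<open>ls i\<close>.\<close>
 obtain k0 where k0: "k0 ~: K" using K by (metis UNIV_eq_I less_irrefl)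
 have fK: "finite K" by simp
 from rel obtain w where "!!j. EX c. ALL a. (if a = j then s else 0) = (\<Sum>k\<in>K. \<beta> k j * \<gamma> k a) + (\<Sum>l. psi a l * w j l) + f * c a + \<delta> j * const (\<sigma> i a)"
  using choice[of "%j w. EX c. ALL a. (if a = j then s else 0) = (\<Sum>k\<in>K. \<beta> k j * \<gamma> k a) + (\<Sum>l. psi a l * w l) + f * c a + \<delta> j * const (\<sigma> i a)"]
  by auto
 hence "ALL j. EX c. ALL a. (if a = j then s else 0) = (\<Sum>k\<in>K. \<beta> k j * \<gamma> k a) + (\<Sum>l. psi a l * w j l) + f * c a + \<delta> j * const (\<sigma> i a)"
  by blast
 from choice[OF this] obtain c where wc: "!!j a. (if a = j then s else 0) = (\<Sum>k\<in>K. \<beta> k j * \<gamma> k a) + (\<Sum>l. psi a l * w j l) + f * c j a + \<delta> j * const (\<sigma> i a)"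
  by auto
 note iQ = pr_idl[OF Q(1)]
 define \<omega> where "\<omega> j = (\<Sum>l. const (\<sigma> i l) * w j l)" for j
 have "td Q \<le> td (sx -` Q) + card (insert k0 K)"
 proof (rule td_le_fibre[OF Q(1) s, where \<beta> = "%k j. if k = k0 then \<omega> j else \<beta> k j"
    and \<eta> = "%k. if k = k0 then ls i else (\<Sum>i. Tv i * sx (\<gamma> k i))"])
  fix j
  have "(if a = j then s else 0) - \<delta> j * const (\<sigma> i a) = (\<Sum>k\<in>K. \<beta> k j * \<gamma> k a) + (\<Sum>l. psi a l * w j l) + f * c j a" for a
   using wc[of a j] by simp
  from T_dot[OF this] have
   "(\<Sum>a. Tv a * sx (if a = j then s else 0)) - (\<Sum>a. Tv a * sx (\<delta> j * const (\<sigma> i a))) =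
    (\<Sum>k\<in>K. sx (\<beta> k j) * (\<Sum>i. Tv i * sx (\<gamma> k i))) + (\<Sum>b. l b * sx (w j b)) + sx f * (\<Sum>i. Tv i * sx (c j i))"
   by (simp add: sub_simps right_diff_distrib sum_subtractf)
  moreover have "(\<Sum>a. Tv a * sx (\<delta> j * const (\<sigma> i a))) = sx (\<delta> j) * Ts i"
   by (simp add: sub_simps Ts_def sum_distrib_left ac_simps)
  ultimately have 1: "sx s * Tv j = (\<Sum>k\<in>K. sx (\<beta> k j) * (\<Sum>i. Tv i * sx (\<gamma> k i))) + (\<Sum>b. l b * sx (w j b)) +
    (sx f * (\<Sum>i. Tv i * sx (c j i)) + sx (\<delta> j) * Ts i)"
   by (simp add: T_dot_unit algebra_simps)
  have "(\<Sum>b. l b * sx (w j b)) = (\<Sum>a. ls a * sx (\<Sum>b. const (\<sigma> a b) * w j b))"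
   unfolding l_ls sum_distrib_right by (subst sum.swap) (simp add: sub_simps sum_distrib_left ac_simps)
  also have "\<dots> = ls i * sx (\<omega> j) + (\<Sum>a\<in>UNIV - {i}. ls a * sx (\<Sum>b. const (\<sigma> a b) * w j b))"
   by (subst sum.remove[of _ i]) (auto simp: \<omega>_def)
  finally have 2: "sx s * Tv j = (\<Sum>k\<in>K. sx (\<beta> k j) * (\<Sum>i. Tv i * sx (\<gamma> k i))) + sx (\<omega> j) * ls i +
    ((\<Sum>a\<in>UNIV - {i}. ls a * sx (\<Sum>b. const (\<sigma> a b) * w j b)) + (sx f * (\<Sum>i. Tv i * sx (c j i)) + sx (\<delta> j) * Ts i))"
   unfolding 1 by (simp add: ac_simps)
  have 3: "(\<Sum>k\<in>insert k0 K. sx (if k = k0 then \<omega> j else \<beta> k j) * (if k = k0 then ls i else (\<Sum>i. Tv i * sx (\<gamma> k i)))) =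
    sx (\<omega> j) * ls i + (\<Sum>k\<in>K. sx (\<beta> k j) * (\<Sum>i. Tv i * sx (\<gamma> k i)))"
  proof -
   have "(\<Sum>k\<in>K. sx (if k = k0 then \<omega> j else \<beta> k j) * (if k = k0 then ls i else (\<Sum>i. Tv i * sx (\<gamma> k i)))) =
     (\<Sum>k\<in>K. sx (\<beta> k j) * (\<Sum>i. Tv i * sx (\<gamma> k i)))" using k0 by (intro sum.cong) auto
   thus ?thesis unfolding sum.insert[OF fK k0] by simp
  qed
  show "sx s * Tv j - (\<Sum>k\<in>insert k0 K. sx (if k = k0 then \<omega> j else \<beta> k j) * (if k = k0 then ls i else (\<Sum>i. Tv i * sx (\<gamma> k i)))) \<in> Q"
   unfolding 2 3 using ls Q(2)
   by (auto simp: intro!: idl_add[OF iQ] idl_sum[OF iQ] idl_multr[OF iQ] idl_mult[OF iQ, of "Ts i"])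
 qed
 thus ?thesis using k0 by simp
qed

text \<open>If \<open>ls i\<close> is not in Q, the fibre may gain a dimension. Where the
  transformed p_i is outside Q, \<open>ls i\<close> is the only generator needed. Otherwise the base
  prime is not minimal over f by the choice of basis, and the lost dimension pays for the gain; on
  the common zeros of the p the bound is that of \<open>locgen\<close>.\<close>

lemma td_link:
 assumes Q: "pr Q" "hideal w1 Q" "sx f \<in> Q" and ls: "!!j. j ~= i ==> ls j \<in> Q"
 shows "td Q \<le> CARD('n)"
proof (cases "ls i \<in> Q")
 case True
 have "ls j \<in> Q" for j using ls True by (cases "j = i") auto
 hence "L \<subseteq> Q" unfolding L_ls using Q by (intro gen_least pr_idl) auto
 thus ?thesis using td_L Q by blast
next
 case False
 let ?P = "sx -` Q :: ('n, 'k) mpoly set"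
 have P: "pr ?P" "hideal w1 ?P" "f \<in> ?P"
  using Q by (auto simp: pr_vimage ring_map_sub hideal_vimage_sx)
 have T: "Ts i \<in> Q" by (rule Ts_in[OF Q(1) ls False])
 have "ALL j. j ~= i --> ls j \<in> Q" using ls by blast
 note fib = td_fibre_ls[where i = i, OF Q(1,3) this T]
 have P1: "td ?P + 1 \<le> CARD('n)" by (rule td_sx_less[OF Q(1,3)])
 let ?ps = "\<Sum>j. const (\<sigma> i j) * p j"
 show ?thesis
 proof (cases "sx ?ps \<in> Q")
  case False
  have "EX w c. ALL a. (if a = j then ?ps else 0) = (\<Sum>k\<in>{}. 0 * 0) + (\<Sum>l. psi a l * w l) + f * c a + p j * const (\<sigma> i a)" for j
  proof -
   have "(\<Sum>a. p a * ((if a = j then ?ps else 0) - p j * const (\<sigma> i a))) = 0"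
    by (simp add: right_diff_distrib sum_subtractf if_distrib[of "%x. _ * x"] sum_distrib_left ac_simps cong: if_cong)
   hence "(\<Sum>a. p a * ((if a = j then ?ps else 0) - p j * const (\<sigma> i a))) \<in> gen {f}" using idl_0[OF idl_gen] by simp
   then obtain w c where "!!a. (if a = j then ?ps else 0) - p j * const (\<sigma> i a) = (\<Sum>l. psi a l * w l) + f * c a"
    unfolding syz by blast
   hence "(if a = j then ?ps else 0) = (\<Sum>k\<in>{}. 0 * 0) + (\<Sum>l. psi a l * w l) + f * c a + p j * const (\<sigma> i a)" for a
    by (simp only: diff_eq_eq) simp
   thus ?thesis by blast
  qed
  from fib[OF False _ this] P1 show ?thesis by simp
 next
  case True
  hence "?P ~: bad" using good by auto
  hence P2: "td ?P + 1 < CARD('n)" using P by (simp add: bad_def)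
  show ?thesis
  proof (cases "ALL k. p k \<in> ?P")
   case False
   then obtain k where k: "sx (p k) ~: Q" by auto
   have "EX w c. ALL a. (if a = j then p k else 0) = (\<Sum>k\<in>{k}. p j * (if a = k then 1 else 0)) + (\<Sum>l. psi a l * w l) + f * c a + 0 * const (\<sigma> i a)" for j
    using koszul_relation[of j k] by (simp add: if_distrib[of "%x. _ * x"] cong: if_cong)
   from fib[OF k _ this] P2 N2 show ?thesis by simp
  next
   case pP: True
   show ?thesis
   proof (cases "ALL v. xv v \<in> Q")
    case True thus ?thesis using td_all_x Q by blast
   next
    case False
    then obtain v where v: "var v ~: ?P" by (auto simp: sub_simps)
    obtain K :: "'n set" and \<gamma> \<beta> s where K: "card K + td ?P + 1 \<le> CARD('n)" "s ~: ?P"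
     "!!j. EX w c. ALL i. (if i = j then s else 0) = (\<Sum>k\<in>K. \<beta> k j * \<gamma> k i) + (\<Sum>l. psi i l * w l) + f * c i"
     by (rule locgen_prime[OF P pP[rule_format] v]) (rule that; assumption)
    have "EX w c. ALL a. (if a = j then s else 0) = (\<Sum>k\<in>K. \<beta> k j * \<gamma> k a) + (\<Sum>l. psi a l * w l) + f * c a + 0 * const (\<sigma> i a)" for j
     using K(3)[of j] by simp
    from fib[OF _ _ this] K(1,2) show ?thesis by simp
   qed
  qed
 qed
qed

text \<open>\<open>Ts i\<close> multiplies L into the complete intersection without
  \<open>ls i\<close>. That one is unmixed, so \<open>Ts i * h\<close> lies in it. Hence every T
  carries h into L, and this torsion is removed in T-degree zero by \<open>reg\<close> and in
  positive T-degree by the Tate complex.\<close>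

lemma unmixed:
 assumes E: "!!g. g \<in> E ==> EX d. homog w1 d g" "!!g. g \<in> E ==> EX N. g ^ N * h \<in> L"
  and dim: "!!Q. pr Q ==> hideal w1 Q ==> L Un E \<subseteq> Q ==> td Q < CARD('n)"
 shows "h \<in> L"
proof -
 let ?n = "CARD('n)"
 let ?w = "case_sum (%_. 0) w1 :: 'n + 'n => nat"
 obtain en :: "nat => 'n" where en: "bij_betw en {0..<?n} UNIV" using ex_bij_betw_nat_finite[OF finite] by blast
 hence en_inj: "inj_on en {..<?n}" and en_img: "en ` {..<?n} = UNIV" by (auto simp: bij_betw_def atLeast0LessThan)
 define b where "b j = (if j < ?n then ls (en j) else sx f)" for j
 have img: "b ` ({..?n} - {i}) = insert (sx f) (ls ` (UNIV - {en i}))" if "i < ?n" for i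
 proof -
  have "{..?n} - {i} = insert ?n ({..<?n} - {i})" using that by auto
  moreover have "b ` ({..<?n} - {i}) = ls ` en ` ({..<?n} - {i})" by (auto simp: b_def image_iff)
  moreover have "en ` ({..<?n} - {i}) = UNIV - {en i}"
   using inj_on_image_set_diff[OF en_inj, of "{..<?n}" "{i}"] that en_img by simp
  ultimately have "b ` ({..?n} - {i}) = insert (b ?n) (ls ` (UNIV - {en i}))" by (metis image_insert)
  thus ?thesis by (simp add: b_def)
 qed
 have imgL: "gen (b ` {..?n}) = L"
 proof -
  have "b ` {..?n} = insert (sx f) (ls ` en ` {..<?n})" by (auto simp: b_def image_iff lessThan_Suc_atMost[symmetric] less_Suc_eq)
  thus ?thesis by (simp add: L_ls en_img)
 qed
 have hom: "homog w1 (if i < ?n then 2 else m) (b i) & (if i < ?n then 2 else m) \<ge> 1" for i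
  using ls_homog m by (simp add: b_def homog_sx[OF f_homog])
 have c: "?n = card ({..?n} - {i})" "?n \<le> CARD('n + 'n)" "CARD('n + 'n) - ?n = ?n" if "i < ?n" for i using that by simp_all
 have dim1: "\<not> ind Q (Suc (CARD('n + 'n) - ?n))" if i: "i < ?n" and Q: "pr Q" "hideal w1 Q" "b ` ({..?n} - {i}) \<subseteq> Q" for i Q
 proof
  assume "ind Q (Suc (CARD('n + 'n) - ?n))"
  hence "Suc ?n \<le> td Q" unfolding c(3)[OF i] by (rule le_td[OF Q(1)])
  moreover have "td Q \<le> ?n" by (rule td_link[OF Q(1,2), of "en i"]) (use Q(3) in \<open>auto simp: img[OF i]\<close>)
  ultimately show False by simp
 qed
 have exact: "koszul_exact ({..?n} - {i}) b" if i: "i < ?n" for i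
  by (rule complete_intersection_koszul[where a = b and d = "%i. if i < ?n then 2 else m", OF inf _ c(1,2)[OF i]]) (use hom dim1[OF i] in auto)
 have Ts_h: "Ts (en i) * h \<in> L" if i: "i < ?n" for i
 proof -
  let ?b = "b ` ({..?n} - {i})"
  have "Ts (en i) * ls (en i) \<in> gen ?b"
  proof -
   have eq: "Ts (en i) * ls (en i) = - (\<Sum>j\<in>UNIV - {en i}. Ts j * ls j)"
    using sum_Ts_ls sum.remove[of UNIV "en i" "%j. Ts j * ls j"] by (simp add: eq_neg_iff_add_eq_0)
   have "Ts j * ls j \<in> gen ?b" if "j \<in> UNIV - {en i}" for j
    unfolding img[OF i] by (intro idl_mult[OF idl_gen] genI) (use that in simp)
   thus ?thesis unfolding eq by (rule idl_minus[OF idl_gen idl_sum[OF idl_gen]])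
  qed
  hence TL: "Ts (en i) * F \<in> gen ?b" if "F \<in> L" for F
  proof (intro gen_insert_range_mult[OF idl_gen _ _ that[unfolded L_ls]])
   show "Ts (en i) * sx f \<in> gen ?b" unfolding img[OF i] by (intro idl_mult[OF idl_gen] genI) simp
   fix j assume *: "Ts (en i) * ls (en i) \<in> gen ?b"
   show "Ts (en i) * ls j \<in> gen ?b"
   proof (cases "j = en i")
    case False
    thus ?thesis unfolding img[OF i] by (intro idl_mult[OF idl_gen] genI) simp
   qed (use * in simp)
  qed
  have "Ts (en i) * h \<in> gen ?b"
  proof (rule complete_intersection_unmixed[where a = b and d = "%i. if i < ?n then 2 else m" and E = "insert (ls (en i)) E", OF inf _ c(1,2)[OF i]])
   fix g assume g: "g \<in> insert (ls (en i)) E"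
   show "EX e. homog w1 e g" using g E(1) ls_homog by blast
   show "EX M. g ^ M * (Ts (en i) * h) \<in> gen ?b"
   proof (cases "g = ls (en i)")
    case True
    have "g ^ 1 * (Ts (en i) * h) = h * (Ts (en i) * ls (en i))" by (simp add: True ac_simps)
    thus ?thesis using TL[OF ls_L] idl_mult[OF idl_gen] by metis
   next
    case False
    then obtain N where "g ^ N * h \<in> L" using g E(2) by blast
    from TL[OF this] show ?thesis by (auto simp: ac_simps)
   qed
  next
   fix Q assume Q: "pr Q" "hideal w1 Q" "?b Un insert (ls (en i)) E \<subseteq> Q"
   have "L \<subseteq> Q" unfolding L_ls
   proof (intro gen_least pr_idl[OF Q(1)] subsetI)
    fix x assume "x \<in> insert (sx f) (range ls)"
    thus "x \<in> Q" using Q(3) img[OF i] by (cases "x = ls (en i)") auto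
   qed
   hence "td Q < ?n" using dim Q by simp
   thus "\<not> ind Q (CARD('n + 'n) - ?n)" unfolding c(3)[OF i] using le_td[OF Q(1)] by fastforce
  qed (use hom dim1[OF i] in auto)
  moreover have "gen ?b \<subseteq> L" unfolding imgL[symmetric] by (rule gen_mono) auto
  ultimately show ?thesis by blast
 qed
 have Tv_h: "Tv j * h \<in> L" for j
 proof -
  have "Ts i * h \<in> L" for i using Ts_h en_img by (metis UNIV_I imageE lessThan_iff)
  thus ?thesis unfolding Tv_Ts[of j] sum_distrib_right
   by (intro idl_sum[OF idl_L]) (simp add: mult.assoc idl_mult[OF idl_L])
 qed
 have wl: "homog ?w 1 (l j)" for j
 proof -
  have "homog ?w (1 + 0) (Tv i * sx (psi i j))" for i
   using homog_var[of ?w "Inr i"] by (intro homog_mult homog_T_sx) simp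
  thus ?thesis unfolding l_def by (intro homog_sum) simp
 qed
 have wf: "homog ?w 0 (sx f)" by (rule homog_T_sx)
 have hL: "hideal ?w L" unfolding L_def by (rule hideal_gen) (use wl wf in blast)
 have Tv_hc: "Tv j * hcomp ?w e h \<in> L" for j e
 proof -
  have "hcomp ?w (Suc e) (Tv j * h) \<in> L" using hL Tv_h by (simp add: hideal_def)
  thus ?thesis by (simp add: hcomp_mult_homog[OF homog_var])
 qed
 have "hcomp ?w e h \<in> L" for e
 proof (cases "e = 0")
  case True
  define r where "r = sub (case_sum var (%_. 0)) h"
  have "r * p j \<in> gen {f}" for j
  proof -
   \<comment> \<open>Evaluation at T = p sends L into (f) and T_j r to p_j r, so that
     \<open>reg\<close> applies to r.\<close>
   let ?\<theta> = "sub (case_sum var p)"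
   have "L \<subseteq> ?\<theta> -` gen {f}"
    unfolding L_def
   proof (intro gen_least idl_vimage ring_map_sub idl_gen subsetI)
    have sxi: "?\<theta> (sx G) = G" for G by (simp add: sub_sub sub_simps sub_var)
    fix F assume "F \<in> insert (sx f) (range l)"
    then consider "F = sx f" | a where "F = l a" by blast
    thus "F \<in> ?\<theta> -` gen {f}"
    proof cases
     case 1 thus ?thesis by (simp add: sxi genI)
    next
     case (2 a)
     have "(\<Sum>i. p i * psi i a) \<in> gen {f}"
      unfolding syz by (rule exI[of _ "%j. if j = a then 1 else 0"], rule exI[of _ "%_. 0"])
       (simp add: if_distrib[of "%x. _ * x"] cong: if_cong)
     thus ?thesis by (simp add: 2 l_def sub_simps sxi)
    qed
   qed
   moreover have "Tv j * sx r \<in> L" using Tv_hc[of j 0] by (simp add: hcomp_T_zero r_def)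
   ultimately have "?\<theta> (Tv j * sx r) \<in> gen {f}" by blast
   thus ?thesis by (simp add: sub_simps sub_sub sub_var mult.commute)
  qed
  hence "r \<in> gen {f}" by (rule reg)
  hence "sx r \<in> L" using gen_least[OF idl_vimage[OF ring_map_sub idl_L], of "{f}"] f_L by blast
  thus ?thesis by (simp add: True hcomp_T_zero r_def)
 next
  case False
  \<comment> \<open>\<theta> turns the \<open>Ts i\<close> into variables, the form in which the
    torsion lemma is stated; \<theta>' is its inverse.\<close>
  let ?\<theta> = "sub (case_sum xv (%j. \<Sum>i. const (\<tau> j i) * Tv i)) :: ('n + 'n, 'k) mpoly => ('n + 'n, 'k) mpoly"
  let ?\<theta>' = "sub (case_sum xv Ts) :: ('n + 'n, 'k) mpoly => ('n + 'n, 'k) mpoly"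
  have \<theta>Ts: "?\<theta> (Ts i) = Tv i" for i
  proof -
   have "?\<theta> (Ts i) = (\<Sum>k. (\<Sum>j. const (\<sigma> i j) * const (\<tau> j k)) * Tv k)"
    unfolding Ts_def sub_simps sum_distrib_right by (subst sum.swap) (simp add: sub_simps sum_distrib_left ac_simps)
   thus ?thesis unfolding const_\<sigma>\<tau> by (simp add: if_distrib[of "%x. x * _"] cong: if_cong)
  qed
  have \<theta>\<theta>': "?\<theta> (?\<theta>' F) = F" for F
  proof -
   have "?\<theta> (case_sum xv Ts v) = var v" for v by (cases v) (simp_all add: sub_simps \<theta>Ts)
   thus ?thesis by (simp add: sub_sub sub_var)
  qed
  have \<theta>'\<theta>: "?\<theta>' (?\<theta> F) = F" for F
  proof -
   have "?\<theta>' (case_sum xv (%j. \<Sum>i. const (\<tau> j i) * Tv i) v) = var v" for v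
    by (cases v) (simp_all add: sub_simps Tv_Ts[symmetric])
   thus ?thesis by (simp add: sub_sub sub_var)
  qed
  have \<theta>h: "homog ?w d (?\<theta> F)" if "homog ?w d F" for d F
  proof (rule homog_sub[of ?w ?w, OF _ that])
   fix v show "homog ?w (?w v) (case_sum xv (%j. \<Sum>i. const (\<tau> j i) * Tv i) v)"
    using homog_mult[OF homog_const homog_var[of ?w "Inr _"]] homog_var[of ?w v]
    by (cases v) (auto intro!: homog_sum)
  qed
  have wls: "homog ?w 1 (ls j)" for j
   unfolding ls_def using homog_mult[OF homog_const wl] by (intro homog_sum) simp
  have mem: "?\<theta> F \<in> gen ((%i. ?\<theta> (b i)) ` {..?n})" if "F \<in> L" for F
  proof -
   have "idl (?\<theta> -` gen ((%i. ?\<theta> (b i)) ` {..?n}))" by (intro idl_vimage ring_map_sub idl_gen)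
   hence "gen (b ` {..?n}) \<subseteq> ?\<theta> -` gen ((%i. ?\<theta> (b i)) ` {..?n})" by (rule gen_least) (auto intro!: genI)
   thus ?thesis using that unfolding imgL by blast
  qed
  have "?\<theta> (hcomp ?w e h) \<in> gen ((%i. ?\<theta> (b i)) ` {..?n})"
  proof (rule almost_complete_intersection_torsion[where Tn = "%i. Inr (en i)" and w = ?w and e = e])
   show "inj_on (%i. Inr (en i) :: 'n + 'n) {..<?n}" using en_inj by (simp add: inj_on_def)
   show "?n \<ge> 1" using N2 by simp
   show "?w v = (if v \<in> (%i. Inr (en i)) ` {..<?n} then 1 else 0)" for v
   proof (cases v)
    case (Inr j)
    have "j \<in> en ` {..<?n}" using en_img by simp
    thus ?thesis using Inr by auto
   qed auto
   show "homog ?w 1 (?\<theta> (b i))" if "i < ?n" for i using that \<theta>h[OF wls] by (simp add: b_def)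
   show "homog ?w 0 (?\<theta> (b ?n))" using \<theta>h[OF wf] by (simp add: b_def)
   show "koszul_exact ({..?n} - {i}) (%i. ?\<theta> (b i))" if "i < ?n" for i
    by (rule koszul_exact_automorphism[OF ring_map_sub ring_map_sub \<theta>\<theta>' \<theta>'\<theta> exact[OF that]])
   show "homog ?w e (?\<theta> (hcomp ?w e h))" by (rule \<theta>h[OF homog_hcomp])
   show "e \<ge> 1" using False by simp
   show "Tv (en i) * ?\<theta> (hcomp ?w e h) \<in> gen ((%i. ?\<theta> (b i)) ` {..?n})" if "i < ?n" for i
   proof -
    have "Ts (en i) * hcomp ?w e h \<in> L" unfolding Ts_def sum_distrib_right
     by (intro idl_sum[OF idl_L]) (simp add: mult.assoc idl_mult[OF idl_L] Tv_hc)
    from mem[OF this] show ?thesis unfolding sub_simps(4) \<theta>Ts by (simp add: sub_simps \<theta>Ts)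
   qed
   have "(\<Sum>i<?n. Tv (en i) * ?\<theta> (b i)) = ?\<theta> (\<Sum>i<?n. Ts (en i) * ls (en i))"
    unfolding sub_simps by (intro sum.cong) (auto simp: \<theta>Ts b_def)
   also have "(\<Sum>i<?n. Ts (en i) * ls (en i)) = (\<Sum>j. Ts j * ls j)"
    using sum.reindex_bij_betw[OF en, of "%j. Ts j * ls j"] by (simp add: atLeast0LessThan)
   finally show "(\<Sum>i<?n. Tv (en i) * ?\<theta> (b i)) = 0" by (simp add: sum_Ts_ls sub_simps)
  qed
  moreover have "gen ((%i. ?\<theta> (b i)) ` {..?n}) \<subseteq> ?\<theta>' -` L"
  proof (intro gen_least idl_vimage ring_map_sub idl_L subsetI)
   fix x assume "x \<in> (%i. ?\<theta> (b i)) ` {..?n}"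
   then obtain i where "i \<le> ?n" "x = ?\<theta> (b i)" by auto
   thus "x \<in> ?\<theta>' -` L" using genI[of "b i" "b ` {..?n}"] imgL by (simp add: \<theta>'\<theta>)
  qed
  ultimately have "?\<theta> (hcomp ?w e h) \<in> ?\<theta>' -` L" by blast
  thus ?thesis by (simp add: \<theta>'\<theta>)
 qed
 thus ?thesis by (rule hideal_hcompI[OF hL])
qed

end

lemma (in linear_gorenstein) unmixed_L:
 assumes E: "!!g. g \<in> E ==> EX d. homog w1 d g" "!!g. g \<in> E ==> EX N. g ^ N * h \<in> L"
  and dim: "!!Q. pr Q ==> hideal w1 Q ==> L Un E \<subseteq> Q ==> td Q < CARD('n)"
 shows "h \<in> L"
proof -
 obtain \<sigma> \<tau> :: "'n => 'n => 'k" where "ALL i k. (\<Sum>j. \<sigma> i j * \<tau> j k) = (if i = k then 1 else 0)"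
   "ALL i k. (\<Sum>j. \<tau> i j * \<sigma> j k) = (if i = k then 1 else 0)"
   "ALL i. ALL P:bad. (\<Sum>j. const (\<sigma> i j) * p j) ~: P"
  using good_basis by blast
 then interpret linear_gorenstein_basis f m e psi p \<sigma> \<tau>
  by (intro linear_gorenstein_basis.intro linear_gorenstein_axioms linear_gorenstein_basis_axioms.intro) auto
 show ?thesis by (rule unmixed[OF E dim])
qed

section \<open>Dimension before adding the hypersurface\<close>

context linear_gorenstein
begin

text \<open>If the identity holds modulo \<open>f\<close> only, multiply with the adjugate of \<open>s - f C\<close>.\<close>

lemma relation_without_f:
 fixes K :: "'n set"
 assumes rel: "!!j. EX w c. ALL i. (if i = j then s else 0) = (\<Sum>k\<in>K. \<beta> k j * \<gamma> k i) + (\<Sum>l. psi i l * w l) + f * c i"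
  and P: "pr P" "f \<in> P" "s ~: P"
 shows "EX \<delta> \<beta>'. \<delta> ~: P & (ALL j. sx \<delta> * Tv j - (\<Sum>k\<in>K. sx (\<beta>' k j) * (\<Sum>i. Tv i * sx (\<gamma> k i))) \<in> L0)"
proof -
 have "ALL j. EX w. EX c. ALL i. (if i = j then s else 0) = (\<Sum>k\<in>K. \<beta> k j * \<gamma> k i) + (\<Sum>l. psi i l * w l) + f * c i"
  using rel by blast
 from choice[OF this] obtain w where
  "ALL j. EX c. ALL i. (if i = j then s else 0) = (\<Sum>k\<in>K. \<beta> k j * \<gamma> k i) + (\<Sum>l. psi i l * w j l) + f * c i"
  by auto
 from choice[OF this] obtain c where
  wc: "!!j i. (if i = j then s else 0) = (\<Sum>k\<in>K. \<beta> k j * \<gamma> k i) + (\<Sum>l. psi i l * w j l) + f * c j i"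
  by auto
 define M :: "('n, 'k) mpoly ^ 'n ^ 'n" where "M = (\<chi> i j. (if i = j then s else 0) - f * c j i)"
 have M: "M $ i $ j = (\<Sum>k\<in>K. \<beta> k j * \<gamma> k i) + (\<Sum>l. psi i l * w j l)" for i j
  unfolding M_def by (simp add: wc[of i j])
 define N :: "('n, 'k) mpoly ^ 'n ^ 'n" where "N = (\<chi> i j. if i = j then s else 0)"
 have "det M - det N \<in> P"
 proof (rule det_cong_idl[OF pr_idl[OF P(1)]])
  have "f * c j i \<in> P" for i j using idl_multr[OF pr_idl[OF P(1)] P(2)] by blast
  thus "M $ i $ j - N $ i $ j \<in> P" for i j
   using idl_minus[OF pr_idl[OF P(1)], of "f * c j i"] by (simp add: M_def N_def)
 qed
 moreover have "det N = s ^ CARD('n)" by (subst det_diagonal) (auto simp: N_def)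
 moreover have "s ^ CARD('n) ~: P" using pr_power[OF P(1)] P(3) by blast
 ultimately have d: "det M ~: P" using idl_diff[OF pr_idl[OF P(1)], of "det M" "det M - s ^ CARD('n)"] by auto
 define \<beta>' where "\<beta>' k j = (\<Sum>j'. \<beta> k j' * cof M j j')" for k j
 have "sx (det M) * Tv j - (\<Sum>k\<in>K. sx (\<beta>' k j) * (\<Sum>i. Tv i * sx (\<gamma> k i))) \<in> L0" for j
 proof -
  have "(if i = j then det M else 0) = (\<Sum>k\<in>K. \<beta>' k j * \<gamma> k i) + (\<Sum>l. psi i l * (\<Sum>j'. w j' l * cof M j j')) + f * 0" for i
  proof -
   have "(\<Sum>k\<in>K. \<beta>' k j * \<gamma> k i) = (\<Sum>j'. (\<Sum>k\<in>K. \<beta> k j' * \<gamma> k i) * cof M j j')"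
    unfolding \<beta>'_def sum_distrib_right by (subst sum.swap) (simp add: ac_simps)
   moreover have "(\<Sum>l. psi i l * (\<Sum>j'. w j' l * cof M j j')) = (\<Sum>j'. (\<Sum>l. psi i l * w j' l) * cof M j j')"
    unfolding sum_distrib_left sum_distrib_right by (subst sum.swap) (simp add: ac_simps)
   ultimately show ?thesis
    using row_cof[of M i j] unfolding M by (simp add: distrib_right sum.distrib)
  qed
  from T_dot[OF this] have "sx (det M) * Tv j - (\<Sum>k\<in>K. sx (\<beta>' k j) * (\<Sum>i. Tv i * sx (\<gamma> k i))) =
    (\<Sum>ja. l ja * sx (\<Sum>j'. w j' ja * cof M j j'))"
   unfolding T_dot_unit by (simp add: sub_simps)
  thus ?thesis by (simp add: idl_sum[OF idl_L0] idl_multr[OF idl_L0] l_L0)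
 qed
 thus ?thesis using d by blast
qed

text \<open>Cut the base of Q with f: a prime P1 over it loses at most one dimension, the local
  relations hold there, and \<open>relation_without_f\<close> frees them from f. Only a prime with
  zero contraction can reach n + 1, and then the T are proportional up to a nonzero factor
  s.\<close>

lemma td_L0:
 assumes Q: "pr Q" "hideal w1 Q" "L0 \<subseteq> Q" and x: "xv v ~: Q"
 shows "td Q \<le> CARD('n) \<or> sx -` Q = {0 :: ('n, 'k) mpoly} & td Q \<le> CARD('n) + 1 &
  (EX s \<beta> \<eta>. s ~= 0 & (ALL j. sx s * Tv j - sx (\<beta> j) * \<eta> \<in> L0))"
proof (cases "sx f \<in> Q")
 case True
 hence "L \<subseteq> Q" using Q l_L0 unfolding L_def by (intro gen_least pr_idl) auto
 thus ?thesis using td_L Q by blast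
next
 case False
 let ?P = "sx -` Q :: ('n, 'k) mpoly set"
 have P: "pr ?P" "hideal w1 ?P" "f ~: ?P" "var v ~: ?P"
  using Q False x by (auto simp: pr_vimage ring_map_sub hideal_vimage_sx sub_simps)
 obtain P1 where P1: "pr P1" "hideal w1 P1" "?P \<subseteq> P1" "f \<in> P1" "td ?P \<le> Suc (td P1)"
  using prime_over_hypersurface[OF inf P(1,2) f_homog m] by blast
 show ?thesis
 proof (cases "ALL v. var v \<in> P1")
  \<comment> \<open>All variables lie in P1, so the base has dimension at most one. An entry psi i j
    outside the base prime lets l_j and l_i eliminate T_i and T_j.\<close>
  case True
  hence "td P1 = 0" using td_max P1 by blast
  hence tP: "td ?P \<le> 1" using P1 by simp
  have "EX i j. psi i j ~: ?P"
  proof (rule ccontr)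
   assume "\<not> ?thesis"
   hence "gen (range (%(i, j). psi i j)) \<subseteq> ?P" using P(1) by (intro gen_least pr_idl) auto
   thus False using psi_max P(4) by blast
  qed
  then obtain i j where ij: "psi i j ~: ?P" by blast
  hence ne: "i ~= j" using psi_diag[of i] idl_0[OF pr_idl[OF P(1)]] by auto
  let ?K = "UNIV - {i, j}"
  have split: "(\<Sum>a. g a) = g i + g j + (\<Sum>a\<in>?K. g a)" for g :: "'n => ('n + 'n, 'k) mpoly"
  proof -
   have "sum g (insert i (insert j ?K)) = g i + g j + sum g ?K" using ne by (simp add: add.assoc)
   moreover have "insert i (insert j ?K) = UNIV" by blast
   ultimately show ?thesis by simp
  qed
  have lj: "sx (psi i j) * Tv i + (\<Sum>a\<in>?K. Tv a * sx (psi a j)) = l j"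
   unfolding l_def split by (simp add: psi_diag sub_simps mult.commute)
  have li: "sx (psi i j) * Tv j - (\<Sum>a\<in>?K. Tv a * sx (psi a i)) = - l i"
  proof -
   have "l i = Tv j * sx (psi j i) + (\<Sum>a\<in>?K. Tv a * sx (psi a i))"
    unfolding l_def split by (simp add: psi_diag sub_simps)
   moreover have "psi j i = - psi i j" by (rule psi_alt)
   ultimately show ?thesis by (simp add: sub_simps)
  qed
  have "td Q \<le> td ?P + card ?K"
  proof (rule td_le_fibre[OF Q(1), where s = "psi i j" and \<eta> = Tv and
     \<beta> = "%k a. if a = i then - psi k j else if a = j then psi k i else if a = k then psi i j else 0"])
   show "sx (psi i j) ~: Q" using ij by simp
   fix a
   consider "a = i" | "a = j" "a ~= i" | "a \<in> ?K" by blast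
   thus "sx (psi i j) * Tv a - (\<Sum>k\<in>?K. sx (if a = i then - psi k j else if a = j then psi k i else if a = k then psi i j else 0) * Tv k) \<in> Q"
   proof cases
    case 1
    hence "sx (psi i j) * Tv a - (\<Sum>k\<in>?K. sx (if a = i then - psi k j else if a = j then psi k i else if a = k then psi i j else 0) * Tv k) = l j"
     unfolding lj[symmetric] by (simp add: sub_simps sum_negf mult.commute)
    thus ?thesis using l_L0 Q(3) by auto
   next
    case 2
    hence "sx (psi i j) * Tv a - (\<Sum>k\<in>?K. sx (if a = i then - psi k j else if a = j then psi k i else if a = k then psi i j else 0) * Tv k) = - l i"
     unfolding li[symmetric] by (simp add: sub_simps mult.commute)
    thus ?thesis using l_L0 Q(3) idl_minus[OF pr_idl[OF Q(1)]] by auto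
   next
    case 3
    hence "(\<Sum>k\<in>?K. sx (if a = i then - psi k j else if a = j then psi k i else if a = k then psi i j else 0) * Tv k) =
     (\<Sum>k\<in>?K. if k = a then sx (psi i j) * Tv a else 0)" by (intro sum.cong) (auto simp: sub_simps)
    also have "\<dots> = sx (psi i j) * Tv a" using 3 by (subst sum.delta) auto
    finally show ?thesis using idl_0[OF pr_idl[OF Q(1)]] by simp
   qed
  qed
  moreover have "card ?K = CARD('n) - 2" using ne by (subst card_Diff_subset) auto
  ultimately show ?thesis using tP N2 by linarith
 next
  case False
  then obtain v1 where v1: "var v1 ~: P1" by blast
  show ?thesis
  proof (cases "ALL k. p k \<in> P1")
   case True
   obtain K :: "'n set" and \<gamma> \<beta> s where K: "card K + td P1 + 1 \<le> CARD('n)" "s ~: P1"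
    "!!j. EX w c. ALL i. (if i = j then s else 0) = (\<Sum>k\<in>K. \<beta> k j * \<gamma> k i) + (\<Sum>l. psi i l * w l) + f * c i"
    by (rule locgen_prime[OF P1(1,2,4) True[rule_format] v1]) (rule that; assumption)
   obtain \<delta> \<beta>' where \<delta>: "\<delta> ~: P1" "!!j. sx \<delta> * Tv j - (\<Sum>k\<in>K. sx (\<beta>' k j) * (\<Sum>i. Tv i * sx (\<gamma> k i))) \<in> L0"
    using relation_without_f[OF K(3) P1(1,4) K(2)] by blast
   have "td Q \<le> td ?P + card K"
    by (rule td_le_fibre[OF Q(1), where s = \<delta> and \<beta> = \<beta>' and \<eta> = "%k. \<Sum>i. Tv i * sx (\<gamma> k i)"])
     (use \<delta> P1(3) Q(3) in auto)
   thus ?thesis using P1(5) K(1) by linarith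
  next
   case False
   then obtain k where k: "p k ~: P1" by blast
   have "EX w c. ALL i. (if i = j then p k else 0) = (\<Sum>b\<in>{k}. p j * (if i = b then 1 else 0)) + (\<Sum>a. psi i a * w a) + f * c i" for j
    using koszul_relation[of j k] by (simp add: if_distrib[of "%x. _ * x"] cong: if_cong)
   from relation_without_f[OF this P1(1,4) k] obtain \<delta> and \<beta>' :: "'n => 'n => ('n, 'k) mpoly" where \<delta>: "\<delta> ~: P1"
    "!!j. sx \<delta> * Tv j - (\<Sum>b\<in>{k}. sx (\<beta>' b j) * (\<Sum>i. Tv i * sx (if i = b then 1 else 0))) \<in> L0"
    by blast
   have tQ: "td Q \<le> td ?P + card {k}"
    by (rule td_le_fibre[OF Q(1), where s = \<delta> and \<beta> = \<beta>' and \<eta> = "%b. \<Sum>i. Tv i * sx (if i = b then 1 else 0)"])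
     (use \<delta> P1(3) Q(3) in auto)
   show ?thesis
   proof (cases "?P = {0}")
    case True
    have "\<delta> ~= 0" using \<delta>(1) idl_0[OF pr_idl[OF P1(1)]] by auto
    moreover have "sx \<delta> * Tv j - sx (\<beta>' k j) * (\<Sum>i. Tv i * sx (if i = k then 1 else 0)) \<in> L0" for j
     using \<delta>(2)[of j] by simp
    ultimately have "EX s \<beta> \<eta>. s ~= 0 & (ALL j. sx s * Tv j - sx (\<beta> j) * \<eta> \<in> L0)"
     by (intro exI[of _ \<delta>] exI[of _ "\<beta>' k"] exI[of _ "\<Sum>i. Tv i * sx (if i = k then 1 else 0)"]) blast
    thus ?thesis using True tQ td_le[OF P(1)] by auto
   next
    case False
    then obtain F where "F \<in> ?P" "F ~= 0" using idl_0[OF pr_idl[OF P(1)]] by blast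
    hence "td ?P + 1 \<le> CARD('n)" using td_nonzero[OF P(1)] by blast
    thus ?thesis using tQ by simp
   qed
  qed
 qed
qed

end

section \<open>The Jacobian dual and its cofactors\<close>

lemma homogeneous_iff: "homogeneous d F <-> homog w1 d F"
proof -
 have "sum (lk t) UNIV = sum (lk t) (keys t)" for t :: "'a \<Rightarrow>\<^sub>0 nat"
  by (rule sum.mono_neutral_right) (auto simp: in_keys_iff)
 thus ?thesis by (simp add: homog_iff homogeneous_def total_degree_def)
qed

lemma mem_gen_single: "F \<in> gen {a} <-> (EX r. F = r * (a :: 'a::comm_ring_1))"
 using gen_image[of "{()}" "%_. a"] by auto

lemma var_mult_eq_0: "var v * F = 0 ==> (F :: ('v::finite, 'k::field) mpoly) = 0"
 using mpoly_mult_eq_0[of "var v" F] by (simp add: var_neq_0)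

lemma var_dvd:
 fixes C D :: "('v::finite, 'k::field) mpoly"
 assumes "i ~= j" "var i * C = var j * D" shows "EX E. C = var j * E"
proof -
 let ?h = "sub (%v. if v = j then 0 else var v) :: ('v, 'k) mpoly => ('v, 'k) mpoly"
 have "?h (var i * C) = ?h (var j * D)" using assms by simp
 hence "var i * ?h C = 0" using assms(1) by (simp add: sub_simps)
 hence "?h C = 0" by (rule var_mult_eq_0)
 moreover have "C - ?h C \<in> gen {var j}"
  by (rule ring_map_cong_idl[OF ring_map_id ring_map_sub idl_gen]) (auto simp: sub_simps genI idl_0[OF idl_gen])
 ultimately show ?thesis by (auto simp: mem_gen_single mult.commute)
qed

lemma det_ring_map:
 assumes "ring_map h" shows "det (\<chi> i j. h (M $ i $ j)) = h (det (M :: 'a::comm_ring_1^'n^'n))"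
proof -
 have h: "h (of_int (sign p)) = of_int (sign p)" for p :: "'n => 'n"
  by (cases p rule: sign_cases) (simp_all add: ring_map_simps[OF assms])
 show ?thesis by (simp add: det_def ring_map_simps[OF assms] h)
qed

lemma td_zero: "td {0 :: ('v::finite, 'k::field) mpoly} = CARD('v)"
 using ind_vars[of UNIV "{0 :: ('v, 'k) mpoly}"] le_td[OF pr_zero] td_le[OF pr_zero] by (metis finite_class.finite_UNIV le_antisym singletonD)

text \<open>Substituting two vectors that are independent modulo \<open>q\<close> for \<open>x\<close>: \<open>x = s\<^sub>1 v\<^sub>1 + s\<^sub>2 v\<^sub>2\<close>.\<close>

definition line :: "('n => ('m, 'k::comm_ring_1) mpoly) => ('n + 'm, 'k) mpoly => ('m, 'k) mpoly poly" where
 "line v = ev (%c. [:const c:]) (case_sum (%k. [:0, v k:]) (%j. [:var j:]))"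

definition plane :: "('n => ('m, 'k::comm_ring_1) mpoly) => ('n => ('m, 'k) mpoly) => ('n + 'm, 'k) mpoly => ('m, 'k) mpoly poly poly" where
 "plane v w = ev (%c. [:[:const c:]:]) (case_sum (%k. [:[:0, v k:], [:w k:]:]) (%j. [:[:var j:]:]))"

lemma ring_map_line: "ring_map (line v)" unfolding line_def by (rule ring_map_ev[OF ring_map_constC])
lemma ring_map_constCC: "ring_map (%c :: 'k::comm_ring_1. [:[:const c :: ('m, 'k) mpoly:]:])"
 by (rule ring_map_comp[OF ring_map_C ring_map_constC])
lemma ring_map_plane: "ring_map (plane v w)" unfolding plane_def by (rule ring_map_ev[OF ring_map_constCC])

lemma line_simps: "line v (const c) = [:const c:]" "line v (xv k) = [:0, v k:]" "line v (Tv j) = [:var j:]"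
 unfolding line_def by (simp_all add: ev_simps[OF ring_map_constC])
lemma plane_simps: "plane v w (const c) = [:[:const c:]:]" "plane v w (xv k) = [:[:0, v k:], [:w k:]:]" "plane v w (Tv j) = [:[:var j:]:]"
 unfolding plane_def by (simp_all add: ev_simps[OF ring_map_constCC])

lemma line_sT: "line v (sT G) = [:G:]"
 by (rule ring_map_eqI[OF ring_map_comp[OF ring_map_line ring_map_sub] ring_map_C]) (simp_all add: sub_simps line_simps)
lemma plane_sT: "plane v w (sT G) = [:[:G:]:]"
 by (rule ring_map_eqI[OF ring_map_comp[OF ring_map_plane ring_map_sub] ring_map_comp[OF ring_map_C ring_map_C]]) (simp_all add: sub_simps plane_simps)

lemma line_sx:
 assumes "homog w1 d G" shows "line v (sx G) = [:sub v G:] * [:0, 1:] ^ d"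
proof -
 have "line v (sx G) = ev (%c. [:const c:]) (%k. [:v k:] * [:0, 1:] ^ 1) G"
  by (rule ring_map_eqI[OF ring_map_comp[OF ring_map_line ring_map_sub] ring_map_ev[OF ring_map_constC]])
   (simp_all add: sub_simps line_simps ev_simps[OF ring_map_constC])
 also have "\<dots> = ev (%c. [:const c:]) (%k. [:v k:]) G * [:0, 1:] ^ d"
  using ev_homog_scale[OF ring_map_constC assms, of "%k. [:v k:]" "[:0, 1:]"] by simp
 also have "ev (%c. [:const c:]) (%k. [:v k:]) G = [:sub v G:]"
  by (rule ring_map_eqI[OF ring_map_ev[OF ring_map_constC] ring_map_comp[OF ring_map_C ring_map_sub]])
   (simp_all add: sub_simps ev_simps[OF ring_map_constC])
 finally show ?thesis .
qed

lemma ring_map_coeff_0: "ring_map (%p :: 'a::comm_ring_1 poly. coeff p 0)" by (rule ring_mapI) (simp_all add: coeff_mult)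

lemma coeff_plane: "coeff (plane v w F) 0 = line v F"
proof -
 have "coeff (plane v w (var z)) 0 = line v (var z)" for z by (cases z) (simp_all add: line_simps plane_simps)
 from ring_map_eqI[OF ring_map_comp[OF ring_map_coeff_0 ring_map_plane] ring_map_line _ this] show ?thesis by (simp add: line_simps plane_simps)
qed

lemma coeff_line: "coeff (line v F) 0 = sub (case_sum (%_. 0) var) F"
proof -
 have "coeff (line v (var z)) 0 = sub (case_sum (%_. 0) var) (var z)" for z by (cases z) (simp_all add: line_simps sub_simps)
 from ring_map_eqI[OF ring_map_comp[OF ring_map_coeff_0 ring_map_line] ring_map_sub _ this] show ?thesis by (simp add: line_simps sub_simps)
qed

section \<open>Dimension of preimages under lines and planes\<close>

lemma td_project:
 fixes q :: "('m::finite, 'k::field) mpoly set"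
 assumes q: "pr q" shows "td q \<le> td (sub (case_sum (%_ :: 'n::finite. 0) var) -` q)"
proof -
 let ?h = "sub (case_sum (%_ :: 'n. 0) var) :: ('n + 'm, 'k) mpoly => ('m, 'k) mpoly"
 obtain w where w: "alg_indep q w (td q)" using td_ind[OF q] by (auto simp: ind_def)
 have "?h (sub (%i. sT (w i)) G) = sub w G" for G by (simp add: sub_sub sub_simps sub_var)
 hence "alg_indep (?h -` q) (%i. sT (w i)) (td q)" using w by (simp add: alg_indep_def)
 hence "ind (?h -` q) (td q)" by (auto simp: ind_def)
 thus ?thesis by (rule le_td[OF pr_vimage[OF ring_map_sub q]])
qed

text \<open>The preimage under x = s v lies properly inside the preimage under x = 0, and the latter
  already has \<open>td\<close> at least td q.\<close>

lemma td_line: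
 fixes q :: "('m::finite, 'k::field) mpoly set" and v :: "'n::finite => ('m, 'k) mpoly"
 assumes q: "pr q" and v: "v i ~: q" shows "td q + 1 \<le> td (line v -` poly_ext q)"
proof -
 let ?h = "sub (case_sum (%_ :: 'n. 0) var) :: ('n + 'm, 'k) mpoly => ('m, 'k) mpoly"
 have "line v -` poly_ext q \<subseteq> ?h -` q" by (auto simp: poly_ext_def) (metis coeff_line)
 moreover have "xv i \<in> ?h -` q" by (simp add: sub_simps idl_0[OF pr_idl[OF q]])
 moreover have "xv i ~: line v -` poly_ext q"
 proof
  assume "xv i \<in> line v -` poly_ext q"
  hence "ALL a. coeff [:0, v i:] a \<in> q" unfolding poly_ext_def vimage_def mem_Collect_eq line_simps .
  hence "coeff [:0, v i:] (Suc 0) \<in> q" by blast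
  thus False using v by simp
 qed
 ultimately have "line v -` poly_ext q \<subset> ?h -` q" by blast
 from td_strict[OF pr_vimage[OF ring_map_line pr_poly_ext[OF q]] pr_vimage[OF ring_map_sub q] this] td_project[OF q, where 'n = 'n]
 show ?thesis by linarith
qed

text \<open>The equation v_i x_j - v_j x_i vanishes on the line through v but not on the plane of v
  and w, so the preimage for the plane is strictly smaller than that for the line.\<close>

lemma td_plane:
 fixes q :: "('m::finite, 'k::field) mpoly set" and v :: "'n::finite => ('m, 'k) mpoly"
 assumes q: "pr q" and v: "v i * w j - v j * w i ~: q" shows "td q + 2 \<le> td (plane v w -` poly_ext (poly_ext q))"
proof -
 have "v i ~: q \<or> v j ~: q" using v idl_diff[OF pr_idl[OF q]] idl_multr[OF pr_idl[OF q]] by blast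
 hence 1: "td q + 1 \<le> td (line v -` poly_ext q)" using td_line[OF q] by blast
 define F where "F = sT (v i) * xv j - sT (v j) * (xv i :: ('n + 'm, 'k) mpoly)"
 have "plane v w -` poly_ext (poly_ext q) \<subseteq> line v -` poly_ext q"
  by (auto simp: poly_ext_def) (metis coeff_plane)
 moreover have "line v F = 0"
  by (simp add: F_def ring_map_simps[OF ring_map_line] line_sT line_simps mult.commute)
 hence "F \<in> line v -` poly_ext q" using idl_0[OF pr_idl[OF q]] by (simp add: poly_ext_def)
 moreover have "F ~: plane v w -` poly_ext (poly_ext q)"
 proof
  assume "F \<in> plane v w -` poly_ext (poly_ext q)"
  hence "coeff (coeff (plane v w F) 1) 0 \<in> q" by (simp add: poly_ext_def)
  moreover have "coeff (coeff (plane v w F) 1) 0 = v i * w j - v j * w i"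
   by (simp add: F_def ring_map_simps[OF ring_map_plane] plane_sT plane_simps)
  ultimately show False using v by simp
 qed
 ultimately have "plane v w -` poly_ext (poly_ext q) \<subset> line v -` poly_ext q" by blast
 from td_strict[OF pr_vimage[OF ring_map_plane pr_poly_ext[OF pr_poly_ext[OF q]]] pr_vimage[OF ring_map_line pr_poly_ext[OF q]] this] 1
 show ?thesis by linarith
qed

context linear_gorenstein
begin

text \<open>The Jacobian dual as a matrix over k[T] alone; \<open>flat_jacobian_dual\<close>
  identifies its image \<open>BP\<close> with that of the matrix of the theorem.\<close>

definition B :: "('n, 'k) mpoly ^ 'n ^ 'n" where
 "B = (\<chi> k j. \<Sum>i. var i * const (lk (psi i j) (sng k 1)))"

lemma psi_B: "psi i j = (\<Sum>k. var k * const (lk (psi i j) (sng k 1)))"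
 using linear_form_eq_sum[of "psi i j"] psi_homog homogeneous_iff by metis

lemma l_B: "l j = (\<Sum>k. xv k * sT (B $ k $ j))"
proof -
 have "l j = (\<Sum>i. Tv i * sx (\<Sum>k. var k * const (lk (psi i j) (sng k 1))))" unfolding l_def psi_B[symmetric] ..
 also have "\<dots> = (\<Sum>k. xv k * sT (B $ k $ j))"
  unfolding B_def sub_simps sum_distrib_left vec_lambda_beta by (subst sum.swap) (simp add: sub_simps ac_simps)
 finally show ?thesis .
qed

lemma B_T: "(\<Sum>j. var j * B $ k $ j) = 0"
proof -
 have a: "lk (psi i j) t = - lk (psi j i) t" for i j t by (subst psi_alt) simp
 have "(\<Sum>j. var j * B $ k $ j) = (\<Sum>j. \<Sum>i. var j * (var i * const (lk (psi i j) (sng k 1))))"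
  by (simp add: B_def sum_distrib_left)
 also have "\<dots> = 0"
 proof (rule antisym_sum)
  fix i j
  show "var i * (var j * const (lk (psi j i) (sng k 1))) = - (var j * (var i * const (lk (psi i j) (sng k 1))))"
   unfolding a[of j i] by (simp add: ring_map_simps[OF ring_map_const] mult.left_commute)
 qed (simp_all add: psi_diag const_simps)
 finally show ?thesis .
qed

lemma B_homog: "homog w1 1 (B $ k $ j)"
proof -
 have "homog w1 (1 + 0) (var i * const c)" for i :: 'n and c :: 'k by (intro homog_mult homog_const) (use homog_var[of w1 i] in simp)
 thus ?thesis unfolding B_def by (auto intro!: homog_sum)
qed

lemma det_B: "det B = 0"
proof -
 have "var k * det B = (\<Sum>j. var j * (if j = k then det B else 0))" for k by (simp add: if_distrib[of "%x. _ * x"] cong: if_cong)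
 also have "(\<Sum>j. var j * (if j = k then det B else 0)) = (\<Sum>i. (\<Sum>j. var j * B $ i $ j) * cof B i k)" for k
  unfolding col_cof[symmetric] sum_distrib_left sum_distrib_right by (subst sum.swap) (simp add: ac_simps)
 finally have "var k * det B = 0" for k by (simp add: B_T)
 thus ?thesis by (rule var_mult_eq_0)
qed

lemma T_cof: "var i * cof B k j = var j * cof B k i"
proof (cases "i = j")
 case False
 let ?B = "transp B"
 have c: "cof B k j = rdet ?B j (axis k 1)" for j using cof_transpose[of B j k] by (simp only: cof_def)
 have "(\<Sum>r. var r *s ?B $ r) = 0"
  by (simp add: vec_eq_iff Finite_Cartesian_Product.transpose_def B_T)
 from cofactor_relation[OF False this, of "axis k 1"]
 have "var i * cof B k j - var j * cof B k i = det (\<chi> r. if r = j then axis k 1 else if r = i then 0 else ?B $ r)"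
  unfolding c .
 also have "(\<chi> r. if r = j then axis k 1 else if r = i then 0 else ?B $ r) =
   (\<chi> r. if r = i then 0 else (\<chi> r. if r = j then axis k 1 else ?B $ r) $ r)"
  using False by (auto simp: vec_eq_iff)
 also have "det \<dots> = 0" using rdet_0[of "\<chi> r. if r = j then axis k 1 else ?B $ r" i] by (simp only: rdet_def)
 finally show ?thesis by (simp only: right_minus_eq)
qed simp

text \<open>Each row of cofactors is proportional to T by \<open>T_cof\<close>, and two different
  variables have no common factor.\<close>

lemma ex_u: "EX u. ALL k j. cof B k j = var j * u k"
proof -
 obtain a b :: 'n where ab: "a ~= b" using ex_neq[OF N2] by blast
 have "EX E. cof B k a = var a * E" for k using var_dvd[of b a "cof B k a" "cof B k b"] ab T_cof by metis
 then obtain u where u: "!!k. cof B k a = var a * u k" by metis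
 have "cof B k j = var j * u k" for k j
 proof -
  have "var a * (cof B k j - var j * u k) = 0" using T_cof[of a k j] u[of k] by (simp add: algebra_simps)
  thus ?thesis using var_mult_eq_0 by fastforce
 qed
 thus ?thesis by blast
qed

definition u :: "'n => ('n, 'k) mpoly" where "u = (SOME u. ALL k j. cof B k j = var j * u k)"

lemma cof_u: "cof B k j = var j * u k" using someI_ex[OF ex_u] unfolding u_def by blast

lemma u_homog: "homog w1 (CARD('n) - 2) (u k)"
proof -
 have C: "homog w1 (CARD('n) - 1) (cof B k j)" for j
 proof -
  have P: "homog w1 (\<Sum>i. if i = k then 0 else 1) (\<Prod>i\<in>UNIV. (\<chi> i. if i = k then axis j 1 else B $ i) $ i $ p i)" for p :: "'n => 'n"
   by (rule homog_prod) (use B_homog homog_1 homog_0 in \<open>auto simp: axis_def\<close>)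
  have s: "(\<Sum>i. if i = k then 0 else 1 :: nat) = CARD('n) - 1"
   by (subst sum.remove[of _ k]) (auto simp: card_Diff_singleton)
  have "homog w1 (CARD('n) - 1) (of_int (sign p) * (\<Prod>i\<in>UNIV. (\<chi> i. if i = k then axis j 1 else B $ i) $ i $ p i))" for p :: "'n => 'n"
   using P[of p] homog_minus[OF P[of p]] unfolding s by (cases p rule: sign_cases) simp_all
  thus ?thesis unfolding cof_def rdet_def det_def by (intro homog_sum) blast
 qed
 have "hcomp w1 d (u k) = 0" if "d ~= CARD('n) - 2" for d
 proof -
  fix j :: 'n
  have "hcomp w1 (Suc d) (var j * u k) = 0" using hcomp_homog[OF C[of j], of "Suc d"] that N2 by (simp add: cof_u)
  hence "var j * hcomp w1 d (u k) = 0" by (simp add: hcomp_mult_homog[OF homog_var])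
  thus ?thesis by (rule var_mult_eq_0)
 qed
 hence "hcomp w1 d (u k) = hcomp w1 d (hcomp w1 (CARD('n) - 2) (u k))" for d
  by (simp add: hcomp_hcomp)
 hence "u k = hcomp w1 (CARD('n) - 2) (u k)" by (rule hcomp_ext)
 thus ?thesis using homog_hcomp by metis
qed

lemma u_B: "(\<Sum>k. u k * B $ k $ j) = 0"
proof -
 have "var i * (\<Sum>k. u k * B $ k $ j) = (\<Sum>k. B $ k $ j * cof B k i)" for i
  by (simp add: cof_u sum_distrib_left ac_simps)
 hence "var i * (\<Sum>k. u k * B $ k $ j) = 0" for i by (simp add: col_cof det_B)
 thus ?thesis by (rule var_mult_eq_0)
qed

definition BP :: "('n + 'n, 'k) mpoly ^ 'n ^ 'n" where "BP = (\<chi> i j. sT (B $ i $ j))"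

lemma cof_BP: "cof BP k j = Tv j * sT (u k)"
proof -
 have "cof BP k j = det (\<chi> a b. sT ((\<chi> i. if i = k then axis j 1 else B $ i) $ a $ b))"
  unfolding cof_def rdet_def BP_def by (intro arg_cong[where f = det]) (auto simp: vec_eq_iff axis_def sub_simps)
 also have "\<dots> = sT (cof B k j)" unfolding cof_def rdet_def by (rule det_ring_map[OF ring_map_sub])
 finally show ?thesis by (simp add: cof_u sub_simps)
qed

text \<open>Cramer's rule for the relation x B = l. The cofactors are T_j u_k, so a factor T_j
  remains; \<open>x_u_L\<close> removes it modulo L.\<close>

lemma x_u_L0: "Tv j * (xv i * sT (u k) - xv k * sT (u i)) \<in> L0"
proof (cases "i = k")
 case True thus ?thesis by (simp add: idl_0[OF idl_L0])
next
 case False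
 have "(\<Sum>r. xv r *s BP $ r) = (\<chi> j. l j)" by (simp add: vec_eq_iff BP_def l_B)
 from cofactor_relation[OF False this, of "axis j 1"]
 have "xv i * (Tv j * sT (u k)) - xv k * (Tv j * sT (u i)) = det (\<chi> r. if r = k then axis j 1 else if r = i then \<chi> j. l j else BP $ r)"
  unfolding cof_BP[unfolded cof_def] .
 also have "(\<chi> r. if r = k then axis j 1 else if r = i then \<chi> j. l j else BP $ r) =
   (\<chi> r. if r = i then \<chi> j. l j else (\<chi> r. if r = k then axis j 1 else BP $ r) $ r)"
  using False by (auto simp: vec_eq_iff)
 also have "det \<dots> = rdet (\<chi> r. if r = k then axis j 1 else BP $ r) i (\<chi> j. l j)" by (simp add: rdet_def)
 also have "\<dots> \<in> L0" unfolding rdet_cof by (auto intro!: idl_sum[OF idl_L0] idl_multr[OF idl_L0] l_L0)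
 finally show ?thesis by (simp add: algebra_simps)
qed

lemma line_l: "line u (l j) = 0"
proof -
 have s: "(\<Sum>k\<in>A. [:0, g k:]) = [:0, \<Sum>k\<in>A. g k:]" for g :: "'n => ('n, 'k) mpoly" and A
  by (induction A rule: infinite_finite_induct) simp_all
 have "line u (l j) = (\<Sum>k. [:0, u k * B $ k $ j:])"
  by (simp add: l_B ring_map_simps[OF ring_map_line] line_simps line_sT mult.commute)
 thus ?thesis by (simp add: s u_B)
qed

text \<open>The cofactors vanish on a set of codimension at least two: at such a prime \<open>B\<close> would have
  corank two, and \<open>L\<^sub>0\<close> would have a component of too large dimension.\<close>

lemma plane_prime:
 assumes q: "pr q" "!!k. u k \<in> q"
 shows "EX Q i. pr Q & hideal w1 Q & L0 \<subseteq> Q & td q + 2 \<le> td Q & xv i ~: Q & (ALL d G. homog w1 d G --> G \<in> q --> sT G \<in> Q)"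
proof -
 have "cof B k j \<in> q" for k j by (simp add: cof_u idl_mult[OF pr_idl[OF q(1)]] q(2))
 then obtain v w i j where vw: "!!a. (\<Sum>r. v r * B $ r $ a) \<in> q" "!!a. (\<Sum>r. w r * B $ r $ a) \<in> q" "v i * w j - v j * w i ~: q"
  using two_kernel_vectors[OF q(1), of B] det_B idl_0[OF pr_idl[OF q(1)]] by auto
 define Q where "Q = plane v w -` poly_ext (poly_ext q)"
 have Q: "pr Q" unfolding Q_def by (intro pr_vimage ring_map_plane pr_poly_ext q)
 have s: "(\<Sum>k\<in>A. [:[:0, g k:], [:h k:]:]) = [:[:0, \<Sum>k\<in>A. g k:], [:\<Sum>k\<in>A. h k:]:]" for g h :: "'n => ('n, 'k) mpoly" and A
  by (induction A rule: infinite_finite_induct) simp_all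
 have "plane v w (l a) = (\<Sum>k. [:[:0, v k * B $ k $ a:], [:w k * B $ k $ a:]:])" for a
  by (simp add: l_B ring_map_simps[OF ring_map_plane] plane_simps plane_sT mult.commute)
 hence "l a \<in> Q" for a
  using vw(1,2) idl_0[OF pr_idl[OF q(1)]] by (auto simp: Q_def s poly_ext_def coeff_pCons split: nat.split)
 hence LQ: "L0 \<subseteq> Q" unfolding L0_def using Q by (intro gen_least pr_idl) auto
 have "td q + 2 \<le> td Q" unfolding Q_def by (rule td_plane[OF q(1) vw(3)])
 moreover have "td Q \<le> td (core w1 Q)" by (rule td_mono[OF pr_core[OF Q] Q core_subset[OF pr_idl[OF Q]]])
 moreover have "EX i. xv i ~: core w1 Q"
 proof -
  have "v i ~: q \<or> v j ~: q" using vw(3) idl_diff[OF pr_idl[OF q(1)]] idl_multr[OF pr_idl[OF q(1)]] by blast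
  then obtain i where "v i ~: q" by blast
  hence "coeff (coeff (plane v w (xv i)) 0) 1 ~: q" by (simp add: plane_simps)
  hence "xv i ~: Q" by (auto simp: Q_def poly_ext_def)
  thus ?thesis using core_subset[OF pr_idl[OF Q]] by blast
 qed
 moreover have "sT G \<in> core w1 Q" if "homog w1 d G" "G \<in> q" for d G
  by (rule homog_mem_core[OF homog_sT[OF that(1)] pr_idl[OF Q]])
   (use that idl_0[OF pr_idl[OF q(1)]] in \<open>auto simp: Q_def plane_sT poly_ext_def coeff_pCons split: nat.split\<close>)
 moreover have "L0 \<subseteq> core w1 Q" by (rule hideal_subset_core[OF hideal_L0 LQ])
 ultimately show ?thesis using pr_core[OF Q] hideal_core[OF pr_idl[OF Q]] by (meson order_trans)
qed

text \<open>Were u zero, B would have corank at least two over k(T), and a plane in its kernel would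
  give a prime over L0 of dimension n + 2, more than \<open>td_L0\<close> allows.\<close>

lemma u_neq_0: "EX k. u k ~= 0"
proof (rule ccontr)
 assume "\<not> ?thesis"
 hence "!!k. u k \<in> {0}" by simp
 from plane_prime[OF pr_zero this] obtain Q i where Q: "pr Q" "hideal w1 Q" "L0 \<subseteq> Q" "CARD('n) + 2 \<le> td Q" "xv i ~: Q"
  unfolding td_zero by blast
 thus False using td_L0[OF Q(1-3,5)] by linarith
qed

text \<open>The generic component of L0: the homogeneous core of the ideal of all polynomials that
  vanish at x = s u.\<close>

definition Q0 :: "('n + 'n, 'k) mpoly set" where "Q0 = core w1 (line u -` poly_ext {0})"

lemma Q0_subset: "F \<in> Q0 ==> line u F = 0"
proof -
 assume "F \<in> Q0"
 hence "F \<in> line u -` poly_ext {0}"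
  unfolding Q0_def using core_subset[OF pr_idl[OF pr_vimage[OF ring_map_line pr_poly_ext[OF pr_zero]]]] by blast
 thus ?thesis by (simp add: poly_ext_def poly_eq_iff)
qed

text \<open>The parameter s on the line through u gives dimension n + 1. This leaves only the second
  alternative of \<open>td_L0\<close>, in which the contraction to S is zero.\<close>

lemma Q0: "pr Q0" "hideal w1 Q0" "L0 \<subseteq> Q0" "CARD('n) + 1 \<le> td Q0" "sx -` Q0 = {0}"
proof -
 let ?Q = "line u -` poly_ext {0}"
 have Q: "pr ?Q" by (intro pr_vimage ring_map_line pr_poly_ext pr_zero)
 show p: "pr Q0" unfolding Q0_def by (rule pr_core[OF Q])
 show h: "hideal w1 Q0" unfolding Q0_def by (rule hideal_core[OF pr_idl[OF Q]])
 have "L0 \<subseteq> ?Q" unfolding L0_def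
  by (rule gen_least[OF pr_idl[OF Q]]) (auto simp: line_l poly_ext_def)
 thus L: "L0 \<subseteq> Q0" unfolding Q0_def by (rule hideal_subset_core[OF hideal_L0])
 obtain k where k: "u k ~: {0}" using u_neq_0 by auto
 have "td ?Q \<le> td Q0" unfolding Q0_def by (rule td_mono[OF pr_core[OF Q] Q core_subset[OF pr_idl[OF Q]]])
 thus t: "CARD('n) + 1 \<le> td Q0" using td_line[where v = u and i = k, OF pr_zero k] by (simp add: td_zero)
 have "xv k ~: Q0"
 proof
  assume "xv k \<in> Q0"
  hence "line u (xv k) = 0" by (rule Q0_subset)
  thus False using k by (simp add: line_simps)
 qed
 from td_L0[OF p h L this] t show "sx -` Q0 = {0}" by linarith
qed

text \<open>If f vanished at u, it would lie in \<open>Q0\<close>, whose contraction to S is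
  zero.\<close>

lemma f_u: "sub u f ~= 0"
proof
 assume fu: "sub u f = 0"
 let ?Q = "line u -` poly_ext {0}"
 have Q: "pr ?Q" by (intro pr_vimage ring_map_line pr_poly_ext pr_zero)
 have "sx f \<in> ?Q" using fu line_sx[OF f_homog, of u] by (simp add: poly_ext_def)
 hence "sx f \<in> Q0" unfolding Q0_def by (intro homog_mem_core[OF homog_sx[OF f_homog] pr_idl[OF Q]])
 thus False using Q0(5) f0 by blast
qed

text \<open>Otherwise \<open>plane_prime\<close> gives a prime over L0 of dimension above n, so T is
  proportional to some \<beta> over the x, modulo L0. As the u lie in this prime they vanish at
  \<beta>. Read modulo \<open>Q0\<close>, the same proportionality then makes u zero.\<close>

lemma td_u:
 assumes q: "pr q" "!!k. u k \<in> q" shows "td q + 2 \<le> CARD('n)"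
proof (rule ccontr)
 assume *: "\<not> ?thesis"
 obtain Q v where Q: "pr Q" "hideal w1 Q" "L0 \<subseteq> Q" "td q + 2 \<le> td Q" "xv v ~: Q" and
  Qq: "!!d G. homog w1 d G ==> G \<in> q ==> sT G \<in> Q" using plane_prime[OF q] by blast
 have "\<not> td Q \<le> CARD('n)" using * Q(4) by linarith
 with td_L0[OF Q(1-3,5)] have Qx: "sx -` Q = {0 :: ('n, 'k) mpoly}"
  and ex: "EX s \<beta> \<eta>. s ~= 0 & (ALL j. sx s * Tv j - sx (\<beta> j) * \<eta> \<in> L0)" by blast+
 obtain s \<beta> \<eta> where s: "s ~= 0" "!!j. sx s * Tv j - sx (\<beta> j) * \<eta> \<in> L0" using ex by blast
 let ?N = "CARD('n) - 2"
 \<comment> \<open>n - 2 is the degree of the u_k; a form of this degree at T is compared with its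
   value at \<beta>.\<close>
 have rel: "sx s ^ ?N * sT G - \<eta> ^ ?N * sx (sub \<beta> G) \<in> L0" if G: "homog w1 ?N G" for G
 proof -
  have "sub (%j. Tv j * sx s ^ Suc 0) G - sub (%j. sx (\<beta> j) * \<eta> ^ Suc 0) G \<in> L0"
   by (rule ring_map_cong_idl[OF ring_map_sub ring_map_sub idl_L0])
    (use s(2) in \<open>simp_all add: sub_simps mult.commute idl_0[OF idl_L0]\<close>)
  hence "sT G * sx s ^ ?N - sub (%j. sx (\<beta> j)) G * \<eta> ^ ?N \<in> L0"
   unfolding ev_homog_scale[OF ring_map_const G] .
  thus ?thesis by (simp only: sub_sub mult.commute)
 qed
 have "\<eta> ~: Q"
 proof
  assume \<eta>: "\<eta> \<in> Q"
  have "td Q \<le> td (sx -` Q :: ('n, 'k) mpoly set) + card ({} :: 'n set)"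
  proof (rule td_le_fibre[OF Q(1), where s = s and \<beta> = "%_ _. 0" and \<eta> = "%_. 0"])
   show "sx s ~: Q" using Qx s(1) by blast
   have "sx s * Tv j - sx (\<beta> j) * \<eta> + sx (\<beta> j) * \<eta> \<in> Q" for j
    by (intro idl_add[OF pr_idl[OF Q(1)]] idl_mult[OF pr_idl[OF Q(1)] \<eta>]) (use s(2) Q(3) in blast)
   thus "sx s * Tv j - (\<Sum>k\<in>{}. sx 0 * 0) \<in> Q" for j by simp
  qed
  thus False using * Q(4) by (simp add: Qx td_zero)
 qed
 have "u k = 0" for k
 proof -
  have uQ: "sT (u k) \<in> Q" by (rule Qq[OF u_homog q(2)])
  have "\<eta> ^ ?N * sx (sub \<beta> (u k)) \<in> Q"
   using idl_diff[OF pr_idl[OF Q(1)] idl_mult[OF pr_idl[OF Q(1)] uQ, of "sx s ^ ?N"] subsetD[OF Q(3) rel[OF u_homog, of k]]] by simp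
  hence "sx (sub \<beta> (u k)) \<in> Q" using pr_mult[OF Q(1)] pr_power[OF Q(1)] \<open>\<eta> ~: Q\<close> by blast
  hence "sub \<beta> (u k) = 0" using Qx by blast
  hence "sx s ^ ?N * sT (u k) \<in> Q0" using rel[OF u_homog, of k] Q0(3) by (auto simp: sub_simps)
  moreover have "sx s ~: Q0" using Q0(5) s(1) by blast
  ultimately have "sT (u k) \<in> Q0" using pr_mult[OF Q0(1)] pr_power[OF Q0(1)] by blast
  from Q0_subset[OF this] show ?thesis by (simp add: line_sT)
 qed
 thus False using u_neq_0 by blast
qed

end

section \<open>The iterated gcds generate the defining ideal\<close>

context linear_gorenstein
begin

abbreviation (input) wX :: "'n + 'n => nat" where "wX \<equiv> case_sum w1 (%_. 0)"
abbreviation (input) wT :: "'n + 'n => nat" where "wT \<equiv> case_sum (%_. 0) w1"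

text \<open>The Rees ideal of the p, pulled back to polynomials in x and T. Substituting T = p in
  each T-degree separately replaces the auxiliary variable t.\<close>

definition rees :: "('n + 'n, 'k) mpoly set" where
 "rees = {F. ALL d. sub (case_sum var p) (hcomp wT d F) \<in> gen {f}}"

text \<open>The colon ideal of L by the m-th power of (x), tested on products of m variables;
  \<open>colon_saturation\<close> makes the connection.\<close>

definition saturation :: "('n + 'n, 'k) mpoly set" where
 "saturation = {F. ALL vs. length vs = m --> prod_list (map xv vs) * F \<in> L}"

lemma homog_X_sT: "homog wX 0 (sT F)"
 using homog_var[of wX "Inr _"] by (intro homog_sub[of _ "%_. 0", OF _ homog_weight_0]) simp

lemma homog_X_sx: "homog w1 d F ==> homog wX d (sx F)"
 by (rule homog_sub[of wX w1]) (use homog_var[of wX "Inl _"] in auto)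

lemma homog_T_sT: "homog w1 d F ==> homog wT d (sT F)"
 by (rule homog_sub[of wT w1]) (use homog_var[of wT "Inr _"] in auto)

text \<open>\<open>unmixed_L\<close> with all T as E: a prime containing L and every T_j has no more
  dimension than its contraction to S, which contains f, so its \<open>td\<close> is below
  n.\<close>

lemma x_u_L: "xv i * sT (u k) - xv k * sT (u i) \<in> L"
proof (rule unmixed_L[where E = "range Tv"])
 fix g assume "g \<in> range (Tv :: 'n => ('n + 'n, 'k) mpoly)"
 then obtain j where g: "g = Tv j" by blast
 show "EX d. homog w1 d g" unfolding g by (rule exI, rule homog_var)
 show "EX N. g ^ N * (xv i * sT (u k) - xv k * sT (u i)) \<in> L"
  using x_u_L0[of j i k] L0_L g by (intro exI[of _ 1]) auto
next
 fix Q assume Q: "pr Q" "hideal w1 Q" "L Un range Tv \<subseteq> Q"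
 have "td Q \<le> td (sx -` Q :: ('n, 'k) mpoly set) + card ({} :: 'n set)"
  by (rule td_le_fibre[OF Q(1), where s = 1 and \<beta> = "%_ _. 0" and \<eta> = "%_. 0"])
   (use Q pr_1[OF Q(1)] in \<open>auto simp: sub_simps\<close>)
 thus "td Q < CARD('n)" using td_sx_less[OF Q(1)] f_L Q(3) by fastforce
qed

text \<open>Modulo L0, x_i (T_a u_k) may be exchanged for u_i (x_k T_a). Hence a form of x-degree j
  can be evaluated at x = u after multiplication by the j-th power of T_a u_k.\<close>

lemma x_substitution:
 assumes h: "homog wX j h"
 shows "(Tv a * sT (u k)) ^ j * h - (xv k * Tv a) ^ j * sT (sub (case_sum u var) h) \<in> L0"
proof -
 let ?g = "case_sum (%i. xv i) Tv :: 'n + 'n => ('n + 'n, 'k) mpoly"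
 let ?g' = "case_sum (%i. sT (u i)) Tv :: 'n + 'n => ('n + 'n, 'k) mpoly"
 have "sub (%v. ?g v * (Tv a * sT (u k)) ^ wX v) h - sub (%v. ?g' v * (xv k * Tv a) ^ wX v) h \<in> L0"
 proof (rule ring_map_cong_idl[OF ring_map_sub ring_map_sub idl_L0])
  fix v show "sub (%v. ?g v * (Tv a * sT (u k)) ^ wX v) (var v) - sub (%v. ?g' v * (xv k * Tv a) ^ wX v) (var v) \<in> L0"
   using x_u_L0[of a _ k] by (cases v) (auto simp: sub_simps algebra_simps idl_0[OF idl_L0])
 qed (simp add: sub_simps idl_0[OF idl_L0])
 hence "sub ?g h * (Tv a * sT (u k)) ^ j - sub ?g' h * (xv k * Tv a) ^ j \<in> L0"
  unfolding ev_homog_scale[OF ring_map_const h] .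
 moreover have "?g = var" by (auto split: sum.split)
 hence "sub ?g h = h" by (simp add: sub_var)
 moreover have "sT (sub (case_sum u var) h) = sub ?g' h"
  unfolding sub_sub by (rule arg_cong[where f = "%z. sub z h"]) (auto simp: sub_simps split: sum.split)
 ultimately show ?thesis by (simp add: mult.commute)
qed

text \<open>The analogous exchange of p_a T_j for p_j T_a modulo L; the value at T = p lies in (f),
  so it disappears.\<close>

lemma p_substitution:
 assumes h: "homog wT d h" and r: "sub (case_sum var p) h \<in> gen {f}"
 shows "sx (p a) ^ d * h \<in> L"
proof -
 let ?g = "case_sum xv Tv :: 'n + 'n => ('n + 'n, 'k) mpoly"
 let ?g' = "case_sum xv (%j. sx (p j)) :: 'n + 'n => ('n + 'n, 'k) mpoly"
 have "sub (%v. ?g v * sx (p a) ^ wT v) h - sub (%v. ?g' v * Tv a ^ wT v) h \<in> L"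
 proof (rule ring_map_cong_idl[OF ring_map_sub ring_map_sub idl_L])
  fix v show "sub (%v. ?g v * sx (p a) ^ wT v) (var v) - sub (%v. ?g' v * Tv a ^ wT v) (var v) \<in> L"
   using p_T_L[of a] by (cases v) (auto simp: sub_simps algebra_simps idl_0[OF idl_L])
 qed (simp add: sub_simps idl_0[OF idl_L])
 hence "sub ?g h * sx (p a) ^ d - sub ?g' h * Tv a ^ d \<in> L"
  unfolding ev_homog_scale[OF ring_map_const h] .
 moreover have "?g = var" by (auto split: sum.split)
 hence "sub ?g h = h" by (simp add: sub_var)
 moreover have "sx (sub (case_sum var p) h) = sub ?g' h"
  unfolding sub_sub by (rule arg_cong[where f = "%z. sub z h"]) (auto simp: sub_simps split: sum.split)
 ultimately have "h * sx (p a) ^ d - sx (sub (case_sum var p) h) * Tv a ^ d \<in> L" by simp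
 moreover have "sx (sub (case_sum var p) h) \<in> L"
  using r gen_least[OF idl_vimage[OF ring_map_sub idl_L], of "{f}"] f_L by blast
 ultimately have "h * sx (p a) ^ d - sx (sub (case_sum var p) h) * Tv a ^ d + sx (sub (case_sum var p) h) * Tv a ^ d \<in> L"
  by (intro idl_add[OF idl_L] idl_multr[OF idl_L])
 thus ?thesis by (simp add: mult.commute)
qed

lemma idl_rees: "idl rees"
proof -
 have "sub (case_sum var p) (hcomp wT d (G * F)) \<in> gen {f}" if F: "F \<in> rees" for F G d
 proof -
  have "G * F = (\<Sum>e\<le>degree (homog_map wT G). hcomp wT e G * F)"
   unfolding sum_distrib_right[symmetric] using sum_hcomp[of G wT] by simp
  hence "hcomp wT d (G * F) = (\<Sum>e\<le>degree (homog_map wT G). if e \<le> d then hcomp wT e G * hcomp wT (d - e) F else 0)"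
   by (simp add: hcomp_sum hcomp_mult_homog[OF homog_hcomp])
  thus ?thesis using F
   by (auto simp: sub_simps rees_def if_distrib idl_0[OF idl_gen] intro!: idl_sum[OF idl_gen] idl_mult[OF idl_gen])
 qed
 thus ?thesis
  by (intro idlI) (auto simp: rees_def hcomp_0 hcomp_add sub_simps idl_0[OF idl_gen] intro!: idl_add[OF idl_gen])
qed

lemma homog_rees: "homog wT d h ==> h \<in> rees <-> sub (case_sum var p) h \<in> gen {f}"
 by (auto simp: rees_def hcomp_homog sub_simps idl_0[OF idl_gen])

lemma l_T_homog: "homog wT 1 (l j)"
proof -
 have "homog wT (1 + 0) (Tv i * sx (psi i j))" for i
  using homog_var[of wT "Inr i"] by (intro homog_mult homog_T_sx) simp
 thus ?thesis unfolding l_def by (intro homog_sum) simp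
qed

lemma L_rees: "L \<subseteq> rees"
 unfolding L_def
proof (intro gen_least idl_rees subsetI)
 have s: "sub (case_sum var p) (sx G) = G" for G by (simp add: sub_sub sub_simps sub_var)
 fix F assume "F \<in> insert (sx f) (range l)"
 then consider "F = sx f" | a where "F = l a" by blast
 thus "F \<in> rees"
 proof cases
  case 1
  thus ?thesis unfolding 1 homog_rees[OF homog_T_sx] by (simp add: s genI)
 next
  case (2 a)
  have "(\<Sum>i. p i * psi i a) \<in> gen {f}"
   unfolding syz by (rule exI[of _ "%j. if j = a then 1 else 0"], rule exI[of _ "%_. 0"])
    (simp add: if_distrib[of "%x. _ * x"] cong: if_cong)
  thus ?thesis unfolding 2 homog_rees[OF l_T_homog] by (simp add: l_def sub_simps s)
 qed
qed

text \<open>(f) is a complete intersection of codimension one, hence unmixed, while the variables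
  together leave only dimension zero; n >= 2 separates the two dimensions.\<close>

lemma x_torsion_mod_f:
 assumes "!!v. var v ^ M * h \<in> gen {f}" shows "h \<in> gen {f}"
proof -
 have "h \<in> gen ((%_. f) ` {0 :: nat})"
 proof (rule complete_intersection_unmixed[where a = "%_. f" and d = "%_. m" and c = 1 and E = "range var", OF inf])
  show "1 \<le> CARD('n)" using N2 by simp
  show "EX e. homog w1 e g" if g: "g \<in> range var" for g
  proof -
   obtain v where v: "g = var v" using g by blast
   show ?thesis unfolding v by (rule exI, rule homog_var)
  qed
  show "EX M. g ^ M * h \<in> gen ((%_. f) ` {0 :: nat})" if "g \<in> range var" for g using assms that by auto
 next
  fix Q assume Q: "pr Q" "hideal w1 Q" "(%_. f) ` {0 :: nat} \<subseteq> Q"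
  hence "td Q + 1 \<le> CARD('n)" using td_nonzero[OF Q(1) _ f0] by simp
  thus "\<not> ind Q (Suc (CARD('n) - 1))" using le_td[OF Q(1)] by fastforce
 next
  fix Q assume Q: "pr Q" "hideal w1 Q" "(%_. f) ` {0 :: nat} Un range var \<subseteq> Q"
  hence "td Q = 0" by (intro td_max) auto
  thus "\<not> ind Q (CARD('n) - 1)" using le_td[OF Q(1)] N2 by fastforce
 qed (use f_homog m in auto)
 thus ?thesis by simp
qed

lemma saturation_rees: "saturation \<subseteq> rees"
proof
 fix F assume F: "F \<in> saturation"
 have s: "sub (case_sum var p) (xv v) = var v" for v by (simp add: sub_simps)
 have "var v ^ m * sub (case_sum var p) (hcomp wT d F) \<in> gen {f}" for v d
 proof -
  have "xv v ^ m * F \<in> L" using F unfolding saturation_def by (auto dest!: spec[of _ "replicate m v"])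
  hence "sub (case_sum var p) (hcomp wT d (xv v ^ m * F)) \<in> gen {f}" using L_rees by (auto simp: rees_def)
  moreover have "homog wT 0 (xv v ^ m :: ('n + 'n, 'k) mpoly)" using homog_power[OF homog_var[of wT "Inl v"], of m] by simp
  ultimately show ?thesis by (simp add: hcomp_mult_homog sub_simps)
 qed
 thus "F \<in> rees" unfolding rees_def by (blast intro: x_torsion_mod_f)
qed

text \<open>If some u_k is not in q, the line through u turns q into a prime over L that contains
  the p, and \<open>td_L_in\<close> bounds it. If all u_k are in q, \<open>td_u\<close>
  applies.\<close>

lemma td_p_u:
 assumes q: "pr q" "hideal w1 q" "sub u f \<in> q" "!!a. sub u (p a) \<in> q"
 shows "td q + 2 \<le> CARD('n)"
proof (cases "ALL k. u k \<in> q")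
 case True thus ?thesis using td_u[OF q(1)] by blast
next
 case False
 then obtain k where k: "u k ~: q" by blast
 let ?Q = "line u -` poly_ext q"
 have Q: "pr ?Q" by (intro pr_vimage ring_map_line pr_poly_ext q)
 have sx: "sx G \<in> ?Q" if "homog w1 d G" "sub u G \<in> q" for d G
 proof -
  have "line u (sx G) = [:sub u G:] * [:0, 1:] ^ d" by (rule line_sx[OF that(1)])
  moreover have "[:sub u G:] \<in> poly_ext q" using that(2) idl_0[OF pr_idl[OF q(1)]] by (auto simp: poly_ext_def coeff_pCons split: nat.split)
  ultimately show ?thesis by (simp only: vimage_def mem_Collect_eq idl_multr[OF idl_poly_ext[OF pr_idl[OF q(1)]]])
 qed
 have lQ: "l j \<in> ?Q" for j using idl_0[OF pr_idl[OF q(1)]] by (simp add: line_l poly_ext_def)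
 have L: "L \<subseteq> ?Q" unfolding L_def using sx[OF f_homog q(3)] lQ by (intro gen_least pr_idl[OF Q]) auto
 let ?C = "core w1 ?Q"
 have xk: "xv k ~: ?C"
 proof
  assume "xv k \<in> ?C"
  hence "xv k \<in> ?Q" using core_subset[OF pr_idl[OF Q]] by blast
  hence "ALL a. coeff [:0, u k:] a \<in> q" unfolding poly_ext_def vimage_def mem_Collect_eq line_simps .
  hence "coeff [:0, u k:] (Suc 0) \<in> q" by blast
  thus False using k by simp
 qed
 have "td ?C < CARD('n)"
 proof (rule td_L_in[OF pr_core[OF Q] hideal_core[OF pr_idl[OF Q]] hideal_subset_core[OF hideal_L L] _ xk])
  show "sx (p a) \<in> ?C" for a by (rule homog_mem_core[OF homog_sx[OF p_homog] pr_idl[OF Q] sx[OF p_homog q(4)]])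
 qed
 moreover have "td ?Q \<le> td ?C" by (rule td_mono[OF pr_core[OF Q] Q core_subset[OF pr_idl[OF Q]]])
 ultimately show ?thesis using td_line[where v = u and i = k, OF q(1) k] by linarith
qed

text \<open>Evaluation at x = u sends L into (f(u)). Powers of the p(u) can be cancelled because
  f(u) and all p(u) vanish together only in codimension two.\<close>

lemma f_u_dvd:
 assumes h: "!!a. sx (p a) ^ N * h \<in> L" shows "EX c. sub (case_sum u var) h = c * sub u f"
proof (cases "homog w1 0 (sub u f)")
 \<comment> \<open>f(u) has degree zero, which happens for n = 2; it is then a nonzero
   constant.\<close>
 case True
 hence "sub u f = const (ev (%x. x) (%_. 0) (sub u f))" using hcomp_homog[OF True, of 0] hcomp_zero[of "sub u f"] by simp
 then obtain c where c: "sub u f = const c" by blast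
 hence "c ~= 0" using f_u by (auto simp: const_simps)
 hence "const (1 / c) * sub u f = (1 :: ('n, 'k) mpoly)" unfolding c const_simps(2)[symmetric] by (simp add: const_def)
 hence "sub (case_sum u var) h = (sub (case_sum u var) h * const (1 / c)) * sub u f" by (simp only: mult.assoc mult_1_right)
 thus ?thesis by blast
next
 case False
 have hu: "homog w1 (d * (CARD('n) - 2)) (sub u F)" if "homog w1 d F" for d F
 proof (rule homog_sub[of w1 "%_. CARD('n) - 2", OF u_homog])
  show "homog (%_. CARD('n) - 2) (d * (CARD('n) - 2)) F"
   using that by (auto simp: homog_iff sum_distrib_left[symmetric])
 qed
 have d1: "m * (CARD('n) - 2) \<ge> 1" using hu[OF f_homog] False by (cases "m * (CARD('n) - 2)") auto
 let ?\<theta> = "sub (case_sum u var)"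
 have sx: "?\<theta> (sx G) = sub u G" for G by (simp add: sub_sub sub_simps)
 have sT: "?\<theta> (sT G) = G" for G by (simp add: sub_sub sub_simps sub_var)
 have "L \<subseteq> ?\<theta> -` gen {sub u f}"
  unfolding L_def
  by (intro gen_least idl_vimage ring_map_sub idl_gen)
   (auto simp: sx genI l_B sub_simps sT u_B idl_0[OF idl_gen])
 hence "?\<theta> (sx (p a) ^ N * h) \<in> gen {sub u f}" for a using h by blast
 hence ph: "sub u (p a) ^ N * ?\<theta> h \<in> gen {sub u f}" for a by (simp add: sub_simps sx)
 have "?\<theta> h \<in> gen ((%_. sub u f) ` {0 :: nat})"
 proof (rule complete_intersection_unmixed[where a = "%_. sub u f" and d = "%_. m * (CARD('n) - 2)" and c = 1
    and E = "range (%a. sub u (p a))", OF inf])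
  show "1 \<le> CARD('n)" using N2 by simp
  show "EX e. homog w1 e g" if "g \<in> range (%a. sub u (p a))" for g using hu[OF p_homog] that by blast
  show "EX M. g ^ M * ?\<theta> h \<in> gen ((%_. sub u f) ` {0 :: nat})" if "g \<in> range (%a. sub u (p a))" for g using ph that by auto
 next
  fix Q assume Q: "pr Q" "hideal w1 Q" "(%_. sub u f) ` {0 :: nat} \<subseteq> Q"
  hence "td Q + 1 \<le> CARD('n)" using td_nonzero[OF Q(1) _ f_u] by simp
  thus "\<not> ind Q (Suc (CARD('n) - 1))" using le_td[OF Q(1)] by fastforce
 next
  fix Q assume Q: "pr Q" "hideal w1 Q" "(%_. sub u f) ` {0 :: nat} Un range (%a. sub u (p a)) \<subseteq> Q"
  hence "td Q + 2 \<le> CARD('n)" by (intro td_p_u) auto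
  thus "\<not> ind Q (CARD('n) - 1)" using le_td[OF Q(1)] by fastforce
 qed (use hu[OF f_homog] d1 in auto)
 thus ?thesis by (auto simp: mem_gen_single)
qed

text \<open>Away from x = 0 the p already make the dimension small enough by \<open>td_L_in\<close>;
  where all x vanish, a nonzero T_k u_k does.\<close>

lemma mem_L_if:
 assumes "!!a. sx (p a) ^ N * h \<in> L" "!!a k. (Tv a * sT (u k)) ^ M * h \<in> L" shows "h \<in> L"
proof (rule unmixed_L[where E = "range (%a. sx (p a)) Un range (%(a, k). Tv a * sT (u k))"])
 fix g assume g: "g \<in> range (%a. sx (p a)) Un range (%(a, k). Tv a * sT (u k))"
 then consider a where "g = sx (p a)" | a k where "g = Tv a * sT (u k)" by auto
 thus "EX d. homog w1 d g"
 proof cases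
  case 1 thus ?thesis using homog_sx[OF p_homog] by blast
 next
  case (2 a k)
  show ?thesis unfolding 2 by (rule exI, rule homog_mult[OF homog_var homog_sT[OF u_homog]])
 qed
 show "EX N. g ^ N * h \<in> L" using g assms by auto
next
 fix Q assume Q: "pr Q" "hideal w1 Q" "L Un (range (%a. sx (p a)) Un range (%(a, k). Tv a * sT (u k))) \<subseteq> Q"
 show "td Q < CARD('n)"
 proof (cases "EX v. xv v ~: Q")
  case True thus ?thesis using td_L_in[OF Q(1,2)] Q(3) by blast
 next
  case False
  obtain k where k: "u k ~= 0" using u_neq_0 by blast
  have "(%(a, k). Tv a * sT (u k)) (k, k) \<in> Q" using Q(3) by blast
  hence "sT (var k * u k) \<in> Q" by (simp add: sub_simps)
  moreover have "var k * u k ~= 0" using k var_mult_eq_0 by blast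
  ultimately show ?thesis using td_all_x_strict[OF Q(1,2)] False by blast
 qed
qed

text \<open>A cycle of inclusions. Multiplication by a variable x_i undoes a step of the iteration
  modulo L, so products of j variables carry w j into L. Conversely, an element of the Rees ideal of
  x-degree j at most m is matched with w (m - j), which has the same x-degree; after subtracting a
  multiple it vanishes at x = u and therefore lies in L.\<close>

lemma iteration_ideal:
 assumes w0: "w 0 = sx f" and wc: "!!j. j < m ==> w j = (\<Sum>k. xv k * c j k)"
  and cX: "!!j k. j < m ==> homog wX (m - Suc j) (c j k)" and cT: "!!j. j < m ==> EX b. ALL k. homog wT b (c j k)"
  and wS: "!!j. j < m ==> w (Suc j) = const (\<kappa> j) * (\<Sum>k. sT (u k) * c j k)" and \<kappa>: "!!j. \<kappa> j ~= 0"
 shows "gen (L Un w ` {..m}) = rees" and "gen (L Un w ` {..m}) = saturation"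
proof -
 let ?W = "gen (L Un w ` {..m})"
 \<comment> \<open>\<open>x_u_L\<close> exchanges the contraction with u for the contraction with x,
   at the price of moving the factors x_i and u_i.\<close>
 have xw: "xv i * w (Suc j) - const (\<kappa> j) * sT (u i) * w j \<in> L" if j: "j < m" for i j
 proof -
  have "xv i * w (Suc j) - const (\<kappa> j) * sT (u i) * w j =
    const (\<kappa> j) * (\<Sum>k. (xv i * sT (u k) - xv k * sT (u i)) * c j k)"
   unfolding wS[OF j] wc[OF j] by (simp add: sum_distrib_left left_diff_distrib right_diff_distrib sum_subtractf ac_simps)
  thus ?thesis by (simp add: idl_mult[OF idl_L] idl_sum[OF idl_L] idl_multr[OF idl_L] x_u_L)
 qed
 have sat: "prod_list (map xv vs) * w j \<in> L" if "length vs = j" "j \<le> m" for vs j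
  using that
 proof (induction vs arbitrary: j)
  case Nil thus ?case using f_L w0 by simp
 next
  case (Cons v vs)
  then obtain j' where j': "j = Suc j'" "length vs = j'" "j' < m" by (cases j) auto
  have "prod_list (map xv (v # vs)) * w j = prod_list (map xv vs) * (xv v * w (Suc j') - const (\<kappa> j') * sT (u v) * w j')
    + const (\<kappa> j') * sT (u v) * (prod_list (map xv vs) * w j')" by (simp add: j' algebra_simps)
  thus ?case using xw[OF j'(3)] Cons.IH[OF j'(2)] j'(3) by (simp add: idl_add[OF idl_L] idl_mult[OF idl_L])
 qed
 have isat: "idl saturation"
  by (rule idlI) (auto simp: saturation_def distrib_left idl_0[OF idl_L] idl_add[OF idl_L] mult.left_commute[of "prod_list _"] idl_mult[OF idl_L])
 have "w j \<in> saturation" if "j \<le> m" for j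
  unfolding saturation_def
 proof (intro CollectI allI impI)
  fix vs :: "'n list" assume vs: "length vs = m"
  have "prod_list (map xv (take j vs @ drop j vs)) = prod_list (map xv (drop j vs)) * (prod_list (map xv (take j vs)) :: ('n + 'n, 'k) mpoly)"
   unfolding map_append prod_list.append by (rule mult.commute)
  hence "prod_list (map xv vs) = prod_list (map xv (drop j vs)) * (prod_list (map xv (take j vs)) :: ('n + 'n, 'k) mpoly)"
   by (simp only: append_take_drop_id)
  thus "prod_list (map xv vs) * w j \<in> L"
   using sat[of "take j vs" j] that vs by (simp add: mult.assoc idl_mult[OF idl_L])
 qed
 hence 1: "?W \<subseteq> saturation"
  by (intro gen_least isat) (auto simp: saturation_def idl_mult[OF idl_L])
 have wT: "EX b. homog wT b (w j)" if j: "j \<le> m" for j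
 proof (cases j)
  case 0 thus ?thesis using w0 homog_T_sx by metis
 next
  case (Suc j')
  then obtain b where b: "!!k. homog wT b (c j' k)" using cT[of j'] j by auto
  have "homog wT (0 + ((CARD('n) - 2) + b)) (w j)"
   unfolding Suc wS[OF Suc_le_lessD[OF j[unfolded Suc]]] by (intro homog_mult homog_const homog_sum homog_T_sT u_homog b)
  thus ?thesis by blast
 qed
 have wX: "homog wX (m - j) (w j)" if j: "j \<le> m" for j
 proof (cases j)
  case 0 thus ?thesis using w0 homog_X_sx[OF f_homog] by simp
 next
  case (Suc j')
  have "homog wX (0 + (0 + (m - Suc j'))) (w j)"
   unfolding Suc wS[OF Suc_le_lessD[OF j[unfolded Suc]]]
   by (intro homog_mult homog_const homog_sum homog_X_sT cX) (use j Suc in simp)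
  thus ?thesis using Suc by simp
 qed
 \<comment> \<open>Contraction with u and contraction with x have the same value at x = u, so there
   every w j is f(u) up to a nonzero constant.\<close>
 have wu: "EX \<mu>. \<mu> ~= 0 & sub (case_sum u var) (w j) = const \<mu> * sub u f" if "j \<le> m" for j
  using that
 proof (induction j)
  case 0
  show ?case by (rule exI[of _ 1]) (simp add: w0 sub_sub sub_simps ring_map_simps(1)[OF ring_map_const])
 next
  case (Suc j)
  then obtain \<mu> where \<mu>: "\<mu> ~= 0" "sub (case_sum u var) (w j) = const \<mu> * sub u f" by auto
  have "sub (case_sum u var) (w (Suc j)) = const (\<kappa> j) * sub (case_sum u var) (w j)"
   unfolding wS[OF Suc_le_lessD[OF Suc.prems]] wc[OF Suc_le_lessD[OF Suc.prems]]
   by (simp add: sub_simps sub_sub sub_var)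
  hence "sub (case_sum u var) (w (Suc j)) = const (\<kappa> j * \<mu>) * sub u f" by (simp add: \<mu>(2) const_simps mult.assoc)
  thus ?case using \<mu>(1) \<kappa>[of j] by (intro exI[of _ "\<kappa> j * \<mu>"]) simp
 qed
 have 2: "rees \<subseteq> ?W"
 proof
  fix F assume F: "F \<in> rees"
  have "hcomp wX j (hcomp wT d F) \<in> ?W" for d j
  proof -
   define h where "h = hcomp wX j (hcomp wT d F)"
   have hX: "homog wX j h" unfolding h_def by (rule homog_hcomp)
   have hT: "homog wT d h"
   proof -
    have "t \<in> keys (hcomp wT d F)" if "t \<in> keys h" for t
     using that unfolding h_def by (auto simp: in_keys_iff lookup_hcomp[of _ _ "hcomp wT d F"] split: if_splits)
    thus ?thesis using homog_hcomp[of wT d F] unfolding homog_iff by blast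
   qed
   have "sub (case_sum var p) h \<in> gen {f}"
   proof -
    \<comment> \<open>The p have degree e, so substituting T = p is homogeneous for the weights 1 on
      x and e on T. This isolates the part of x-degree j in the component of T-degree d.\<close>
    let ?G = "hcomp wT d F" and ?w = "case_sum w1 (%_. e) :: 'n + 'n => nat"
    have "hcomp ?w (j + e * d) ?G = h"
    proof (rule poly_mapping_eqI)
     fix t
     have "(\<Sum>v\<in>keys t. ?w v * lk t v) = (\<Sum>v\<in>keys t. wX v * lk t v) + e * (\<Sum>v\<in>keys t. wT v * lk t v)"
      unfolding sum_distrib_left sum.distrib[symmetric] by (intro sum.cong) (auto split: sum.split)
     moreover have "(\<Sum>v\<in>keys t. wT v * lk t v) = d" if "lk ?G t ~= 0"
      using homog_hcomp[of wT d F, unfolded homog_iff, rule_format, of t] that unfolding in_keys_iff .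
     ultimately show "lk (hcomp ?w (j + e * d) ?G) t = lk h t" by (auto simp: h_def lookup_hcomp[of _ _ ?G])
    qed
    moreover have "sub (case_sum var p) (hcomp ?w (j + e * d) ?G) = hcomp w1 (j + e * d) (sub (case_sum var p) ?G)"
     by (rule hcomp_sub[symmetric]) (use p_homog homog_var[of w1] in \<open>auto split: sum.split\<close>)
    moreover have "hideal w1 (gen {f})" by (rule hideal_gen) (use f_homog in auto)
    ultimately show ?thesis using F by (simp add: rees_def hideal_def)
   qed
   from p_substitution[OF hT this] have ph: "sx (p a) ^ d * h \<in> L" for a .
   obtain g where g: "sub (case_sum u var) h = g * sub u f" using f_u_dvd[OF ph] by blast
   show ?thesis
   proof (cases "j \<le> m")
    case True
    obtain \<mu> where \<mu>: "\<mu> ~= 0" "sub (case_sum u var) (w (m - j)) = const \<mu> * sub u f" using wu[of "m - j"] by auto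
    obtain b where b: "homog wT b (w (m - j))" using wT[of "m - j"] by auto
    have "w (m - j) \<in> rees" using 1 saturation_rees genI[of "w (m - j)" "L Un w ` {..m}"] by auto
    from p_substitution[OF b this[unfolded homog_rees[OF b]]] have pw: "sx (p a) ^ b * w (m - j) \<in> L" for a .
    define h1 where "h1 = h - sT (g * const (1 / \<mu>)) * w (m - j)"
    have "homog wX (0 + (m - (m - j))) (sT (g * const (1 / \<mu>)) * w (m - j))"
     by (intro homog_mult homog_X_sT wX) simp
    hence h1X: "homog wX j h1" unfolding h1_def using True hX by (intro homog_diff) simp_all
    have c1: "const (1 / \<mu>) * const \<mu> = (1 :: ('n, 'k) mpoly)" using \<mu>(1) by (simp add: const_simps[symmetric]) (simp add: const_def)
    have "sub (case_sum u var) h1 = g * sub u f - g * (const (1 / \<mu>) * const \<mu>) * sub u f"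
     unfolding h1_def by (simp add: sub_simps g \<mu>(2) sub_sub sub_var mult.assoc)
    hence "sub (case_sum u var) h1 = 0" unfolding c1 by simp
    hence "(Tv a * sT (u k)) ^ j * h1 \<in> L" for a k
     using x_substitution[OF h1X, of a k] L0_L by (auto simp: sub_simps)
    moreover have "sx (p a) ^ (d + b) * h1 \<in> L" for a
    proof -
     have "sx (p a) ^ (d + b) * h1 = sx (p a) ^ b * (sx (p a) ^ d * h) - sx (p a) ^ d * sT (g * const (1 / \<mu>)) * (sx (p a) ^ b * w (m - j))"
      by (simp add: h1_def power_add algebra_simps)
     thus ?thesis by (simp add: idl_diff[OF idl_L] idl_mult[OF idl_L] ph pw)
    qed
    ultimately have "h1 \<in> L" by (intro mem_L_if[of "d + b" h1 j])
    hence "h1 + sT (g * const (1 / \<mu>)) * w (m - j) \<in> ?W"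
     by (intro idl_add[OF idl_gen] idl_mult[OF idl_gen] genI) auto
    thus ?thesis by (simp add: h1_def h_def)
   next
    \<comment> \<open>For x-degree above m nothing has to be subtracted: (x_k T_a)^m f(u) already
      lies in L.\<close>
    case False
    have "(Tv a * sT (u k)) ^ j * h \<in> L" for a k
    proof -
     have f1: "(xv k * Tv a) ^ m * sT (sub u f) \<in> L"
     proof -
      have e: "sub (case_sum u var) (sx f) = sub u f" by (simp add: sub_sub sub_simps)
      have "(Tv a * sT (u k)) ^ m * sx f - (xv k * Tv a) ^ m * sT (sub u f) \<in> L"
       using x_substitution[OF homog_X_sx[OF f_homog], of a k] L0_L e by auto
      from idl_diff[OF idl_L idl_mult[OF idl_L f_L, of "(Tv a * sT (u k)) ^ m"] this] show ?thesis by simp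
     qed
     have "(xv k * Tv a) ^ j * sT (g * sub u f) = (xv k * Tv a) ^ (j - m) * sT g * ((xv k * Tv a) ^ m * sT (sub u f))"
     proof -
      have "(xv k * Tv a) ^ j = (xv k * Tv a) ^ (j - m) * (xv k * Tv a :: ('n + 'n, 'k) mpoly) ^ m"
       using False by (simp add: power_add[symmetric])
      thus ?thesis by (simp add: sub_simps ac_simps)
     qed
     hence "(xv k * Tv a) ^ j * sT (g * sub u f) \<in> L" using f1 by (simp add: idl_mult[OF idl_L])
     hence "(Tv a * sT (u k)) ^ j * h - (xv k * Tv a) ^ j * sT (g * sub u f) + (xv k * Tv a) ^ j * sT (g * sub u f) \<in> L"
      using x_substitution[OF hX, of a k] L0_L by (intro idl_add[OF idl_L]) (auto simp: g)
     thus ?thesis by simp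
    qed
    hence "h \<in> L" by (intro mem_L_if[of d h j] ph)
    thus ?thesis by (auto simp: h_def intro: genI)
   qed
  qed
  hence "hcomp wT d F \<in> ?W" for d
   using sum_hcomp[of "hcomp wT d F" wX] idl_sum[OF idl_gen, of "{..degree (homog_map wX (hcomp wT d F))}"] by metis
  thus "F \<in> ?W"
   using sum_hcomp[of F wT] idl_sum[OF idl_gen, of "{..degree (homog_map wT F)}" "%d. hcomp wT d F"] by metis
 qed
 show "?W = rees" and "?W = saturation" using 1 2 saturation_rees by blast+
qed

end

section \<open>Localization\<close>

abbreviation RT :: "'a::comm_ring_1 ring" where "RT \<equiv> ring_of_type_algebra"

lemma RT_simps [simp]:
 "carrier RT = UNIV" "x \<otimes>\<^bsub>RT\<^esub> y = x * y" "x \<oplus>\<^bsub>RT\<^esub> y = x + y" "\<one>\<^bsub>RT\<^esub> = 1" "\<zero>\<^bsub>RT\<^esub> = 0"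
 by (simp_all add: ring_of_type_algebra_def)

lemma ideal_RT: "ideal Q RT <-> idl Q"
proof
 assume "ideal Q RT"
 then interpret ideal Q RT .
 show "idl Q" using additive_subgroup.zero_closed[OF is_additive_subgroup] additive_subgroup.a_closed[OF is_additive_subgroup] I_l_closed by (intro idlI) simp_all
next
 assume Q: "idl Q"
 interpret cring RT by rule
 have m: "\<ominus>\<^bsub>RT\<^esub> x = - x" for x by (rule minus_equality) simp_all
 show "ideal Q RT"
 proof (rule idealI[OF ring_axioms])
  show "subgroup Q (add_monoid RT)"
   by (rule add.subgroupI) (use idl_0[OF Q] in \<open>auto simp: idl_add[OF Q] idl_minus[OF Q] m\<close>)
 qed (simp_all add: idl_mult[OF Q] idl_multr[OF Q])
qed

lemma genideal_RT: "Idl\<^bsub>RT\<^esub> U = gen U" by (simp add: genideal_def gen_def ideal_RT)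

lemma primeideal_RT: "primeideal Q RT <-> pr Q"
proof
 assume "primeideal Q RT"
 then interpret primeideal Q RT .
 have Q: "idl Q" using is_ideal by (simp add: ideal_RT)
 have "1 ~: Q"
 proof
  assume "1 \<in> Q"
  hence "r \<in> Q" for r using idl_mult[OF Q, of 1 r] by simp
  thus False using I_notcarr by auto
 qed
 thus "pr Q" using Q I_prime by (simp add: pr_def)
next
 assume Q: "pr Q"
 thus "primeideal Q RT"
  by (intro primeidealI) (auto simp: ideal_RT pr_def)
qed

lemma gen_insert: "gen (insert b (gen U)) = gen (insert b U)"
 by (intro equalityI gen_subI) (use gen_mono[of U "insert b U"] in \<open>auto intro: genI\<close>)

section \<open>Fractions modulo a prime, contraction of primes, local generators\<close>

context
 fixes P :: "'r::comm_ring_1 set"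
 assumes P: "pr P"
begin

lemma mult_notin: "s ~: P ==> t ~: P ==> s * t ~: P" using pr_mult[OF P] by blast

lemma equiv_frac_rel: "equiv (UNIV \<times> - P) (frac_rel RT P)"
proof (rule equivI)
 show "frac_rel RT P \<subseteq> (UNIV \<times> - P) \<times> (UNIV \<times> - P)" by (auto simp: frac_rel_def)
 show "refl_on (UNIV \<times> - P) (frac_rel RT P)"
  by (rule refl_onI) (use pr_1[OF P] in \<open>auto simp: frac_rel_def\<close>)
 show "sym (frac_rel RT P)" 
 proof (rule symI)
  fix x y assume "(x, y) \<in> frac_rel RT P"
  then obtain a s b t u where "x = (a, s)" "y = (b, t)" "s ~: P" "t ~: P" "u ~: P" "u * (b * s) = u * (a * t)"
   by (auto simp: frac_rel_def)
  thus "(y, x) \<in> frac_rel RT P" by (auto simp: frac_rel_def)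
 qed
 show "trans (frac_rel RT P)"
 proof (rule transI)
  fix x y z assume "(x, y) \<in> frac_rel RT P" "(y, z) \<in> frac_rel RT P"
  then obtain a s b t c r u v where xyz: "x = (a, s)" "y = (b, t)" "z = (c, r)"
   "s ~: P" "t ~: P" "r ~: P" and uv: "u ~: P" "u * (a * t) = u * (b * s)" "v ~: P" "v * (b * r) = v * (c * t)"
   by (auto simp: frac_rel_def)
  have "u * v * t * (a * r) = (u * (a * t)) * v * r" by (simp add: ac_simps)
  also have "\<dots> = u * s * (v * (b * r))" unfolding uv(2) by (simp add: ac_simps)
  also have "\<dots> = u * v * t * (c * s)" unfolding uv(4) by (simp add: ac_simps)
  finally have "u * v * t * (a * r) = u * v * t * (c * s)" .
  thus "(x, z) \<in> frac_rel RT P" using xyz uv(1,3)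
   by (auto simp: frac_rel_def mult_notin intro!: bexI[of _ "u * v * t"])
 qed
qed

lemma loc_frac_eq:
 "s ~: P ==> t ~: P ==> loc_frac RT P a s = loc_frac RT P b t <-> (EX u. u ~: P & u * (a * t) = u * (b * s))"
 unfolding loc_frac_def using eq_equiv_class_iff[OF equiv_frac_rel, of "(a, s)" "(b, t)"]
 by (auto simp: frac_rel_def)

lemma loc_frac_eqI: "s ~: P ==> t ~: P ==> a * t = b * s ==> loc_frac RT P a s = loc_frac RT P b t"
 using pr_1[OF P] by (subst loc_frac_eq) auto

abbreviation RP where "RP \<equiv> localization RT P"

lemma carrier_RP: "carrier RP = {loc_frac RT P a s | a s. s ~: P}"
 by (auto simp: localization_def loc_frac_def quotient_def)

lemma RP_mult:
 assumes "s ~: P" "t ~: P"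
 shows "loc_frac RT P a s \<otimes>\<^bsub>RP\<^esub> loc_frac RT P b t = loc_frac RT P (a * b) (s * t)"
proof -
 have "congruent2 (frac_rel RT P) (frac_rel RT P) (%(a, s) (b, t). loc_frac RT P (a * b) (s * t))"
 proof (rule congruent2I')
  fix x x' y y' assume "(x, x') \<in> frac_rel RT P" "(y, y') \<in> frac_rel RT P"
  then obtain a s a' s' b t b' t' u v where xy: "x = (a, s)" "x' = (a', s')" "y = (b, t)" "y' = (b', t')"
   "s ~: P" "s' ~: P" "t ~: P" "t' ~: P" and uv: "u ~: P" "u * (a * s') = u * (a' * s)" "v ~: P" "v * (b * t') = v * (b' * t)"
   by (auto simp: frac_rel_def)
  have "u * v * (a * b * (s' * t')) = (u * (a * s')) * (v * (b * t'))" by (simp add: ac_simps)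
  also have "\<dots> = u * v * (a' * b' * (s * t))" unfolding uv by (simp add: ac_simps)
  finally show "(case x of (a, s) => %(b, t). loc_frac RT P (a * b) (s * t)) y = (case x' of (a, s) => %(b, t). loc_frac RT P (a * b) (s * t)) y'"
   using xy uv(1,3) by (auto simp: loc_frac_eq mult_notin intro!: exI[of _ "u * v"])
 qed
 from UN_equiv_class2[OF equiv_frac_rel equiv_frac_rel this, of "(a, s)" "(b, t)"] assms
 show ?thesis by (simp add: localization_def loc_frac_def[of _ _ a s] loc_frac_def[of _ _ b t] case_prod_unfold)
qed

lemma RP_add:
 assumes "s ~: P" "t ~: P"
 shows "loc_frac RT P a s \<oplus>\<^bsub>RP\<^esub> loc_frac RT P b t = loc_frac RT P (a * t + b * s) (s * t)"
proof -
 have "congruent2 (frac_rel RT P) (frac_rel RT P) (%(a, s) (b, t). loc_frac RT P (a * t + b * s) (s * t))"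
 proof (rule congruent2I')
  fix x x' y y' assume "(x, x') \<in> frac_rel RT P" "(y, y') \<in> frac_rel RT P"
  then obtain a s a' s' b t b' t' u v where xy: "x = (a, s)" "x' = (a', s')" "y = (b, t)" "y' = (b', t')"
   "s ~: P" "s' ~: P" "t ~: P" "t' ~: P" and uv: "u ~: P" "u * (a * s') = u * (a' * s)" "v ~: P" "v * (b * t') = v * (b' * t)"
   by (auto simp: frac_rel_def)
  have "u * v * ((a * t + b * s) * (s' * t')) = (u * (a * s')) * (v * t * t') + (v * (b * t')) * (u * s * s')" by (simp add: algebra_simps)
  also have "\<dots> = u * v * ((a' * t' + b' * s') * (s * t))" unfolding uv by (simp add: algebra_simps)
  finally show "(case x of (a, s) => %(b, t). loc_frac RT P (a * t + b * s) (s * t)) y = (case x' of (a, s) => %(b, t). loc_frac RT P (a * t + b * s) (s * t)) y'"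
   using xy uv(1,3) by (auto simp: loc_frac_eq mult_notin intro!: exI[of _ "u * v"])
 qed
 from UN_equiv_class2[OF equiv_frac_rel equiv_frac_rel this, of "(a, s)" "(b, t)"] assms
 show ?thesis by (simp add: localization_def loc_frac_def[of _ _ a s] loc_frac_def[of _ _ b t] case_prod_unfold)
qed

lemma RP_consts: "\<one>\<^bsub>RP\<^esub> = loc_frac RT P 1 1" "\<zero>\<^bsub>RP\<^esub> = loc_frac RT P 0 1"
 by (simp_all add: localization_def)

lemma loc_frac_carrier: "s ~: P ==> loc_frac RT P a s \<in> carrier RP" by (auto simp: carrier_RP)

lemma cring_RP: "cring RP"
proof -
 have rep: thesis if "x \<in> carrier RP" "!!a s. x = loc_frac RT P a s ==> s ~: P ==> thesis" for x thesis
  using that by (auto simp: carrier_RP)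
 note s = loc_frac_carrier RP_consts RP_add RP_mult mult_notin pr_1[OF P]
 have 1: "x \<oplus>\<^bsub>RP\<^esub> y \<in> carrier RP" "x \<otimes>\<^bsub>RP\<^esub> y \<in> carrier RP" "x \<oplus>\<^bsub>RP\<^esub> y = y \<oplus>\<^bsub>RP\<^esub> x" "x \<otimes>\<^bsub>RP\<^esub> y = y \<otimes>\<^bsub>RP\<^esub> x"
  if "x \<in> carrier RP" "y \<in> carrier RP" for x y
  by (rule rep[OF that(1)], rule rep[OF that(2)], simp add: s ac_simps)+
 have 2: "(x \<oplus>\<^bsub>RP\<^esub> y) \<oplus>\<^bsub>RP\<^esub> z = x \<oplus>\<^bsub>RP\<^esub> (y \<oplus>\<^bsub>RP\<^esub> z)" "(x \<otimes>\<^bsub>RP\<^esub> y) \<otimes>\<^bsub>RP\<^esub> z = x \<otimes>\<^bsub>RP\<^esub> (y \<otimes>\<^bsub>RP\<^esub> z)"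
  "(x \<oplus>\<^bsub>RP\<^esub> y) \<otimes>\<^bsub>RP\<^esub> z = x \<otimes>\<^bsub>RP\<^esub> z \<oplus>\<^bsub>RP\<^esub> y \<otimes>\<^bsub>RP\<^esub> z"
  if "x \<in> carrier RP" "y \<in> carrier RP" "z \<in> carrier RP" for x y z
  by (rule rep[OF that(1)], rule rep[OF that(2)], rule rep[OF that(3)], simp add: s, rule loc_frac_eqI, simp_all add: s algebra_simps)+
 have 3: "\<zero>\<^bsub>RP\<^esub> \<oplus>\<^bsub>RP\<^esub> x = x" "\<one>\<^bsub>RP\<^esub> \<otimes>\<^bsub>RP\<^esub> x = x" "EX y:carrier RP. y \<oplus>\<^bsub>RP\<^esub> x = \<zero>\<^bsub>RP\<^esub>" if x: "x \<in> carrier RP" for x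
 proof -
  obtain a t where x: "x = loc_frac RT P a t" "t ~: P" using rep[OF x] by blast
  show "\<zero>\<^bsub>RP\<^esub> \<oplus>\<^bsub>RP\<^esub> x = x" "\<one>\<^bsub>RP\<^esub> \<otimes>\<^bsub>RP\<^esub> x = x" using x(2) unfolding x(1) by (simp_all add: s)
  have "loc_frac RT P (- a) t \<oplus>\<^bsub>RP\<^esub> x = \<zero>\<^bsub>RP\<^esub>" using x(2) unfolding x(1) by (simp add: s, intro loc_frac_eqI) (simp_all add: s)
  thus "EX y:carrier RP. y \<oplus>\<^bsub>RP\<^esub> x = \<zero>\<^bsub>RP\<^esub>" using x loc_frac_carrier by blast
 qed
 have 4: "\<zero>\<^bsub>RP\<^esub> \<in> carrier RP" "\<one>\<^bsub>RP\<^esub> \<in> carrier RP" by (simp_all add: s)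
 show ?thesis by (intro cringI abelian_groupI comm_monoidI) (fact 1 2 3 4)+
qed

lemma contraction_prime:
 assumes Q: "primeideal Q RP"
 shows "pr {x. loc_frac RT P x 1 \<in> Q}" "{x. loc_frac RT P x 1 \<in> Q} \<subseteq> P"
proof -
 interpret primeideal Q RP by (rule Q)
 note 1 = pr_1[OF P]
 have one: "\<one>\<^bsub>RP\<^esub> ~: Q" using I_notcarr one_imp_carrier by blast
 show "pr {x. loc_frac RT P x 1 \<in> Q}"
  unfolding pr_def
 proof (intro conjI allI impI idlI)
  show "0 \<in> {x. loc_frac RT P x 1 \<in> Q}" using additive_subgroup.zero_closed[OF is_additive_subgroup] by (simp add: RP_consts)
  show "1 ~: {x. loc_frac RT P x 1 \<in> Q}" using one by (simp add: RP_consts)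
  fix a b
  show "a + b \<in> {x. loc_frac RT P x 1 \<in> Q}" if "a \<in> {x. loc_frac RT P x 1 \<in> Q}" "b \<in> {x. loc_frac RT P x 1 \<in> Q}"
   using that additive_subgroup.a_closed[OF is_additive_subgroup, of "loc_frac RT P a 1" "loc_frac RT P b 1"] by (simp add: RP_add 1)
  show "a * b \<in> {x. loc_frac RT P x 1 \<in> Q}" if "b \<in> {x. loc_frac RT P x 1 \<in> Q}"
   using that I_l_closed[OF _ loc_frac_carrier[OF 1], of "loc_frac RT P b 1" a] by (simp add: RP_mult 1)
  show "a \<in> {x. loc_frac RT P x 1 \<in> Q} \<or> b \<in> {x. loc_frac RT P x 1 \<in> Q}" if "a * b \<in> {x. loc_frac RT P x 1 \<in> Q}"
   using that I_prime[OF loc_frac_carrier[OF 1] loc_frac_carrier[OF 1], of a b] by (simp add: RP_mult 1)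
 qed
 show "{x. loc_frac RT P x 1 \<in> Q} \<subseteq> P"
 proof
  fix s assume s: "s \<in> {x. loc_frac RT P x 1 \<in> Q}"
  show "s \<in> P"
  proof (rule ccontr)
   assume "s ~: P"
   hence "loc_frac RT P 1 s \<otimes>\<^bsub>RP\<^esub> loc_frac RT P s 1 = \<one>\<^bsub>RP\<^esub>"
    using 1 by (simp add: RP_mult RP_consts, intro loc_frac_eqI) simp_all
   thus False using one I_l_closed[OF _ loc_frac_carrier[OF \<open>s ~: P\<close>], of "loc_frac RT P s 1" 1] s by simp
  qed
 qed
qed

lemma contraction_strict:
 assumes Q: "primeideal Q RP" "primeideal Q' RP" "Q \<subset> Q'"
 shows "{x. loc_frac RT P x 1 \<in> Q} \<subset> {x. loc_frac RT P x 1 \<in> Q'}"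
proof -
 interpret Q: primeideal Q RP by (rule Q)
 interpret Q': primeideal Q' RP by (rule Q)
 obtain y where y: "y \<in> Q'" "y ~: Q" using Q(3) by blast
 then obtain a s where as: "y = loc_frac RT P a s" "s ~: P" using Q'.Icarr[OF y(1)] unfolding carrier_RP by blast
 note 1 = pr_1[OF P]
 have "loc_frac RT P s 1 \<otimes>\<^bsub>RP\<^esub> y = loc_frac RT P a 1"
  unfolding as(1) RP_mult[OF 1 as(2)] using as(2) 1 by (intro loc_frac_eqI) simp_all
 moreover have "loc_frac RT P 1 s \<otimes>\<^bsub>RP\<^esub> loc_frac RT P a 1 = y"
  unfolding as(1) RP_mult[OF as(2) 1] using as(2) by (intro loc_frac_eqI) simp_all
 ultimately have "loc_frac RT P a 1 \<in> Q'" "loc_frac RT P a 1 ~: Q"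
  using Q'.I_l_closed[OF y(1) loc_frac_carrier[OF 1, of s]] Q.I_l_closed[OF _ loc_frac_carrier[OF as(2)], of "loc_frac RT P a 1" 1] y(2)
  by auto
 thus ?thesis using Q(3) by blast
qed

lemma mu_localization:
 assumes "mu RP (ideal_localization RT P I) \<le> enat c" "idl I"
 shows "EX Y. finite Y & card Y \<le> c & Y \<subseteq> I & (ALL a:I. EX s. s ~: P & s * a \<in> gen Y)"
proof -
 interpret RP: cring RP by (rule cring_RP)
 let ?M = "{enat (card U) | U. finite U & U \<subseteq> carrier RP & Idl\<^bsub>RP\<^esub> U = ideal_localization RT P I}"
 \<comment> \<open>The infimum of the empty set is infinite, so a finite bound provides a finite
   generating set.\<close>
 have "?M ~= {}" using assms(1) unfolding mu_def by (metis Inf_empty enat_ord_simps(5) infinity_ileE top_enat_def)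
 hence "Inf ?M \<in> ?M" using wellorder_InfI[of _ ?M] by blast
 then obtain U where U: "finite U" "U \<subseteq> carrier RP" "Idl\<^bsub>RP\<^esub> U = ideal_localization RT P I" "enat (card U) \<le> enat c"
  using assms(1) unfolding mu_def by auto
 have "ALL y:U. EX x s. y = loc_frac RT P x s & x \<in> I & s ~: P"
  using RP.genideal_self[OF U(2)] unfolding U(3) ideal_localization_def by auto
 then obtain x s where xs: "!!y. y \<in> U ==> y = loc_frac RT P (x y) (s y) & x y \<in> I & s y ~: P" by metis
 let ?Y = "x ` U"
 note 1 = pr_1[OF P]
 \<comment> \<open>The fractions whose numerator lies in \<open>gen Y\<close> up to a factor outside
   P. They form an ideal that contains U, hence the whole localized ideal.\<close>
 define G0 where "G0 = {loc_frac RT P z t | z t. t ~: P & (EX r. r ~: P & r * z \<in> gen ?Y)}"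
 have G: "loc_frac RT P z t \<in> G0 <-> (EX r. r ~: P & r * z \<in> gen ?Y)" if t: "t ~: P" for z t
 proof
  assume "loc_frac RT P z t \<in> G0"
  then obtain z' t' r where z': "loc_frac RT P z t = loc_frac RT P z' t'" "t' ~: P" "r ~: P" "r * z' \<in> gen ?Y" unfolding G0_def by blast
  obtain v where v: "v ~: P" "v * (z * t') = v * (z' * t)" using z'(1) unfolding loc_frac_eq[OF t z'(2)] by blast
  have "(v * r * t') * z = r * (v * (z * t'))" by (simp add: ac_simps)
  also have "\<dots> = (v * t) * (r * z')" unfolding v(2) by (simp add: ac_simps)
  finally have "(v * r * t') * z \<in> gen ?Y" using idl_mult[OF idl_gen z'(4)] by metis
  thus "EX r. r ~: P & r * z \<in> gen ?Y" using v(1) z'(2,3) mult_notin by blast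
 qed (use t in \<open>unfold G0_def, blast\<close>)
 have GE: thesis if "b \<in> G0" "!!z t r. b = loc_frac RT P z t ==> t ~: P ==> r ~: P ==> r * z \<in> gen ?Y ==> thesis" for b thesis
  using that unfolding G0_def by blast
 have GP: "b \<in> carrier RP" if "b \<in> G0" for b using that by (rule GE) (simp add: loc_frac_carrier)
 have "ideal G0 RP"
 proof (rule idealI[OF RP.ring_axioms])
  have l: "y \<otimes>\<^bsub>RP\<^esub> b \<in> G0" if b: "b \<in> G0" and y: "y \<in> carrier RP" for b y
  proof -
   obtain z t r where z: "b = loc_frac RT P z t" "t ~: P" "r ~: P" "r * z \<in> gen ?Y" using b by (rule GE)
   obtain w q where w: "y = loc_frac RT P w q" "q ~: P" using y unfolding carrier_RP by blast
   have "r ~: P & r * (w * z) \<in> gen ?Y" using z idl_mult[OF idl_gen, of "r * z" ?Y w] by (simp add: ac_simps)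
   thus ?thesis unfolding z(1) w(1) RP_mult[OF w(2) z(2)] G[OF mult_notin[OF w(2) z(2)]] by blast
  qed
  show "subgroup G0 (add_monoid RP)"
  proof (rule RP.add.subgroupI)
   show "G0 \<subseteq> carrier RP" using GP by blast
   have "1 * 0 \<in> gen ?Y" using idl_0[OF idl_gen] by simp
   hence "loc_frac RT P 0 1 \<in> G0" using 1 unfolding G[OF 1] by blast
   thus "G0 ~= {}" by blast
  next
   fix b assume b: "b \<in> G0"
   hence bc: "b \<in> carrier RP" by (rule GP)
   have "\<ominus>\<^bsub>RP\<^esub> b = (\<ominus>\<^bsub>RP\<^esub> \<one>\<^bsub>RP\<^esub>) \<otimes>\<^bsub>RP\<^esub> b" using bc by (simp add: RP.l_minus)
   thus "\<ominus>\<^bsub>RP\<^esub> b \<in> G0" using l[OF b, of "\<ominus>\<^bsub>RP\<^esub> \<one>\<^bsub>RP\<^esub>"] by simp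
  next
   fix b b' assume b: "b \<in> G0" "b' \<in> G0"
   obtain z t r where z: "b = loc_frac RT P z t" "t ~: P" and r: "r ~: P" "r * z \<in> gen ?Y" using b(1) by (rule GE)
   obtain z' t' r' where z': "b' = loc_frac RT P z' t'" "t' ~: P" and r': "r' ~: P" "r' * z' \<in> gen ?Y" using b(2) by (rule GE)
   have "r * r' * (z * t' + z' * t) = r' * t' * (r * z) + r * t * (r' * z')" by (simp add: algebra_simps)
   also have "\<dots> \<in> gen ?Y" by (intro idl_add[OF idl_gen] idl_mult[OF idl_gen r(2)] idl_mult[OF idl_gen r'(2)])
   finally have "r * r' ~: P & r * r' * (z * t' + z' * t) \<in> gen ?Y" using mult_notin[OF r(1) r'(1)] by simp
   thus "b \<oplus>\<^bsub>RP\<^esub> b' \<in> G0" unfolding z(1) z'(1) RP_add[OF z(2) z'(2)] G[OF mult_notin[OF z(2) z'(2)]] by blast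
  qed
  show "y \<otimes>\<^bsub>RP\<^esub> b \<in> G0" "b \<otimes>\<^bsub>RP\<^esub> y \<in> G0" if "b \<in> G0" "y \<in> carrier RP" for b y
  proof -
   have "b \<in> carrier RP" by (rule GP[OF that(1)])
   thus "y \<otimes>\<^bsub>RP\<^esub> b \<in> G0" "b \<otimes>\<^bsub>RP\<^esub> y \<in> G0" using l[OF that] RP.m_comm[OF _ that(2)] by simp_all
  qed
 qed
 moreover have "U \<subseteq> G0"
 proof
  fix y assume y: "y \<in> U"
  have "x y \<in> gen ?Y" using y by (auto intro: genI)
  hence "1 ~: P & 1 * x y \<in> gen ?Y" using 1 by simp
  hence "loc_frac RT P (x y) (s y) \<in> G0" using G xs[OF y] by blast
  thus "y \<in> G0" using xs[OF y] by simp
 qed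
 ultimately have IG: "ideal_localization RT P I \<subseteq> G0" unfolding U(3)[symmetric] by (rule RP.genideal_minimal)
 have "EX t. t ~: P & t * a \<in> gen ?Y" if "a \<in> I" for a
 proof -
  have "loc_frac RT P a 1 \<in> ideal_localization RT P I" using that 1 unfolding ideal_localization_def by auto
  thus ?thesis using IG G[OF 1] by blast
 qed
 moreover have "finite ?Y" "card ?Y \<le> c" "?Y \<subseteq> I" using U(1,4) xs card_image_le[OF U(1), of x] by auto
 ultimately show ?thesis by blast
qed

lemma krull_dim_localization:
 assumes "!!k C. (!!i. i \<le> k ==> pr (C i) & C i \<subseteq> P) ==> (!!i. i < k ==> C i \<subset> C (Suc i)) ==> k \<le> r"
 shows "krull_dim RP \<le> enat r"
 unfolding krull_dim_def
proof (rule Sup_least, clarify)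
 fix k and C assume C: "\<forall>i\<le>k. primeideal (C i) RP" "\<forall>i<k. C i \<subset> C (Suc i)"
 have "k \<le> r"
  by (rule assms[of k "%i. {x. loc_frac RT P x 1 \<in> C i}"])
   (use C in \<open>simp_all add: contraction_prime contraction_strict\<close>)
 thus "enat k \<le> enat r" by simp
qed

end

text \<open>G_d without localizations: denominators of the local generators are cleared, and the
  dimension is replaced by a bound for chains of primes inside P.\<close>

lemma satisfies_G_generators:
 fixes P I :: "'r::comm_ring_1 set"
 assumes G: "satisfies_G RT I d" and P: "pr P" "I \<subseteq> P" "idl I" and r: "r < d"
  and dim: "!!k C. (!!i. i \<le> k ==> pr (C i) & C i \<subseteq> P) ==> (!!i. i < k ==> C i \<subset> C (Suc i)) ==> k \<le> r"
 shows "EX Y. finite Y & card Y \<le> r & Y \<subseteq> I & (ALL a:I. EX s. s ~: P & s * a \<in> gen Y)"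
proof -
 have k: "krull_dim (localization RT P) \<le> enat r" by (rule krull_dim_localization[OF P(1) dim])
 hence "krull_dim (localization RT P) + 1 \<le> enat r + enat 1" unfolding one_enat_def by (rule add_right_mono)
 hence "krull_dim (localization RT P) + 1 \<le> enat d" using r by (auto elim!: order_trans)
 hence "mu (localization RT P) (ideal_localization RT P I) \<le> krull_dim (localization RT P)"
  using P(1,2) by (intro G[unfolded satisfies_G_def primeideal_RT, rule_format] conjI)
 hence "mu (localization RT P) (ideal_localization RT P I) \<le> enat r" using k by (rule order_trans)
 from mu_localization[OF P(1) this P(3)] show ?thesis .
qed

section \<open>Homogeneous generators of the ideal\<close>

lemma enat_Sup_gt: "enat c < Sup {enat (g x) | x. A x} ==> EX x. A x & c < g x"
 unfolding less_Sup_iff by auto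

lemma regular_pair:
 assumes "grade RT I > 1"
 shows "EX y:I. EX z:I. (ALL r. y * r = 0 --> r = 0) & (ALL r. z * r \<in> gen {y} --> r \<in> gen {y})"
proof -
 obtain xs where xs: "regular_sequence RT xs" "set xs \<subseteq> I" "1 < length xs"
  using enat_Sup_gt[of 1 length "%xs. regular_sequence RT xs & set xs \<subseteq> I"] assms
  by (auto simp: grade_def one_enat_def)
 have r: "xs ! i * r \<in> gen (set (take i xs)) ==> r \<in> gen (set (take i xs))" if "i < length xs" for i r
  using xs(1) that by (simp add: regular_sequence_def genideal_RT)
 have e: "gen {} = {0 :: 'a}" using gen_least[OF idl_zero, of "{} :: 'a set"] idl_0[OF idl_gen] by blast
 have "take 1 xs = [xs ! 0]" using xs(3) by (cases xs) auto
 moreover have "xs ! 0 \<in> set xs" "xs ! 1 \<in> set xs" "xs ~= []" using xs(3) by (auto intro!: nth_mem)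
 ultimately show ?thesis using r[of 0] r[OF xs(3)] xs(2,3) by - (rule bexI[of _ "xs ! 0"], rule bexI[of _ "xs ! 1"], auto simp: e)
qed

text \<open>Grade at least two makes every homomorphism \<open>I \<rightarrow> R\<close> a multiplication.\<close>

lemma hom_ideal_scalar:
 fixes a b :: "'n::finite => 'r::comm_ring_1"
 assumes h: "!!v. (\<Sum>j. a j * v j) = 0 ==> (\<Sum>j. b j * v j) = 0"
  and y: "y = (\<Sum>j. a j * q j)" "!!r. y * r = 0 ==> r = 0"
  and z: "z = (\<Sum>j. a j * q' j)" "!!r. z * r \<in> gen {y} ==> r \<in> gen {y}"
 shows "EX c. ALL j. b j = c * a j"
proof -
 have s: "(\<Sum>j. g j * (c * v j - d * w j)) = c * (\<Sum>j. g j * v j) - d * (\<Sum>j. g j * w j)" for g v w :: "'n => 'r" and c d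
  by (simp add: right_diff_distrib sum_subtractf sum_distrib_left ac_simps)
 have "z * (\<Sum>j. b j * q j) - y * (\<Sum>j. b j * q' j) = 0"
  unfolding s[symmetric] by (rule h) (simp add: s y(1)[symmetric] z(1)[symmetric] mult.commute)
 hence "z * (\<Sum>j. b j * q j) \<in> gen {y}" by (auto simp: mem_gen_single mult.commute)
 then obtain c where c: "(\<Sum>j. b j * q j) = c * y" using z(2) by (auto simp: mem_gen_single)
 have "b j = c * a j" for j
 proof -
  have u: "(\<Sum>i. g i * (if i = j then 1 else 0)) = g j" for g :: "'n => 'r"
   by (simp add: if_distrib[of "%x. _ * x"] cong: if_cong)
  have "(\<Sum>i. b i * (y * (if i = j then 1 else 0) - a j * q i)) = 0"
   by (rule h) (simp add: s u y(1)[symmetric] mult.commute)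
  hence "y * (b j - c * a j) = 0" unfolding s u c by (simp add: algebra_simps)
  thus ?thesis using y(2) by fastforce
 qed
 thus ?thesis by blast
qed

text \<open>Components of r below degree d are negligible modulo J, so only the constant term of F
  contributes to degree d of the product.\<close>

lemma hcomp_mult_lowest:
 assumes J: "idl J" and r: "!!i. i < d ==> hcomp w1 i r \<in> J"
 shows "hcomp w1 d (F * r) - hcomp w1 0 F * hcomp w1 d r \<in> J"
proof -
 let ?D = "degree (homog_map w1 F)"
 have "F * r = (\<Sum>i\<le>?D. hcomp w1 i F * r)" unfolding sum_distrib_right[symmetric] using sum_hcomp[of F w1] by simp
 hence "hcomp w1 d (F * r) = (\<Sum>i\<le>?D. if i \<le> d then hcomp w1 i F * hcomp w1 (d - i) r else 0)"
  by (simp add: hcomp_sum hcomp_mult_homog[OF homog_hcomp])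
 also have "\<dots> = hcomp w1 0 F * hcomp w1 d r + (\<Sum>i\<in>{..?D} - {0}. if i \<le> d then hcomp w1 i F * hcomp w1 (d - i) r else 0)"
  by (simp add: sum.remove[of _ 0])
 finally have "hcomp w1 d (F * r) - hcomp w1 0 F * hcomp w1 d r =
   (\<Sum>i\<in>{..?D} - {0}. if i \<le> d then hcomp w1 i F * hcomp w1 (d - i) r else 0)" by simp
 also have "\<dots> \<in> J"
 proof (rule idl_sum[OF J])
  fix i assume "i \<in> {..?D} - {0}"
  thus "(if i \<le> d then hcomp w1 i F * hcomp w1 (d - i) r else 0) \<in> J"
   using r[of "d - i"] by (simp add: idl_0[OF J] idl_mult[OF J])
 qed
 finally show ?thesis .
qed

lemma homog_in_max: "homog w1 d F ==> d \<ge> 1 ==> F \<in> max_ideal"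
proof -
 assume "homog w1 d F" "d \<ge> 1"
 hence "const (ev (%x. x) (%_. 0) F) = (0 :: ('a, 'b) mpoly)"
  using hcomp_zero[of F] hcomp_homog[of w1 d F 0] by simp
 hence "lk (const (ev (%x. x) (%_. 0) F) :: ('a, 'b) mpoly) 0 = 0" by simp
 thus ?thesis by (simp add: const_def max_ideal_def)
qed

lemma unit_sum: "(\<Sum>i. g i * (if i = j then s else 0)) = g j * (s :: 'a::comm_ring_1)" for j :: "'n::finite"
 by (simp add: if_distrib[of "%x. _ * x"] cong: if_cong)

text \<open>The hypotheses of the theorem pulled back to S along \<pi>. The \<alpha> are arbitrary
  lifts of the given generators of I, which need not be homogeneous.\<close>

locale gorenstein_lift =
 fixes f :: "('n::finite, 'k::field) mpoly" and m d :: nat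
  and psi :: "'n => 'n => ('n, 'k) mpoly" and \<alpha> :: "'n => ('n, 'k) mpoly"
  and \<pi> :: "('n, 'k) mpoly => 'r::comm_ring_1" and I :: "'r set"
 assumes inf: "infinite (UNIV :: 'k set)"
  and m: "m \<ge> 1" and f_homog: "homog w1 m f" and f0: "f ~= 0"
  and psi_alt: "!!i j. psi i j = - psi j i" and psi_diag: "!!i. psi i i = 0"
  and psi_homog: "!!i j. homog w1 1 (psi i j)"
  and psi_max: "!!v. var v \<in> gen (range (%(i, j). psi i j))"
  and \<pi>: "ring_map \<pi>" "surj \<pi>" "!!x. \<pi> x = 0 <-> x \<in> gen {f}"
  and I: "I = range (%v. \<Sum>j. \<pi> (\<alpha> j) * v j)"
  and syz_\<pi>: "!!v. (\<Sum>j. \<pi> (\<alpha> j) * v j) = 0 <-> (EX w. ALL i. v i = (\<Sum>j. \<pi> (psi i j) * w j))"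
  and grade: "grade RT I > 1"
  and G: "satisfies_G RT I d" and card: "CARD('n) = d + 1"
begin

lemma \<pi>_sum: "\<pi> (\<Sum>j. g j * v j) = (\<Sum>j. \<pi> (g j) * \<pi> (v j))"
 by (simp add: ring_map_simps[OF \<pi>(1)])

lemma \<pi>_lift: obtains v' where "!!j. v j = \<pi> (v' j)"
 using that[of "%j. inv_into UNIV \<pi> (v j)"] surj_f_inv_f[OF \<pi>(2)] by simp

lemma \<pi>_eq: "\<pi> x = \<pi> y <-> x - y \<in> gen {f}"
 using \<pi>(3)[of "x - y"] by (simp add: ring_map_simps[OF \<pi>(1)])

lemma syz_\<alpha>: "(\<Sum>j. \<alpha> j * v j) \<in> gen {f} <-> (EX w c. ALL i. v i = (\<Sum>j. psi i j * w j) + f * c i)"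
proof -
 have "(\<Sum>j. \<alpha> j * v j) \<in> gen {f} <-> (EX w. ALL i. \<pi> (v i) = (\<Sum>j. \<pi> (psi i j) * w j))"
  unfolding \<pi>(3)[symmetric] \<pi>_sum syz_\<pi> ..
 also have "\<dots> <-> (EX w. ALL i. \<pi> (v i) = \<pi> (\<Sum>j. psi i j * w j))"
 proof
  assume "EX w. ALL i. \<pi> (v i) = (\<Sum>j. \<pi> (psi i j) * w j)"
  then obtain w where w: "ALL i. \<pi> (v i) = (\<Sum>j. \<pi> (psi i j) * w j)" by blast
  obtain w' where "!!j. w j = \<pi> (w' j)" by (rule \<pi>_lift[of w]) blast
  thus "EX w. ALL i. \<pi> (v i) = \<pi> (\<Sum>j. psi i j * w j)" using w by (auto simp: \<pi>_sum intro!: exI[of _ w'])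
 qed (auto simp: \<pi>_sum)
 also have "\<dots> <-> (EX w. ALL i. EX c. v i = (\<Sum>j. psi i j * w j) + f * c)"
  unfolding \<pi>_eq mem_gen_single by (simp add: diff_eq_eq mult.commute add.commute)
 finally show ?thesis by (simp only: choice_iff)
qed

lemma idl_I: "idl I"
 unfolding I
proof (rule idlI)
 show "0 \<in> range (%v. \<Sum>j. \<pi> (\<alpha> j) * v j)" by (rule range_eqI[of _ _ "%_. 0"]) simp
 fix r x y assume "x \<in> range (%v. \<Sum>j. \<pi> (\<alpha> j) * v j)" 
 then obtain v where v: "x = (\<Sum>j. \<pi> (\<alpha> j) * v j)" by blast
 show "r * x \<in> range (%v. \<Sum>j. \<pi> (\<alpha> j) * v j)"
  by (rule range_eqI[of _ _ "%j. r * v j"]) (simp add: v sum_distrib_left mult.left_commute)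
 assume "y \<in> range (%v. \<Sum>j. \<pi> (\<alpha> j) * v j)"
 then obtain w where w: "y = (\<Sum>j. \<pi> (\<alpha> j) * w j)" by blast
 show "x + y \<in> range (%v. \<Sum>j. \<pi> (\<alpha> j) * v j)"
  by (rule range_eqI[of _ _ "%j. v j + w j"]) (simp add: v w distrib_left sum.distrib)
qed

lemma hideal_f: "hideal w1 (gen {f})" using hideal_gen[of "{f}" w1] f_homog by blast

text \<open>Hom(I, R) = R in terms of lifts: a row \<beta> that kills the syzygies of \<alpha>
  defines a homomorphism from I to R.\<close>

lemma scalar:
 assumes \<beta>: "!!v. (\<Sum>j. \<alpha> j * v j) \<in> gen {f} ==> (\<Sum>j. \<beta> j * v j) \<in> gen {f}"
 shows "EX c. ALL j. \<beta> j - c * \<alpha> j \<in> gen {f}"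
proof -
 obtain y z where yz: "y \<in> I" "z \<in> I" "!!r. y * r = 0 ==> r = 0" "!!r. z * r \<in> gen {y} ==> r \<in> gen {y}"
  using regular_pair[OF grade] by blast
 obtain q q' where q: "y = (\<Sum>j. \<pi> (\<alpha> j) * q j)" "z = (\<Sum>j. \<pi> (\<alpha> j) * q' j)" using yz(1,2) unfolding I by blast
 have "EX c. ALL j. \<pi> (\<beta> j) = c * \<pi> (\<alpha> j)"
 proof (rule hom_ideal_scalar[OF _ q(1) yz(3) q(2) yz(4)])
  fix v assume v: "(\<Sum>j. \<pi> (\<alpha> j) * v j) = 0"
  obtain v' where "!!j. v j = \<pi> (v' j)" by (rule \<pi>_lift[of v]) blast
  thus "(\<Sum>j. \<pi> (\<beta> j) * v j) = 0" using v \<beta>[of v'] by (simp add: \<pi>_sum[symmetric] \<pi>(3))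
 qed
 then obtain c where c: "!!j. \<pi> (\<beta> j) = c * \<pi> (\<alpha> j)" by blast
 obtain c' where "c = \<pi> c'" using \<pi>(2) by (metis surj_def)
 hence "\<pi> (\<beta> j) = \<pi> (c' * \<alpha> j)" for j using c by (simp add: ring_map_simps[OF \<pi>(1)])
 thus ?thesis unfolding \<pi>_eq by blast
qed

lemma reg_\<alpha>:
 assumes "!!j. r * \<alpha> j \<in> gen {f}" shows "r \<in> gen {f}"
proof -
 obtain y where y: "y \<in> I" "!!r. y * r = 0 ==> r = 0"
  using regular_pair[OF grade] by blast
 obtain q where q: "y = (\<Sum>j. \<pi> (\<alpha> j) * q j)" using y(1) unfolding I by blast
 have z: "\<pi> r * \<pi> (\<alpha> j) = 0" for j using assms[of j] by (simp add: \<pi>(3)[symmetric] ring_map_simps[OF \<pi>(1)])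
 have "y * \<pi> r = (\<Sum>j. (\<pi> r * \<pi> (\<alpha> j)) * q j)" unfolding q sum_distrib_right by (simp add: ac_simps)
 hence "y * \<pi> r = 0" by (simp add: z)
 thus ?thesis using y(2) \<pi>(3) by blast
qed

lemma one_notin: "1 ~: gen {f}"
proof
 assume "1 \<in> gen {f}"
 moreover have "gen {f} \<subseteq> max_ideal" using homog_in_max[OF f_homog m] pr_idl[OF pr_max_ideal] by (intro gen_least) auto
 ultimately show False using pr_1[OF pr_max_ideal] by blast
qed

text \<open>Let e be the lowest degree in which some \<alpha> j is nonzero modulo f. As psi is
  linear, its columns still kill the components of degree e. By \<open>scalar\<close> these
  components are \<epsilon> times \<alpha>, and comparing degree e gives \<epsilon> the constant
  term one.\<close>

lemma homogeneous_generators: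
 obtains e p \<epsilon> where "!!j. homog w1 e (p j)" "hcomp w1 0 \<epsilon> = 1" "!!j. p j - \<epsilon> * \<alpha> j \<in> gen {f}"
proof -
 let ?N = "%d. EX j. hcomp w1 d (\<alpha> j) ~: gen {f}"
 have "EX d. ?N d"
 proof (rule ccontr)
  assume "\<nexists>d. ?N d"
  hence "1 * \<alpha> j \<in> gen {f}" for j using hideal_hcompI[OF hideal_f, of "\<alpha> j"] by simp
  thus False using one_notin reg_\<alpha>[of 1] by blast
 qed
 define e where "e = (LEAST d. ?N d)"
 have e: "?N e" unfolding e_def by (rule LeastI_ex[OF \<open>EX d. ?N d\<close>])
 have low: "hcomp w1 d (\<alpha> j) \<in> gen {f}" if "d < e" for d j using not_less_Least[OF that[unfolded e_def]] by blast
 have "EX c. ALL j. hcomp w1 e (\<alpha> j) - c * \<alpha> j \<in> gen {f}"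
 proof (rule scalar)
  fix v assume "(\<Sum>j. \<alpha> j * v j) \<in> gen {f}"
  then obtain w c where wc: "!!i. v i = (\<Sum>j. psi i j * w j) + f * c i" unfolding syz_\<alpha> by blast
  have col: "(\<Sum>i. hcomp w1 e (\<alpha> i) * psi i j) \<in> gen {f}" for j
  proof -
   have "(\<Sum>i. \<alpha> i * psi i j) \<in> gen {f}"
    unfolding syz_\<alpha> by (rule exI[of _ "%i. if i = j then 1 else 0"], rule exI[of _ "%_. 0"]) (simp add: unit_sum)
   hence "hcomp w1 (Suc e) (\<Sum>i. \<alpha> i * psi i j) \<in> gen {f}" using hideal_f by (simp add: hideal_def)
   thus ?thesis using hcomp_mult_homog2[OF psi_homog] by (simp add: hcomp_sum)
  qed
  have "(\<Sum>i. hcomp w1 e (\<alpha> i) * v i) = (\<Sum>j. (\<Sum>i. hcomp w1 e (\<alpha> i) * psi i j) * w j) +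
    f * (\<Sum>i. hcomp w1 e (\<alpha> i) * c i)"
  proof -
   have "(\<Sum>i. hcomp w1 e (\<alpha> i) * (\<Sum>j. psi i j * w j)) = (\<Sum>j. (\<Sum>i. hcomp w1 e (\<alpha> i) * psi i j) * w j)"
    unfolding sum_distrib_left sum_distrib_right by (subst sum.swap) (simp add: ac_simps)
   moreover have "(\<Sum>i. hcomp w1 e (\<alpha> i) * (f * c i)) = f * (\<Sum>i. hcomp w1 e (\<alpha> i) * c i)"
    unfolding sum_distrib_left by (simp add: ac_simps)
   ultimately show ?thesis by (simp add: wc distrib_left sum.distrib)
  qed
  also have "\<dots> \<in> gen {f}"
   by (intro idl_add[OF idl_gen] idl_sum[OF idl_gen] idl_multr[OF idl_gen] col genI) simp
  finally show "(\<Sum>i. hcomp w1 e (\<alpha> i) * v i) \<in> gen {f}" .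
 qed
 then obtain \<epsilon> where \<epsilon>: "!!j. hcomp w1 e (\<alpha> j) - \<epsilon> * \<alpha> j \<in> gen {f}" by blast
 have "hcomp w1 0 \<epsilon> = 1"
 proof -
  obtain c where c: "hcomp w1 0 \<epsilon> = const c" using hcomp_zero by blast
  have "const (1 - c) * hcomp w1 e (\<alpha> j) \<in> gen {f}" for j
  proof -
   have "hcomp w1 e (hcomp w1 e (\<alpha> j) - \<epsilon> * \<alpha> j) \<in> gen {f}" using \<epsilon> hideal_f by (simp add: hideal_def)
   moreover have "hcomp w1 e (\<epsilon> * \<alpha> j) - hcomp w1 0 \<epsilon> * hcomp w1 e (\<alpha> j) \<in> gen {f}"
    by (rule hcomp_mult_lowest[OF idl_gen low])
   ultimately have "hcomp w1 e (hcomp w1 e (\<alpha> j) - \<epsilon> * \<alpha> j) + (hcomp w1 e (\<epsilon> * \<alpha> j) - hcomp w1 0 \<epsilon> * hcomp w1 e (\<alpha> j)) \<in> gen {f}"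
    by (rule idl_add[OF idl_gen])
   thus ?thesis by (simp add: hcomp_diff hcomp_hcomp c ring_map_simps[OF ring_map_const] algebra_simps)
  qed
  hence "1 - c = 0" using e const_mult_cancel[OF idl_gen] by blast
  thus ?thesis by (simp add: c ring_map_simps(1)[OF ring_map_const])
 qed
 thus thesis using that[of e "%j. hcomp w1 e (\<alpha> j)" \<epsilon>] homog_hcomp \<epsilon> by blast
qed

text \<open>With constant term one, multiplication by \<epsilon> does not change the lowest
  component; so the components of r are treated by increasing degree.\<close>

lemma unit_nzd:
 assumes \<epsilon>: "hcomp w1 0 \<epsilon> = 1" and r: "\<epsilon> * r \<in> gen {f}" shows "r \<in> gen {f}"
proof (rule hideal_hcompI[OF hideal_f])
 fix d show "hcomp w1 d r \<in> gen {f}"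
 proof (induction d rule: less_induct)
  case (less d)
  have "hcomp w1 d (\<epsilon> * r) \<in> gen {f}" using r hideal_f by (simp add: hideal_def)
  hence "hcomp w1 d (\<epsilon> * r) - (hcomp w1 d (\<epsilon> * r) - hcomp w1 0 \<epsilon> * hcomp w1 d r) \<in> gen {f}"
   by (rule idl_diff[OF idl_gen _ hcomp_mult_lowest[OF idl_gen less.IH]])
  thus ?case by (simp add: \<epsilon>)
 qed
qed

text \<open>The height of the image of P is at most d - td P, since \<open>td\<close> drops strictly
  along chains of primes. As td P is positive, this is below d, the range in which G_d applies, and
  G_d yields at most that many generators up to denominators.\<close>

lemma local_generators:
 assumes P: "pr P" "hideal w1 P" "f \<in> P" "!!j. \<alpha> j \<in> P" "var v ~: P"
 shows "\<exists>(K :: 'n set) \<gamma> \<beta> s. card K + td P + 1 \<le> CARD('n) & s ~: P &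
    (ALL j. EX w c. ALL i. (if i = j then s else 0) = (\<Sum>k\<in>K. \<beta> k j * \<gamma> k i) + (\<Sum>l. psi i l * w l) + f * c i)"
proof -
 have fP: "gen {f} \<subseteq> P" using P by (intro gen_least pr_idl) auto
 have mem: "\<pi> x \<in> \<pi> ` P <-> x \<in> P" for x
 proof
  assume "\<pi> x \<in> \<pi> ` P"
  then obtain y where "y \<in> P" "x - y \<in> gen {f}" using \<pi>_eq by blast
  thus "x \<in> P" using fP idl_add[OF pr_idl[OF P(1)], of "x - y" y] by auto
 qed simp
 have prP: "pr (\<pi> ` P)"
 proof -
  have h: "\<pi> x + \<pi> y = \<pi> (x + y)" "\<pi> x * \<pi> y = \<pi> (x * y)" "0 = \<pi> 0" "1 = \<pi> 1" for x y by (simp_all add: ring_map_simps[OF \<pi>(1)])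
  have *: "(!!x. Q (\<pi> x)) ==> Q r" for Q r using \<pi>(2) by (metis surj_def)
  show ?thesis unfolding pr_def
  proof (intro conjI idlI allI impI)
   show "0 \<in> \<pi> ` P" unfolding h(3) mem by (rule idl_0[OF pr_idl[OF P(1)]])
   show "1 ~: \<pi> ` P" unfolding h(4) mem by (rule pr_1[OF P(1)])
   fix a b
   obtain x y where xy: "a = \<pi> x" "b = \<pi> y" using \<pi>(2) by (metis surj_def)
   show "a + b \<in> \<pi> ` P" if "a \<in> \<pi> ` P" "b \<in> \<pi> ` P"
    using that idl_add[OF pr_idl[OF P(1)], of x y] unfolding xy h mem by blast
   show "a * b \<in> \<pi> ` P" if "b \<in> \<pi> ` P"
    using that idl_mult[OF pr_idl[OF P(1)], of y x] unfolding xy h mem by blast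
   show "a \<in> \<pi> ` P \<or> b \<in> \<pi> ` P" if "a * b \<in> \<pi> ` P"
    using that pr_mult[OF P(1), of x y] unfolding xy h mem by blast
  qed
 qed
 have IP: "I \<subseteq> \<pi> ` P"
  unfolding I using P(4) by (auto intro!: idl_sum[OF pr_idl[OF prP]] idl_multr[OF pr_idl[OF prP]])
 have t1: "td P \<ge> 1" by (rule td_pos[OF P(1,2,5)])
 have tP: "td P \<le> d" using td_nonzero[OF P(1,3) f0] card by simp
 have "EX Y. finite Y & card Y \<le> d - td P & Y \<subseteq> I & (ALL a:I. EX s. s ~: \<pi> ` P & s * a \<in> gen Y)"
 proof (rule satisfies_G_generators[OF G prP IP idl_I])
  show "d - td P < d" using t1 tP by linarith
  fix k C assume C: "!!i. i \<le> k ==> pr (C i) & C i \<subseteq> \<pi> ` P" "!!i. i < k ==> C i \<subset> C (Suc i)"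
  let ?D = "%i. \<pi> -` C i"
  have D: "pr (?D i)" if "i \<le> k" for i using C(1)[OF that] by (blast intro: pr_vimage[OF \<pi>(1)])
  have "td (?D i) + i \<le> d" if "i \<le> k" for i
   using that
  proof (induction i)
   case 0
   have "\<pi> f = 0" using \<pi>(3) by (simp add: genI)
   hence "f \<in> ?D 0" using C(1)[of 0] by (simp add: idl_0 pr_def)
   thus ?case using td_nonzero[OF D[of 0] _ f0] card by simp
  next
   case (Suc i)
   have "?D i \<subset> ?D (Suc i)" using C(2)[of i] Suc.prems surj_vimage_empty[OF \<pi>(2)] surj_image_vimage_eq[OF \<pi>(2)]
    by (metis Suc_le_lessD psubset_eq vimage_mono)
   thus ?case using td_strict[OF D D, of i "Suc i"] Suc by simp
  qed
  moreover have "td P \<le> td (?D k)"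
  proof (rule td_mono[OF D P(1)])
   show "?D k \<subseteq> P" using C(1)[of k] mem by blast
  qed simp
  ultimately show "k \<le> d - td P" by fastforce
 qed
 then obtain Y where Y: "finite Y" "card Y \<le> d - td P" "Y \<subseteq> I" "!!a. a \<in> I ==> EX s. s ~: \<pi> ` P & s * a \<in> gen Y" by blast
 \<comment> \<open>The few generators are indexed by a subset of \<open>'n\<close>, the index type
   that \<open>locgen\<close> uses.\<close>
 have "card Y \<le> card (UNIV :: 'n set)" using Y(2) card by linarith
 then obtain K :: "'n set" where "card K = card Y" by (meson obtain_subset_with_card_n)
 then obtain g where g: "bij_betw g K Y" using Y(1) by (metis finite_same_card_bij finite)
 have "ALL k:K. EX v. g k = (\<Sum>i. \<pi> (\<alpha> i) * v i)" using g Y(3) unfolding I bij_betw_def by blast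
 then obtain \<gamma>' where \<gamma>': "!!k. k \<in> K ==> g k = (\<Sum>i. \<pi> (\<alpha> i) * \<gamma>' k i)" by metis
 define \<gamma> where "\<gamma> k i = inv_into UNIV \<pi> (\<gamma>' k i)" for k i
 have \<gamma>: "\<gamma>' k i = \<pi> (\<gamma> k i)" for k i by (simp add: \<gamma>_def surj_f_inv_f[OF \<pi>(2)])
 have gk: "g k = \<pi> (\<Sum>i. \<alpha> i * \<gamma> k i)" if "k \<in> K" for k using \<gamma>'[OF that] by (simp add: \<pi>_sum \<gamma>)
 have "\<pi> (\<alpha> j) \<in> I" for j unfolding I by (rule range_eqI[of _ _ "%i. if i = j then 1 else 0"]) (simp add: unit_sum)
 hence "ALL j. EX t. t ~: P & \<pi> t * \<pi> (\<alpha> j) \<in> gen Y" using Y(4) \<pi>(2) mem by (metis surj_def)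
 then obtain t where t: "!!j. t j ~: P" "!!j. \<pi> (t j) * \<pi> (\<alpha> j) \<in> gen Y" by metis
 define s where "s = prod t UNIV"
 have s: "s ~: P" unfolding s_def by (rule pr_prod_notin[OF P(1) t(1)])
 have rep: "EX w c. ALL i. (if i = j then s else 0) = (\<Sum>k\<in>K. \<beta> k * \<gamma> k i) + (\<Sum>l. psi i l * w l) + f * c i"
  if \<beta>: "\<pi> (s * \<alpha> j) = \<pi> (\<Sum>k\<in>K. \<beta> k * (\<Sum>i. \<alpha> i * \<gamma> k i))" for j \<beta>
 proof -
  have "(\<Sum>i. \<alpha> i * ((if i = j then s else 0) - (\<Sum>k\<in>K. \<beta> k * \<gamma> k i))) = s * \<alpha> j - (\<Sum>k\<in>K. \<beta> k * (\<Sum>i. \<alpha> i * \<gamma> k i))"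
  proof -
   have "(\<Sum>i. \<alpha> i * (\<Sum>k\<in>K. \<beta> k * \<gamma> k i)) = (\<Sum>k\<in>K. \<beta> k * (\<Sum>i. \<alpha> i * \<gamma> k i))"
    unfolding sum_distrib_left by (subst sum.swap) (simp add: ac_simps)
   thus ?thesis by (simp add: right_diff_distrib sum_subtractf unit_sum mult.commute)
  qed
  hence "(\<Sum>i. \<alpha> i * ((if i = j then s else 0) - (\<Sum>k\<in>K. \<beta> k * \<gamma> k i))) \<in> gen {f}"
   using \<beta> by (simp add: \<pi>_eq)
  then obtain w c where "!!i. (if i = j then s else 0) - (\<Sum>k\<in>K. \<beta> k * \<gamma> k i) = (\<Sum>l. psi i l * w l) + f * c i"
   unfolding syz_\<alpha> by blast
  hence "ALL i. (if i = j then s else 0) = (\<Sum>k\<in>K. \<beta> k * \<gamma> k i) + (\<Sum>l. psi i l * w l) + f * c i"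
   by (simp add: diff_eq_eq ac_simps)
  thus ?thesis by blast
 qed
 have "ALL j. EX \<beta>. \<pi> (s * \<alpha> j) = \<pi> (\<Sum>k\<in>K. \<beta> k * (\<Sum>i. \<alpha> i * \<gamma> k i))"
 proof
  fix j
  have "\<pi> (s * \<alpha> j) = \<pi> (prod t (UNIV - {j})) * (\<pi> (t j) * \<pi> (\<alpha> j))"
   unfolding s_def by (simp add: prod.remove[of UNIV j] ring_map_simps(3)[OF \<pi>(1)] ac_simps)
  also have "\<dots> \<in> gen (g ` K)" using idl_mult[OF idl_gen t(2)] g by (simp add: bij_betw_def)
  finally obtain r where r: "\<pi> (s * \<alpha> j) = (\<Sum>k\<in>K. r k * g k)" using gen_image[of K g] by auto
  obtain \<beta> where \<beta>: "!!k. r k = \<pi> (\<beta> k)" by (rule \<pi>_lift[of r]) blast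
  have "\<pi> (\<Sum>k\<in>K. \<beta> k * (\<Sum>i. \<alpha> i * \<gamma> k i)) = (\<Sum>k\<in>K. r k * g k)"
   by (subst ring_map_simps(8)[OF \<pi>(1)], rule sum.cong[OF refl]) (simp only: gk \<beta> ring_map_simps(3)[OF \<pi>(1)])
  thus "EX \<beta>. \<pi> (s * \<alpha> j) = \<pi> (\<Sum>k\<in>K. \<beta> k * (\<Sum>i. \<alpha> i * \<gamma> k i))" unfolding r by (intro exI[of _ \<beta>]) (rule sym)
 qed
 from choice[OF this] obtain \<beta> where \<beta>: "ALL j. \<pi> (s * \<alpha> j) = \<pi> (\<Sum>k\<in>K. \<beta> j k * (\<Sum>i. \<alpha> i * \<gamma> k i))" ..
 hence "ALL j. EX w c. ALL i. (if i = j then s else 0) = (\<Sum>k\<in>K. \<beta> j k * \<gamma> k i) + (\<Sum>l. psi i l * w l) + f * c i"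
  using rep[OF \<beta>[rule_format]] by (intro allI)
 moreover have "card K + td P + 1 \<le> CARD('n)" using \<open>card K = card Y\<close> Y(2) tP card by linarith
 ultimately show ?thesis using s by (intro exI[of _ K] exI[of _ \<gamma>] exI[of _ "%k j. \<beta> j k"] exI[of _ s]) simp
qed

text \<open>The lowest components of lifts of the generators of \<open>I\<close> generate it up to a nonzerodivisor.\<close>

lemma linear_gorenstein:
 obtains e p \<epsilon> where "linear_gorenstein f m e psi p" "hcomp w1 0 \<epsilon> = 1" "!!j. p j - \<epsilon> * \<alpha> j \<in> gen {f}"
proof -
 obtain e p \<epsilon> where p: "!!j. homog w1 e (p j)" and \<epsilon>: "hcomp w1 0 \<epsilon> = 1" and p\<alpha>: "!!j. p j - \<epsilon> * \<alpha> j \<in> gen {f}"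
  by (rule homogeneous_generators) (rule that; assumption)
 have cong: "(\<Sum>j. p j * v j) \<in> gen {f} <-> (\<Sum>j. \<alpha> j * v j) \<in> gen {f}" for v
 proof -
  have "(\<Sum>j. p j * v j) - \<epsilon> * (\<Sum>j. \<alpha> j * v j) = (\<Sum>j. (p j - \<epsilon> * \<alpha> j) * v j)"
   by (simp add: sum_distrib_left sum_subtractf left_diff_distrib mult.assoc)
  also have "\<dots> \<in> gen {f}" by (intro idl_sum[OF idl_gen] idl_multr[OF idl_gen] p\<alpha>)
  finally have *: "(\<Sum>j. p j * v j) - \<epsilon> * (\<Sum>j. \<alpha> j * v j) \<in> gen {f}" .
  show ?thesis
  proof
   assume "(\<Sum>j. p j * v j) \<in> gen {f}"
   from idl_diff[OF idl_gen this *] show "(\<Sum>j. \<alpha> j * v j) \<in> gen {f}" by - (rule unit_nzd[OF \<epsilon>], simp)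
  next
   assume "(\<Sum>j. \<alpha> j * v j) \<in> gen {f}"
   from idl_add[OF idl_gen * idl_mult[OF idl_gen this, of \<epsilon>]] show "(\<Sum>j. p j * v j) \<in> gen {f}" by simp
  qed
 qed
 have cong1: "p j * r \<in> gen {f} <-> \<alpha> j * r \<in> gen {f}" for j r
  using cong[of "%i. if i = j then r else 0"] by (simp add: unit_sum)
 have reg: "r \<in> gen {f}" if "!!j. r * p j \<in> gen {f}" for r
  by (rule reg_\<alpha>) (use that cong1 in \<open>simp add: mult.commute\<close>)
 have N2: "CARD('n) \<ge> 2" by (rule alternating_card[OF psi_diag psi_max])
 \<comment> \<open>For e = 0 the p j would be constants. The relation between two of them is a
   syzygy with constant entries, but syzygies have their entries in the irrelevant ideal; so all p j
   would vanish, against \<open>reg\<close>.\<close>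
 have e: "e \<ge> 1"
 proof (rule ccontr)
  assume "\<not> e \<ge> 1"
  hence "e = 0" by linarith
  hence "homog w1 0 (p j)" for j using p[of j] by simp
  hence "p j = const (ev (%x. x) (%_. 0) (p j))" for j using hcomp_homog[of w1 0 "p j" 0] hcomp_zero[of "p j"] by simp
  then obtain c where c: "!!j. p j = const (c j)" by (rule that)
  have "c j = 0" for j
  proof -
   obtain i where i: "i ~= j" using ex_neq[OF N2] by blast
   let ?v = "%a. (if a = j then const (c i) else 0) - (if a = i then const (c j) else (0 :: ('n, 'k) mpoly))"
   have z: "(\<Sum>a. p a * ?v a) = 0" by (simp add: right_diff_distrib sum_subtractf unit_sum c mult.commute)
   have "(\<Sum>a. \<alpha> a * ?v a) \<in> gen {f}" unfolding cong[symmetric] z by (rule idl_0[OF idl_gen])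
   then obtain w b where wb: "!!a. ?v a = (\<Sum>l. psi a l * w l) + f * b a" unfolding syz_\<alpha> by blast
   have "(\<Sum>l. psi i l * w l) + f * b i \<in> max_ideal"
    using homog_in_max[OF psi_homog] homog_in_max[OF f_homog m] pr_idl[OF pr_max_ideal]
    by (intro idl_add idl_sum idl_multr) auto
   hence "- const (c j) \<in> (max_ideal :: ('n, 'k) mpoly set)" using wb[of i] i by simp
   hence "const (c j) \<in> (max_ideal :: ('n, 'k) mpoly set)" using idl_minus[OF pr_idl[OF pr_max_ideal]] by fastforce
   thus ?thesis by (rule const_in_prime[OF pr_max_ideal])
  qed
  hence "1 * p j \<in> gen {f}" for j using idl_0[OF idl_gen] by (simp add: c const_simps)
  thus False using reg one_notin by blast
 qed
 have "linear_gorenstein f m e psi p"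
 proof
  fix P v assume P: "pr P" "hideal w1 P" "f \<in> P" "!!j. p j \<in> P" "var v ~: P"
  have fP: "gen {f} \<subseteq> P" using P by (intro gen_least pr_idl) auto
  have "\<epsilon> ~: P" using P(1,2) \<epsilon> pr_1[OF P(1)] by (metis hideal_def)
  moreover have "\<epsilon> * \<alpha> j \<in> P" for j using idl_diff[OF pr_idl[OF P(1)] P(4)[of j] subsetD[OF fP p\<alpha>[of j]]] by simp
  ultimately have \<alpha>P: "\<alpha> j \<in> P" for j using pr_mult[OF P(1)] by blast
  show "\<exists>(K :: 'n set) \<gamma> \<beta> s. card K + td P + 1 \<le> CARD('n) & s ~: P &
    (ALL j. EX w c. ALL i. (if i = j then s else 0) = (\<Sum>k\<in>K. \<beta> k j * \<gamma> k i) + (\<Sum>l. psi i l * w l) + f * c i)"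
   by (rule local_generators[OF P(1-3) \<alpha>P P(5)])
 qed (fact inf m f_homog f0 psi_alt psi_diag psi_homog psi_max e p reg | (unfold cong, rule syz_\<alpha>))+
 thus thesis using that \<epsilon> p\<alpha> by blast
qed

end

section \<open>The iterated polynomial ring and the minors\<close>

lemma gen_image_surj:
 assumes "ring_map h" "surj h" shows "h ` gen U = gen (h ` U)"
proof
 show "h ` gen U \<subseteq> gen (h ` U)"
  using gen_least[OF idl_vimage[OF assms(1) idl_gen], of U "h ` U"] gen_incl[of "h ` U"] by blast
 have "idl (h ` gen U)"
 proof (rule idlI)
  show "0 \<in> h ` gen U" using idl_0[OF idl_gen, of U] ring_map_simps(4)[OF assms(1)] by (metis imageI)
  fix r x y assume "x \<in> h ` gen U"
  then obtain a where a: "x = h a" "a \<in> gen U" by blast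
  obtain c where "r = h c" using assms(2) by (metis surj_def)
  thus "r * x \<in> h ` gen U" using a idl_mult[OF idl_gen] by (auto simp: ring_map_simps(3)[OF assms(1), symmetric])
  assume "y \<in> h ` gen U"
  then obtain b where "y = h b" "b \<in> gen U" by blast
  thus "x + y \<in> h ` gen U" using a idl_add[OF idl_gen] by (auto simp: ring_map_simps(2)[OF assms(1), symmetric])
 qed
 thus "gen (h ` U) \<subseteq> h ` gen U" using gen_incl[of U] by (intro gen_least) auto
qed

text \<open>S[T] as a single polynomial ring, with x as \<open>Inl\<close> and T as
  \<open>Inr\<close>, so that weights, primes and \<open>td\<close> treat both kinds of variables
  uniformly.\<close>

definition flat :: "('m, ('n, 'k::comm_ring_1) mpoly) mpoly => ('n + 'm, 'k) mpoly" where
 "flat = ev sx Tv"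

definition unflat :: "('n + 'm, 'k::comm_ring_1) mpoly => ('m, ('n, 'k) mpoly) mpoly" where
 "unflat = ev (%c. const (const c)) (case_sum (%i. const (var i)) var)"

lemma ring_map_const_const: "ring_map (%c :: 'k::comm_ring_1. const (const c :: ('n, 'k) mpoly) :: ('m, ('n, 'k) mpoly) mpoly)"
 by (rule ring_map_comp[OF ring_map_const ring_map_const])

lemma ring_map_flat: "ring_map flat" unfolding flat_def by (rule ring_map_ev[OF ring_map_sub])
lemma ring_map_unflat: "ring_map unflat" unfolding unflat_def by (rule ring_map_ev[OF ring_map_const_const])
lemma flat_simps: "flat (const c) = sx c" "flat (var j) = Tv j"
 unfolding flat_def by (simp_all add: ev_simps[OF ring_map_sub])
lemmas flat_ring_simps = ring_map_simps[OF ring_map_flat]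

lemma unflat_sx: "unflat (sx c) = const c"
 by (rule ring_map_eqI[OF ring_map_comp[OF ring_map_unflat ring_map_sub] ring_map_const])
  (simp_all add: sub_simps unflat_def ev_simps[OF ring_map_const_const])

lemma unflat_flat: "unflat (flat F) = F"
 by (rule ring_map_eqI[OF ring_map_comp[OF ring_map_unflat ring_map_flat] ring_map_id])
  (simp_all add: flat_simps unflat_sx, simp add: unflat_def ev_simps[OF ring_map_const_const])

lemma flat_unflat: "flat (unflat F) = F"
proof (rule ring_map_eqI[OF ring_map_comp[OF ring_map_flat ring_map_unflat] ring_map_id])
 show "flat (unflat (var v)) = var v" for v :: "'a + 'b"
  by (cases v) (simp_all add: unflat_def ev_simps[OF ring_map_const_const] flat_simps sub_simps)
qed (simp add: unflat_def ev_simps[OF ring_map_const_const] flat_simps sub_simps)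

lemma surj_flat: "surj flat" by (rule surjI, rule flat_unflat)
lemma flat_vimage: "flat ` Q = Q' ==> Q = flat -` Q'" by (auto, metis unflat_flat)
lemma flat_eq_0: "flat F = 0 <-> F = 0" by (metis unflat_flat flat_ring_simps(4))

lemma flat_set_add:
 assumes "idl Q'" "flat ` Q = Q'"
 shows "flat ` (Q <+>\<^bsub>RT\<^esub> PIdl\<^bsub>RT\<^esub> g) = gen (insert (flat g) Q')"
proof -
 have 1: "x \<in> Q <+>\<^bsub>RT\<^esub> PIdl\<^bsub>RT\<^esub> g <-> (EX q:Q. EX r. x = q + r * g)" for x
  by (auto simp: set_add_def' cgenideal_def)
 have "gen (insert (flat g) Q') = {q + r * flat g | q r. q \<in> Q'}"
  using gen_Un_image[OF assms(1), of "{()}" "%_. flat g"] by auto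
 also have "\<dots> = flat ` {x. EX q:Q. EX r. x = q + r * g}"
 proof (intro equalityI subsetI)
  fix y assume "y \<in> {q + r * flat g | q r. q \<in> Q'}"
  then obtain q r where "q \<in> Q" "y = flat q + flat (unflat r) * flat g" using assms(2) by (auto simp: flat_unflat)
  thus "y \<in> flat ` {x. EX q:Q. EX r. x = q + r * g}"
   unfolding flat_ring_simps(2,3)[symmetric] by blast
 qed (unfold assms(2)[symmetric], force simp: flat_ring_simps)
 finally show ?thesis using 1 by blast
qed

lemma flat_homog:
 fixes F :: "('m::finite, ('n::finite, 'k::comm_ring_1) mpoly) mpoly"
 assumes w: "!!t. t \<in> keys F ==> homog w a (sx (lk F t))" "!!t. t \<in> keys F ==> (\<Sum>v\<in>keys t. lk t v * w (Inr v)) = b"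
 shows "homog w (a + b) (flat F)"
 unfolding flat_def ev_def[of sx]
proof (rule homog_sum, rule homog_mult[OF w(1)])
 fix t assume "t \<in> keys F"
 show "homog w b (ev_monom Tv t)" unfolding w(2)[OF \<open>t \<in> keys F\<close>, symmetric] ev_monom_def by (intro homog_prod homog_power homog_var)
qed

lemma flat_bihomog:
 fixes F :: "('n::finite, ('n, 'k::comm_ring_1) mpoly) mpoly"
 assumes "bihomogeneous a b F"
 shows "homog (case_sum w1 (%_. 0)) a (flat F)" "homog (case_sum (%_. 0) w1) b (flat F)"
proof -
 have F: "homog w1 b F" "!!t. t \<in> keys F ==> homog w1 a (lk F t)" using assms by (auto simp: bihomogeneous_def homogeneous_iff)
 have "homog (case_sum w1 (%_. 0) :: 'n + 'n => nat) (a + 0) (flat F)"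
  by (rule flat_homog) (use F(2) homog_var[of "case_sum w1 (%_. 0) :: 'n + 'n => nat" "Inl _"] in \<open>auto intro!: homog_sub[of _ w1]\<close>)
 thus "homog (case_sum w1 (%_. 0)) a (flat F)" by simp
 have "homog (case_sum (%_. 0) w1 :: 'n + 'n => nat) (0 + b) (flat F)"
  by (rule flat_homog, rule homog_T_sx) (use F(1) in \<open>auto simp: homog_iff\<close>)
 thus "homog (case_sum (%_. 0) w1) b (flat F)" by simp
qed

section \<open>Maximal minors and their greatest common divisor\<close>

lemma maximal_minors: "minors CARD('n) (M :: 'a::comm_ring_1 ^ 'c ^ 'n::finite) = {det (\<chi> i j. M $ i $ \<delta> j) | \<delta>. inj \<delta>}"
proof -
 let ?N = "{..<CARD('n)}"
 \<comment> \<open>The row numbering \<rho> is a bijection for maximal minors, so it can be absorbed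
   into the choice of columns.\<close>
 have *: "(\<Sum>p | p permutes ?N. of_int (sign p) * (\<Prod>i<CARD('n). M $ \<rho> i $ \<gamma> (p i))) = det (\<chi> i j. M $ i $ \<gamma> (inv_into ?N \<rho> j))"
  if \<rho>: "bij_betw \<rho> ?N UNIV" for \<rho> and \<gamma> :: "nat => 'c"
 proof -
  let ?r = "inv_into ?N \<rho>" and ?h = "map_permutation ?N \<rho>"
  have inj: "inj_on \<rho> ?N" and r: "bij_betw ?r UNIV ?N" and \<rho>r: "\<rho> (?r x) = x" "i \<in> ?N ==> ?r (\<rho> i) = i" for x i
   using \<rho> bij_betw_inv_into[OF \<rho>] bij_betw_inv_into_right[OF \<rho>] bij_betw_inv_into_left[OF \<rho>] by (auto simp: bij_betw_def)
  have h: "bij_betw ?h {p. p permutes ?N} {q. q permutes UNIV}"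
   by (rule bij_betw_byWitness[where f' = "map_permutation UNIV ?r"])
    (use map_permutation_compose_inv[OF \<rho>, of _ ?r] map_permutation_compose_inv[OF r, of _ \<rho>] map_permutation_permutes[OF \<rho>]
     map_permutation_permutes[OF r] \<rho>r in auto)
  have "(\<Prod>i\<in>UNIV. M $ i $ \<gamma> (?r (?h p i))) = (\<Prod>i<CARD('n). M $ \<rho> i $ \<gamma> (p i))" if p: "p permutes ?N" for p
  proof (subst prod.reindex_bij_betw[OF \<rho>, symmetric], rule prod.cong[OF refl])
   fix i assume i: "i \<in> ?N"
   hence "p i \<in> ?N" using permutes_in_image[OF p] by blast
   thus "M $ \<rho> i $ \<gamma> (?r (?h p (\<rho> i))) = M $ \<rho> i $ \<gamma> (p i)" using i by (simp add: map_permutation_apply[OF inj] \<rho>r)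
  qed
  hence "(\<Sum>p | p permutes ?N. of_int (sign p) * (\<Prod>i<CARD('n). M $ \<rho> i $ \<gamma> (p i))) =
    (\<Sum>p | p permutes ?N. of_int (sign (?h p)) * (\<Prod>i\<in>UNIV. M $ i $ \<gamma> (?r (?h p i))))"
   by (intro sum.cong refl) (simp add: sign_map_permutation[OF inj])
  also have "\<dots> = (\<Sum>q | q permutes (UNIV :: 'n set). of_int (sign q) * (\<Prod>i\<in>UNIV. M $ i $ \<gamma> (?r (q i))))"
   by (rule sum.reindex_bij_betw[OF h])
  finally show ?thesis by (simp add: det_def)
 qed
 have card: "card ?N = card (UNIV :: 'n set)" by simp
 show ?thesis
 proof (intro equalityI subsetI)
  fix x assume "x \<in> minors CARD('n) M"
  then obtain \<rho> :: "nat => 'n" and \<gamma> where inj: "inj_on \<rho> ?N" "inj_on \<gamma> ?N"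
   and x: "x = (\<Sum>p | p permutes ?N. of_int (sign p) * (\<Prod>i<CARD('n). M $ \<rho> i $ \<gamma> (p i)))" by (auto simp: minors_def)
  have "\<rho> ` ?N = UNIV" using card_image[OF inj(1)] by (intro card_subset_eq) auto
  hence \<rho>: "bij_betw \<rho> ?N UNIV" using inj(1) by (simp add: bij_betw_def)
  have "inj (%j. \<gamma> (inv_into ?N \<rho> j))"
   using comp_inj_on[of "inv_into ?N \<rho>" UNIV \<gamma>] inj(2) bij_betw_inv_into[OF \<rho>] by (simp add: bij_betw_def comp_def)
  thus "x \<in> {det (\<chi> i j. M $ i $ \<delta> j) | \<delta>. inj \<delta>}" unfolding x *[OF \<rho>] by (intro CollectI exI[of _ "%j. \<gamma> (inv_into ?N \<rho> j)"]) simp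
 next
  fix x assume "x \<in> {det (\<chi> i j. M $ i $ \<delta> j) | \<delta>. inj \<delta>}"
  then obtain \<delta> where \<delta>: "inj \<delta>" "x = det (\<chi> i j. M $ i $ \<delta> j)" by blast
  obtain \<rho> :: "nat => 'n" where \<rho>: "bij_betw \<rho> ?N UNIV" using finite_same_card_bij[OF _ _ card] by auto
  have "x = det (\<chi> i j. M $ i $ (\<delta> \<circ> \<rho>) (inv_into ?N \<rho> j))" unfolding \<delta>(2) by (simp add: bij_betw_inv_into_right[OF \<rho>])
  moreover have "inj_on (\<delta> \<circ> \<rho>) ?N" "inj_on \<rho> ?N" using \<rho> \<delta>(1) by (auto simp: bij_betw_def intro: comp_inj_on inj_on_subset)
  ultimately show "x \<in> minors CARD('n) M" unfolding *[OF \<rho>, symmetric] minors_def by blast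
 qed
qed

lemma det_replace_column: "det (\<chi> a b. if b = j then c a else B $ a $ b) = (\<Sum>a. c a * cof B a j)"
proof -
 have "det (\<chi> a b. if b = j then c a else B $ a $ b) = rdet (transp B) j (\<chi> a. c a)"
  unfolding rdet_def by (subst det_transpose[symmetric], rule arg_cong[where f = det]) (simp add: vec_eq_iff Finite_Cartesian_Product.transpose_def)
 thus ?thesis by (simp add: rdet_cof cof_transpose)
qed

text \<open>\<open>homog_map\<close> turns the total degree into a polynomial degree, which is
  additive as there are no zero divisors. So a unit has degree zero.\<close>

lemma unit_const:
 assumes "h * E = (1 :: ('v::finite, 'k::field) mpoly)" shows "EX \<kappa>. \<kappa> ~= 0 & h = const \<kappa>"
proof -
 let ?p = "homog_map w1 h" and ?q = "homog_map w1 E"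
 have n: "h ~= 0" "E ~= 0" using assms by auto
 hence "?p ~= 0" "?q ~= 0" using sum_hcomp[of h w1] sum_hcomp[of E w1] by (auto simp: hcomp_def)
 hence "coeff ?p (degree ?p) * coeff ?q (degree ?q) ~= 0" using mpoly_mult_eq_0 leading_coeff_neq_0 by blast
 hence "coeff (?p * ?q) (degree ?p + degree ?q) ~= 0" by (simp add: coeff_mult_degree_sum)
 hence "coeff 1 (degree ?p + degree ?q) ~= (0 :: ('v, 'k) mpoly)" by (simp only: homog_map_simps(3)[symmetric] assms homog_map_simps(1) not_False_eq_True)
 from le_degree[OF this] have "degree ?p = 0" by simp
 hence "h = hcomp w1 0 h" using sum_hcomp[of h w1] by simp
 then obtain \<kappa> where "h = const \<kappa>" unfolding hcomp_zero by blast
 thus ?thesis using n(1) by (auto intro!: exI[of _ \<kappa>] simp: const_simps)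
qed

context linear_gorenstein
begin

text \<open>The minor without the extra column is det B = 0 up to sign, and the minor with it that
  omits column j is T_j times G up to sign. As n >= 2, the T_j have no common factor, so the gcd is
  G up to a nonzero constant.\<close>

lemma gcd_minors:
 fixes M :: "('n, ('n, 'k) mpoly) mpoly ^ 'n option ^ 'n"
 assumes MB: "!!k j. flat (M $ k $ Some j) = BP $ k $ j" and g: "is_gcd (minors CARD('n) M) g"
  and G: "(\<Sum>k. sT (u k) * flat (M $ k $ None)) ~= 0" (is "?G ~= 0")
 shows "EX \<kappa>. \<kappa> ~= 0 & flat g = const \<kappa> * ?G"
proof -
 let ?N = "%j. \<chi> a b. if b = j then flat (M $ a $ None) else BP $ a $ b"
 have N: "det (?N j) = Tv j * ?G" for j
  by (simp add: det_replace_column cof_BP sum_distrib_left ac_simps)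
 have D: "flat (det (\<chi> i j. M $ i $ \<delta> j)) = det (\<chi> i j. flat (M $ i $ \<delta> j))" for \<delta> :: "'n => 'n option"
  using det_ring_map[OF ring_map_flat, of "\<chi> i j. M $ i $ \<delta> j"] by simp
 have perm: "det (\<chi> i j. A $ i $ s j) = of_int (sign s) * det A" if "inj s" for s and A :: "('n + 'n, 'k) mpoly ^ 'n ^ 'n"
  using that by (intro det_permute_columns bij_imp_permutes) (simp_all add: bij_def finite_UNIV_inj_surj)
 have G_dvd: "?G dvd flat (det (\<chi> i j. M $ i $ \<delta> j))" if \<delta>: "inj \<delta>" for \<delta> :: "'n => 'n option"
 proof (cases "None \<in> range \<delta>")
  case False
  define s where "s = the \<circ> \<delta>"
  have s: "\<delta> j = Some (s j)" for j using False by (cases "\<delta> j") (auto simp: s_def, metis rangeI)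
  hence "inj s" using \<delta> by (auto simp: inj_def)
  have "det BP = 0" unfolding BP_def by (simp add: det_ring_map[OF ring_map_sub] det_B sub_simps)
  hence "det (\<chi> i j. flat (M $ i $ \<delta> j)) = 0" using perm[OF \<open>inj s\<close>, of BP] by (simp add: s MB)
  thus ?thesis by (simp add: D)
 next
  case True
  then obtain b where b: "\<delta> b = None" by (metis imageE)
  have "card (range \<delta>) < CARD('n option)" using card_image[OF \<delta>] by simp
  then obtain z where z: "z ~: range \<delta>" by (metis UNIV_I subsetI card_mono finite_class.finite_UNIV finite_imageI linorder_not_less)
  then obtain j where j: "Some j ~: range \<delta>" using True by (cases z) auto
  \<comment> \<open>Writing the omitted column j in place of the extra one turns \<delta> into a
    permutation, whose sign relates the minor to \<open>?N j\<close>.\<close>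
  define s where "s a = (case \<delta> a of None => j | Some i => i)" for a
  have "inj s"
  proof (rule injI)
   fix a a' assume "s a = s a'"
   hence "\<delta> a = \<delta> a'" using j by (auto simp: s_def split: option.splits) (metis rangeI)+
   thus "a = a'" using \<delta> by (simp add: inj_eq)
  qed
  have "(\<chi> i a. flat (M $ i $ \<delta> a)) = (\<chi> i a. ?N j $ i $ s a)"
  proof -
   have "flat (M $ i $ \<delta> a) = ?N j $ i $ s a" for i a
    using j by (cases "\<delta> a") (auto simp: s_def MB, metis rangeI)
   thus ?thesis by (simp add: vec_eq_iff)
  qed
  hence *: "det (\<chi> i a. flat (M $ i $ \<delta> a)) = of_int (sign s) * (Tv j * ?G)" by (simp only: perm[OF \<open>inj s\<close>] N)
  show ?thesis unfolding D * by (intro dvd_mult dvd_refl)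
 qed
 have dvd: "flat x dvd flat y <-> x dvd y" for x y :: "('n, ('n, 'k) mpoly) mpoly"
 proof
  assume "flat x dvd flat y"
  then obtain r where "flat y = flat x * r" ..
  hence "flat y = flat (x * unflat r)" by (simp only: flat_ring_simps(3) flat_unflat)
  from arg_cong[OF this, of unflat] have "y = x * unflat r" by (simp only: unflat_flat)
  thus "x dvd y" ..
 qed (elim dvdE, simp only: flat_ring_simps(3) dvd_triv_left)
 have g1: "!!\<delta>. inj \<delta> ==> g dvd det (\<chi> i j. M $ i $ (\<delta> :: 'n => 'n option) j)"
  and g2: "(!!\<delta>. inj \<delta> ==> h dvd det (\<chi> i j. M $ i $ (\<delta> :: 'n => 'n option) j)) ==> h dvd g" for h
  using g unfolding is_gcd_def maximal_minors by blast+
 have "unflat ?G dvd g"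
  by (rule g2) (simp only: dvd[symmetric] flat_unflat G_dvd)
 hence "?G dvd flat g" unfolding dvd[symmetric] flat_unflat .
 then obtain h where h: "flat g = ?G * h" ..
 have "h dvd Tv j" for j
 proof -
  let ?\<delta> = "%b. if b = j then None else Some b"
  have "inj ?\<delta>" by (auto simp: inj_def)
  hence "g dvd det (\<chi> i b. M $ i $ ?\<delta> b)" by (rule g1)
  hence "?G * h dvd det (\<chi> i b. flat (M $ i $ ?\<delta> b))" unfolding dvd[symmetric] D h .
  also have "(\<chi> i b. flat (M $ i $ ?\<delta> b)) = ?N j" by (simp add: vec_eq_iff MB)
  finally obtain r where "Tv j * ?G = ?G * h * r" unfolding N by (elim dvdE)
  hence "?G * (Tv j - h * r) = 0" by (simp add: algebra_simps)
  from mpoly_mult_eq_0[OF this] have "Tv j = h * r" using G by simp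
  thus ?thesis ..
 qed
 then obtain r where r: "!!j. Tv j = h * r j" unfolding dvd_def by metis
 obtain a b :: 'n where "a ~= b" using ex_neq[OF N2] by blast
 moreover have "Tv a * r b = Tv b * r a" by (simp add: r ac_simps)
 ultimately obtain E where "r b = Tv b * E" using var_dvd[of "Inr a" "Inr b" "r b" "r a"] by auto
 hence "Tv b * (1 - h * E) = 0" using r[of b] by (simp add: algebra_simps)
 from var_mult_eq_0[OF this] have "h * E = 1" by simp
 from unit_const[OF this] obtain \<kappa> where "\<kappa> ~= 0" "h = const \<kappa>" by blast
 thus ?thesis using h by (intro exI[of _ \<kappa>]) (simp only: mult.commute simp_thms)
qed

end

section \<open>Colon ideal, gcd-iteration and Rees map in the flat ring\<close>

lemma ideal_pow_mult:
 assumes Q: "idl Q"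
 shows "(ALL b:ideal_pow RT (gen (range x)) n. F * b \<in> Q) <-> (ALL vs. length vs = n --> prod_list (map x vs) * F \<in> Q)"
proof
 have "prod_list (map x vs) \<in> ideal_pow RT (gen (range x)) (length vs)" for vs
 proof (induction vs)
  case (Cons v vs)
  have "x v \<in> gen (range x)" by (simp add: genI)
  from ideal_prod.prod[OF this Cons, of RT] show ?case by (simp add: ideal_pow_def)
 qed (simp add: ideal_pow_def)
 thus "ALL b:ideal_pow RT (gen (range x)) n. F * b \<in> Q ==> ALL vs. length vs = n --> prod_list (map x vs) * F \<in> Q"
  by (metis mult.commute)
 show "ALL b:ideal_pow RT (gen (range x)) n. F * b \<in> Q" if "ALL vs. length vs = n --> prod_list (map x vs) * F \<in> Q"
  using that
 proof (induction n arbitrary: F)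
  case 0 thus ?case by (simp add: idl_multr[OF Q])
 next
  case (Suc n)
  have "F * b \<in> Q" if "b \<in> gen (range x) \<cdot>\<^bsub>RT\<^esub> ideal_pow RT (gen (range x)) n" for b
   using that
  proof (induction rule: ideal_prod.induct)
   case (prod i j)
   have "idl {i. i * (F * j) \<in> Q}"
    by (rule idlI) (simp_all add: idl_0[OF Q] distrib_right idl_add[OF Q] mult.assoc idl_mult[OF Q])
   moreover have "x v * (F * j) \<in> Q" for v
   proof -
    have "prod_list (map x vs) * (x v * F) \<in> Q" if "length vs = n" for vs
     using Suc.prems[rule_format, of "v # vs"] that by (simp add: ac_simps)
    thus ?thesis using Suc.IH[of "x v * F"] prod(2) by (simp add: mult.assoc)
   qed
   ultimately have "gen (range x) \<subseteq> {i. i * (F * j) \<in> Q}" by (intro gen_least) auto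
   thus ?case using prod(1) by (auto simp: ac_simps)
  qed (simp add: distrib_left idl_add[OF Q])
  thus ?case by (simp add: ideal_pow_def)
 qed
qed

lemma ex_vec: "(EX w :: 'a^'n. P (%j. w $ j)) <-> (EX w. P w)"
proof
 assume "EX w. P w"
 then obtain w where "P w" ..
 hence "P (%j. (\<chi> j. w j) $ j)" by simp
 thus "EX w :: 'a^'n. P (%j. w $ j)" ..
qed blast

lemma homog_unique: "homog w d F ==> homog w e F ==> F ~= 0 ==> d = e"
 using hcomp_homog[of w d F e] hcomp_homog[of w e F e] by (simp split: if_splits)

context linear_gorenstein
begin

abbreviation (input) Psi :: "('n, 'k) mpoly ^ 'n ^ 'n" where "Psi \<equiv> \<chi> i j. psi i j"

lemma flat_l: "flat ((Tvec v* map_matrix const Psi) $ j) = l j"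
 by (simp add: vector_matrix_mult_def Tvec_def l_def flat_ring_simps flat_simps mult.commute)

lemma flat_jacobian_dual: "flat (jacobian_dual Psi $ k $ j) = BP $ k $ j"
proof -
 define M :: "('n, ('n, 'k) mpoly) mpoly ^ 'n ^ 'n" where
  "M = (\<chi> k j. \<Sum>i. var i * const (const (lk (psi i j) (sng k 1))))"
 have flat_M: "flat (M $ k $ j) = BP $ k $ j" for k j
  by (simp add: M_def BP_def B_def flat_ring_simps flat_simps sub_simps)
 have bi: "ALL k j. bihomogeneous 0 1 (M $ k $ j)"
  unfolding bihomogeneous_def homogeneous_iff
 proof (intro allI conjI ballI)
  fix k j and t :: "'n \<Rightarrow>\<^sub>0 nat"
  have "homog w1 (1 + 0) (var i * const c)" for i :: 'n and c :: "('n, 'k) mpoly"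
   by (intro homog_mult homog_const) (use homog_var[of w1 i] in simp)
  thus "homog w1 1 (M $ k $ j)" unfolding M_def by (auto intro!: homog_sum)
  have "lk (var i * const (const c)) t = (if sng i 1 = t then const c else (0 :: ('n, 'k) mpoly))" for i :: 'n and c :: 'k
   by (simp add: var_def const_def[of "const c"] mult_single lookup_single when_def)
  hence "homog w1 0 (lk (var i * const (const c :: ('n, 'k) mpoly)) t)" for i :: 'n and c :: 'k
   by (simp add: homog_const homog_0)
  thus "homog w1 0 (lk (M $ k $ j) t)" unfolding M_def vec_lambda_beta lookup_sum by (intro homog_sum)
 qed
 have "flat ((xvec v* M) $ j) = l j" for j
  by (simp add: vector_matrix_mult_def xvec_def flat_ring_simps flat_simps flat_M sub_simps l_B BP_def mult.commute)
 hence "(xvec v* M) $ j = (Tvec v* map_matrix const Psi) $ j" for j using flat_l[of j] unflat_flat by metis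
 hence xM: "xvec v* M = Tvec v* map_matrix const Psi" by (simp add: vec_eq_iff)
 have JD: "is_jacobian_dual Psi (jacobian_dual Psi)"
  by (rule is_jacobian_dual_jacobian_dual) (use psi_homog in \<open>simp add: homogeneous_iff\<close>)
 have "jacobian_dual Psi = M"
  by (rule jacobian_dual_unique) (use JD bi xM in \<open>simp_all add: is_jacobian_dual_def\<close>)
 thus ?thesis by (simp only: flat_M)
qed

abbreviation (input) at_u :: "('n + 'n, 'k) mpoly => ('n, 'k) mpoly" where "at_u \<equiv> sub (case_sum u var)"

lemma partial_flat:
 assumes g: "is_partial g c" "homog wX d (flat g)" "flat g ~= 0"
 shows "flat g = (\<Sum>k. xv k * flat (c $ k))" "homog wX (d - 1) (flat (c $ k))" "EX b. ALL k. homog wT b (flat (c $ k))"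
proof -
 have "g ~= 0" using g(3) by (simp add: flat_eq_0)
 then obtain a b where c: "bihomogeneous (Suc a) b g" "!!i. bihomogeneous a b (c $ i)" and s: "(\<Sum>i. xvec $ i * c $ i) = g"
  using g(1) by (auto simp: is_partial_def)
 have "d = Suc a" by (rule homog_unique[OF g(2) flat_bihomog(1)[OF c(1)] g(3)])
 thus "homog wX (d - 1) (flat (c $ k))" using flat_bihomog(1)[OF c(2)] by simp
 show "EX b. ALL k. homog wT b (flat (c $ k))" using flat_bihomog(2)[OF c(2)] by blast
 show "flat g = (\<Sum>k. xv k * flat (c $ k))"
  unfolding s[symmetric] by (simp add: xvec_def flat_ring_simps flat_simps sub_simps)
qed

text \<open>The invariant of the gcd-iteration: w 0 is f, w (j + 1) the gcd obtained from w j, and c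
  j the column chosen for w j. Nonvanishing at x = u is what keeps all these gcds nonzero.\<close>

definition iterates :: "nat => (nat => ('n + 'n, 'k) mpoly) => (nat => 'n => ('n + 'n, 'k) mpoly) => (nat => 'k) => bool" where
 "iterates i w c \<kappa> <-> w 0 = sx f & (ALL j. \<kappa> j ~= 0) &
   (\<forall>j<i. w j = (\<Sum>k. xv k * c j k) & (ALL k. homog wX (m - Suc j) (c j k)) & (EX b. ALL k. homog wT b (c j k)) & at_u (w j) ~= 0) &
   (ALL j. Suc j < i --> w (Suc j) = const (\<kappa> j) * (\<Sum>k. sT (u k) * c j k))"

text \<open>The contractions of the column with x and with u have the same value at x = u, so the
  new gcd is again nonzero there.\<close>

lemma gcd_iterate:
 assumes it: "iterates (Suc i) w c \<kappa>" and g: "is_gcd (minors CARD('n) M) g"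
  and M: "!!k j. flat (M $ k $ Some j) = BP $ k $ j" "!!k. flat (M $ k $ None) = c i k"
 shows "EX \<kappa>'. \<kappa>' ~= 0 & flat g = const \<kappa>' * (\<Sum>k. sT (u k) * c i k) & homog wX (m - Suc i) (flat g) & at_u (flat g) ~= 0"
proof -
 let ?G = "\<Sum>k. sT (u k) * c i k"
 have w: "w i = (\<Sum>k. xv k * c i k)" "!!k. homog wX (m - Suc i) (c i k)" "at_u (w i) ~= 0" using it lessI[of i] unfolding iterates_def by blast+
 have sT: "at_u (sT H) = H" for H by (simp add: sub_sub sub_simps sub_var)
 have uG: "at_u ?G = at_u (w i)" unfolding w(1) by (simp add: sub_simps sT)
 have G0: "?G ~= 0" using w(3) unfolding uG[symmetric] by (rule contrapos_nn) (simp only: ring_map_simps(4)[OF ring_map_sub])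
 obtain \<kappa>' where \<kappa>': "\<kappa>' ~= 0" "flat g = const \<kappa>' * ?G" using gcd_minors[OF M(1) g, unfolded M(2), OF G0] by blast
 have "homog wX (0 + (0 + (m - Suc i))) (flat g)" unfolding \<kappa>'(2) by (intro homog_mult homog_const homog_sum homog_X_sT w(2))
 moreover have "at_u (flat g) = const \<kappa>' * at_u (w i)" unfolding \<kappa>'(2) uG[symmetric] by (simp only: sub_simps)
 hence "at_u (flat g) ~= 0" using const_mult_cancel[OF idl_zero \<kappa>'(1), of "at_u (w i)"] w(3) by auto
 ultimately show ?thesis using \<kappa>' by (intro exI[of _ \<kappa>'] conjI) simp_all
qed

text \<open>The i-th iteration has used i - 1 gcds: its ideal is generated over L by w 0, ..., w (i
  - 1), and its extra column belongs to w (i - 1).\<close>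

lemma gcd_iteration_iterates:
 assumes "gcd_iteration Psi (append_column (jacobian_dual Psi) c0) L1 i M L'" and c0: "is_partial (const f) c0" and L1: "flat ` L1 = L"
 shows "EX i' w c \<kappa>. i = Suc i' & iterates i w c \<kappa> & (ALL k j. flat (M $ k $ Some j) = BP $ k $ j) & (ALL k. flat (M $ k $ None) = c i' k) &
  flat ` L' = gen (L Un w ` {..<i})"
 using assms(1)
proof (induction rule: gcd_iteration.induct)
 case first
 have f: "homog wX m (flat (const f))" "flat (const f) ~= 0"
  using homog_X_sx[OF f_homog] f0 by (simp_all only: flat_simps) (metis const_simps(3) flat_eq_0 flat_simps(1) lookup_zero lookup_single_eq const_def)
 have "at_u (sx f) ~= 0" using f_u by (simp add: sub_sub sub_simps)
 hence "iterates 1 (%_. sx f) (%_ k. flat (c0 $ k)) (%_. 1)"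
  using partial_flat[OF c0 f] by (simp add: iterates_def flat_simps)
 moreover have "gen (L Un (%_. sx f) ` {..<1::nat}) = L" using f_L gen_idl[OF idl_L] by (simp add: insert_absorb lessThan_Suc)
 ultimately show ?case using L1
  by (intro exI[of _ 0] exI[of _ "%_. sx f"] exI[of _ "%_ k. flat (c0 $ k)"] exI[of _ "%_. 1"])
   (simp add: append_column_def flat_jacobian_dual)
next
 case (step i M L' g c')
 then obtain i' w c \<kappa> where IH: "i = Suc i'" "iterates i w c \<kappa>" "!!k j. flat (M $ k $ Some j) = BP $ k $ j" "!!k. flat (M $ k $ None) = c i' k"
  "flat ` L' = gen (L Un w ` {..<i})" by blast
 obtain \<kappa>' where \<kappa>': "\<kappa>' ~= 0" "flat g = const \<kappa>' * (\<Sum>k. sT (u k) * c i' k)" "homog wX (m - i) (flat g)" "at_u (flat g) ~= 0"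
  using gcd_iterate[OF IH(2)[unfolded IH(1)] step(2) IH(3,4)] IH(1) by auto
 have g0: "flat g ~= 0" using \<kappa>'(4) by (auto simp: sub_simps)
 note c' = partial_flat[OF step(3) \<kappa>'(3) g0]
 let ?w = "w(i := flat g)" and ?c = "c(i := %k. flat (c' $ k))" and ?\<kappa> = "\<kappa>(i' := \<kappa>')"
 have "iterates (Suc i) ?w ?c ?\<kappa>"
  using IH(2) \<kappa>'(1,2,4) c' IH(1) by (auto simp: iterates_def less_Suc_eq)
 moreover have "flat ` (L' <+>\<^bsub>RT\<^esub> PIdl\<^bsub>RT\<^esub> g) = gen (L Un ?w ` {..<Suc i})"
  unfolding flat_set_add[OF idl_gen IH(5)] gen_insert by (rule arg_cong[where f = gen]) (auto simp: lessThan_Suc)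
 ultimately show ?case
  by (intro exI[of _ i] exI[of _ ?w] exI[of _ ?c] exI[of _ ?\<kappa>] conjI) (assumption | simp add: append_column_def flat_jacobian_dual)+
qed

lemma flat_gcd_iteration:
 assumes it: "gcd_iteration Psi (append_column (jacobian_dual Psi) c0) L1 m M L'" "is_partial (const f) c0" "flat ` L1 = L"
  and g: "is_gcd (minors CARD('n) M) g"
 shows "L' <+>\<^bsub>RT\<^esub> PIdl\<^bsub>RT\<^esub> g = flat -` rees" "L' <+>\<^bsub>RT\<^esub> PIdl\<^bsub>RT\<^esub> g = flat -` saturation"
proof -
 obtain m' w c \<kappa> where IH: "m = Suc m'" "iterates m w c \<kappa>" "!!k j. flat (M $ k $ Some j) = BP $ k $ j" "!!k. flat (M $ k $ None) = c m' k"
  "flat ` L' = gen (L Un w ` {..<m})" using gcd_iteration_iterates[OF it] by blast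
 have "iterates (Suc m') w c \<kappa>" using IH(2) by (simp only: IH(1)[symmetric])
 from gcd_iterate[OF this g IH(3,4)] obtain \<kappa>' where \<kappa>': "\<kappa>' ~= 0" "flat g = const \<kappa>' * (\<Sum>k. sT (u k) * c m' k)"
  by blast
 \<comment> \<open>The gcd of the last matrix is not added by the iteration itself; it becomes w
   m.\<close>
 let ?w = "w(m := flat g)" and ?\<kappa> = "\<kappa>(m' := \<kappa>')"
 have "flat ` (L' <+>\<^bsub>RT\<^esub> PIdl\<^bsub>RT\<^esub> g) = gen (L Un ?w ` {..m})"
  unfolding flat_set_add[OF idl_gen IH(5)] gen_insert by (rule arg_cong[where f = gen]) (auto simp: lessThan_Suc_atMost[symmetric] lessThan_Suc)
 moreover have W: "?w 0 = sx f" "!!j. j < m ==> ?w j = (\<Sum>k. xv k * c j k)" "!!j k. j < m ==> homog wX (m - Suc j) (c j k)"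
  "!!j. j < m ==> EX b. ALL k. homog wT b (c j k)" "!!j. ?\<kappa> j ~= 0"
  using IH(2) m \<kappa>'(1) by (simp_all add: iterates_def)
 have "?w (Suc j) = const (?\<kappa> j) * (\<Sum>k. sT (u k) * c j k)" if "j < m" for j
 proof (cases "j = m'")
  case True thus ?thesis using \<kappa>'(2) IH(1) by simp
 next
  case False
  hence "Suc j < m" using that IH(1) by linarith
  hence "w (Suc j) = const (\<kappa> j) * (\<Sum>k. sT (u k) * c j k)" using IH(2) unfolding iterates_def by blast
  thus ?thesis using \<open>Suc j < m\<close> False by simp
 qed
 note iteration_ideal[of ?w c ?\<kappa>, OF W(1-4) this W(5)]
 ultimately show "L' <+>\<^bsub>RT\<^esub> PIdl\<^bsub>RT\<^esub> g = flat -` rees" "L' <+>\<^bsub>RT\<^esub> PIdl\<^bsub>RT\<^esub> g = flat -` saturation"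
  using flat_vimage by blast+
qed

lemma colon_saturation:
 assumes L1: "flat ` L1 = L"
 shows "colon RT L1 (ideal_pow RT (gen (range (%i. xvec $ i))) m) = flat -` saturation"
proof -
 have L1': "L1 = flat -` L" by (rule flat_vimage[OF L1])
 have "idl L1" unfolding L1' by (rule idl_vimage[OF ring_map_flat idl_L])
 have "flat (prod_list (map (%i. xvec $ i) vs)) = (prod_list (map xv vs) :: ('n + 'n, 'k) mpoly)" for vs :: "'n list"
  by (induction vs) (simp_all add: flat_ring_simps xvec_def flat_simps sub_simps)
 hence "F \<in> colon RT L1 (ideal_pow RT (gen (range (%i. xvec $ i))) m) <-> flat F \<in> saturation" for F
  using ideal_pow_mult[OF \<open>idl L1\<close>, of "%i. xvec $ i" m F] by (simp add: colon_def saturation_def L1' flat_ring_simps)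
 thus ?thesis by auto
qed

text \<open>In T-degree d the values at p and at \<alpha> differ modulo f by the factor
  \<epsilon>^d, which is a nonzerodivisor. Hence the given generators of I and the homogeneous p
  have the same Rees ideal.\<close>

lemma rees_map_eq_0:
 fixes \<pi> :: "('n, 'k) mpoly => 'r::comm_ring_1"
 assumes \<pi>: "ring_map \<pi>" "!!x. \<pi> x = 0 <-> x \<in> gen {f}"
  and \<epsilon>: "!!r. \<epsilon> * r \<in> gen {f} ==> r \<in> gen {f}" and p\<alpha>: "!!j. p j - \<epsilon> * \<alpha> j \<in> gen {f}"
 shows "rees_map (\<chi> j. \<pi> (\<alpha> j)) (Poly_Mapping.map \<pi> F) = 0 <-> flat F \<in> rees"
proof -
 let ?a = "\<chi> j. \<pi> (\<alpha> j)" and ?E = "sub (case_sum var \<alpha>) :: _ => ('n, 'k) mpoly"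
 \<comment> \<open>Reduction by \<pi> followed by the Rees map, read on the flat ring. The
   coefficient of t^d is the value at T = \<alpha> of the component of T-degree d.\<close>
 define \<Psi> where "\<Psi> = ev (%c. [:\<pi> (const c):]) (case_sum (%i. [:\<pi> (var i):]) (%j. [:0, \<pi> (\<alpha> j):]))"
 have C: "ring_map (%c. [:\<pi> c:])" "ring_map (%c. \<pi> (const c))" "ring_map (%c. [:\<pi> (const c):])"
  by (intro ring_map_comp[OF ring_map_C] ring_map_comp[OF \<pi>(1)] \<pi>(1) ring_map_const)+
 have \<Psi>: "ring_map \<Psi>" unfolding \<Psi>_def by (rule ring_map_ev[OF C(3)])
 have \<Psi>_sx: "\<Psi> (sx c) = [:\<pi> c:]" for c
  by (rule ring_map_eqI[OF ring_map_comp[OF \<Psi> ring_map_sub] C(1)]) (simp_all add: \<Psi>_def sub_simps ev_simps[OF C(3)])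
 have "rees_map ?a (Poly_Mapping.map \<pi> F) = ev (%c. [:\<pi> c:]) (%i. [:0, \<pi> (\<alpha> i):]) F"
 proof -
  have lm: "lk (Poly_Mapping.map \<pi> F) t = \<pi> (lk F t)" for t
   by (simp add: Poly_Mapping.map.rep_eq when_def ring_map_simps[OF \<pi>(1)])
  have "keys (Poly_Mapping.map \<pi> F) \<subseteq> keys F" by (auto simp: in_keys_iff lm ring_map_simps[OF \<pi>(1)])
  hence "ev (%c. [:c:]) (%i. [:0, \<pi> (\<alpha> i):]) (Poly_Mapping.map \<pi> F) = (\<Sum>t\<in>keys F. [:\<pi> (lk F t):] * ev_monom (%i. [:0, \<pi> (\<alpha> i):]) t)"
   by (subst ev_superset[OF ring_map_C]) (simp_all add: lm)
  thus ?thesis by (simp add: rees_map_def ev_def ev_monom_superset[of UNIV])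
 qed
 also have "\<dots> = \<Psi> (flat F)"
  by (rule ring_map_eqI[OF ring_map_ev[OF C(1)] ring_map_comp[OF \<Psi> ring_map_flat]])
   (simp_all add: ev_simps[OF C(1)] flat_simps \<Psi>_sx, simp add: \<Psi>_def ev_simps[OF C(3)])
 also have "\<Psi> (flat F) = 0 <-> (ALL d. \<pi> (?E (hcomp wT d (flat F))) = 0)"
 proof -
  have h: "\<Psi> h = monom (\<pi> (?E h)) d" if "homog wT d h" for h d
  proof -
   have "ev (%c. [:\<pi> (const c):]) (%v. [:case_sum (%i. \<pi> (var i)) (%j. \<pi> (\<alpha> j)) v:] * [:0, 1:] ^ wT v) h = [:\<pi> (?E h):] * [:0, 1:] ^ d"
    unfolding ev_homog_scale[OF C(3) that]
   proof (rule arg_cong[where f = "%z. z * _"])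
    show "ev (%c. [:\<pi> (const c):]) (%v. [:case_sum (%i. \<pi> (var i)) (%j. \<pi> (\<alpha> j)) v:]) h = [:\<pi> (?E h):]"
     by (rule ring_map_eqI[OF ring_map_ev[OF C(3)] ring_map_comp[OF C(1) ring_map_sub]])
      (auto simp: ev_simps[OF C(3)] sub_simps split: sum.split)
   qed
   moreover have "(%v. [:case_sum (%i. \<pi> (var i)) (%j. \<pi> (\<alpha> j)) v:] * [:0, 1:] ^ wT v) = case_sum (%i. [:\<pi> (var i):]) (%j. [:0, \<pi> (\<alpha> j):])"
    by (auto split: sum.split)
   ultimately have "\<Psi> h = [:\<pi> (?E h):] * [:0, 1:] ^ d" by (simp only: \<Psi>_def)
   thus ?thesis by (simp add: monom_altdef)
  qed
  let ?D = "degree (homog_map wT (flat F))"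
  have s: "\<Psi> (flat F) = (\<Sum>d\<le>?D. monom (\<pi> (?E (hcomp wT d (flat F)))) d)"
   using arg_cong[OF sum_hcomp[of "flat F" wT], of \<Psi>] h[OF homog_hcomp] by (simp only: ring_map_simps[OF \<Psi>])
  have "coeff (\<Psi> (flat F)) d = \<pi> (?E (hcomp wT d (flat F)))" for d
  proof (cases "d \<le> ?D")
   case False
   hence "hcomp wT d (flat F) = 0" by (simp add: hcomp_def coeff_eq_0)
   thus ?thesis using False by (simp add: s coeff_sum sub_simps ring_map_simps[OF \<pi>(1)])
  qed (simp add: s coeff_sum)
  thus ?thesis by (simp add: poly_eq_iff)
 qed
 also have "\<dots> <-> flat F \<in> rees"
 proof -
  have "sub (case_sum var p) h \<in> gen {f} <-> ?E h \<in> gen {f}" if h: "homog wT d h" for h d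
  proof -
   have "sub (case_sum var p) h - sub (%v. case_sum var \<alpha> v * \<epsilon> ^ wT v) h \<in> gen {f}"
   proof (rule ring_map_cong_idl[OF ring_map_sub ring_map_sub idl_gen])
    show "sub (case_sum var p) (var v) - sub (%v. case_sum var \<alpha> v * \<epsilon> ^ wT v) (var v) \<in> gen {f}" for v
     using p\<alpha> by (cases v) (auto simp: sub_simps idl_0[OF idl_gen] mult.commute)
   qed (simp add: sub_simps idl_0[OF idl_gen])
   hence *: "sub (case_sum var p) h - \<epsilon> ^ d * ?E h \<in> gen {f}" unfolding ev_homog_scale[OF ring_map_const h] mult.commute[of "\<epsilon> ^ d"] .
   have \<epsilon>d: "\<epsilon> ^ d * r \<in> gen {f} ==> r \<in> gen {f}" for r
    by (induction d) (auto simp: mult.assoc dest: \<epsilon>)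
   show ?thesis
   proof
    assume "sub (case_sum var p) h \<in> gen {f}"
    from idl_diff[OF idl_gen this *] show "?E h \<in> gen {f}" by - (rule \<epsilon>d, simp)
   next
    assume "?E h \<in> gen {f}"
    from idl_add[OF idl_gen * idl_mult[OF idl_gen this, of "\<epsilon> ^ d"]] show "sub (case_sum var p) h \<in> gen {f}" by simp
   qed
  qed
  from this[OF homog_hcomp] show ?thesis by (simp add: rees_def \<pi>(2))
 qed
 finally show ?thesis .
qed

end

section \<open>Colon ideal and Rees ideal over the quotient ring\<close>

theorem theorem5p2:
  fixes d m :: nat
    and f :: "('n::finite, 'k::field) mpoly"
    and \<pi> :: "('n, 'k) mpoly \<Rightarrow> 'r::comm_ring_1"
    and I :: "'r set"
    and a :: "'r ^ 'n"
    and \<phi> :: "'r ^ 'n ^ 'n"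
    and \<psi> :: "('n, 'k) mpoly ^ 'n ^ 'n"
    and L A Lm :: "('n, ('n, 'k) mpoly) mpoly set"
    and B Bm :: "('n, ('n, 'k) mpoly) mpoly ^ ('n option) ^ 'n"
    and g :: "('n, ('n, 'k) mpoly) mpoly"
  defines "S \<equiv> (ring_of_type_algebra :: ('n, 'k) mpoly ring)"
    and "R \<equiv> (ring_of_type_algebra :: 'r ring)"
    and "ST \<equiv> (ring_of_type_algebra :: ('n, ('n, 'k) mpoly) mpoly ring)"
  assumes "infinite (UNIV :: 'k set)"
    and "CARD('n) = d + 1"
    and "m \<ge> 1" and "homogeneous m f" and "f \<noteq> 0"
    \<comment> \<open>\<open>R = S/(f)\<close>, with \<open>\<pi>\<close> the residue map\<close>
    and "\<pi> \<in> ring_hom S R" and "surj \<pi>" and "a_kernel S R \<pi> = PIdl\<^bsub>S\<^esub> f"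
    and "perfect_gorenstein_ideal R I 3"
    and "alternating \<phi>" and "\<forall>i j. \<exists>l. homogeneous 1 l \<and> \<phi> $ i $ j = \<pi> l"
    and "presents \<phi> a I"
    and "satisfies_G R I d"
    and "mu R I = enat (d + 1)"
    and "minor_ideal 1 \<phi> = \<pi> ` (Idl\<^bsub>S\<^esub> (range var))"
    and "alternating \<psi>" and "\<forall>i j. homogeneous 1 (\<psi> $ i $ j)"
    and "minor_ideal 1 \<psi> = Idl\<^bsub>S\<^esub> (range var)"
    and "map_matrix \<pi> \<psi> = \<phi>"
    and "L = Idl\<^bsub>ST\<^esub> (insert (const f) (range (\<lambda>j. (Tvec v* map_matrix const \<psi>) $ j)))"
    and "A = colon ST L (ideal_pow ST (Idl\<^bsub>ST\<^esub> (range (\<lambda>i. xvec $ i))) m)"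
    and "is_modified_jacobian_dual \<psi> f B"
    and "gcd_iteration \<psi> B L m Bm Lm"
    and "is_gcd (minors (d + 1) Bm) g"
  shows "A = Lm <+>\<^bsub>ST\<^esub> PIdl\<^bsub>ST\<^esub> g \<and>
    rees_ideal a = Poly_Mapping.map \<pi> ` (Lm <+>\<^bsub>ST\<^esub> PIdl\<^bsub>ST\<^esub> g)"
proof -
 let ?psi = "%i j. \<psi> $ i $ j"
 have \<pi>: "ring_map \<pi>" using assms(9) by (auto simp: ring_map_def S_def R_def ring_hom_def)
 have ker: "\<pi> x = 0 <-> x \<in> gen {f}" for x
  using assms(11) by (auto simp: a_kernel_def' S_def R_def cgenideal_def mem_gen_single)
 define \<alpha> where "\<alpha> j = inv_into UNIV \<pi> (a $ j)" for j
 have \<alpha>: "\<pi> (\<alpha> j) = a $ j" for j unfolding \<alpha>_def by (rule surj_f_inv_f[OF assms(10)])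
 have a: "a = (\<chi> j. \<pi> (\<alpha> j))" by (simp add: vec_eq_iff \<alpha>)
 have \<psi>: "\<psi> = (\<chi> i j. ?psi i j)" by (simp add: vec_eq_iff)
 have hom: "homog w1 m f" "\<psi> $ i $ j = - \<psi> $ j $ i" "\<psi> $ i $ i = 0" "homog w1 1 (\<psi> $ i $ j)" for i j
  using assms(7,19,20) unfolding homogeneous_iff alternating_def by blast+
 interpret gl: gorenstein_lift f m d ?psi \<alpha> \<pi> I
 proof
  have "minors 1 \<psi> \<subseteq> range (%(i, j). ?psi i j)"
  proof
   fix x assume "x \<in> minors 1 \<psi>"
   then obtain \<rho> \<gamma> where "x = (\<Sum>p | p permutes {..<1::nat}. of_int (sign p) * (\<Prod>i<1. \<psi> $ \<rho> i $ \<gamma> (p i)))" by (auto simp: minors_def)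
   moreover have "{p. p permutes {..<1::nat}} = {id}" by (simp add: lessThan_Suc)
   ultimately show "x \<in> range (%(i, j). ?psi i j)" by (auto intro: range_eqI[of _ _ "(\<rho> 0, \<gamma> 0)"])
  qed
  moreover have "gen (minors 1 \<psi>) = gen (range var)" using assms(21) by (simp add: minor_ideal_def genideal_RT S_def)
  ultimately show "var v \<in> gen (range (%(i, j). ?psi i j))" for v
   using gen_mono[of "minors 1 \<psi>" "range (%(i, j). ?psi i j)"] genI[of "var v" "range var"] by blast
  have "range (%v. \<Sum>j. a $ j * v $ j) = I" and syz: "{v. (\<Sum>j. a $ j * v $ j) = 0} = range (%w. \<phi> *v w)"
   using assms(15) by (simp_all add: presents_def)
  moreover have "range (%v. \<Sum>j. a $ j * v $ j) = range (%v. \<Sum>j. \<pi> (\<alpha> j) * v j)"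
   using ex_vec[of "%v. x = (\<Sum>j. a $ j * v j)" for x] by (auto simp: \<alpha> image_iff)
  ultimately show "I = range (%v. \<Sum>j. \<pi> (\<alpha> j) * v j)" by simp
  have \<phi>: "\<phi> $ i $ j = \<pi> (?psi i j)" for i j using assms(22)[symmetric] by (simp add: map_matrix_def)
  show "(\<Sum>j. \<pi> (\<alpha> j) * v j) = 0 <-> (EX w. ALL i. v i = (\<Sum>j. \<pi> (?psi i j) * w j))" for v
  proof -
   have "(\<Sum>j. \<pi> (\<alpha> j) * v j) = 0 <-> (\<chi> j. v j) \<in> range (%w. \<phi> *v w)" unfolding syz[symmetric] by (simp add: \<alpha>)
   also have "\<dots> <-> (EX w. ALL i. v i = (\<Sum>j. \<phi> $ i $ j * w $ j))" by (auto simp: image_iff vec_eq_iff matrix_vector_mult_def)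
   also have "\<dots> <-> (EX w. ALL i. v i = (\<Sum>j. \<phi> $ i $ j * w j))" by (rule ex_vec)
   finally show ?thesis by (simp only: \<phi>)
  qed
  show "grade RT I > 1" using assms(12) by (simp add: perfect_gorenstein_ideal_def R_def one_enat_def)
  show "satisfies_G RT I d" using assms(16) by (simp add: R_def)
 qed (fact assms(4-6,8,10) \<pi> ker hom)+
 obtain e p \<epsilon> where lg: "linear_gorenstein f m e ?psi p" and \<epsilon>: "hcomp w1 0 \<epsilon> = 1" "!!j. p j - \<epsilon> * \<alpha> j \<in> gen {f}"
  by (rule gl.linear_gorenstein) (rule that; assumption)
 interpret lg: linear_gorenstein f m e ?psi p by (rule lg)
 obtain c0 where c0: "is_partial (const f) c0" "B = append_column (jacobian_dual \<psi>) c0"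
  using assms(25) by (auto simp: is_modified_jacobian_dual_def)
 have "L = gen (insert (const f) (range (%j. (Tvec v* map_matrix const \<psi>) $ j)))"
  using assms(23) by (simp add: ST_def genideal_RT)
 hence L: "flat ` L = lg.L"
  unfolding lg.L_def by (simp add: gen_image_surj[OF ring_map_flat surj_flat] image_image flat_simps lg.flat_l[folded \<psi>])
 have it: "gcd_iteration (\<chi> i j. ?psi i j) (append_column (jacobian_dual (\<chi> i j. ?psi i j)) c0) L m Bm Lm"
  using assms(26) c0(2) by (simp add: \<psi>[symmetric])
 have g: "is_gcd (minors CARD('n) Bm) g" using assms(27) assms(5) by simp
 note W = lg.flat_gcd_iteration[OF it c0(1) L g]
 have "A = Lm <+>\<^bsub>ST\<^esub> PIdl\<^bsub>ST\<^esub> g"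
  unfolding ST_def W(2) using assms(24) lg.colon_saturation[OF L] by (simp add: ST_def genideal_RT)
 moreover have rees: "rees_map a (Poly_Mapping.map \<pi> F) = 0 <-> flat F \<in> lg.rees" for F
  unfolding a by (rule lg.rees_map_eq_0[OF \<pi> ker gl.unit_nzd[OF \<epsilon>(1)] \<epsilon>(2)])
 have "rees_ideal a = Poly_Mapping.map \<pi> ` (flat -` lg.rees)"
 proof (intro equalityI subsetI)
  fix H assume H: "H \<in> rees_ideal a"
  \<comment> \<open>A lift of H coefficient by coefficient; zero coefficients stay zero, so the
    support remains finite.\<close>
  define F where "F = Poly_Mapping.map (inv_into UNIV \<pi>) H"
  have 1: "lk F t = (if lk H t = 0 then 0 else inv_into UNIV \<pi> (lk H t))" for t by (simp add: F_def Poly_Mapping.map.rep_eq when_def)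
  have 2: "lk (Poly_Mapping.map \<pi> F) t = \<pi> (lk F t)" for t
   by (simp add: Poly_Mapping.map.rep_eq when_def ring_map_simps(4)[OF \<pi>])
  have "Poly_Mapping.map \<pi> F = H"
   by (rule poly_mapping_eqI) (simp add: 1 2 ring_map_simps(4)[OF \<pi>] surj_f_inv_f[OF assms(10)])
  thus "H \<in> Poly_Mapping.map \<pi> ` (flat -` lg.rees)" using H rees[of F] by (auto simp: rees_ideal_def)
 qed (auto simp: rees_ideal_def rees)
 ultimately show ?thesis using W(1) by (simp add: ST_def)
qed

end
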